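(* Let $r \in \{1,2,\ldots,\infty\}$, let $M$ be a compact Riemannian $C^r$ manifold with induced distance $\rho$, and let $T : M \to M$ be a $C^r$ diffeomorphism. Let $X \subset M$ be a compact set and let $\mu$ be a Borel probability measure on $X$. Fix $k \in \mathbb{N}$ and assume that $\mu\left(\bigcup_{p=1}^{k-1} \mathrm{Per}_p(T)\right) = 0$. Then the following hold for a prevalent $C^r$ observable $h : M \to \mathbb{R}$ (prevalence in $C^r(M,\mathbb{R})$): (1) if $k > \dim_H X$ and $k \geq \dim M$, then for $\mu$-a.e. $x \in X$ there exists $C = C(x,h) \in [0,\infty)$ such that $$\rho(x,y) \leq C\,\|\phi_{h,k}(x) - \phi_{h,k}(y)\| \quad \text{for every } y \in X;$$ (2) if $k > \dim M$, then for $\mu$-a.e. $x \in X$ there exist open neighbourhoods $U$ of $x$ in $M$ and $V$ of $\phi_{h,k}(x)$ in $\mathbb{R}^k$ such that $\phi_{h,k}$ is a $C^r$ diffeomorphism between $U$ and $V \cap \phi_{h,k}(M)$.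
   Context: Notation. $\mathbb{N} = \{1,2,\ldots\}$. Manifolds are finite-dimensional and Hausdorff. A Riemannian $C^r$ manifold is a $C^r$ manifold with a metric tensor depending continuously on the point; $\rho : M \times M \to [0,\infty)$ is the (finite-valued) metric on $M$ induced by the metric tensor, and $\dim_H$ is the Hausdorff dimension with respect to $\rho$. $\|\cdot\|$ is the Euclidean norm on $\mathbb{R}^k$. $\mathrm{Per}_p(T) = \{x \in M : T^p x = x\}$. For $h : M \to \mathbb{R}$, the $k$-delay coordinate map is $\phi_{h,k} : M \to \mathbb{R}^k$, $\phi_{h,k}(x) = (h(x), h(Tx), \ldots, h(T^{k-1}x))$. Part of statement (2) is that $V \cap \phi_{h,k}(M)$ is an embedded $C^r$ submanifold of $\mathbb{R}^k$. Prevalence. $C^r(M,\mathbb{R})$ carries the topology of uniform convergence of derivatives of orders up to $r$ (all orders if $r=\infty$); it is a complete metrizable linear space. In a complete linear metric space $W$, a Borel set $S \subset W$ is prevalent if there is a Borel measure $\nu$ on $W$, positive and finite on some compact set in $W$, such that for every $v \in W$ one has $v + e \in S$ for $\nu$-almost every $e \in W$. A non-Borel set is prevalent if it contains a prevalent Borel set. A property holds for a prevalent element if the set of elements having it is prevalent. *)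

theory Defs
  imports "HOL-Probability.Probability" "HOL-Library.Function_Algebras"
begin

text \<open>
  The space \<open>\<real>\<^sup>n\<close> is \<^term>\<open>Euclidean_space n\<close>: functions \<^typ>\<open>nat \<Rightarrow> real\<close> vanishing at all
  indices \<open>\<ge> n\<close>, with the subspace topology of the product topology.  Hence \<open>\<real>\<^sup>m\<close> is literally
  the subset \<open>\<real>\<^sup>m \<times> {0}\<close> of \<open>\<real>\<^sup>k\<close> for \<open>m \<le> k\<close>, and dimension \<open>0\<close> is included.  The
  smoothness class \<open>r\<close> is an \<^typ>\<open>enat\<close>, with \<open>r = \<infinity>\<close> allowed.
\<close>

section \<open>Differentiability classes on open subsets of Euclidean space\<close>

definition partial_deriv :: "nat \<Rightarrow> ((nat \<Rightarrow> real) \<Rightarrow> real) \<Rightarrow> (nat \<Rightarrow> real) \<Rightarrow> real" where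
  "partial_deriv i f x = deriv (\<lambda>t. f (x(i := t))) (x i)"

text \<open>Meaningful for \<open>U\<close> open in \<open>\<real>\<^sup>n\<close>; the values of \<open>f\<close> outside \<open>U\<close> are then irrelevant.\<close>

primrec Ck_on :: "nat \<Rightarrow> nat \<Rightarrow> (nat \<Rightarrow> real) set \<Rightarrow> ((nat \<Rightarrow> real) \<Rightarrow> real) \<Rightarrow> bool" where
  "Ck_on n 0 U f \<longleftrightarrow> continuous_on U f"
| "Ck_on n (Suc m) U f \<longleftrightarrow> continuous_on U f \<and>
     (\<forall>i<n. (\<forall>x\<in>U. (\<lambda>t. f (x(i := t))) field_differentiable at (x i)) \<and>
            Ck_on n m U (partial_deriv i f))"

definition Cr_on :: "nat \<Rightarrow> enat \<Rightarrow> (nat \<Rightarrow> real) set \<Rightarrow> ((nat \<Rightarrow> real) \<Rightarrow> real) \<Rightarrow> bool" where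
  "Cr_on n r U f \<longleftrightarrow> (\<forall>m. enat m \<le> r \<longrightarrow> Ck_on n m U f)"

definition Cr_map_on ::
  "nat \<Rightarrow> nat \<Rightarrow> enat \<Rightarrow> (nat \<Rightarrow> real) set \<Rightarrow> ((nat \<Rightarrow> real) \<Rightarrow> (nat \<Rightarrow> real)) \<Rightarrow> bool" where
  "Cr_map_on n m r U f \<longleftrightarrow>
     f ` U \<subseteq> topspace (Euclidean_space m) \<and> (\<forall>j<m. Cr_on n r U (\<lambda>x. f x j))"


section \<open>Manifolds\<close>

text \<open>A chart is a pair of a domain and a coordinate map.\<close>

type_synonym 'a chart = "'a set \<times> ('a \<Rightarrow> nat \<Rightarrow> real)"

definition chart_inv :: "'a chart \<Rightarrow> (nat \<Rightarrow> real) \<Rightarrow> 'a" where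
  "chart_inv c = inv_into (fst c) (snd c)"

definition chart_image :: "'a chart \<Rightarrow> (nat \<Rightarrow> real) set" where
  "chart_image c = snd c ` fst c"

definition is_chart :: "nat \<Rightarrow> 'a::topological_space set \<Rightarrow> 'a chart \<Rightarrow> bool" where
  "is_chart n S c \<longleftrightarrow>
     openin (top_of_set S) (fst c) \<and>
     openin (Euclidean_space n) (chart_image c) \<and>
     homeomorphism (fst c) (chart_image c) (snd c) (chart_inv c)"

text \<open>The atlas need not be maximal.\<close>

definition Cr_atlas :: "nat \<Rightarrow> enat \<Rightarrow> 'a::topological_space set \<Rightarrow> 'a chart set \<Rightarrow> bool" where
  "Cr_atlas n r S A \<longleftrightarrow>
     (\<forall>c\<in>A. is_chart n S c) \<and>
     (\<Union>c\<in>A. fst c) = S \<and>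
     (\<forall>c\<in>A. \<forall>d\<in>A. Cr_map_on n n r (snd c ` (fst c \<inter> fst d)) (snd d \<circ> chart_inv c))"

text \<open>\<open>C\<^sup>r\<close> maps between an \<open>n\<close>-manifold \<open>S\<close> with atlas \<open>A\<close> and an \<open>m\<close>-manifold \<open>S'\<close> with
  atlas \<open>A'\<close>.\<close>

definition Cr_between ::
  "nat \<Rightarrow> nat \<Rightarrow> enat \<Rightarrow> 'a::topological_space set \<Rightarrow> 'a chart set
     \<Rightarrow> 'b::topological_space set \<Rightarrow> 'b chart set \<Rightarrow> ('a \<Rightarrow> 'b) \<Rightarrow> bool" where
  "Cr_between n m r S A S' A' f \<longleftrightarrow>
     f ` S \<subseteq> S' \<and> continuous_on S f \<and>
     (\<forall>c\<in>A. \<forall>d\<in>A'. Cr_map_on n m r (snd c ` (fst c \<inter> f -` fst d)) (snd d \<circ> f \<circ> chart_inv c))"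

definition Cr_diffeo ::
  "nat \<Rightarrow> enat \<Rightarrow> 'a::topological_space set \<Rightarrow> 'a chart set
     \<Rightarrow> 'b::topological_space set \<Rightarrow> 'b chart set \<Rightarrow> ('a \<Rightarrow> 'b) \<Rightarrow> bool" where
  "Cr_diffeo n r S A S' A' f \<longleftrightarrow>
     bij_betw f S S' \<and>
     Cr_between n n r S A S' A' f \<and> Cr_between n n r S' A' S A (inv_into S f)"

definition Cr_functions :: "nat \<Rightarrow> enat \<Rightarrow> 'a chart set \<Rightarrow> ('a \<Rightarrow> real) set" where
  "Cr_functions n r A = {h. \<forall>c\<in>A. Cr_on n r (chart_image c) (h \<circ> chart_inv c)}"

definition restrict_atlas :: "'a chart set \<Rightarrow> 'a set \<Rightarrow> 'a chart set" where
  "restrict_atlas A U = (\<lambda>c. (fst c \<inter> U, snd c)) ` A"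

text \<open>Ambient charts of \<open>\<real>\<^sup>k\<close> straightening \<open>S\<close> to \<open>\<real>\<^sup>m \<times> {0}\<close>, and the charts of \<open>S\<close> they
  induce.\<close>

definition slice_chart :: "nat \<Rightarrow> nat \<Rightarrow> enat \<Rightarrow> (nat \<Rightarrow> real) set \<Rightarrow> (nat \<Rightarrow> real) chart \<Rightarrow> bool" where
  "slice_chart k m r S c \<longleftrightarrow>
     openin (Euclidean_space k) (fst c) \<and>
     openin (Euclidean_space k) (chart_image c) \<and>
     inj_on (snd c) (fst c) \<and>
     Cr_map_on k k r (fst c) (snd c) \<and>
     Cr_map_on k k r (chart_image c) (chart_inv c) \<and>
     snd c ` (fst c \<inter> S) = chart_image c \<inter> topspace (Euclidean_space m)"

definition slice_atlas :: "nat \<Rightarrow> nat \<Rightarrow> enat \<Rightarrow> (nat \<Rightarrow> real) set \<Rightarrow> (nat \<Rightarrow> real) chart set" where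
  "slice_atlas k m r S = restrict_atlas {c. slice_chart k m r S c} S"

definition embedded_submanifold :: "nat \<Rightarrow> nat \<Rightarrow> enat \<Rightarrow> (nat \<Rightarrow> real) set \<Rightarrow> bool" where
  "embedded_submanifold k m r S \<longleftrightarrow>
     m \<le> k \<and> S \<subseteq> topspace (Euclidean_space k) \<and>
     (\<forall>p\<in>S. \<exists>c. slice_chart k m r S c \<and> p \<in> fst c)"


section \<open>Continuous Riemannian metrics and the induced distance\<close>

text \<open>\<open>g c x i j\<close> is the \<open>(i, j)\<close> coefficient of the metric tensor at \<open>x\<close> in the chart \<open>c\<close>.\<close>

type_synonym 'a metric_tensor = "'a chart \<Rightarrow> 'a \<Rightarrow> nat \<Rightarrow> nat \<Rightarrow> real"

definition Riemannian_metric ::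
  "nat \<Rightarrow> 'a::topological_space chart set \<Rightarrow> 'a metric_tensor \<Rightarrow> bool" where
  "Riemannian_metric n A g \<longleftrightarrow>
     (\<forall>c\<in>A. \<forall>i<n. \<forall>j<n. continuous_on (fst c) (\<lambda>x. g c x i j)) \<and>
     (\<forall>c\<in>A. \<forall>x\<in>fst c. \<forall>i<n. \<forall>j<n. g c x i j = g c x j i) \<and>
     (\<forall>c\<in>A. \<forall>x\<in>fst c. \<forall>v. (\<exists>i<n. v i \<noteq> 0) \<longrightarrow> (\<Sum>i<n. \<Sum>j<n. g c x i j * v i * v j) > 0) \<and>
     (\<forall>c\<in>A. \<forall>d\<in>A. \<forall>x\<in>fst c \<inter> fst d. \<forall>i<n. \<forall>j<n.
        g c x i j = (\<Sum>a<n. \<Sum>b<n. g d x a b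
           * partial_deriv i (\<lambda>y. snd d (chart_inv c y) a) (snd c x)
           * partial_deriv j (\<lambda>y. snd d (chart_inv c y) b) (snd c x)))"

definition C1_arc :: "nat \<Rightarrow> 'a::topological_space chart set \<Rightarrow> real \<Rightarrow> real \<Rightarrow> (real \<Rightarrow> 'a) \<Rightarrow> bool" where
  "C1_arc n A a b \<gamma> \<longleftrightarrow>
     continuous_on {a..b} \<gamma> \<and>
     (\<forall>c\<in>A. \<forall>i<n. \<exists>v.
        (\<forall>t\<in>{a..b} \<inter> \<gamma> -` fst c.
           ((\<lambda>s. snd c (\<gamma> s) i) has_real_derivative v t) (at t within {a..b})) \<and>
        continuous_on ({a..b} \<inter> \<gamma> -` fst c) v)"

definition piecewise_C1_curve ::
  "nat \<Rightarrow> 'a::topological_space chart set \<Rightarrow> (real \<Rightarrow> 'a) \<Rightarrow> bool" where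
  "piecewise_C1_curve n A \<gamma> \<longleftrightarrow>
     (\<exists>P. finite P \<and> {0, 1} \<subseteq> P \<and> P \<subseteq> {0..1} \<and>
        (\<forall>a\<in>P. \<forall>b\<in>P. a < b \<and> {a<..<b} \<inter> P = {} \<longrightarrow> C1_arc n A a b \<gamma>))"

text \<open>The Riemannian norm of the velocity, computed in any chart around \<open>\<gamma> t\<close>; the value does not
  depend on the chart when \<open>\<gamma>\<close> is differentiable at \<open>t\<close>.\<close>

definition speed ::
  "nat \<Rightarrow> 'a chart set \<Rightarrow> 'a metric_tensor \<Rightarrow> (real \<Rightarrow> 'a) \<Rightarrow> real \<Rightarrow> real" where
  "speed n A g \<gamma> t =
     (let c = (SOME c. c \<in> A \<and> \<gamma> t \<in> fst c)
      in sqrt (\<Sum>i<n. \<Sum>j<n. g c (\<gamma> t) i j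
           * deriv (\<lambda>s. snd c (\<gamma> s) i) t * deriv (\<lambda>s. snd c (\<gamma> s) j) t))"

definition curve_length ::
  "nat \<Rightarrow> 'a chart set \<Rightarrow> 'a metric_tensor \<Rightarrow> (real \<Rightarrow> 'a) \<Rightarrow> ennreal" where
  "curve_length n A g \<gamma> = (\<integral>\<^sup>+ t \<in> {0..1}. ennreal (speed n A g \<gamma> t) \<partial>lborel)"

text \<open>Infinite exactly for points in different components.\<close>

definition path_distance ::
  "nat \<Rightarrow> 'a::topological_space chart set \<Rightarrow> 'a metric_tensor \<Rightarrow> 'a \<Rightarrow> 'a \<Rightarrow> ennreal" where
  "path_distance n A g x y =
     (INF \<gamma> \<in> {\<gamma>. piecewise_C1_curve n A \<gamma> \<and> \<gamma> 0 = x \<and> \<gamma> 1 = y}. curve_length n A g \<gamma>)"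

text \<open>A finite-valued metric induced by the metric tensor.  For connected manifolds it is
  unique and equals the infimum of the lengths of curves; otherwise any metric extending
  this infimum to pairs of points in different components is admitted.\<close>

definition Riemannian_distance ::
  "nat \<Rightarrow> 'a::topological_space chart set \<Rightarrow> 'a metric_tensor \<Rightarrow> ('a \<Rightarrow> 'a \<Rightarrow> real) \<Rightarrow> bool" where
  "Riemannian_distance n A g \<rho> \<longleftrightarrow>
     Metric_space UNIV \<rho> \<and>
     (\<forall>x y. path_distance n A g x y < \<infinity> \<longrightarrow> ennreal (\<rho> x y) = path_distance n A g x y)"


section \<open>Hausdorff dimension\<close>

definition ediam :: "('a \<Rightarrow> 'a \<Rightarrow> real) \<Rightarrow> 'a set \<Rightarrow> ennreal" where
  "ediam d E = (SUP x\<in>E. SUP y\<in>E. ennreal (d x y))"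

definition hausdorff_content :: "('a \<Rightarrow> 'a \<Rightarrow> real) \<Rightarrow> real \<Rightarrow> real \<Rightarrow> 'a set \<Rightarrow> ennreal" where
  "hausdorff_content d s \<delta> S =
     (INF E \<in> {E :: nat \<Rightarrow> 'a set. S \<subseteq> (\<Union>i. E i) \<and> (\<forall>i. ediam d (E i) \<le> ennreal \<delta>)}.
        \<Sum>i. ennreal (enn2real (ediam d (E i)) powr s))"

definition hausdorff_measure :: "('a \<Rightarrow> 'a \<Rightarrow> real) \<Rightarrow> real \<Rightarrow> 'a set \<Rightarrow> ennreal" where
  "hausdorff_measure d s S = (SUP \<delta>\<in>{0<..}. hausdorff_content d s \<delta> S)"

text \<open>Only exponents \<open>s > 0\<close> are used, which avoids conventions for \<open>0\<^sup>0\<close>.\<close>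

definition hausdorff_dim :: "('a \<Rightarrow> 'a \<Rightarrow> real) \<Rightarrow> 'a set \<Rightarrow> ennreal" where
  "hausdorff_dim d S = (INF s \<in> {s. 0 < s \<and> hausdorff_measure d s S = 0}. ennreal s)"


section \<open>Prevalence and the space of observables\<close>

text \<open>The linear structure of \<open>W\<close> is that of the ambient type, which for function types is the
  pointwise one.\<close>

definition borel_sets_of :: "'v topology \<Rightarrow> 'v set set" where
  "borel_sets_of W = sigma_sets (topspace W) {U. openin W U}"

definition prevalent_borel :: "'v::ab_group_add topology \<Rightarrow> 'v set \<Rightarrow> bool" where
  "prevalent_borel W S \<longleftrightarrow>
     S \<in> borel_sets_of W \<and>
     (\<exists>\<nu>. space \<nu> = topspace W \<and> sets \<nu> = borel_sets_of W \<and>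
        (\<exists>K. compactin W K \<and> 0 < emeasure \<nu> K \<and> emeasure \<nu> K < \<infinity>) \<and>
        (\<forall>v\<in>topspace W. AE e in \<nu>. v + e \<in> S))"

definition prevalent :: "'v::ab_group_add topology \<Rightarrow> 'v set \<Rightarrow> bool" where
  "prevalent W S \<longleftrightarrow> S \<subseteq> topspace W \<and> (\<exists>B\<subseteq>S. prevalent_borel W B)"

text \<open>\<open>foldr partial_deriv is\<close> is the iterated partial derivative along the list of indices
  \<open>is\<close>.\<close>

definition Cr_basic_open ::
  "nat \<Rightarrow> enat \<Rightarrow> 'a chart set \<Rightarrow> 'a chart \<Rightarrow> 'a set \<Rightarrow> nat list \<Rightarrow> ('a \<Rightarrow> real) \<Rightarrow> real
     \<Rightarrow> ('a \<Rightarrow> real) set" where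
  "Cr_basic_open n r A c K is f \<epsilon> =
     {h \<in> Cr_functions n r A. \<forall>x\<in>K.
        \<bar>foldr partial_deriv is (h \<circ> chart_inv c) (snd c x)
          - foldr partial_deriv is (f \<circ> chart_inv c) (snd c x)\<bar> < \<epsilon>}"

text \<open>Uniform convergence, on compact subsets of chart domains, of all partial derivatives of
  orders up to \<open>r\<close>.  On a compact manifold this does not depend on the choice of the atlas.\<close>

definition Cr_topology ::
  "nat \<Rightarrow> enat \<Rightarrow> 'a::topological_space chart set \<Rightarrow> ('a \<Rightarrow> real) topology" where
  "Cr_topology n r A = topology_generated_by
     {Cr_basic_open n r A c K is f \<epsilon> | c K is f \<epsilon>.
        c \<in> A \<and> compact K \<and> K \<subseteq> fst c \<and> set is \<subseteq> {..<n} \<and> enat (length is) \<le> r \<and>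
        f \<in> Cr_functions n r A \<and> \<epsilon> > 0}"


section \<open>Delay coordinates\<close>

definition Per :: "nat \<Rightarrow> ('a \<Rightarrow> 'a) \<Rightarrow> 'a set" where
  "Per p T = {x. (T ^^ p) x = x}"

definition delay_map :: "('a \<Rightarrow> 'a) \<Rightarrow> ('a \<Rightarrow> real) \<Rightarrow> nat \<Rightarrow> 'a \<Rightarrow> (nat \<Rightarrow> real)" where
  "delay_map T h k x = (\<lambda>i. if i < k then h ((T ^^ i) x) else 0)"

definition euclidean_norm :: "nat \<Rightarrow> (nat \<Rightarrow> real) \<Rightarrow> real" where
  "euclidean_norm k v = L2_set v {..<k}"

end

theory Submission
  imports Defs "HOL-Computational_Algebra.Polynomial"
begin

text \<open>
  The probe is the Lebesgue measure on a cube of coefficients of all products of at most \<open>2 k\<close>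
  functions from a finite family which separates points and tangent vectors.  Such products
  interpolate values at \<open>2 k\<close> points and first derivatives at \<open>k\<close> points.  Hence, for \<open>x\<close> not
  periodic of period less than \<open>k\<close>, the map sending the coefficients to \<open>\<phi>(x) - \<phi>(y)\<close> has rank \<open>k\<close>
  for all \<open>y\<close> outside a finite set, so that \<open>\<bar>\<phi>(x) - \<phi>(y)\<bar> \<le> \<epsilon>\<close> has probability \<open>O(\<epsilon>\<^sup>k)\<close>; covering a
  set of vanishing \<open>k\<close>-dimensional Hausdorff measure by small sets shows that almost surely
  \<open>\<phi>(y) \<noteq> \<phi>(x)\<close> for all \<open>y \<noteq> x\<close>.  The same argument over the unit sphere of the tangent space, of
  dimension less than \<open>k\<close>, shows that almost surely \<open>d\<phi>(x)\<close> is injective.  Both facts together give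
  the Lipschitz bound at \<open>x\<close>, and Fubini exchanges the quantifiers over \<open>x\<close> and over the coefficients.

  If \<open>k > n\<close>, this applies to the whole manifold in place of \<open>X\<close>.  Conversely, the Lipschitz bound
  over the whole manifold makes \<open>\<phi>\<close> injective at \<open>x\<close> and immersive at \<open>x\<close>, so that \<open>\<phi>\<close> is near \<open>x\<close> the
  graph of a function of \<open>n\<close> of the \<open>k\<close> coordinates, and this graph is all of the image near \<open>\<phi>(x)\<close>.
\<close>

section \<open>Calculus in the spaces \<open>\<real>\<^sup>n\<close>\<close>

text \<open>Two measurability demands shape the proof: prevalence asks for a Borel set of
  observables, and Fubini asks for a jointly measurable property of points and coefficients.
  Injectivity together with immersivity at x has no evident description of this kind. The Lipschitz
  bound has one: its constant may be taken to be an integer, y may run through a countable dense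
  set, and for a fixed constant the set of good x is closed in X and its measure depends
  semicontinuously on the observable. This is why statement (2), too, is reached through the
  Lipschitz bound. Rank k is recorded by a matrix b of coefficients for which
  \<open>\<Sum>j<m. b i j * f j y l\<close> is within 1 / (4 k) of the identity matrix. Being an
  open condition, it survives on a neighbourhood of y with the same b, and it feeds directly into a
  packing argument for the measure estimate. From the metric tensor the later arguments draw two
  comparisons: near each point chart coordinates bound the distance from above, and observables are
  Lipschitz for it, which bounds it from below.\<close>

abbreviation Rn :: "nat \<Rightarrow> (nat \<Rightarrow> real) set" where
  "Rn n \<equiv> topspace (Euclidean_space n)"

lemma in_Rn: "x \<in> Rn n \<longleftrightarrow> (\<forall>i\<ge>n. x i = 0)"
  by (simp add: topspace_Euclidean_space)

lemma openin_Rn_top_of_set: "openin (Euclidean_space n) = openin (top_of_set (Rn n))"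
  by (simp add: Euclidean_space_def euclidean_product_topology)

text \<open>Only finitely many coordinates are restricted, so this is a basic open set of the full
  product; the intersection with \<open>Rn n\<close> is taken where it is used.\<close>

lemma open_box:
  fixes x :: "nat \<Rightarrow> real"
  shows "open {y. \<forall>i<n. \<bar>y i - x i\<bar> < e}"
proof -
  have "open {y. \<forall>i\<in>{..<n}. y i \<in> ball (x i) e}"
    by (rule product_topology_basis') auto
  also have "{y. \<forall>i\<in>{..<n}. y i \<in> ball (x i) e} = {y. \<forall>i<n. \<bar>y i - x i\<bar> < e}"
    by (auto simp: dist_real_def abs_minus_commute)
  finally show ?thesis .
qed

lemma tendsto_funI:
  fixes f :: "'c \<Rightarrow> nat \<Rightarrow> real"
  assumes "\<And>i. ((\<lambda>x. f x i) \<longlongrightarrow> l i) F"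
  shows "(f \<longlongrightarrow> l) F"
  using assms limitin_componentwise[of "\<lambda>_. euclidean" UNIV f l F]
  by (auto simp: euclidean_product_topology)

text \<open>If no box of half-width 1 / (m + 1) around x fitted into U, points chosen in these boxes
  outside U would converge to x in every coordinate, those from index n on being constantly
  0.\<close>

lemma open_contains_box:
  fixes x :: "nat \<Rightarrow> real"
  assumes "open U" "x \<in> U" "x \<in> Rn n"
  obtains e where "e > 0" "\<And>y. y \<in> Rn n \<Longrightarrow> (\<And>i. i < n \<Longrightarrow> \<bar>y i - x i\<bar> < e) \<Longrightarrow> y \<in> U"
proof (rule ccontr)
  assume H: "\<not> thesis"
  have "\<exists>y. y \<in> Rn n \<and> (\<forall>i<n. \<bar>y i - x i\<bar> < 1 / Suc m) \<and> y \<notin> U" for m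
    using that[of "1 / Suc m"] H by force
  then obtain y where y: "\<And>m. y m \<in> Rn n" "\<And>m i. i < n \<Longrightarrow> \<bar>y m i - x i\<bar> < 1 / Suc m" "\<And>m. y m \<notin> U"
    by metis
  have "y \<longlonglongrightarrow> x"
  proof (rule tendsto_funI)
    fix i
    show "(\<lambda>m. y m i) \<longlonglongrightarrow> x i"
    proof (cases "i < n")
      case True
      have "(\<lambda>m. y m i - x i) \<longlonglongrightarrow> 0"
      proof (rule Lim_null_comparison)
        show "\<forall>\<^sub>F m in sequentially. norm (y m i - x i) \<le> 1 / Suc m"
          using y(2)[OF True] by (intro always_eventually) (auto simp: less_imp_le)
        show "(\<lambda>m. 1 / real (Suc m)) \<longlonglongrightarrow> 0"
          using LIMSEQ_inverse_real_of_nat by (simp add: inverse_eq_divide)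
      qed
      then show ?thesis by (simp add: LIM_zero_iff)
    next
      case False
      then show ?thesis using y(1) assms(3) by (auto simp: in_Rn)
    qed
  qed
  then have "\<forall>\<^sub>F m in sequentially. y m \<in> U"
    using assms(1,2) topological_tendstoD by blast
  then show False using y(3) by (auto simp: eventually_sequentially)
qed

text \<open>Turns the subspace topology of a product into inequalities for n coordinates. Most
  openness and continuity arguments below are carried out in this sup-norm form.\<close>

lemma openin_Rn_iff:
  "openin (Euclidean_space n) U \<longleftrightarrow>
     U \<subseteq> Rn n \<and> (\<forall>x\<in>U. \<exists>e>0. \<forall>y\<in>Rn n. (\<forall>i<n. \<bar>y i - x i\<bar> < e) \<longrightarrow> y \<in> U)"
  (is "?L \<longleftrightarrow> ?R")
proof
  assume ?L
  then obtain V where V: "open V" "U = Rn n \<inter> V"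
    by (auto simp: openin_Rn_top_of_set openin_open)
  show ?R
  proof (intro conjI ballI)
    show "U \<subseteq> Rn n" using V by auto
    fix x assume "x \<in> U"
    then obtain e where "e > 0" "\<And>y. y \<in> Rn n \<Longrightarrow> (\<And>i. i < n \<Longrightarrow> \<bar>y i - x i\<bar> < e) \<Longrightarrow> y \<in> V"
      using open_contains_box[of V x n] V by blast
    then show "\<exists>e>0. \<forall>y\<in>Rn n. (\<forall>i<n. \<bar>y i - x i\<bar> < e) \<longrightarrow> y \<in> U"
      using V by blast
  qed
next
  assume R: ?R
  have "\<exists>T. openin (Euclidean_space n) T \<and> x \<in> T \<and> T \<subseteq> U" if x: "x \<in> U" for x
  proof -
    obtain e where e: "e > 0" "\<forall>y\<in>Rn n. (\<forall>i<n. \<bar>y i - x i\<bar> < e) \<longrightarrow> y \<in> U"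
      using R x by blast
    have "openin (Euclidean_space n) (Rn n \<inter> {y. \<forall>i<n. \<bar>y i - x i\<bar> < e})"
      unfolding openin_Rn_top_of_set using open_box by (rule openin_open_Int)
    moreover have "x \<in> Rn n \<inter> {y. \<forall>i<n. \<bar>y i - x i\<bar> < e}" using R x e by auto
    moreover have "Rn n \<inter> {y. \<forall>i<n. \<bar>y i - x i\<bar> < e} \<subseteq> U" using e by auto
    ultimately show ?thesis by blast
  qed
  then show ?L using openin_subopen[of "Euclidean_space n" U] by blast
qed

lemma continuous_on_Rn_iff:
  fixes f :: "(nat \<Rightarrow> real) \<Rightarrow> real"
  assumes "U \<subseteq> Rn n"
  shows "continuous_on U f \<longleftrightarrow>
    (\<forall>x\<in>U. \<forall>e>0. \<exists>d>0. \<forall>y\<in>U. (\<forall>i<n. \<bar>y i - x i\<bar> < d) \<longrightarrow> \<bar>f y - f x\<bar> < e)" (is "?L \<longleftrightarrow> ?R")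
proof
  assume L: ?L
  show ?R
  proof (intro ballI allI impI)
    fix x and e :: real assume x: "x \<in> U" "e > 0"
    obtain A where A: "open A" "A \<inter> U = f -` ball (f x) e \<inter> U"
      using L[unfolded continuous_on_open_invariant, rule_format, OF open_ball] by blast
    then have "x \<in> A" using x by auto
    then obtain d where "d > 0" and d: "\<And>y. y \<in> Rn n \<Longrightarrow> (\<And>i. i < n \<Longrightarrow> \<bar>y i - x i\<bar> < d) \<Longrightarrow> y \<in> A"
      using open_contains_box[OF A(1)] assms x by blast
    then show "\<exists>d>0. \<forall>y\<in>U. (\<forall>i<n. \<bar>y i - x i\<bar> < d) \<longrightarrow> \<bar>f y - f x\<bar> < e"
    proof (intro exI[of _ d] conjI ballI impI)
      fix y assume y: "y \<in> U" "\<forall>i<n. \<bar>y i - x i\<bar> < d"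
      then have "y \<in> A" using assms d by blast
      then show "\<bar>f y - f x\<bar> < e"
        using A(2) y by (auto simp: dist_real_def abs_minus_commute set_eq_iff)
    qed (rule \<open>d > 0\<close>)
  qed
next
  assume R: ?R
  show ?L
    unfolding continuous_on_topological
  proof (intro ballI allI impI)
    fix x B assume x: "x \<in> U" "open B" "f x \<in> B"
    then obtain e where e: "e > 0" "ball (f x) e \<subseteq> B" using open_contains_ball by blast
    obtain d where d: "d > 0" "\<forall>y\<in>U. (\<forall>i<n. \<bar>y i - x i\<bar> < d) \<longrightarrow> \<bar>f y - f x\<bar> < e"
      using R x e by blast
    show "\<exists>A. open A \<and> x \<in> A \<and> (\<forall>y\<in>U. y \<in> A \<longrightarrow> f y \<in> B)"
      using d e open_box[of n x d]
      by (intro exI[of _ "{y. \<forall>i<n. \<bar>y i - x i\<bar> < d}"])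
         (auto simp: dist_real_def abs_minus_commute subset_iff)
  qed
qed

section \<open>Partial derivatives and classes of differentiability\<close>

lemma upd_in_Rn: "x \<in> Rn n \<Longrightarrow> i < n \<Longrightarrow> x(i := t) \<in> Rn n"
  by (auto simp: in_Rn)

text \<open>This is what makes partial derivatives local: near \<open>x i\<close> the line through x
  in direction i stays in U, so values of a function outside U do not affect its derivatives in
  U.\<close>

lemma eventually_upd_in:
  assumes "openin (Euclidean_space n) U" "x \<in> U" "i < n"
  shows "\<forall>\<^sub>F t in nhds (x i). x(i := t) \<in> U"
proof -
  obtain e where e: "e > 0" "\<forall>y\<in>Rn n. (\<forall>i<n. \<bar>y i - x i\<bar> < e) \<longrightarrow> y \<in> U"
    using assms openin_Rn_iff by blast
  have "x(i := t) \<in> U" if "dist t (x i) < e" for t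
    using e(2) upd_in_Rn[of x n i t] that assms e(1) openin_Rn_iff[of n U]
    by (auto simp: dist_real_def)
  then show ?thesis using e(1) unfolding eventually_nhds_metric by blast
qed

lemma partial_deriv_eqI:
  "((\<lambda>t. f (x(i := t))) has_real_derivative D) (at (x i)) \<Longrightarrow> partial_deriv i f x = D"
  unfolding partial_deriv_def by (rule DERIV_imp_deriv)

lemma has_partial_cong:
  assumes "openin (Euclidean_space n) U" "x \<in> U" "i < n" "\<And>y. y \<in> U \<Longrightarrow> f y = g y"
  shows "((\<lambda>t. f (x(i := t))) has_real_derivative D) (at (x i)) \<longleftrightarrow>
         ((\<lambda>t. g (x(i := t))) has_real_derivative D) (at (x i))"
proof (rule DERIV_cong_ev)
  show "\<forall>\<^sub>F t in nhds (x i). f (x(i := t)) = g (x(i := t))"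
    using eventually_upd_in[OF assms(1-3)] by eventually_elim (use assms(4) in auto)
qed auto

lemma partial_deriv_cong:
  assumes "openin (Euclidean_space n) U" "x \<in> U" "i < n" "\<And>y. y \<in> U \<Longrightarrow> f y = g y"
  shows "partial_deriv i f x = partial_deriv i g x"
  unfolding partial_deriv_def deriv_def using has_partial_cong[OF assms(1-3), of f g] assms(4) by simp

lemma Ck_on_cong:
  assumes "openin (Euclidean_space n) U" "\<And>x. x \<in> U \<Longrightarrow> f x = g x" "Ck_on n m U f"
  shows "Ck_on n m U g"
  using assms(2,3)
proof (induction m arbitrary: f g)
  case 0
  then show ?case using continuous_on_cong[of U U f g] by simp
next
  case (Suc m)
  have "(\<lambda>t. g (x(i := t))) field_differentiable at (x i)" if "x \<in> U" "i < n" for x i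
    using Suc.prems(2) has_partial_cong[OF assms(1) that, of f g] Suc.prems(1) that
    unfolding Ck_on.simps field_differentiable_def by metis
  moreover have "Ck_on n m U (partial_deriv i g)" if "i < n" for i
    by (rule Suc.IH[of "partial_deriv i f"])
       (use Suc.prems that partial_deriv_cong[OF assms(1), of _ i f g] in auto)
  ultimately show ?case using Suc.prems continuous_on_cong[of U U f g] by simp
qed

text \<open>\<open>Ck_on\<close> speaks about the total operator \<open>partial_deriv\<close>; here
  the derivatives may be exhibited by formulas instead. All closure properties below are inductions
  driven by this rule.\<close>

lemma Ck_on_SucI:
  assumes "openin (Euclidean_space n) U" "continuous_on U f"
    "\<And>i x. i < n \<Longrightarrow> x \<in> U \<Longrightarrow> ((\<lambda>t. f (x(i := t))) has_real_derivative f' i x) (at (x i))"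
    "\<And>i. i < n \<Longrightarrow> Ck_on n m U (f' i)"
  shows "Ck_on n (Suc m) U f"
proof -
  have "Ck_on n m U (partial_deriv i f)" if "i < n" for i
    by (rule Ck_on_cong[OF assms(1) _ assms(4)[OF that]])
       (use assms(3)[OF that] partial_deriv_eqI in metis)
  then show ?thesis using assms by (auto simp: field_differentiable_def)
qed

lemma Ck_on_continuous: "Ck_on n m U f \<Longrightarrow> continuous_on U f"
  by (cases m) auto

lemma Ck_on_partial: "Ck_on n (Suc m) U f \<Longrightarrow> i < n \<Longrightarrow> Ck_on n m U (partial_deriv i f)"
  by simp

lemma Ck_on_has_partial:
  "Ck_on n (Suc m) U f \<Longrightarrow> i < n \<Longrightarrow> x \<in> U \<Longrightarrow>
   ((\<lambda>t. f (x(i := t))) has_real_derivative partial_deriv i f x) (at (x i))"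
  by (simp add: partial_deriv_def DERIV_deriv_iff_field_differentiable)

lemma Ck_on_SucD: "Ck_on n (Suc m) U f \<Longrightarrow> Ck_on n m U f"
  by (induction m arbitrary: f) auto

lemma Ck_on_mono: "Ck_on n m U f \<Longrightarrow> m' \<le> m \<Longrightarrow> Ck_on n m' U f"
  by (induction m) (auto simp: le_Suc_eq simp del: Ck_on.simps(2) dest: Ck_on_SucD)

lemma Ck_on_subset: "Ck_on n m U f \<Longrightarrow> U' \<subseteq> U \<Longrightarrow> Ck_on n m U' f"
  by (induction m arbitrary: f) (auto intro: continuous_on_subset)

text \<open>Every ingredient of the class is a pointwise or continuity condition, so a cover by open
  pieces suffices; the induction passes to partial derivatives on the same pieces.\<close>

lemma Ck_on_local:
  assumes "\<And>x. x \<in> U \<Longrightarrow> \<exists>V. openin (Euclidean_space n) V \<and> x \<in> V \<and> V \<subseteq> U \<and> Ck_on n m V f"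
  shows "Ck_on n m U f"
  using assms
proof (induction m arbitrary: f)
  case 0
  have "continuous_on U f"
    unfolding continuous_on_eq_continuous_within
  proof
    fix x assume "x \<in> U"
    then obtain V where V: "openin (Euclidean_space n) V" "x \<in> V" "V \<subseteq> U" "continuous_on V f"
      using 0 by force
    then obtain W where W: "open W" "V = Rn n \<inter> W" by (auto simp: openin_Rn_top_of_set openin_open)
    have "U \<subseteq> Rn n" using 0 openin_subset by fastforce
    \<comment> \<open>V is a neighbourhood of x relative to U as well, because U lies inside
      \<open>Rn n\<close>.\<close>
    then have "V = U \<inter> W" using W V by auto
    then show "continuous (at x within U) f"
      using V W at_within_nhd[of x W U V]
      by (auto simp: continuous_on_eq_continuous_within continuous_within)
  qed
  then show ?case by simp
next
  case (Suc m)
  have "continuous_on U f"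
  proof -
    have "Ck_on n m U f"
    proof (rule Suc.IH)
      fix x assume "x \<in> U"
      from Suc.prems[OF this] obtain V where "openin (Euclidean_space n) V" "x \<in> V" "V \<subseteq> U" "Ck_on n (Suc m) V f"
        by blast
      then show "\<exists>V. openin (Euclidean_space n) V \<and> x \<in> V \<and> V \<subseteq> U \<and> Ck_on n m V f"
        using Ck_on_SucD[of n m V f] by blast
    qed
    then show ?thesis by (rule Ck_on_continuous)
  qed
  moreover have "Ck_on n m U (partial_deriv i f)" if "i < n" for i
  proof (rule Suc.IH)
    fix x assume "x \<in> U"
    from Suc.prems[OF this] obtain V where "openin (Euclidean_space n) V" "x \<in> V" "V \<subseteq> U" "Ck_on n (Suc m) V f"
      by blast
    then show "\<exists>V. openin (Euclidean_space n) V \<and> x \<in> V \<and> V \<subseteq> U \<and> Ck_on n m V (partial_deriv i f)"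
      using that by (intro exI[of _ V]) simp
  qed
  moreover have "(\<lambda>t. f (x(i := t))) field_differentiable at (x i)" if "x \<in> U" "i < n" for x i
    using Suc.prems[OF that(1)] that(2) by auto
  ultimately show ?case by simp
qed

lemma Ck_on_const [simp]: "Ck_on n m U (\<lambda>x. c)"
proof (induction m arbitrary: c)
  case (Suc m)
  have "partial_deriv i (\<lambda>x. c) = (\<lambda>x. 0)" for i
    by (simp add: partial_deriv_def fun_eq_iff)
  then show ?case using Suc by simp
qed simp

lemma Ck_on_coord:
  assumes "openin (Euclidean_space n) U"
  shows "Ck_on n m U (\<lambda>x. x j)"
proof (cases m)
  case 0
  then show ?thesis by (simp add: continuous_on_subset[OF continuous_on_product_coordinates])
next
  case (Suc m')
  show ?thesis unfolding Suc
  proof (rule Ck_on_SucI[OF assms, where f' = "\<lambda>i x. if i = j then 1 else 0"])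
    fix i x
    show "((\<lambda>t. (x(i := t)) j) has_real_derivative (if i = j then 1 else 0)) (at (x i))"
      by (cases "i = j") auto
  qed (simp_all add: continuous_on_subset[OF continuous_on_product_coordinates])
qed

lemma Ck_on_add:
  assumes "openin (Euclidean_space n) U" "Ck_on n m U f" "Ck_on n m U g"
  shows "Ck_on n m U (\<lambda>x. f x + g x)"
  using assms(2,3)
proof (induction m arbitrary: f g)
  case 0
  then show ?case by (simp add: continuous_on_add)
next
  case (Suc m)
  show ?case
  proof (rule Ck_on_SucI[OF assms(1), where f' = "\<lambda>i x. partial_deriv i f x + partial_deriv i g x"])
    show "continuous_on U (\<lambda>x. f x + g x)"
      using Suc.prems by (intro continuous_on_add Ck_on_continuous)
    fix i assume i: "i < n"
    show "Ck_on n m U (\<lambda>x. partial_deriv i f x + partial_deriv i g x)"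
      by (rule Suc.IH[OF Ck_on_partial[OF Suc.prems(1) i] Ck_on_partial[OF Suc.prems(2) i]])
    fix x assume x: "x \<in> U"
    show "((\<lambda>t. f (x(i := t)) + g (x(i := t))) has_real_derivative
        partial_deriv i f x + partial_deriv i g x) (at (x i))"
      by (rule DERIV_add[OF Ck_on_has_partial[OF Suc.prems(1) i x] Ck_on_has_partial[OF Suc.prems(2) i x]])
  qed
qed

lemma Ck_on_mult:
  assumes "openin (Euclidean_space n) U" "Ck_on n m U f" "Ck_on n m U g"
  shows "Ck_on n m U (\<lambda>x. f x * g x)"
  using assms(2,3)
proof (induction m arbitrary: f g)
  case 0
  then show ?case by (simp add: continuous_on_mult)
next
  case (Suc m)
  show ?case
  proof (rule Ck_on_SucI[OF assms(1), where f' = "\<lambda>i x. partial_deriv i f x * g x + partial_deriv i g x * f x"])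
    show "continuous_on U (\<lambda>x. f x * g x)"
      using Suc.prems by (intro continuous_on_mult Ck_on_continuous)
    fix i assume i: "i < n"
    show "Ck_on n m U (\<lambda>x. partial_deriv i f x * g x + partial_deriv i g x * f x)"
      using Suc.prems[THEN Ck_on_SucD] Suc.prems[THEN Ck_on_partial, OF i]
      by (intro Ck_on_add[OF assms(1)] Suc.IH)
    fix x assume x: "x \<in> U"
    show "((\<lambda>t. f (x(i := t)) * g (x(i := t))) has_real_derivative
        partial_deriv i f x * g x + partial_deriv i g x * f x) (at (x i))"
      by (rule DERIV_cong[OF DERIV_mult[OF Ck_on_has_partial[OF Suc.prems(1) i x]
          Ck_on_has_partial[OF Suc.prems(2) i x]]]) simp
  qed
qed

lemma Ck_on_sum:
  assumes "openin (Euclidean_space n) U" "\<And>a. a \<in> I \<Longrightarrow> Ck_on n m U (f a)"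
  shows "Ck_on n m U (\<lambda>x. \<Sum>a\<in>I. f a x)"
  using assms(2) by (induction I rule: infinite_finite_induct) (auto intro: Ck_on_add[OF assms(1)])

lemma Ck_on_prod:
  assumes "openin (Euclidean_space n) U" "\<And>a. a \<in> I \<Longrightarrow> Ck_on n m U (f a)"
  shows "Ck_on n m U (\<lambda>x. \<Prod>a\<in>I. f a x)"
  using assms(2) by (induction I rule: infinite_finite_induct) (auto intro: Ck_on_mult[OF assms(1)])

lemma Ck_on_cmult:
  "openin (Euclidean_space n) U \<Longrightarrow> Ck_on n m U f \<Longrightarrow> Ck_on n m U (\<lambda>x. c * f x)"
  by (rule Ck_on_mult) auto

lemma Ck_on_diff:
  assumes "openin (Euclidean_space n) U" "Ck_on n m U f" "Ck_on n m U g"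
  shows "Ck_on n m U (\<lambda>x. f x - g x)"
  using Ck_on_add[OF assms(1,2) Ck_on_cmult[OF assms(1,3), of "-1"]] by simp

text \<open>The derivative of 1 / f is written with two factors \<open>inverse (f x)\<close>, so the
  induction hypothesis about the reciprocal itself applies to each of them.\<close>

lemma Ck_on_inverse:
  assumes "openin (Euclidean_space n) U" "Ck_on n m U f" "\<And>x. x \<in> U \<Longrightarrow> f x \<noteq> 0"
  shows "Ck_on n m U (\<lambda>x. inverse (f x))"
  using assms(2)
proof (induction m)
  case 0
  then show ?case using assms(3) by (simp add: continuous_on_inverse)
next
  case (Suc m)
  have IH: "Ck_on n m U (\<lambda>x. inverse (f x))" using Suc Ck_on_SucD by blast
  show ?case
  proof (rule Ck_on_SucI[OF assms(1), where f' = "\<lambda>i x. (-1) * (inverse (f x) * partial_deriv i f x * inverse (f x))"])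
    show "continuous_on U (\<lambda>x. inverse (f x))" using IH by (rule Ck_on_continuous)
    fix i assume i: "i < n"
    show "Ck_on n m U (\<lambda>x. (-1) * (inverse (f x) * partial_deriv i f x * inverse (f x)))"
      by (intro Ck_on_cmult[OF assms(1)] Ck_on_mult[OF assms(1)] IH Ck_on_partial[OF Suc.prems] i)
    fix x assume x: "x \<in> U"
    show "((\<lambda>t. inverse (f (x(i := t)))) has_real_derivative
        (-1) * (inverse (f x) * partial_deriv i f x * inverse (f x))) (at (x i))"
      by (rule DERIV_cong[OF DERIV_inverse'[OF Ck_on_has_partial[OF Suc.prems i x]]]) (use assms(3)[OF x] in auto)
  qed
qed


section \<open>Mean values, first order expansions and chain rules\<close>

lemma MVT_between:
  fixes f :: "real \<Rightarrow> real"
  assumes "\<And>t. \<bar>t - a\<bar> \<le> \<bar>b - a\<bar> \<Longrightarrow> (f has_real_derivative f' t) (at t)"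
  shows "\<exists>t. \<bar>t - a\<bar> \<le> \<bar>b - a\<bar> \<and> f b - f a = f' t * (b - a)"
proof -
  consider "a < b" | "a = b" | "b < a" by linarith
  then show ?thesis
  proof cases
    case 1
    then obtain z where "a < z" "z < b" "f b - f a = (b - a) * f' z"
      using MVT2[of a b f f'] assms by force
    then show ?thesis by (intro exI[of _ z]) (auto simp: mult.commute)
  next
    case 3
    then obtain z where z: "b < z" "z < a" "f a - f b = (a - b) * f' z"
      using MVT2[of b a f f'] assms by force
    then have "f b - f a = f' z * (b - a)" by (simp add: algebra_simps)
    with z show ?thesis by (intro exI[of _ z]) auto
  qed auto
qed

text \<open>Walking from x to y one coordinate at a time reduces everything to the mean value
  theorem in one variable. There is a separate intermediate point for each coordinate; for limits
  this is good enough, since each stays in the box of half-widths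
  \<open>\<bar>y i - x i\<bar>\<close> around x.\<close>

lemma Ck_on_MVT:
  assumes "Ck_on n (Suc 0) U f" "x \<in> Rn n" "y \<in> Rn n"
    and box: "\<And>z. z \<in> Rn n \<Longrightarrow> (\<And>i. i < n \<Longrightarrow> \<bar>z i - x i\<bar> \<le> \<bar>y i - x i\<bar>) \<Longrightarrow> z \<in> U"
  obtains \<xi> where "\<And>j. j < n \<Longrightarrow> \<xi> j \<in> U" "\<And>j i. j < n \<Longrightarrow> i < n \<Longrightarrow> \<bar>\<xi> j i - x i\<bar> \<le> \<bar>y i - x i\<bar>"
    "f y - f x = (\<Sum>j<n. partial_deriv j f (\<xi> j) * (y j - x j))"
proof -
  \<comment> \<open>The vertices of the walk: z j has already taken over the first j coordinates of
    y.\<close>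
  define z where "z = (\<lambda>j i. if i < j then y i else x i)"
  have zU: "(z j)(j := t) \<in> U" if "j < n" "\<bar>t - x j\<bar> \<le> \<bar>y j - x j\<bar>" for j t
    by (rule box) (use that assms(2,3) in \<open>auto simp: z_def in_Rn\<close>)
  have zS: "z (Suc j) = (z j)(j := y j)" "z j = (z j)(j := x j)" for j
    by (auto simp: z_def fun_eq_iff less_Suc_eq)
  have "\<exists>t. \<bar>t - x j\<bar> \<le> \<bar>y j - x j\<bar> \<and> f (z (Suc j)) - f (z j) = partial_deriv j f ((z j)(j := t)) * (y j - x j)"
    if j: "j < n" for j
  proof -
    have "((\<lambda>t. f ((z j)(j := t))) has_real_derivative partial_deriv j f ((z j)(j := t))) (at t)"
      if "\<bar>t - x j\<bar> \<le> \<bar>y j - x j\<bar>" for t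
      using Ck_on_has_partial[OF assms(1) j zU[OF j that]] by simp
    from MVT_between[OF this] show ?thesis using zS by metis
  qed
  then obtain t where t: "\<And>j. j < n \<Longrightarrow> \<bar>t j - x j\<bar> \<le> \<bar>y j - x j\<bar>"
    "\<And>j. j < n \<Longrightarrow> f (z (Suc j)) - f (z j) = partial_deriv j f ((z j)(j := t j)) * (y j - x j)"
    by metis
  define \<xi> where "\<xi> j = (z j)(j := t j)" for j
  have "f y - f x = f (z n) - f (z 0)"
  proof -
    have "z n = y" "z 0 = x" using assms(2,3) by (auto simp: z_def in_Rn fun_eq_iff)
    then show ?thesis by simp
  qed
  also have "\<dots> = (\<Sum>j<n. f (z (Suc j)) - f (z j))"
    by (rule sum_lessThan_telescope[symmetric])
  also have "\<dots> = (\<Sum>j<n. partial_deriv j f (\<xi> j) * (y j - x j))"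
    using t(2) by (simp add: \<xi>_def)
  finally show ?thesis
    using t(1) zU by (intro that[of \<xi>]) (auto simp: \<xi>_def z_def)
qed

text \<open>An exact linear expansion whose coefficients tend to the partial derivatives; it plays
  the role of total differentiability. The filter is arbitrary so that the same statement serves
  one-sided curves, the difference quotients of an implicit function, and full limits at a
  point.\<close>

lemma Ck_on_expansion:
  assumes U: "openin (Euclidean_space n) U" "Ck_on n (Suc 0) U f" "x \<in> U"
    and \<gamma>: "\<forall>\<^sub>F s in F. \<gamma> s \<in> Rn n" "\<And>i. i < n \<Longrightarrow> ((\<lambda>s. \<gamma> s i) \<longlongrightarrow> x i) F"
  obtains c where "\<And>j. j < n \<Longrightarrow> (c j \<longlongrightarrow> partial_deriv j f x) F"
    "\<forall>\<^sub>F s in F. f (\<gamma> s) - f x = (\<Sum>j<n. c j s * (\<gamma> s j - x j))"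
proof -
  have near: "\<forall>\<^sub>F s in F. \<gamma> s \<in> Rn n \<and> (\<forall>i<n. \<bar>\<gamma> s i - x i\<bar> < d)" if "d > 0" for d
  proof -
    have "\<forall>\<^sub>F s in F. \<forall>i\<in>{..<n}. \<bar>\<gamma> s i - x i\<bar> < d"
      using tendstoD[OF \<gamma>(2) \<open>d > 0\<close>] by (intro eventually_ball_finite) (auto simp: dist_real_def)
    then show ?thesis using \<gamma>(1) by eventually_elim auto
  qed
  obtain e where e: "e > 0" "\<forall>y\<in>Rn n. (\<forall>i<n. \<bar>y i - x i\<bar> < e) \<longrightarrow> y \<in> U"
    using U openin_Rn_iff by blast
  have tR: "x \<in> Rn n" using U openin_subset by blast
  define P where "P = (\<lambda>s \<xi>. (\<forall>j<n. \<xi> j \<in> U \<and> (\<forall>i<n. \<bar>\<xi> j i - x i\<bar> \<le> \<bar>\<gamma> s i - x i\<bar>)) \<and>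
      f (\<gamma> s) - f x = (\<Sum>j<n. partial_deriv j f (\<xi> j) * (\<gamma> s j - x j)))"
  \<comment> \<open>A choice of intermediate points for every s; it is meaningful for those s whose
    point on \<gamma> lies in the box of radius e, hence eventually along F.\<close>
  define \<Xi> where "\<Xi> s = (SOME \<xi>. P s \<xi>)" for s
  have P: "P s (\<Xi> s)" if s: "\<gamma> s \<in> Rn n \<and> (\<forall>i<n. \<bar>\<gamma> s i - x i\<bar> < e)" for s
  proof -
    have "\<exists>\<xi>. P s \<xi>"
    proof (rule Ck_on_MVT[OF U(2) tR conjunct1[OF s]])
      fix z assume "z \<in> Rn n" "\<And>i. i < n \<Longrightarrow> \<bar>z i - x i\<bar> \<le> \<bar>\<gamma> s i - x i\<bar>"
      then show "z \<in> U" using e(2) s by (meson le_less_trans)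
    next
      fix \<xi> assume "\<And>j. j < n \<Longrightarrow> \<xi> j \<in> U"
        "\<And>j i. j < n \<Longrightarrow> i < n \<Longrightarrow> \<bar>\<xi> j i - x i\<bar> \<le> \<bar>\<gamma> s i - x i\<bar>"
        "f (\<gamma> s) - f x = (\<Sum>j<n. partial_deriv j f (\<xi> j) * (\<gamma> s j - x j))"
      then show "\<exists>\<xi>. P s \<xi>" unfolding P_def by (intro exI[of _ \<xi>]) simp
    qed
    then show ?thesis unfolding \<Xi>_def by (rule someI_ex)
  qed
  have evP: "\<forall>\<^sub>F s in F. P s (\<Xi> s)"
    using near[OF e(1)] by eventually_elim (rule P)
  have lim: "((\<lambda>s. partial_deriv j f (\<Xi> s j)) \<longlongrightarrow> partial_deriv j f x) F" if j: "j < n" for j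
  proof (rule tendstoI)
    fix \<epsilon> :: real assume "\<epsilon> > 0"
    have "continuous_on U (partial_deriv j f)" using U(2) j by simp
    then obtain d where d: "d > 0" "\<forall>y\<in>U. (\<forall>i<n. \<bar>y i - x i\<bar> < d) \<longrightarrow> \<bar>partial_deriv j f y - partial_deriv j f x\<bar> < \<epsilon>"
      using continuous_on_Rn_iff[OF openin_subset[OF U(1)]] U(3) \<open>\<epsilon> > 0\<close> by blast
    show "\<forall>\<^sub>F s in F. dist (partial_deriv j f (\<Xi> s j)) (partial_deriv j f x) < \<epsilon>"
      using near[OF d(1)] evP
    proof eventually_elim
      case (elim s)
      then have "\<Xi> s j \<in> U" "\<forall>i<n. \<bar>\<Xi> s j i - x i\<bar> < d"
        using j unfolding P_def by (blast, meson le_less_trans)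
      then show ?case using d(2) by (simp add: dist_real_def)
    qed
  qed
  show ?thesis
    using lim evP by (intro that[of "\<lambda>j s. partial_deriv j f (\<Xi> s j)"]) (auto simp: P_def elim: eventually_mono)
qed

text \<open>Dividing the expansion by s - t gives the derivative. The version within S covers the
  endpoints of arcs, where only one-sided derivatives exist.\<close>

lemma Ck_on_chain_curve:
  assumes U: "openin (Euclidean_space n) U" "Ck_on n (Suc 0) U f" "\<gamma> t \<in> U"
    and \<gamma>: "\<forall>\<^sub>F s in at t within S. \<gamma> s \<in> Rn n"
      "\<And>i. i < n \<Longrightarrow> ((\<lambda>s. \<gamma> s i) has_real_derivative v i) (at t within S)"
  shows "((\<lambda>s. f (\<gamma> s)) has_real_derivative (\<Sum>i<n. partial_deriv i f (\<gamma> t) * v i)) (at t within S)"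
proof -
  have lim: "((\<lambda>s. \<gamma> s i) \<longlongrightarrow> \<gamma> t i) (at t within S)" if "i < n" for i
    using DERIV_continuous[OF \<gamma>(2)[OF that]] by (simp add: continuous_within)
  obtain c where c: "\<And>j. j < n \<Longrightarrow> (c j \<longlongrightarrow> partial_deriv j f (\<gamma> t)) (at t within S)"
    "\<forall>\<^sub>F s in at t within S. f (\<gamma> s) - f (\<gamma> t) = (\<Sum>j<n. c j s * (\<gamma> s j - \<gamma> t j))"
    using Ck_on_expansion[OF U \<gamma>(1) lim] by blast
  have "((\<lambda>s. \<Sum>j<n. c j s * ((\<gamma> s j - \<gamma> t j) / (s - t))) \<longlongrightarrow>
      (\<Sum>j<n. partial_deriv j f (\<gamma> t) * v j)) (at t within S)"
    using \<gamma>(2) c(1) by (intro tendsto_sum tendsto_mult) (auto simp: has_field_derivative_iff)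
  moreover have "\<forall>\<^sub>F s in at t within S. (\<Sum>j<n. c j s * ((\<gamma> s j - \<gamma> t j) / (s - t)))
      = (f (\<gamma> s) - f (\<gamma> t)) / (s - t)"
    using c(2) by eventually_elim (auto simp: sum_divide_distrib)
  ultimately show ?thesis
    unfolding has_field_derivative_iff by (rule Lim_transform_eventually)
qed

lemma continuous_on_into_Rn:
  assumes "F ` U \<subseteq> Rn p" "\<And>j. j < p \<Longrightarrow> continuous_on U (\<lambda>x. F x j)"
  shows "continuous_on U F"
proof (rule continuous_on_coordinatewise_then_product)
  fix j
  show "continuous_on U (\<lambda>x. F x j)"
  proof (cases "j < p")
    case False
    then have "F x j = 0" if "x \<in> U" for x using assms(1) that by (auto simp: in_Rn)
    then show ?thesis using continuous_on_cong[of U U "\<lambda>x. F x j" "\<lambda>_. 0"] by simp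
  qed (rule assms)
qed

text \<open>The chain rule for curves applied to the image under F of the coordinate line through
  x.\<close>

lemma Ck_on_compose_has_partial:
  assumes "openin (Euclidean_space n) U" "openin (Euclidean_space p) V" "F ` U \<subseteq> V"
    "\<And>j. j < p \<Longrightarrow> Ck_on n (Suc m) U (\<lambda>x. F x j)" "Ck_on p (Suc m) V f" "i < n" "x \<in> U"
  shows "((\<lambda>t. f (F (x(i := t)))) has_real_derivative
      (\<Sum>j<p. partial_deriv j f (F x) * partial_deriv i (\<lambda>x. F x j) x)) (at (x i))"
proof -
  have "((\<lambda>t. f (F (x(i := t)))) has_real_derivative
      (\<Sum>j<p. partial_deriv j f (F (x(i := x i))) * partial_deriv i (\<lambda>x. F x j) x)) (at (x i))"
  proof (rule Ck_on_chain_curve[OF assms(2)])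
    show "Ck_on p (Suc 0) V f" using assms(5) by (rule Ck_on_mono) simp
    show "F (x(i := x i)) \<in> V" using assms by auto
    have "\<forall>\<^sub>F t in nhds (x i). F (x(i := t)) \<in> Rn p"
      using eventually_upd_in[OF assms(1,7,6)]
      by eventually_elim (use assms(2,3) openin_subset in blast)
    then show "\<forall>\<^sub>F t in at (x i). F (x(i := t)) \<in> Rn p"
      by (simp add: eventually_nhds_conv_at)
    fix j assume "j < p"
    then show "((\<lambda>t. F (x(i := t)) j) has_real_derivative partial_deriv i (\<lambda>x. F x j) x) (at (x i))"
      by (rule Ck_on_has_partial[OF assms(4) assms(6,7)])
  qed
  then show ?thesis by simp
qed

lemma Ck_on_compose:
  assumes "openin (Euclidean_space n) U" "openin (Euclidean_space p) V" "F ` U \<subseteq> V"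
    "\<And>j. j < p \<Longrightarrow> Ck_on n m U (\<lambda>x. F x j)" "Ck_on p m V f"
  shows "Ck_on n m U (\<lambda>x. f (F x))"
  using assms(4,5)
proof (induction m arbitrary: f)
  case 0
  have "F ` U \<subseteq> Rn p" using assms(2,3) openin_subset by blast
  then have "continuous_on U F" using 0 by (intro continuous_on_into_Rn[of F U p]) auto
  then show ?case using 0 assms(3) by (auto intro: continuous_on_compose2[of V f U F])
next
  case (Suc m)
  have cm: "Ck_on n m U (\<lambda>x. g (F x))" if "Ck_on p m V g" for g
    by (rule Suc.IH[OF _ that]) (use Suc.prems(1) in \<open>auto simp del: Ck_on.simps(2) dest: Ck_on_SucD\<close>)
  show ?case
  proof (rule Ck_on_SucI[OF assms(1)])
    show "continuous_on U (\<lambda>x. f (F x))"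
      using cm[OF Ck_on_SucD[OF Suc.prems(2)]] by (rule Ck_on_continuous)
    fix i assume i: "i < n"
    show "Ck_on n m U (\<lambda>x. \<Sum>j<p. partial_deriv j f (F x) * partial_deriv i (\<lambda>x. F x j) x)"
      using Suc.prems i
      by (intro Ck_on_sum[OF assms(1)] Ck_on_mult[OF assms(1)] cm Ck_on_partial) (auto simp del: Ck_on.simps(2))
    show "((\<lambda>t. f (F (x(i := t)))) has_real_derivative
      (\<Sum>j<p. partial_deriv j f (F x) * partial_deriv i (\<lambda>x. F x j) x)) (at (x i))" if "x \<in> U" for x
      by (rule Ck_on_compose_has_partial[OF assms(1-3) Suc.prems i that])
  qed
qed

text \<open>Since \<open>Rn n\<close> is literally a subset of \<open>Rn k\<close>, restricting a
  function to the smaller space only means forgetting the partial derivatives with index at least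
  n.\<close>

lemma Ck_on_slice: "Ck_on k m W f \<Longrightarrow> n \<le> k \<Longrightarrow> Ck_on n m W f"
  by (induction m arbitrary: f) auto

lemma Cr_onD: "Cr_on n r U f \<Longrightarrow> enat m \<le> r \<Longrightarrow> Ck_on n m U f"
  by (simp add: Cr_on_def)

lemma Cr_on_C1: "Cr_on n r U f \<Longrightarrow> r \<ge> 1 \<Longrightarrow> Ck_on n (Suc 0) U f"
  by (rule Cr_onD) (simp_all add: one_enat_def)

lemma Cr_on_compose:
  assumes "openin (Euclidean_space n) U" "openin (Euclidean_space p) V" "F ` U \<subseteq> V"
    "\<And>j. j < p \<Longrightarrow> Cr_on n r U (\<lambda>x. F x j)" "Cr_on p r V f"
  shows "Cr_on n r U (\<lambda>x. f (F x))"
  using assms(4,5) Ck_on_compose[OF assms(1-3)] by (simp add: Cr_on_def)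

section \<open>Smooth functions of bounded support\<close>

text \<open>The function exp (- 1 / t), extended by 0, with a polynomial in 1 / t as a factor:
  carrying the polynomial makes the class closed under differentiation.\<close>

definition flat :: "real poly \<Rightarrow> real \<Rightarrow> real" where
  "flat P t = (if t > 0 then poly P (1 / t) * exp (- (1 / t)) else 0)"

lemma poly_mult_exp_tendsto_0: "((\<lambda>s. poly P s * exp (- s)) \<longlongrightarrow> (0::real)) at_top"
proof -
  have "((\<lambda>s. \<Sum>i\<le>degree P. coeff P i * (s ^ i / exp s)) \<longlongrightarrow> (\<Sum>i\<le>degree P. coeff P i * 0)) at_top"
    by (intro tendsto_sum tendsto_mult tendsto_const tendsto_power_div_exp_0)
  then show ?thesis
    by (simp add: poly_altdef exp_minus sum_divide_distrib divide_inverse sum_distrib_right mult.assoc)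
qed

lemma flat_has_derivative:
  "(flat P has_real_derivative flat ([:0, 0, 1:] * (P - pderiv P)) t) (at t)"
proof -
  consider "t > 0" | "t < 0" | "t = 0" by linarith
  then show ?thesis
  proof cases
    case 1
    have "((\<lambda>t. poly P (1 / t) * exp (- (1 / t))) has_real_derivative
        flat ([:0, 0, 1:] * (P - pderiv P)) t) (at t)"
      using 1 by (auto intro!: derivative_eq_intros poly_DERIV[THEN DERIV_chain2]
        simp: flat_def algebra_simps power2_eq_square)
    moreover have "\<forall>\<^sub>F s in nhds t. s \<in> {0<..}" using 1 by (intro eventually_nhds_in_open) auto
    then have ev: "\<forall>\<^sub>F s in nhds t. poly P (1 / s) * exp (- (1 / s)) = flat P s"
      by eventually_elim (simp add: flat_def)
    ultimately show ?thesis using DERIV_cong_ev[OF refl ev refl] by blast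
  next
    case 2
    have "\<forall>\<^sub>F s in nhds t. s \<in> {..<0}" using 2 by (intro eventually_nhds_in_open) auto
    then have ev: "\<forall>\<^sub>F s in nhds t. 0 = flat P s"
      by eventually_elim (simp add: flat_def)
    have "((\<lambda>s. 0) has_real_derivative flat ([:0, 0, 1:] * (P - pderiv P)) t) (at t)"
      using 2 by (simp add: flat_def)
    then show ?thesis using DERIV_cong_ev[OF refl ev refl] by blast
  next
    case 3
    \<comment> \<open>At 0 the difference quotient from the right is P (s) * s * exp (- s) with s =
      1 / y, which is again of the given form with the polynomial \<open>pCons 0 P\<close>.\<close>
    have "((\<lambda>y. flat P y / y) \<longlongrightarrow> 0) (at_right 0)"
    proof (rule Lim_transform_eventually)
      show "((\<lambda>y. poly (pCons 0 P) (inverse y) * exp (- inverse y)) \<longlongrightarrow> 0) (at_right (0::real))"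
        by (rule filterlim_compose[OF poly_mult_exp_tendsto_0 filterlim_inverse_at_top_right])
      show "\<forall>\<^sub>F y in at_right 0. poly (pCons 0 P) (inverse y) * exp (- inverse y) = flat P y / y"
        by (auto simp: eventually_at_filter flat_def field_simps)
    qed
    moreover have "((\<lambda>y. flat P y / y) \<longlongrightarrow> 0) (at_left 0)"
      by (rule tendsto_eventually) (auto simp: eventually_at_filter flat_def)
    ultimately have "((\<lambda>y. flat P y / y) \<longlongrightarrow> 0) (at 0)"
      using filterlim_split_at by blast
    then show ?thesis using 3 by (simp add: has_field_derivative_iff flat_def)
  qed
qed

text \<open>The induction has to vary P, because each derivative replaces P by s^2 (P - P').\<close>

lemma Ck_on_flat:
  assumes "openin (Euclidean_space n) U" "\<And>m. Ck_on n m U q"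
  shows "Ck_on n m U (\<lambda>x. flat P (q x))"
proof (induction m arbitrary: P)
  case 0
  have "continuous_on UNIV (flat P)" for P
    using flat_has_derivative DERIV_continuous_on by blast
  then show ?case using assms(2)[of 0] by (auto intro: continuous_on_compose2)
next
  case (Suc m)
  show ?case
  proof (rule Ck_on_SucI[OF assms(1), where f' = "\<lambda>i x. flat ([:0, 0, 1:] * (P - pderiv P)) (q x) * partial_deriv i q x"])
    show "continuous_on U (\<lambda>x. flat P (q x))" using Suc by (rule Ck_on_continuous)
    fix i assume i: "i < n"
    show "Ck_on n m U (\<lambda>x. flat ([:0, 0, 1:] * (P - pderiv P)) (q x) * partial_deriv i q x)"
      by (rule Ck_on_mult[OF assms(1) Suc Ck_on_partial[OF assms(2) i]])
    fix x assume x: "x \<in> U"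
    show "((\<lambda>t. flat P (q (x(i := t)))) has_real_derivative
        flat ([:0, 0, 1:] * (P - pderiv P)) (q x) * partial_deriv i q x) (at (x i))"
      by (rule DERIV_cong[OF DERIV_chain2[OF flat_has_derivative Ck_on_has_partial[OF assms(2) i x]]]) simp
  qed
qed

text \<open>A product of one-variable bumps, so that the set of positivity is exactly the open box
  of half-width e around a in the first n coordinates.\<close>

definition bump :: "nat \<Rightarrow> (nat \<Rightarrow> real) \<Rightarrow> real \<Rightarrow> (nat \<Rightarrow> real) \<Rightarrow> real" where
  "bump n a e x = (\<Prod>i<n. flat 1 (e^2 - (x i - a i)^2))"

lemma bump_pos_iff: "e > 0 \<Longrightarrow> bump n a e x > 0 \<longleftrightarrow> (\<forall>i<n. \<bar>x i - a i\<bar> < e)"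
proof -
  assume e: "e > 0"
  have *: "flat 1 (e^2 - (x i - a i)^2) > 0 \<longleftrightarrow> \<bar>x i - a i\<bar> < e" "flat 1 (e^2 - (x i - a i)^2) \<ge> 0" for i
    using e abs_le_square_iff[of e "x i - a i"] by (auto simp: flat_def)
  show ?thesis
  proof
    assume "bump n a e x > 0"
    have "flat 1 (e^2 - (x i - a i)^2) \<noteq> 0" if "i < n" for i
    proof
      assume "flat 1 (e^2 - (x i - a i)^2) = 0"
      then have "bump n a e x = 0"
        unfolding bump_def using that by (intro prod_zero bexI[of _ i]) auto
      then show False using \<open>bump n a e x > 0\<close> by simp
    qed
    then have "flat 1 (e^2 - (x i - a i)^2) > 0" if "i < n" for i
      using *(2)[of i] that by (simp add: order_less_le)
    then show "\<forall>i<n. \<bar>x i - a i\<bar> < e" using *(1) by blast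
  qed (use * in \<open>auto simp: bump_def intro!: prod_pos\<close>)
qed

lemma bump_nonneg: "bump n a e x \<ge> 0"
  unfolding bump_def by (intro prod_nonneg) (auto simp: flat_def)

lemma Ck_on_bump:
  assumes "openin (Euclidean_space n) U"
  shows "Ck_on n m U (bump n a e)"
proof -
  have "Ck_on n m U (\<lambda>x. bump n a e x)"
    unfolding bump_def power2_eq_square
    by (intro Ck_on_prod[OF assms] Ck_on_flat[OF assms] Ck_on_diff[OF assms] Ck_on_mult[OF assms] Ck_on_const Ck_on_coord[OF assms])
  then show ?thesis by simp
qed

text \<open>An inverse function theorem for maps that alter one coordinate only. On a small box g is
  strictly monotone in coordinate j, so the inverse is found by the intermediate value theorem; its
  derivatives come from implicit differentiation and its smoothness from bootstrapping. Only the
  recovered coordinate \<eta> has to be constructed.\<close>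

lemma primitive_map_inverse:
  assumes U: "openin (Euclidean_space n) U" "Cr_on n r U g" "r \<ge> 1" "u0 \<in> U"
    and j: "j < n" "partial_deriv j g u0 \<noteq> 0"
  obtains W \<eta> where "openin (Euclidean_space n) W" "u0 \<in> W" "W \<subseteq> U"
    "openin (Euclidean_space n) ((\<lambda>u. u(j := g u)) ` W)"
    "\<And>u. u \<in> W \<Longrightarrow> \<eta> (u(j := g u)) = u j" "Cr_on n r ((\<lambda>u. u(j := g u)) ` W) \<eta>"
proof -
  define D where "D = partial_deriv j g"
  \<comment> \<open>Multiplying by this sign makes s * g increasing in coordinate j and avoids
    treating two cases.\<close>
  define s where "s = sgn (D u0)"
  have s: "s = 1 \<or> s = -1" "s * D u0 = \<bar>D u0\<bar>" using j(2) by (auto simp: s_def D_def sgn_if)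
  have C1: "Ck_on n (Suc 0) U g" using U(2,3) by (rule Cr_on_C1)
  have UR: "U \<subseteq> Rn n" using U openin_subset by blast
  obtain e0 where e0: "e0 > 0" "\<forall>y\<in>Rn n. (\<forall>i<n. \<bar>y i - u0 i\<bar> < e0) \<longrightarrow> y \<in> U"
    using U(1,4) openin_Rn_iff by blast
  have "continuous_on U D" using C1 j unfolding D_def by simp
  then obtain e1 where e1: "e1 > 0" "\<forall>y\<in>U. (\<forall>i<n. \<bar>y i - u0 i\<bar> < e1) \<longrightarrow> \<bar>D y - D u0\<bar> < \<bar>D u0\<bar>"
    using continuous_on_Rn_iff[OF UR] U(4) j(2) unfolding D_def by (metis zero_less_abs_iff)
  define e where "e = min e0 e1"
  define W where "W = Rn n \<inter> {y. \<forall>i<n. \<bar>y i - u0 i\<bar> < e}"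
  have Wo: "openin (Euclidean_space n) W"
    unfolding W_def openin_Rn_top_of_set using open_box by (rule openin_open_Int)
  have WU: "W \<subseteq> U" and u0W: "u0 \<in> W" using e0 e1 UR U(4) by (auto simp: W_def e_def)
  have sD: "s * D y > 0" if "y \<in> W" for y
  proof -
    have "\<bar>D y - D u0\<bar> < \<bar>D u0\<bar>" using that e1 WU by (auto simp: W_def e_def)
    then show ?thesis using s by (auto simp: abs_if split: if_splits)
  qed
  \<comment> \<open>A box is convex along coordinate j: a segment in this direction with both ends
    in W lies in W.\<close>
  have Wj: "u(j := t) \<in> W" if "u(j := a) \<in> W" "u(j := b) \<in> W" "a \<le> t" "t \<le> b" for u a b t
  proof -
    have "\<bar>t - u0 j\<bar> < e" using that j(1) by (auto simp: W_def abs_less_iff dest!: spec[of _ j])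
    moreover have "\<forall>i<n. i \<noteq> j \<longrightarrow> \<bar>u i - u0 i\<bar> < e" using that(1) by (force simp: W_def)
    moreover have "u(j := t) \<in> Rn n" using that(1) j(1) by (force simp: W_def in_Rn)
    ultimately show ?thesis by (auto simp: W_def)
  qed
  have der: "((\<lambda>t. g (u(j := t))) has_real_derivative D (u(j := t))) (at t)" if "u(j := t) \<in> W" for u t
    using Ck_on_has_partial[OF C1 j(1), of "u(j := t)"] that WU by (auto simp: D_def)
  have mono: "s * g (u(j := a)) < s * g (u(j := b))" if "u(j := a) \<in> W" "u(j := b) \<in> W" "a < b" for u a b
  proof (rule DERIV_pos_imp_increasing[OF that(3)])
    fix t assume "a \<le> t" "t \<le> b"
    then have t: "u(j := t) \<in> W" using Wj that by blast
    show "\<exists>y. ((\<lambda>t. s * g (u(j := t))) has_real_derivative y) (at t) \<and> 0 < y"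
      using DERIV_cmult[OF der[OF t], of s] sD[OF t] by blast
  qed
  have inj: "a = b" if "u(j := a) \<in> W" "u(j := b) \<in> W" "g (u(j := a)) = g (u(j := b))" for u a b
    using mono[of u a b] mono[of u b a] that by (metis less_irrefl linorder_neqE_linordered_idom)
  define G where "G = (\<lambda>u. u(j := g u))"
  define \<eta> where "\<eta> w = (SOME t. w(j := t) \<in> W \<and> g (w(j := t)) = w j)" for w
  have \<eta>I: "\<eta> w = t" if "w(j := t) \<in> W" "g (w(j := t)) = w j" for w t
    unfolding \<eta>_def
  proof (rule some_equality)
    show "t' = t" if "w(j := t') \<in> W \<and> g (w(j := t')) = w j" for t'
      using inj that \<open>w(j := t) \<in> W\<close> \<open>g (w(j := t)) = w j\<close> by metis
  qed (use that in auto)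
  have GI: "w \<in> G ` W" if "w(j := t) \<in> W" "g (w(j := t)) = w j" for w t
  proof -
    have "w = G (w(j := t))" using that by (simp add: G_def)
    then show ?thesis using that by blast
  qed
  have \<eta>G: "\<eta> (G u) = u j" if "u \<in> W" for u
    by (rule \<eta>I) (use that in \<open>simp_all add: G_def\<close>)
  define H where "H w = w(j := \<eta> w)" for w
  have HG: "H (G u) = u" if "u \<in> W" for u using \<eta>G[OF that] by (auto simp: H_def G_def)
  have HW: "H w \<in> W" "g (H w) = w j" if w: "w \<in> G ` W" for w
  proof -
    obtain u where u: "u \<in> W" "w = G u" using w by blast
    then have "H w = u" using HG by simp
    then show "H w \<in> W" "g (H w) = w j" using u by (auto simp: G_def)
  qed
  \<comment> \<open>A quantitative solvability statement that yields two facts at once: with any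
    \<delta> that the image of W is open, and with \<delta> = \<epsilon> that \<eta> is
    continuous.\<close>
  have solve: "\<exists>\<kappa>>0. \<forall>w\<in>Rn n. (\<forall>i<n. \<bar>w i - G u i\<bar> < \<kappa>) \<longrightarrow>
      (\<exists>t. \<bar>t - u j\<bar> < \<delta> \<and> w(j := t) \<in> W \<and> g (w(j := t)) = w j)" if u: "u \<in> W" and \<delta>: "\<delta> > 0" for u \<delta>
  proof -
    \<comment> \<open>Half of the smaller of \<delta> and the distance from \<open>u j\<close> to
      the wall of the box, so that both points \<open>u j - d\<close> and \<open>u j + d\<close>
      stay inside W and closer than \<delta>.\<close>
    define d where "d = min \<delta> (e - \<bar>u j - u0 j\<bar>) / 2"
    have d: "d > 0" "d < \<delta>" "\<bar>u j - u0 j\<bar> + d < e"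
      using u \<delta> j(1) by (auto simp: d_def W_def min_def field_simps)
    have pW: "u(j := u j + c) \<in> W" if "\<bar>c\<bar> \<le> d" for c
      using u d that j(1) by (auto simp: W_def in_Rn)
    define p where "p c = u(j := u j + c)" for c
    have lt: "s * g (p (-d)) < s * g u" "s * g u < s * g (p d)"
      using mono[of u "u j - d" "u j"] mono[of u "u j" "u j + d"] pW[of "-d"] pW[of d] u d by (auto simp: p_def)
    \<comment> \<open>Half of the smaller gap between the value at u and the values at the two end
      points. The target and the end values may each move by less than \<theta> without destroying
      the bracketing needed for the intermediate value theorem.\<close>
    define \<theta> where "\<theta> = min (s * g (p d) - s * g u) (s * g u - s * g (p (-d))) / 2"
    have \<theta>: "\<theta> > 0" using lt by (auto simp: \<theta>_def)
    have near: "\<exists>\<kappa>>0. \<forall>y\<in>Rn n. (\<forall>i<n. \<bar>y i - p c i\<bar> < \<kappa>) \<longrightarrow> y \<in> W \<and> \<bar>g y - g (p c)\<bar> < \<theta>"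
      if c: "\<bar>c\<bar> \<le> d" for c
    proof -
      have pc: "p c \<in> W" using pW[OF c] by (simp add: p_def)
      obtain k1 where k1: "k1 > 0" "\<forall>y\<in>Rn n. (\<forall>i<n. \<bar>y i - p c i\<bar> < k1) \<longrightarrow> y \<in> W"
        using Wo pc openin_Rn_iff by blast
      obtain k2 where k2: "k2 > 0" "\<forall>y\<in>U. (\<forall>i<n. \<bar>y i - p c i\<bar> < k2) \<longrightarrow> \<bar>g y - g (p c)\<bar> < \<theta>"
        using Ck_on_continuous[OF C1] continuous_on_Rn_iff[OF UR] pc WU \<theta> by blast
      show ?thesis using k1 k2 WU by (intro exI[of _ "min k1 k2"]) auto
    qed
    obtain k1 where k1: "k1 > 0" "\<forall>y\<in>Rn n. (\<forall>i<n. \<bar>y i - p d i\<bar> < k1) \<longrightarrow> y \<in> W \<and> \<bar>g y - g (p d)\<bar> < \<theta>"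
      using near[of d] d(1) by auto
    obtain k2 where k2: "k2 > 0" "\<forall>y\<in>Rn n. (\<forall>i<n. \<bar>y i - p (-d) i\<bar> < k2) \<longrightarrow> y \<in> W \<and> \<bar>g y - g (p (-d))\<bar> < \<theta>"
      using near[of "-d"] d(1) by auto
    show ?thesis
    proof (rule exI[of _ "min \<theta> (min k1 k2)"], intro conjI ballI impI)
      fix w assume w: "w \<in> Rn n" "\<forall>i<n. \<bar>w i - G u i\<bar> < min \<theta> (min k1 k2)"
      have wj: "\<bar>w j - g u\<bar> < \<theta>" using w(2) j(1) by (auto simp: G_def)
      have wi: "\<bar>w i - u i\<bar> < k1" "\<bar>w i - u i\<bar> < k2" if "i < n" "i \<noteq> j" for i
        using w(2) that by (auto simp: G_def)
      have y1: "w(j := u j + d) \<in> W" "\<bar>g (w(j := u j + d)) - g (p d)\<bar> < \<theta>"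
        using k1(2)[rule_format, of "w(j := u j + d)"] w(1) wi k1(1) upd_in_Rn[OF w(1) j(1)] by (auto simp: p_def)
      have y2: "w(j := u j - d) \<in> W" "\<bar>g (w(j := u j - d)) - g (p (-d))\<bar> < \<theta>"
        using k2(2)[rule_format, of "w(j := u j - d)"] w(1) wi k2(1) upd_in_Rn[OF w(1) j(1)] by (auto simp: p_def)
      have sa: "\<bar>s * a - s * b\<bar> = \<bar>a - b\<bar>" for a b
        using s(1) by auto
      have th: "2 * \<theta> \<le> s * g (p d) - s * g u" "2 * \<theta> \<le> s * g u - s * g (p (-d))" by (auto simp: \<theta>_def)
      have "s * g (w(j := u j - d)) \<le> s * w j" "s * w j \<le> s * g (w(j := u j + d))"
        using wj y1(2) y2(2) th sa[of "w j" "g u"] sa[of "g (w(j := u j + d))" "g (p d)"]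
          sa[of "g (w(j := u j - d))" "g (p (-d))"] by linarith+
      moreover have "isCont (\<lambda>t. s * g (w(j := t))) t" if "u j - d \<le> t" "t \<le> u j + d" for t
        by (rule DERIV_isCont[OF DERIV_cmult[OF der[OF Wj[OF y2(1) y1(1) that]]]])
      ultimately obtain t where t: "u j - d \<le> t" "t \<le> u j + d" "s * g (w(j := t)) = s * w j"
        using IVT[of "\<lambda>t. s * g (w(j := t))" "u j - d" "s * w j" "u j + d"] d(1) by auto
      then have "g (w(j := t)) = w j" using s(1) by auto
      moreover have "w(j := t) \<in> W" using Wj[OF y2(1) y1(1)] t by blast
      moreover have "\<bar>t - u j\<bar> < \<delta>" using t d by (auto simp: abs_if)
      ultimately show "\<exists>t. \<bar>t - u j\<bar> < \<delta> \<and> w(j := t) \<in> W \<and> g (w(j := t)) = w j" by blast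
    qed (use \<theta> k1 k2 in auto)
  qed
  have GWR: "G ` W \<subseteq> Rn n" using WU UR j(1) by (auto simp: G_def in_Rn)
  have GWo: "openin (Euclidean_space n) (G ` W)"
    unfolding openin_Rn_iff
  proof (intro conjI ballI GWR)
    fix w assume "w \<in> G ` W"
    then obtain u where u: "u \<in> W" "w = G u" by blast
    obtain \<kappa> where "\<kappa> > 0" "\<forall>w\<in>Rn n. (\<forall>i<n. \<bar>w i - G u i\<bar> < \<kappa>) \<longrightarrow>
      (\<exists>t. \<bar>t - u j\<bar> < 1 \<and> w(j := t) \<in> W \<and> g (w(j := t)) = w j)" using solve[OF u(1), of 1] by auto
    then show "\<exists>e>0. \<forall>y\<in>Rn n. (\<forall>i<n. \<bar>y i - w i\<bar> < e) \<longrightarrow> y \<in> G ` W"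
      using GI u(2) by (intro exI[of _ \<kappa>]) blast
  qed
  have \<eta>c: "continuous_on (G ` W) \<eta>"
    unfolding continuous_on_Rn_iff[OF GWR]
  proof (intro ballI allI impI)
    fix w and \<epsilon> :: real assume "w \<in> G ` W" and \<epsilon>: "\<epsilon> > 0"
    then obtain u where u: "u \<in> W" "w = G u" by blast
    obtain \<kappa> where \<kappa>: "\<kappa> > 0" "\<forall>w\<in>Rn n. (\<forall>i<n. \<bar>w i - G u i\<bar> < \<kappa>) \<longrightarrow>
      (\<exists>t. \<bar>t - u j\<bar> < \<epsilon> \<and> w(j := t) \<in> W \<and> g (w(j := t)) = w j)" using solve[OF u(1) \<epsilon>] by blast
    have "\<bar>\<eta> y - \<eta> w\<bar> < \<epsilon>" if y: "y \<in> G ` W" "\<forall>i<n. \<bar>y i - w i\<bar> < \<kappa>" for y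
    proof -
      obtain t where "\<bar>t - u j\<bar> < \<epsilon>" "y(j := t) \<in> W" "g (y(j := t)) = y j"
        using \<kappa>(2) y u(2) GWR by blast
      then show ?thesis using \<eta>I[of y t] \<eta>G[OF u(1)] u(2) by simp
    qed
    then show "\<exists>d>0. \<forall>y\<in>G ` W. (\<forall>i<n. \<bar>y i - w i\<bar> < d) \<longrightarrow> \<bar>\<eta> y - \<eta> w\<bar> < \<epsilon>"
      using \<kappa>(1) by blast
  qed
  \<comment> \<open>Obtained by differentiating g (H w) = \<open>w j\<close>: the product of
    \<open>D (H w)\<close> with the derivative of \<eta> is 1 in direction j, and minus the i-th
    partial derivative of g in the other directions.\<close>
  define \<eta>' where "\<eta>' i w = (if i = j then inverse (D (H w)) else (-1) * (partial_deriv i g (H w) * inverse (D (H w))))" for i w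
  have DH: "D (H w) \<noteq> 0" if "w \<in> G ` W" for w using sD[OF HW(1)[OF that]] by auto
  \<comment> \<open>Expanding g along the curve t \<mapsto> H (w(i := t)) leaves at most two nonzero
    terms, in coordinates i and j. Since g composed with H is the j-th coordinate, this is a linear
    equation for the increment of \<eta>, solvable because the coefficient in coordinate j tends to
    a nonzero limit.\<close>
  have Wd: "((\<lambda>t. \<eta> (w(i := t))) has_real_derivative \<eta>' i w) (at (w i))" if i: "i < n" and w: "w \<in> G ` W" for i w
  proof -
    let ?F = "at (w i)"
    define \<gamma> where "\<gamma> t = H (w(i := t))" for t
    have \<gamma>w: "\<gamma> (w i) = H w" by (simp add: \<gamma>_def)
    have ev: "\<forall>\<^sub>F t in ?F. w(i := t) \<in> G ` W"
      using eventually_upd_in[OF GWo w i] by (simp add: eventually_nhds_conv_at)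
    have cont: "((\<lambda>t. \<eta> (w(i := t))) \<longlongrightarrow> \<eta> w) ?F"
    proof (rule tendstoI)
      fix \<epsilon> :: real assume "\<epsilon> > 0"
      then obtain d where d: "d > 0" "\<forall>y\<in>G ` W. (\<forall>i<n. \<bar>y i - w i\<bar> < d) \<longrightarrow> \<bar>\<eta> y - \<eta> w\<bar> < \<epsilon>"
        using \<eta>c w unfolding continuous_on_Rn_iff[OF GWR] by blast
      have "\<forall>\<^sub>F t in ?F. dist t (w i) < d" using d(1) by (auto simp: eventually_at intro!: exI[of _ d])
      then show "\<forall>\<^sub>F t in ?F. dist (\<eta> (w(i := t))) (\<eta> w) < \<epsilon>"
        using ev
      proof eventually_elim
        case (elim t)
        then have "\<forall>a<n. \<bar>(w(i := t)) a - w a\<bar> < d" using d(1) by (simp add: dist_real_def)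
        then have "\<bar>\<eta> (w(i := t)) - \<eta> w\<bar> < \<epsilon>" using d(2) elim(2) by blast
        then show ?case by (simp add: dist_real_def)
      qed
    qed
    have lim: "((\<lambda>t. \<gamma> t a) \<longlongrightarrow> H w a) ?F" for a
      using cont by (cases "a = j"; cases "a = i") (auto simp: \<gamma>_def H_def)
    have HwU: "H w \<in> U" using HW(1)[OF w] WU by blast
    have \<gamma>R: "\<forall>\<^sub>F t in ?F. \<gamma> t \<in> Rn n"
      using ev by eventually_elim (use HW(1) WU UR in \<open>auto simp: \<gamma>_def\<close>)
    obtain c where c: "\<And>a. a < n \<Longrightarrow> (c a \<longlongrightarrow> partial_deriv a g (H w)) ?F"
      "\<forall>\<^sub>F t in ?F. g (\<gamma> t) - g (H w) = (\<Sum>a<n. c a t * (\<gamma> t a - H w a))"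
      using Ck_on_expansion[where \<gamma> = \<gamma> and F = ?F, OF U(1) C1 HwU \<gamma>R lim] by blast
    have c0: "\<forall>\<^sub>F t in ?F. c j t \<noteq> 0"
      using tendsto_imp_eventually_ne[OF c(1)[OF j(1)]] DH[OF w] by (simp add: D_def)
    have "\<forall>\<^sub>F t in ?F. t \<noteq> w i" by (simp add: eventually_at_filter)
    then have "\<forall>\<^sub>F t in ?F. (if i = j then inverse (c j t) else (-1) * (c i t * inverse (c j t))) =
        (\<eta> (w(i := t)) - \<eta> w) / (t - w i)"
      using c(2) c0 ev
    proof eventually_elim
      case (elim t)
      define h where "h = \<eta> (w(i := t)) - \<eta> w"
      have "g (\<gamma> t) - g (H w) = (w(i := t)) j - w j"
        using HW(2)[OF elim(4)] HW(2)[OF w] by (simp add: \<gamma>_def)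
      moreover have "(\<Sum>a<n. c a t * (\<gamma> t a - H w a)) = (if i = j then c j t * h else c i t * (t - w i) + c j t * h)"
      proof -
        have "(\<Sum>a<n. c a t * (\<gamma> t a - H w a)) = (\<Sum>a\<in>{i, j}. c a t * (\<gamma> t a - H w a))"
          by (rule sum.mono_neutral_right) (use i j(1) in \<open>auto simp: \<gamma>_def H_def\<close>)
        then show ?thesis by (auto simp: \<gamma>_def H_def h_def)
      qed
      ultimately show ?case
        using elim(1,2,3) unfolding h_def[symmetric]
        by (auto simp: divide_simps mult.commute[of h] split: if_splits; linarith)
    qed
    moreover have "((\<lambda>t. if i = j then inverse (c j t) else (-1) * (c i t * inverse (c j t))) \<longlongrightarrow> \<eta>' i w) ?F"
      using c(1)[OF i] c(1)[OF j(1)] DH[OF w] unfolding \<eta>'_def D_def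
      by (cases "i = j") (auto intro!: tendsto_intros)
    ultimately show ?thesis
      unfolding has_field_derivative_iff
      by (simp add: Lim_transform_eventually)
  qed
  \<comment> \<open>Bootstrapping: if \<eta> is of class m and g of class m + 1, the formulas for
    the derivatives of \<eta> are of class m, so \<eta> is of class m + 1.\<close>
  have Cm: "Ck_on n m (G ` W) \<eta>" if "enat m \<le> r" for m
    using that
  proof (induction m)
    case 0
    then show ?case using \<eta>c by simp
  next
    case (Suc m)
    then have IH: "Ck_on n m (G ` W) \<eta>" by (simp add: Suc_ile_eq order_less_imp_le)
    have H: "Ck_on n m (G ` W) (\<lambda>w. H w a)" for a
      using IH Ck_on_coord[OF GWo] by (cases "a = j") (auto simp: H_def)
    have gm: "Ck_on n (Suc m) U g" using U(2) Suc.prems by (rule Cr_onD)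
    have comp: "Ck_on n m (G ` W) (\<lambda>w. partial_deriv a g (H w))" if "a < n" for a
      by (rule Ck_on_compose[OF GWo U(1) _ H Ck_on_partial[OF gm that]]) (use HW(1) WU in auto)
    have invD: "Ck_on n m (G ` W) (\<lambda>w. inverse (D (H w)))"
      using comp[OF j(1)] DH by (intro Ck_on_inverse[OF GWo]) (auto simp: D_def)
    show ?case
    proof (rule Ck_on_SucI[OF GWo \<eta>c Wd])
      fix i assume i: "i < n"
      show "Ck_on n m (G ` W) (\<eta>' i)"
      proof (cases "i = j")
        case True
        then have "\<eta>' i = (\<lambda>w. inverse (D (H w)))" by (simp add: \<eta>'_def fun_eq_iff)
        then show ?thesis using invD by simp
      next
        case False
        then have "\<eta>' i = (\<lambda>w. (-1) * (partial_deriv i g (H w) * inverse (D (H w))))"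
          by (simp add: \<eta>'_def fun_eq_iff)
        then show ?thesis using Ck_on_cmult[OF GWo Ck_on_mult[OF GWo comp[OF i] invD], of "-1"] by simp
      qed
    qed
  qed
  show ?thesis
    using Wo u0W WU GWo \<eta>G Cm by (intro that[of W \<eta>]) (auto simp: G_def Cr_on_def)
qed

section \<open>Observables on a compact manifold\<close>

lemma partial_deriv_add:
  assumes "Ck_on n (Suc 0) U f" "Ck_on n (Suc 0) U g" "i < n" "x \<in> U"
  shows "partial_deriv i (\<lambda>x. f x + g x) x = partial_deriv i f x + partial_deriv i g x"
  by (rule partial_deriv_eqI[OF DERIV_add[OF Ck_on_has_partial[OF assms(1,3,4)] Ck_on_has_partial[OF assms(2,3,4)]]])

lemma partial_deriv_mult:
  assumes "Ck_on n (Suc 0) U f" "Ck_on n (Suc 0) U g" "i < n" "x \<in> U"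
  shows "partial_deriv i (\<lambda>x. f x * g x) x = partial_deriv i f x * g x + partial_deriv i g x * f x"
  by (rule partial_deriv_eqI, rule DERIV_cong[OF DERIV_mult[OF Ck_on_has_partial[OF assms(1,3,4)] Ck_on_has_partial[OF assms(2,3,4)]]]) simp

lemma partial_deriv_const [simp]: "partial_deriv i (\<lambda>x. c) x = 0"
  by (simp add: partial_deriv_def)

lemma partial_deriv_coord: "partial_deriv i (\<lambda>x. x j) x = (if i = j then 1 else 0)"
  by (cases "i = j") (auto simp: partial_deriv_def)

lemma Cr_on_cong:
  assumes "openin (Euclidean_space n) U" "\<And>x. x \<in> U \<Longrightarrow> f x = g x" "Cr_on n r U f"
  shows "Cr_on n r U g"
  using assms(3) Ck_on_cong[OF assms(1), of f g] assms(2) by (auto simp: Cr_on_def)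

text \<open>Tychonoff's theorem, with the factor {0} at every index from n on.\<close>

lemma compact_box: "compact {y \<in> Rn n. \<forall>i<n. a i \<le> y i \<and> y i \<le> b i}"
proof -
  have "compactin (product_topology (\<lambda>i::nat. euclidean) UNIV) (PiE UNIV (\<lambda>i. if i < n then {a i..b i} else {0}))"
    by (subst compactin_PiE) auto
  moreover have "PiE UNIV (\<lambda>i. if i < n then {a i..b i} else {0}) = {y \<in> Rn n. \<forall>i<n. a i \<le> y i \<and> y i \<le> b i}"
    by (auto simp: in_Rn PiE_iff split: if_splits)
  ultimately show ?thesis by (simp add: euclidean_product_topology)
qed

lemma openin_contains_cbox:
  assumes "openin (Euclidean_space n) U" "a \<in> U"
  obtains e where "e > 0" "{y \<in> Rn n. \<forall>i<n. \<bar>y i - a i\<bar> \<le> e} \<subseteq> U"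
proof -
  obtain e where "e > 0" "\<forall>y\<in>Rn n. (\<forall>i<n. \<bar>y i - a i\<bar> < e) \<longrightarrow> y \<in> U"
    using assms openin_Rn_iff by blast
  then show ?thesis by (intro that[of "e/2"]) (force intro: le_less_trans)+
qed

lemma compact_cbox: "compact {y \<in> Rn n. \<forall>i<n. \<bar>y i - a i\<bar> \<le> e}"
proof -
  have "{y \<in> Rn n. \<forall>i<n. \<bar>y i - a i\<bar> \<le> e} = {y \<in> Rn n. \<forall>i<n. a i - e \<le> y i \<and> y i \<le> a i + e}"
    by (auto simp: abs_le_iff algebra_simps)
  then show ?thesis using compact_box[of n "\<lambda>i. a i - e" "\<lambda>i. a i + e"] by simp
qed

lemma openin_Rn: "openin (Euclidean_space n) (Rn n)"
  by (simp add: openin_Rn_iff zero_less_one exI[of _ 1])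

lemma openin_box: "openin (Euclidean_space n) {u \<in> Rn n. \<forall>i<n. \<bar>u i - a i\<bar> < e}"
proof -
  have "{u \<in> Rn n. \<forall>i<n. \<bar>u i - a i\<bar> < e} = Rn n \<inter> {u. \<forall>i<n. \<bar>u i - a i\<bar> < e}" by auto
  then show ?thesis unfolding openin_Rn_top_of_set using openin_open_Int[OF open_box] by simp
qed

definition dir_deriv :: "nat \<Rightarrow> 'a chart \<Rightarrow> ('a \<Rightarrow> real) \<Rightarrow> 'a \<Rightarrow> (nat \<Rightarrow> real) \<Rightarrow> real" where
  "dir_deriv n c h x v = (\<Sum>i<n. partial_deriv i (\<lambda>u. h (chart_inv c u)) (snd c x) * v i)"

section \<open>Charts, observables and a finite immersive family\<close>

locale compact_Cr_manifold =
  fixes n :: nat and r :: enat and A :: "'a::t2_space chart set"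
  assumes r1: "r \<ge> 1" and cpt: "compact (UNIV :: 'a set)" and atlas: "Cr_atlas n r UNIV A"
begin

lemma chart: assumes "c \<in> A" shows is_chart: "is_chart n UNIV c"
  using atlas assms by (auto simp: Cr_atlas_def)

lemma chart_open [simp]: "c \<in> A \<Longrightarrow> open (fst c)"
  and chart_image_open: "c \<in> A \<Longrightarrow> openin (Euclidean_space n) (chart_image c)"
  and chart_homeo: "c \<in> A \<Longrightarrow> homeomorphism (fst c) (chart_image c) (snd c) (chart_inv c)"
  using chart by (auto simp: is_chart_def)

lemma chart_cover: obtains c where "c \<in> A" "x \<in> fst c"
  using atlas unfolding Cr_atlas_def by blast

lemma chart_inv_snd [simp]: "c \<in> A \<Longrightarrow> x \<in> fst c \<Longrightarrow> chart_inv c (snd c x) = x"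
  using chart_homeo by (simp add: homeomorphism_def)

lemma snd_chart_inv [simp]: "c \<in> A \<Longrightarrow> u \<in> chart_image c \<Longrightarrow> snd c (chart_inv c u) = u"
  using chart_homeo by (simp add: homeomorphism_def)

lemma snd_in_chart_image [simp]: "c \<in> A \<Longrightarrow> x \<in> fst c \<Longrightarrow> snd c x \<in> chart_image c"
  by (simp add: chart_image_def)

lemma chart_inv_in [simp]: "c \<in> A \<Longrightarrow> u \<in> chart_image c \<Longrightarrow> chart_inv c u \<in> fst c"
  using chart_homeo[of c] unfolding homeomorphism_def by blast

lemma chart_image_Rn: "c \<in> A \<Longrightarrow> chart_image c \<subseteq> Rn n"
  using chart_image_open openin_subset by blast

lemma chart_cont: "c \<in> A \<Longrightarrow> continuous_on (fst c) (snd c)"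
  and chart_inv_cont: "c \<in> A \<Longrightarrow> continuous_on (chart_image c) (chart_inv c)"
  using chart_homeo by (auto simp: homeomorphism_def)

lemma chart_eqI:
  assumes "c \<in> A" "x \<in> fst c" "y \<in> fst c" "\<And>i. i < n \<Longrightarrow> snd c x i = snd c y i"
  shows "x = y"
proof -
  have "snd c x \<in> Rn n" "snd c y \<in> Rn n" using assms chart_image_Rn snd_in_chart_image by blast+
  then have "snd c x = snd c y"
    using assms(4) by (auto simp: in_Rn fun_eq_iff) (metis not_le)
  then show ?thesis using assms(1-3) chart_inv_snd by metis
qed

lemma chart_image_of_open:
  assumes "c \<in> A" "open V"
  shows "openin (Euclidean_space n) (snd c ` (fst c \<inter> V))"
    "snd c ` (fst c \<inter> V) = {u \<in> chart_image c. chart_inv c u \<in> V}"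
proof -
  show eq: "snd c ` (fst c \<inter> V) = {u \<in> chart_image c. chart_inv c u \<in> V}"
  proof
    show "{u \<in> chart_image c. chart_inv c u \<in> V} \<subseteq> snd c ` (fst c \<inter> V)"
    proof
      fix u assume "u \<in> {u \<in> chart_image c. chart_inv c u \<in> V}"
      then have "u = snd c (chart_inv c u)" "chart_inv c u \<in> fst c \<inter> V" using assms(1) by auto
      then show "u \<in> snd c ` (fst c \<inter> V)" by blast
    qed
  qed (use assms in auto)
  have "openin (top_of_set (chart_image c)) (chart_image c \<inter> chart_inv c -` V)"
    using chart_inv_cont[OF assms(1)] assms(2) by (rule continuous_openin_preimage_gen)
  moreover have "openin (top_of_set (Rn n)) (chart_image c)"
    using chart_image_open[OF assms(1)] by (simp add: openin_Rn_top_of_set)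
  ultimately have "openin (top_of_set (Rn n)) (chart_image c \<inter> chart_inv c -` V)"
    by (rule openin_trans)
  then show "openin (Euclidean_space n) (snd c ` (fst c \<inter> V))"
    unfolding eq openin_Rn_top_of_set by (simp add: Int_def vimage_def)
qed

lemma chart_inv_image_open:
  assumes "c \<in> A" "openin (Euclidean_space n) W"
  shows "open {x \<in> fst c. snd c x \<in> W}"
proof -
  obtain V where V: "open V" "W = Rn n \<inter> V" using assms(2) by (auto simp: openin_Rn_top_of_set openin_open)
  have "{x \<in> fst c. snd c x \<in> W} = snd c -` V \<inter> fst c"
    using V chart_image_Rn[OF assms(1)] snd_in_chart_image[OF assms(1)] by auto
  then show ?thesis
    using continuous_on_open_vimage[OF chart_open[OF assms(1)]] chart_cont[OF assms(1)] V by auto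
qed

lemma transition_Cr:
  assumes "c \<in> A" "d \<in> A" "a < n"
  shows "Cr_on n r (snd c ` (fst c \<inter> fst d)) (\<lambda>u. snd d (chart_inv c u) a)"
  using atlas assms by (auto simp: Cr_atlas_def Cr_map_on_def)

lemma Cr_functionsD: "h \<in> Cr_functions n r A \<Longrightarrow> c \<in> A \<Longrightarrow> Cr_on n r (chart_image c) (\<lambda>u. h (chart_inv c u))"
  by (simp add: Cr_functions_def o_def)

lemma Cr_functions_C1: "h \<in> Cr_functions n r A \<Longrightarrow> c \<in> A \<Longrightarrow> Ck_on n (Suc 0) (chart_image c) (\<lambda>u. h (chart_inv c u))"
  using Cr_functionsD Cr_on_C1 r1 by blast

text \<open>Smoothness in one chart around each point is enough, since the transition maps carry it
  to every other chart of the atlas.\<close>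

lemma Cr_functionsI:
  assumes "\<And>x. \<exists>c\<in>A. \<exists>V. open V \<and> x \<in> V \<and> V \<subseteq> fst c \<and> Cr_on n r (snd c ` V) (\<lambda>u. h (chart_inv c u))"
  shows "h \<in> Cr_functions n r A"
proof -
  have "Ck_on n m (chart_image d) (\<lambda>u. h (chart_inv d u))" if d: "d \<in> A" and m: "enat m \<le> r" for d m
  proof (rule Ck_on_local)
    fix u assume u: "u \<in> chart_image d"
    obtain c V where c: "c \<in> A" "open V" "chart_inv d u \<in> V" "V \<subseteq> fst c"
      "Cr_on n r (snd c ` V) (\<lambda>u. h (chart_inv c u))" using assms[of "chart_inv d u"] by blast
    let ?W = "snd d ` (fst d \<inter> V)"
    have W: "openin (Euclidean_space n) ?W" "?W = {u \<in> chart_image d. chart_inv d u \<in> V}"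
      using chart_image_of_open[OF d c(2)] by auto
    have cV: "fst c \<inter> V = V" using c(4) by blast
    have "Ck_on n m ?W (\<lambda>u. h (chart_inv c (snd c (chart_inv d u))))"
    proof (rule Ck_on_compose[where F = "\<lambda>u. snd c (chart_inv d u)" and f = "\<lambda>u. h (chart_inv c u)", OF W(1)])
      show "openin (Euclidean_space n) (snd c ` V)" using chart_image_of_open(1)[OF c(1,2)] cV by simp
      show "(\<lambda>u. snd c (chart_inv d u)) ` ?W \<subseteq> snd c ` V" using W(2) by auto
      show "Ck_on n m (snd c ` V) (\<lambda>u. h (chart_inv c u))" using c(5) m by (rule Cr_onD)
      fix a assume "a < n"
      show "Ck_on n m ?W (\<lambda>u. snd c (chart_inv d u) a)"
        by (rule Ck_on_subset[OF Cr_onD[OF transition_Cr[OF d c(1) \<open>a < n\<close>] m]]) (use c(4) in blast)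
    qed
    then have "Ck_on n m ?W (\<lambda>u. h (chart_inv d u))"
      by (rule Ck_on_cong[OF W(1), rotated]) (use W(2) c(1,4) in auto)
    moreover have "u \<in> ?W" "?W \<subseteq> chart_image d" using W(2) u c(3) by auto
    ultimately show "\<exists>V. openin (Euclidean_space n) V \<and> u \<in> V \<and> V \<subseteq> chart_image d \<and> Ck_on n m V (\<lambda>u. h (chart_inv d u))"
      using W(1) by blast
  qed
  then show ?thesis by (simp add: Cr_functions_def Cr_on_def o_def)
qed

lemma Cr_functions_const [simp]: "(\<lambda>x. a) \<in> Cr_functions n r A"
  by (simp add: Cr_functions_def Cr_on_def o_def)

lemma Cr_functions_add:
  "f \<in> Cr_functions n r A \<Longrightarrow> g \<in> Cr_functions n r A \<Longrightarrow> (\<lambda>x. f x + g x) \<in> Cr_functions n r A"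
  using Ck_on_add chart_image_open by (simp add: Cr_functions_def Cr_on_def o_def)

lemma Cr_functions_mult:
  "f \<in> Cr_functions n r A \<Longrightarrow> g \<in> Cr_functions n r A \<Longrightarrow> (\<lambda>x. f x * g x) \<in> Cr_functions n r A"
  using Ck_on_mult chart_image_open by (simp add: Cr_functions_def Cr_on_def o_def)

lemma Cr_functions_sum:
  "(\<And>i. i \<in> I \<Longrightarrow> f i \<in> Cr_functions n r A) \<Longrightarrow> (\<lambda>x. \<Sum>i\<in>I. f i x) \<in> Cr_functions n r A"
  by (induction I rule: infinite_finite_induct) (auto intro: Cr_functions_add)

lemma Cr_functions_comp:
  assumes "Cr_between n n r UNIV A UNIV A S" "h \<in> Cr_functions n r A"
  shows "(\<lambda>x. h (S x)) \<in> Cr_functions n r A"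
proof (rule Cr_functionsI)
  fix x
  obtain c where c: "c \<in> A" "x \<in> fst c" by (rule chart_cover)
  obtain d where d: "d \<in> A" "S x \<in> fst d" by (rule chart_cover)
  let ?V = "fst c \<inter> S -` fst d"
  have "open (S -` fst d)"
    using assms(1) d continuous_on_open_vimage[of UNIV S] by (auto simp: Cr_between_def)
  then have V: "open ?V" using c by auto
  note W = chart_image_of_open[OF c(1) \<open>open (S -` fst d)\<close>]
  have SC: "Cr_on n r (snd c ` ?V) (\<lambda>u. snd d (S (chart_inv c u)) a)" if "a < n" for a
    using assms(1) c(1) d(1) that by (auto simp: Cr_between_def Cr_map_on_def)
  have "Cr_on n r (snd c ` ?V) (\<lambda>u. h (chart_inv d (snd d (S (chart_inv c u)))))"
    by (rule Cr_on_compose[OF W(1) chart_image_open[OF d(1)] _ SC Cr_functionsD[OF assms(2) d(1)]])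
       (use W(2) d(1) in auto)
  then have "Cr_on n r (snd c ` ?V) (\<lambda>u. h (S (chart_inv c u)))"
    by (rule Cr_on_cong[OF W(1), rotated]) (use W(2) d(1) in auto)
  then show "\<exists>c\<in>A. \<exists>V. open V \<and> x \<in> V \<and> V \<subseteq> fst c \<and> Cr_on n r (snd c ` V) (\<lambda>u. h (S (chart_inv c u)))"
    using V c d by (intro bexI[of _ c] exI[of _ ?V]) auto
qed

lemma Cr_functions_funpow:
  assumes "Cr_between n n r UNIV A UNIV A S" "h \<in> Cr_functions n r A"
  shows "(\<lambda>x. h ((S ^^ l) x)) \<in> Cr_functions n r A"
proof (induction l)
  case (Suc l)
  have "(\<lambda>x. h ((S ^^ Suc l) x)) = (\<lambda>x. (\<lambda>x. h ((S ^^ l) x)) (S x))"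
    by (simp add: funpow_swap1)
  then show ?case using Cr_functions_comp[OF assms(1) Suc] by simp
qed (use assms in simp)

lemma Cr_functions_continuous:
  assumes "h \<in> Cr_functions n r A"
  shows "continuous_on UNIV h"
proof -
  have "continuous_on (\<Union>c\<in>A. fst c) h"
  proof (rule continuous_on_open_UN)
    fix c assume c: "c \<in> A"
    have "continuous_on (fst c) (\<lambda>x. h (chart_inv c (snd c x)))"
      using Ck_on_continuous[OF Cr_functions_C1[OF assms c]] chart_cont[OF c]
      by (rule continuous_on_compose2) (use c in auto)
    then show "continuous_on (fst c) h" by (rule continuous_on_eq) (use c in auto)
  qed simp
  then show ?thesis using atlas by (simp add: Cr_atlas_def)
qed

lemma dir_deriv_add:
  assumes "f \<in> Cr_functions n r A" "g \<in> Cr_functions n r A" "c \<in> A" "x \<in> fst c"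
  shows "dir_deriv n c (\<lambda>x. f x + g x) x v = dir_deriv n c f x v + dir_deriv n c g x v"
  using partial_deriv_add[OF Cr_functions_C1[OF assms(1,3)] Cr_functions_C1[OF assms(2,3)]] assms(3,4)
  by (simp add: dir_deriv_def sum.distrib distrib_right)

lemma dir_deriv_mult:
  assumes "f \<in> Cr_functions n r A" "g \<in> Cr_functions n r A" "c \<in> A" "x \<in> fst c"
  shows "dir_deriv n c (\<lambda>x. f x * g x) x v = dir_deriv n c f x v * g x + dir_deriv n c g x v * f x"
  using partial_deriv_mult[OF Cr_functions_C1[OF assms(1,3)] Cr_functions_C1[OF assms(2,3)]] assms(3,4)
  by (simp add: dir_deriv_def sum.distrib sum_distrib_left algebra_simps)

lemma dir_deriv_const [simp]: "dir_deriv n c (\<lambda>x. a) x v = 0"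
  by (simp add: dir_deriv_def)

lemma dir_deriv_sum:
  assumes "\<And>j. j \<in> J \<Longrightarrow> f j \<in> Cr_functions n r A" "c \<in> A" "x \<in> fst c"
  shows "dir_deriv n c (\<lambda>x. \<Sum>j\<in>J. b j * f j x) x v = (\<Sum>j\<in>J. b j * dir_deriv n c (f j) x v)"
  using assms(1)
proof (induction J rule: infinite_finite_induct)
  case (insert j J)
  then have "dir_deriv n c (\<lambda>x. b j * f j x + (\<Sum>j\<in>J. b j * f j x)) x v
      = dir_deriv n c (\<lambda>x. b j * f j x) x v + dir_deriv n c (\<lambda>x. \<Sum>j\<in>J. b j * f j x) x v"
    by (intro dir_deriv_add Cr_functions_mult Cr_functions_sum assms(2,3)) auto
  moreover have "dir_deriv n c (\<lambda>x. b j * f j x) x v = b j * dir_deriv n c (f j) x v"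
    using dir_deriv_mult[of "\<lambda>x. b j" "f j" c x v] insert assms by (simp add: mult.commute)
  ultimately show ?case using insert by simp
qed simp_all

text \<open>Outside the chart domain the extension is 0. Smoothness there uses that the image of K
  in the manifold is compact, hence closed in a Hausdorff space, so that its complement is an open
  set on which the function vanishes.\<close>

lemma chart_extension_Cr:
  assumes c: "c \<in> A" and q: "\<And>m. Ck_on n m (Rn n) q" and K: "compact K" "K \<subseteq> chart_image c"
    and q0: "\<And>u. u \<in> Rn n - K \<Longrightarrow> q u = 0"
  shows "(\<lambda>y. if y \<in> fst c then q (snd c y) else 0) \<in> Cr_functions n r A" (is "?h \<in> _")
proof (rule Cr_functionsI)
  fix x
  have "compact (chart_inv c ` K)"
    using K continuous_on_subset[OF chart_inv_cont[OF c]] by (intro compact_continuous_image) auto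
  then have cl: "closed (chart_inv c ` K)" by (rule compact_imp_closed)
  show "\<exists>d\<in>A. \<exists>V. open V \<and> x \<in> V \<and> V \<subseteq> fst d \<and> Cr_on n r (snd d ` V) (\<lambda>u. ?h (chart_inv d u))"
  proof (cases "x \<in> fst c")
    case True
    have "Ck_on n m (chart_image c) (\<lambda>u. ?h (chart_inv c u))" for m
      by (rule Ck_on_cong[OF chart_image_open[OF c] _ Ck_on_subset[OF q chart_image_Rn[OF c]]]) (use c in auto)
    then show ?thesis using c True by (intro bexI[of _ c] exI[of _ "fst c"]) (auto simp: Cr_on_def chart_image_def)
  next
    case False
    obtain d where d: "d \<in> A" "x \<in> fst d" by (rule chart_cover)
    let ?V = "fst d \<inter> - (chart_inv c ` K)"
    have "x \<notin> chart_inv c ` K" using False c K chart_inv_in by blast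
    moreover have V: "open ?V" using d cl by auto
    moreover have "Ck_on n m (snd d ` ?V) (\<lambda>u. ?h (chart_inv d u))" for m
    proof (rule Ck_on_cong[where f = "\<lambda>u. 0"])
      show "openin (Euclidean_space n) (snd d ` ?V)"
        using chart_image_of_open(1)[OF d(1), of "- (chart_inv c ` K)"] cl by auto
      fix u assume "u \<in> snd d ` ?V"
      then obtain y where y: "y \<in> ?V" "u = snd d y" by blast
      have "?h y = 0"
      proof (cases "y \<in> fst c")
        case True
        then have "snd c y \<notin> K" using y c by (metis ComplD IntD2 chart_inv_snd imageI)
        moreover have "snd c y \<in> Rn n"
          using chart_image_Rn[OF c] snd_in_chart_image[OF c True] by blast
        ultimately show ?thesis using q0 True by simp
      qed simp
      moreover have "chart_inv d u = y" using y d by simp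
      ultimately show "0 = ?h (chart_inv d u)" by (simp only:)
    qed simp
    ultimately show ?thesis using d by (intro bexI[of _ d] exI[of _ ?V]) (auto simp: Cr_on_def)
  qed
qed

text \<open>For finitely many boxes covering the manifold take a bump \<beta> and its products with
  the chart coordinates. Where \<beta> is positive, the quotients recover the coordinates, which
  gives both separation of points and injectivity of the differential.\<close>

lemma separating_immersive_family:
  obtains E where "finite E" "E \<subseteq> Cr_functions n r A"
    "\<And>x y. x \<noteq> y \<Longrightarrow> \<exists>e\<in>E. e x \<noteq> e y"
    "\<And>x. \<exists>c\<in>A. x \<in> fst c \<and> (\<forall>v. (\<exists>i<n. v i \<noteq> 0) \<longrightarrow> (\<exists>e\<in>E. dir_deriv n c e x v \<noteq> 0))"
proof -
  have "\<forall>x. \<exists>c e. c \<in> A \<and> x \<in> fst c \<and> e > 0 \<and> {y \<in> Rn n. \<forall>i<n. \<bar>y i - snd c x i\<bar> \<le> e} \<subseteq> chart_image c"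
  proof
    fix x
    obtain c where c: "c \<in> A" "x \<in> fst c" by (rule chart_cover)
    obtain e where "e > 0" "{y \<in> Rn n. \<forall>i<n. \<bar>y i - snd c x i\<bar> \<le> e} \<subseteq> chart_image c"
      using openin_contains_cbox[OF chart_image_open[OF c(1)], of "snd c x"] c by auto
    then show "\<exists>c e. c \<in> A \<and> x \<in> fst c \<and> e > 0 \<and> {y \<in> Rn n. \<forall>i<n. \<bar>y i - snd c x i\<bar> \<le> e} \<subseteq> chart_image c"
      using c by blast
  qed
  from choice[OF this] obtain C where "\<forall>x. \<exists>e. C x \<in> A \<and> x \<in> fst (C x) \<and> e > 0 \<and>
      {y \<in> Rn n. \<forall>i<n. \<bar>y i - snd (C x) x i\<bar> \<le> e} \<subseteq> chart_image (C x)" by blast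
  from choice[OF this] obtain \<epsilon> where C: "\<And>x. C x \<in> A" "\<And>x. x \<in> fst (C x)" "\<And>x. \<epsilon> x > 0"
    "\<And>x. {y \<in> Rn n. \<forall>i<n. \<bar>y i - snd (C x) x i\<bar> \<le> \<epsilon> x} \<subseteq> chart_image (C x)"
    by blast
  define \<beta> where "\<beta> x = bump n (snd (C x) x) (\<epsilon> x)" for x
  define F where "F x q = (\<lambda>y. if y \<in> fst (C x) then \<beta> x (snd (C x) y) * q (snd (C x) y) else 0)" for x and q :: "(nat \<Rightarrow> real) \<Rightarrow> real"
  have \<beta>C: "Ck_on n m U (\<beta> x)" if "openin (Euclidean_space n) U" for m x U
    unfolding \<beta>_def by (rule Ck_on_bump[OF that])
  have FC: "F x q \<in> Cr_functions n r A" if "\<And>m. Ck_on n m (Rn n) q" for x q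
    unfolding F_def
  proof (rule chart_extension_Cr[OF C(1) _ compact_cbox C(4)])
    show "Ck_on n m (Rn n) (\<lambda>u. \<beta> x u * q u)" for m
      by (intro Ck_on_mult[OF openin_Rn] \<beta>C[OF openin_Rn] that)
    fix u assume "u \<in> Rn n - {y \<in> Rn n. \<forall>i<n. \<bar>y i - snd (C x) x i\<bar> \<le> \<epsilon> x}"
    then have "\<not> \<beta> x u > 0" using bump_pos_iff[OF C(3)] unfolding \<beta>_def by force
    then show "\<beta> x u * q u = 0" using bump_nonneg[of n "snd (C x) x" "\<epsilon> x" u] by (simp add: \<beta>_def)
  qed
  define N where "N x = {y \<in> fst (C x). snd (C x) y \<in> {u \<in> Rn n. \<forall>i<n. \<bar>u i - snd (C x) x i\<bar> < \<epsilon> x}}" for x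
  have No: "open (N x)" for x
    unfolding N_def
  proof (rule chart_inv_image_open[OF C(1)])
    show "openin (Euclidean_space n) {u \<in> Rn n. \<forall>i<n. \<bar>u i - snd (C x) x i\<bar> < \<epsilon> x}"
      by (rule openin_box)
  qed
  have xN: "x \<in> N x" for x
    using C(2,3)[of x] chart_image_Rn[OF C(1)[of x]] snd_in_chart_image[OF C(1)[of x] C(2)[of x]]
    unfolding N_def by auto
  have N\<beta>: "y \<in> N x \<longleftrightarrow> y \<in> fst (C x) \<and> \<beta> x (snd (C x) y) > 0" for x y
    using bump_pos_iff[OF C(3), of n "snd (C x) x" x] chart_image_Rn[OF C(1)] snd_in_chart_image[OF C(1)]
    unfolding N_def \<beta>_def by blast
  obtain X0 where X0: "finite X0" "UNIV \<subseteq> (\<Union>x\<in>X0. N x)"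
    using compactE_image[OF cpt, of UNIV N] No xN by (metis UNIV_I UN_I subsetI)
  define E where "E = (\<Union>x\<in>X0. insert (F x (\<lambda>u. 1)) ((\<lambda>i. F x (\<lambda>u. u i)) ` {..<n}))"
  show ?thesis
  proof (rule that[of E])
    show "finite E" using X0 by (auto simp: E_def)
    show "E \<subseteq> Cr_functions n r A" using FC Ck_on_coord[OF openin_Rn] by (auto simp: E_def)
  next
    fix y z :: 'a assume yz: "y \<noteq> z"
    obtain x where x: "x \<in> X0" "y \<in> N x" using X0 by blast
    show "\<exists>e\<in>E. e y \<noteq> e z"
    proof (rule ccontr)
      assume "\<not> ?thesis"
      then have eq: "F x (\<lambda>u. 1) y = F x (\<lambda>u. 1) z" "\<And>i. i < n \<Longrightarrow> F x (\<lambda>u. u i) y = F x (\<lambda>u. u i) z"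
        using x by (auto simp: E_def)
      have y: "y \<in> fst (C x)" "\<beta> x (snd (C x) y) > 0" using x N\<beta> by auto
      \<comment> \<open>Equality of the bump values already forces z into the same chart domain,
        because the bump is extended by 0 and is positive at y.\<close>
      then have z: "z \<in> fst (C x)" "\<beta> x (snd (C x) z) = \<beta> x (snd (C x) y)"
        using eq(1) by (auto simp: F_def split: if_splits)
      then have "snd (C x) y i = snd (C x) z i" if "i < n" for i
        using eq(2)[OF that] y by (simp add: F_def)
      then show False using chart_eqI[OF C(1) y(1) z(1)] yz by blast
    qed
  next
    fix y
    obtain x where x: "x \<in> X0" "y \<in> N x" using X0 by blast
    have y: "y \<in> fst (C x)" "\<beta> x (snd (C x) y) > 0" using x N\<beta> by auto
    let ?c = "C x" and ?u = "snd (C x) y"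
    have u: "?u \<in> chart_image ?c" using y C by simp
    note o = chart_image_open[OF C(1)[of x]]
    have pd: "partial_deriv i (\<lambda>u. F x q (chart_inv ?c u)) ?u = partial_deriv i (\<lambda>u. \<beta> x u * q u) ?u" if "i < n" for i q
      by (rule partial_deriv_cong[OF o u that]) (use C in \<open>auto simp: F_def\<close>)
    \<comment> \<open>If the derivatives of \<beta> and of \<beta> times coordinate j both vanish in
      direction v, the product rule leaves \<beta> * \<open>v j\<close> = 0.\<close>
    have "\<exists>e\<in>E. dir_deriv n ?c e y v \<noteq> 0" if v: "j < n" "v j \<noteq> 0" for v j
    proof (rule ccontr)
      assume "\<not> ?thesis"
      then have eq: "dir_deriv n ?c (F x (\<lambda>u. 1)) y v = 0" "dir_deriv n ?c (F x (\<lambda>u. u j)) y v = 0"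
        using x v by (auto simp: E_def)
      have z: "(\<Sum>i<n. partial_deriv i (\<beta> x) ?u * v i) = 0"
        using eq(1) by (simp add: dir_deriv_def pd)
      have "0 = (\<Sum>i<n. partial_deriv i (\<lambda>u. \<beta> x u * u j) ?u * v i)"
        using eq(2) by (simp add: dir_deriv_def pd)
      also have "\<dots> = (\<Sum>i<n. (partial_deriv i (\<beta> x) ?u * v i) * ?u j + (if i = j then \<beta> x ?u * v i else 0))"
        using partial_deriv_mult[OF \<beta>C[OF o] Ck_on_coord[OF o] _ u]
        by (intro sum.cong) (auto simp: partial_deriv_coord algebra_simps)
      also have "\<dots> = (\<Sum>i<n. partial_deriv i (\<beta> x) ?u * v i) * ?u j + \<beta> x ?u * v j"
        using v(1) by (simp add: sum.distrib sum_distrib_right)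
      finally show False using z y v by simp
    qed
    then show "\<exists>c\<in>A. y \<in> fst c \<and> (\<forall>v. (\<exists>i<n. v i \<noteq> 0) \<longrightarrow> (\<exists>e\<in>E. dir_deriv n c e y v \<noteq> 0))"
      using C(1)[of x] y(1) by blast
  qed
qed

end

section \<open>Interpolation by products of functions\<close>

text \<open>Linear combinations are built by adding one scaled member at a time, so that closure
  under sums and products follows by rule induction without index sets.\<close>

inductive_set lspan :: "('a \<Rightarrow> real) set \<Rightarrow> ('a \<Rightarrow> real) set" for S where
  zero: "(\<lambda>x. 0) \<in> lspan S"
| step: "f \<in> lspan S \<Longrightarrow> h \<in> S \<Longrightarrow> (\<lambda>x. f x + c * h x) \<in> lspan S"

lemma lspan_superset: "h \<in> S \<Longrightarrow> h \<in> lspan S"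
  using lspan.step[OF lspan.zero, of h S 1] by simp

lemma lspan_add: "g \<in> lspan S \<Longrightarrow> f \<in> lspan S \<Longrightarrow> (\<lambda>x. f x + g x) \<in> lspan S"
proof (induction rule: lspan.induct)
  case (step g h c)
  then show ?case using lspan.step[of "\<lambda>x. f x + g x" S h c] by (simp add: add.assoc)
qed simp

lemma lspan_cmult: "f \<in> lspan S \<Longrightarrow> (\<lambda>x. c * f x) \<in> lspan S"
proof (induction rule: lspan.induct)
  case (step f h d)
  then show ?case using lspan.step[of "\<lambda>x. c * f x" S h "c * d"] by (simp add: algebra_simps)
qed (simp add: lspan.zero)

lemma lspan_mult:
  assumes "\<And>s t. s \<in> S \<Longrightarrow> t \<in> T \<Longrightarrow> (\<lambda>x. s x * t x) \<in> lspan R"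
    and f: "f \<in> lspan S" and g: "g \<in> lspan T"
  shows "(\<lambda>x. f x * g x) \<in> lspan R"
proof -
  have *: "(\<lambda>x. s x * g x) \<in> lspan R" if s: "s \<in> S" for s
    using g
  proof (induction rule: lspan.induct)
    case (step g h d)
    then show ?case using lspan_add[OF lspan_cmult[OF assms(1)[OF s step(2)], of d] step(3)]
      by (simp add: algebra_simps)
  qed (simp add: lspan.zero)
  show ?thesis
    using f
  proof (induction rule: lspan.induct)
    case (step f h d)
    then show ?case using lspan_add[OF lspan_cmult[OF *[OF step(2)], of d] step(3)]
      by (simp add: algebra_simps)
  qed (simp add: lspan.zero)
qed

lemma lspan_finite_repr:
  fixes hs :: "nat \<Rightarrow> 'a \<Rightarrow> real"
  assumes "f \<in> lspan (hs ` {..<m})"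
  shows "\<exists>b. f = (\<lambda>x. \<Sum>j<m. b j * hs j x)"
  using assms
proof (induction rule: lspan.induct)
  case zero
  then show ?case by (intro exI[of _ "\<lambda>_. 0"]) simp
next
  case (step f h c)
  then obtain b i where b: "f = (\<lambda>x. \<Sum>j<m. b j * hs j x)" and i: "i < m" "h = hs i" by blast
  have "f x + c * h x = (\<Sum>j<m. (b(i := b i + c)) j * hs j x)" for x
  proof -
    have "(\<Sum>j<m. (b(i := b i + c)) j * hs j x) = (\<Sum>j<m. b j * hs j x + (if j = i then c * hs i x else 0))"
      by (rule sum.cong) (auto simp: algebra_simps)
    then show ?thesis using b i by (simp add: sum.distrib)
  qed
  then show ?case by (intro exI[of _ "b(i := b i + c)"]) (simp add: fun_eq_iff)
qed

text \<open>Products of exactly D factors. When the constant 1 belongs to E they include all shorter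
  products, which is how different degrees are brought together.\<close>

primrec monomials :: "('a \<Rightarrow> real) set \<Rightarrow> nat \<Rightarrow> ('a \<Rightarrow> real) set" where
  "monomials E 0 = {\<lambda>x. 1}"
| "monomials E (Suc D) = (\<lambda>(e, h). \<lambda>x. e x * h x) ` (E \<times> monomials E D)"

lemma finite_monomials: "finite E \<Longrightarrow> finite (monomials E D)"
  by (induction D) auto

lemma monomials_mult: "s \<in> monomials E D \<Longrightarrow> t \<in> monomials E D' \<Longrightarrow> (\<lambda>x. s x * t x) \<in> monomials E (D + D')"
proof (induction D arbitrary: s)
  case (Suc D)
  then obtain e h where e: "e \<in> E" "h \<in> monomials E D" "s = (\<lambda>x. e x * h x)" by auto
  then have "(\<lambda>x. e x * (h x * t x)) \<in> monomials E (Suc (D + D'))"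
    using Suc.IH[OF e(2) Suc.prems(2)] by force
  then show ?case using e by (simp add: mult.assoc)
qed simp

lemma lspan_monomials_mult:
  "f \<in> lspan (monomials E D) \<Longrightarrow> g \<in> lspan (monomials E D') \<Longrightarrow> (\<lambda>x. f x * g x) \<in> lspan (monomials E (D + D'))"
  by (rule lspan_mult[of "monomials E D" "monomials E D'"]) (auto intro: lspan_superset monomials_mult)

lemma monomials_1: "E = monomials E 1"
  by force

lemma lspan_monomials_const: "(\<lambda>x. 1) \<in> E \<Longrightarrow> (\<lambda>x. c) \<in> lspan (monomials E D)"
proof -
  assume "(\<lambda>x. 1) \<in> E"
  then have "(\<lambda>x. 1) \<in> monomials E D" by (induction D) (force+)
  from lspan_cmult[OF lspan_superset[OF this], of c] show ?thesis by simp
qed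

lemma lspan_monomials_mono:
  assumes "(\<lambda>x. 1) \<in> E" "f \<in> lspan (monomials E D)" "D \<le> D'"
  shows "f \<in> lspan (monomials E D')"
  using lspan_monomials_mult[OF assms(2) lspan_monomials_const[OF assms(1), of 1 "D' - D"]] assms(3) by simp

text \<open>Lagrange interpolation: for each q in Q one factor (e - e q) / (e p - e q), with e
  separating p from q. Hence the degree is the number of points to be annihilated.\<close>

lemma interpolating_monomials:
  assumes "(\<lambda>x. 1) \<in> E" "\<And>x y. x \<noteq> y \<Longrightarrow> \<exists>e\<in>E. e x \<noteq> e y" "finite Q" "p \<notin> Q"
  obtains f where "f \<in> lspan (monomials E (card Q))" "f p = 1" "\<And>q. q \<in> Q \<Longrightarrow> f q = 0"
proof -
  have "\<exists>f\<in>lspan (monomials E (card Q)). f p = 1 \<and> (\<forall>q\<in>Q. f q = 0)"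
    using assms(3,4)
  proof (induction Q rule: finite_induct)
    case empty
    show ?case using lspan_monomials_const[OF assms(1), of 1 0] by auto
  next
    case (insert q Q)
    then obtain f where f: "f \<in> lspan (monomials E (card Q))" "f p = 1" "\<forall>q\<in>Q. f q = 0" by auto
    obtain e where e: "e \<in> E" "e p \<noteq> e q" using assms(2)[of p q] insert by auto
    define a where "a = (\<lambda>x. inverse (e p - e q) * (e x + (- e q)))"
    have "e \<in> lspan (monomials E 1)" using lspan_superset[OF e(1)] monomials_1[of E] by metis
    then have "a \<in> lspan (monomials E 1)"
      unfolding a_def by (intro lspan_cmult lspan_add lspan_monomials_const[OF assms(1)])
    from lspan_monomials_mult[OF this f(1)] have "(\<lambda>x. a x * f x) \<in> lspan (monomials E (card (insert q Q)))"
      using insert by simp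
    moreover have "a p = 1" "a q = 0" using e(2) by (auto simp: a_def)
    ultimately show ?case using f by (intro bexI[of _ "\<lambda>x. a x * f x"]) auto
  qed
  then show ?thesis using that by blast
qed

context compact_Cr_manifold
begin

lemma lspan_Cr: "f \<in> lspan S \<Longrightarrow> S \<subseteq> Cr_functions n r A \<Longrightarrow> f \<in> Cr_functions n r A"
  by (induction rule: lspan.induct) (auto intro!: Cr_functions_add Cr_functions_mult)

lemma monomials_Cr: "E \<subseteq> Cr_functions n r A \<Longrightarrow> monomials E D \<subseteq> Cr_functions n r A"
  by (induction D) (auto intro!: Cr_functions_mult)

text \<open>Supplies the finite-dimensional family of perturbations. The last two conclusions say,
  by means of an explicit coefficient matrix b, that the differences of delay vectors, respectively
  their derivatives in a direction v, depend on the coefficients with full rank k.\<close>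

lemma probe_family:
  fixes T :: "'a \<Rightarrow> 'a"
  assumes T: "Cr_between n n r UNIV A UNIV A T" and T': "Cr_between n n r UNIV A UNIV A (inv T)"
    and bij: "bij T" and k: "k \<ge> 1"
  obtains m :: nat and hs :: "nat \<Rightarrow> 'a \<Rightarrow> real" where "\<forall>j<m. hs j \<in> Cr_functions n r A"
    "\<forall>x y. x \<noteq> y \<longrightarrow> (\<exists>j<m. hs j x \<noteq> hs j y)"
    "\<forall>x y. inj_on (\<lambda>l. (T ^^ l) x) {..<k} \<longrightarrow> (\<forall>l<k. \<forall>l'<k. (T ^^ l') y \<noteq> (T ^^ l) x) \<longrightarrow>
      (\<exists>b. \<forall>i<k. \<forall>l<k. (\<Sum>j<m. b i j * (hs j ((T ^^ l) x) - hs j ((T ^^ l) y))) = (if i = l then 1 else 0))"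
    "\<forall>x. inj_on (\<lambda>l. (T ^^ l) x) {..<k} \<longrightarrow> (\<exists>c\<in>A. x \<in> fst c \<and> (\<forall>v. (\<exists>i<n. v i \<noteq> 0) \<longrightarrow>
      (\<exists>b. \<forall>i<k. \<forall>l<k. (\<Sum>j<m. b i j * dir_deriv n c (\<lambda>z. hs j ((T ^^ l) z)) x v) = (if i = l then 1 else 0))))"
proof -
  obtain E0 where E0: "finite E0" "E0 \<subseteq> Cr_functions n r A"
    "\<And>x y. x \<noteq> y \<Longrightarrow> \<exists>e\<in>E0. e x \<noteq> e y"
    "\<And>x. \<exists>c\<in>A. x \<in> fst c \<and> (\<forall>v. (\<exists>i<n. v i \<noteq> 0) \<longrightarrow> (\<exists>e\<in>E0. dir_deriv n c e x v \<noteq> 0))"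
    using separating_immersive_family by blast
  \<comment> \<open>The functions composed with powers of the inverse of T are included because
    derivatives are to be prescribed along the orbit: composing with the matching power of T returns
    the original function, whose derivative at x in direction v is known to be nonzero for some
    member of \<open>E0\<close>.\<close>
  define E where "E = insert (\<lambda>x. 1) (\<Union>l<k. (\<lambda>e x. e ((inv T ^^ l) x)) ` E0)"
  have E: "finite E" "E \<subseteq> Cr_functions n r A" "(\<lambda>x. 1) \<in> E"
    using E0 Cr_functions_funpow[OF T'] by (auto simp: E_def)
  have "(\<lambda>e x. e ((inv T ^^ 0) x)) ` E0 \<subseteq> E" unfolding E_def using k by (intro subset_insertI2 UN_upper) auto
  then have E0E: "E0 \<subseteq> E" by simp
  have sep: "\<exists>e\<in>E. e x \<noteq> e y" if "x \<noteq> y" for x y using E0(3)[OF that] E0E by blast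
  \<comment> \<open>Interpolation at an orbit point of x kills at most k - 1 other points of this
    orbit and k points of the orbit of y; prescribing a derivative takes one factor plus two for
    each of k - 1 points. Both counts fit into 2 k factors.\<close>
  define S where "S = monomials E (2 * k)"
  have S: "finite S" "S \<subseteq> Cr_functions n r A" using E finite_monomials monomials_Cr by (auto simp: S_def)
  obtain hs where "bij_betw hs {0..<card S} S" using ex_bij_betw_nat_finite[OF S(1)] by blast
  then have hs: "S = hs ` {..<card S}" by (simp add: bij_betw_def lessThan_atLeast0)
  let ?m = "card S"
  have hsC: "hs j \<in> Cr_functions n r A" if "j < ?m" for j using S(2) hs that by blast
  have repr: "\<exists>b. f = (\<lambda>x. \<Sum>j<?m. b j * hs j x)" if "f \<in> lspan S" for f
    using lspan_finite_repr[of f hs ?m] that hs by simp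
  \<comment> \<open>Collects the coefficient vectors found for the individual rows i into one
    matrix.\<close>
  have choose: "\<exists>b. \<forall>i<k. \<forall>l<k. P b i l" if "\<And>i. i < k \<Longrightarrow> \<exists>b. \<forall>l<k. Q b i l" "\<And>b i l. Q (b i) i l \<longleftrightarrow> P b i l"
    for P :: "(nat \<Rightarrow> nat \<Rightarrow> real) \<Rightarrow> nat \<Rightarrow> nat \<Rightarrow> bool" and Q :: "(nat \<Rightarrow> real) \<Rightarrow> nat \<Rightarrow> nat \<Rightarrow> bool"
  proof -
    have "\<forall>i. \<exists>b. i < k \<longrightarrow> (\<forall>l<k. Q b i l)" using that(1) by blast
    from choice[OF this] show ?thesis using that(2) by blast
  qed
  show ?thesis
  proof (rule that[of ?m hs]; intro allI impI)
    show "hs j \<in> Cr_functions n r A" if "j < ?m" for j by (rule hsC[OF that])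
  next
    fix x y :: 'a assume "x \<noteq> y"
    then obtain e where e: "e \<in> E" "e x \<noteq> e y" using sep by blast
    have "e \<in> lspan (monomials E 1)" using lspan_superset[OF e(1)] monomials_1[of E] by metis
    from lspan_monomials_mono[OF E(3) this] have "e \<in> lspan S" unfolding S_def using k by simp
    then obtain b where b: "e = (\<lambda>x. \<Sum>j<?m. b j * hs j x)" using repr by blast
    show "\<exists>j<?m. hs j x \<noteq> hs j y"
    proof (rule ccontr)
      assume "\<not> ?thesis"
      then have "e x = e y" unfolding b by (auto intro!: sum.cong)
      then show False using e by simp
    qed
  next
    fix x y
    assume inj: "inj_on (\<lambda>l. (T ^^ l) x) {..<k}"
      and xy0: "\<forall>l<k. \<forall>l'<k. (T ^^ l') y \<noteq> (T ^^ l) x"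
    have xy: "(T ^^ l') y \<noteq> (T ^^ l) x" if "l < k" "l' < k" for l l' using xy0 that by blast
    show "\<exists>b. \<forall>i<k. \<forall>l<k. (\<Sum>j<?m. b i j * (hs j ((T ^^ l) x) - hs j ((T ^^ l) y))) = (if i = l then 1 else 0)"
    proof (rule choose[where Q = "\<lambda>b i l. (\<Sum>j<?m. b j * (hs j ((T ^^ l) x) - hs j ((T ^^ l) y))) = (if i = l then 1 else 0)"])
      fix i assume i: "i < k"
      define Q where "Q = ((\<lambda>l. (T ^^ l) x) ` ({..<k} - {i})) \<union> (\<lambda>l. (T ^^ l) y) ` {..<k}"
      have "(T ^^ i) x \<notin> Q"
      proof
        assume "(T ^^ i) x \<in> Q"
        then consider l where "l < k" "l \<noteq> i" "(T ^^ i) x = (T ^^ l) x" | l where "l < k" "(T ^^ i) x = (T ^^ l) y"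
          by (auto simp: Q_def)
        then show False
        proof cases
          case 1
          then show ?thesis using inj i by (auto simp: inj_on_def)
        next
          case 2
          then show ?thesis using xy[OF i 2(1)] by simp
        qed
      qed
      moreover have "finite Q" by (simp add: Q_def)
      ultimately obtain f where f: "f \<in> lspan (monomials E (card Q))" "f ((T ^^ i) x) = 1" "\<And>q. q \<in> Q \<Longrightarrow> f q = 0"
        using interpolating_monomials[OF E(3) sep] by blast
      have "card Q \<le> 2 * k"
      proof -
        have "card Q \<le> card ((\<lambda>l. (T ^^ l) x) ` ({..<k} - {i})) + card ((\<lambda>l. (T ^^ l) y) ` {..<k})"
          unfolding Q_def by (rule card_Un_le)
        also have "\<dots> \<le> card ({..<k} - {i}) + card {..<k}" by (intro add_mono card_image_le) auto
        finally show ?thesis using i by simp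
      qed
      with lspan_monomials_mono[OF E(3) f(1)] have "f \<in> lspan S" unfolding S_def by simp
      then obtain b where b: "f = (\<lambda>x. \<Sum>j<?m. b j * hs j x)" using repr by blast
      have "(\<Sum>j<?m. b j * (hs j ((T ^^ l) x) - hs j ((T ^^ l) y))) = (if i = l then 1 else 0)" if l: "l < k" for l
      proof -
        have "(\<Sum>j<?m. b j * (hs j ((T ^^ l) x) - hs j ((T ^^ l) y))) = f ((T ^^ l) x) - f ((T ^^ l) y)"
          unfolding b by (simp add: sum_subtractf algebra_simps)
        moreover have "f ((T ^^ l) y) = 0" by (rule f(3)) (use l in \<open>auto simp: Q_def\<close>)
        moreover have "f ((T ^^ l) x) = (if i = l then 1 else 0)"
          using f(2) f(3)[of "(T ^^ l) x"] l by (auto simp: Q_def)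
        ultimately show ?thesis by simp
      qed
      then show "\<exists>b. \<forall>l<k. (\<Sum>j<?m. b j * (hs j ((T ^^ l) x) - hs j ((T ^^ l) y))) = (if i = l then 1 else 0)"
        by blast
    qed simp
  next
    fix x
    assume inj: "inj_on (\<lambda>l. (T ^^ l) x) {..<k}"
    obtain c where c: "c \<in> A" "x \<in> fst c" and imm: "\<And>v. \<exists>i<n. v i \<noteq> 0 \<Longrightarrow> \<exists>e\<in>E0. dir_deriv n c e x v \<noteq> 0"
      using E0(4)[of x] by blast
    have "\<exists>b. \<forall>i<k. \<forall>l<k. (\<Sum>j<?m. b i j * dir_deriv n c (\<lambda>z. hs j ((T ^^ l) z)) x v) = (if i = l then 1 else 0)"
      if v: "\<exists>i<n. v i \<noteq> 0" for v
    proof (rule choose[where Q = "\<lambda>b i l. (\<Sum>j<?m. b j * dir_deriv n c (\<lambda>z. hs j ((T ^^ l) z)) x v) = (if i = l then 1 else 0)"])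
      fix i assume i: "i < k"
      obtain e0 where e0: "e0 \<in> E0" "dir_deriv n c e0 x v \<noteq> 0" using imm[OF v] by blast
      define e where "e = (\<lambda>x. e0 ((inv T ^^ i) x))"
      have eE: "e \<in> E" using e0(1) i by (auto simp: E_def e_def)
      have TT: "(inv T ^^ i) ((T ^^ i) z) = z" for z
        using bij by (metis bij_fn inv_fn inv_f_f bij_is_inj)
      define Q where "Q = (\<lambda>l. (T ^^ l) x) ` ({..<k} - {i})"
      have "(T ^^ i) x \<notin> Q" using inj i by (auto simp: Q_def inj_on_def)
      moreover have "finite Q" by (simp add: Q_def)
      ultimately obtain g where g: "g \<in> lspan (monomials E (card Q))" "g ((T ^^ i) x) = 1" "\<And>q. q \<in> Q \<Longrightarrow> g q = 0"
        using interpolating_monomials[OF E(3) sep] by blast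
      have cQ: "card Q \<le> k - 1"
      proof -
        have "card Q \<le> card ({..<k} - {i})" unfolding Q_def by (rule card_image_le) auto
        then show ?thesis using i by simp
      qed
      \<comment> \<open>Vanishes at \<open>(T ^^ i) x\<close>, and its composition with
        \<open>T ^^ i\<close> has derivative 1 at x in direction v.\<close>
      define a where "a = (\<lambda>z. inverse (dir_deriv n c e0 x v) * (e z + (- e ((T ^^ i) x))))"
      have "e \<in> lspan (monomials E 1)" using lspan_superset[OF eE] monomials_1[of E] by metis
      then have aE: "a \<in> lspan (monomials E 1)"
        unfolding a_def by (intro lspan_cmult lspan_add lspan_monomials_const[OF E(3)])
      \<comment> \<open>The square makes f vanish to second order at the other orbit points,
        whatever a does there, so its derivatives along them are 0. At \<open>(T ^^ i) x\<close> the
        zero of a removes the derivative of g from the product rule.\<close>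
      define f where "f = (\<lambda>z. a z * (g z * g z))"
      have "f \<in> lspan (monomials E (1 + (card Q + card Q)))"
        unfolding f_def by (intro lspan_monomials_mult aE g(1))
      from lspan_monomials_mono[OF E(3) this] have "f \<in> lspan S" unfolding S_def using cQ k by simp
      then obtain b where b: "f = (\<lambda>x. \<Sum>j<?m. b j * hs j x)" using repr by blast
      have gC: "g \<in> Cr_functions n r A" by (rule lspan_Cr[OF g(1) monomials_Cr[OF E(2)]])
      have aC: "a \<in> Cr_functions n r A" by (rule lspan_Cr[OF aE monomials_Cr[OF E(2)]])
      have fz: "(\<Sum>j<?m. b j * hs j z) = a z * (g z * g z)" for z
        using fun_cong[OF b, of z] by (simp add: f_def)
      have "(\<Sum>j<?m. b j * dir_deriv n c (\<lambda>z. hs j ((T ^^ l) z)) x v) = (if i = l then 1 else 0)" if l: "l < k" for l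
      proof -
        note Cl = Cr_functions_funpow[OF T, where l = l]
        have "(\<Sum>j<?m. b j * dir_deriv n c (\<lambda>z. hs j ((T ^^ l) z)) x v) = dir_deriv n c (\<lambda>z. \<Sum>j<?m. b j * hs j ((T ^^ l) z)) x v"
          by (rule dir_deriv_sum[symmetric, OF _ c]) (auto intro: Cl hsC)
        also have "\<dots> = dir_deriv n c (\<lambda>z. a ((T ^^ l) z) * (g ((T ^^ l) z) * g ((T ^^ l) z))) x v"
          by (simp add: fz)
        also have "\<dots> = dir_deriv n c (\<lambda>z. a ((T ^^ l) z)) x v * (g ((T ^^ l) x) * g ((T ^^ l) x))
             + (2 * dir_deriv n c (\<lambda>z. g ((T ^^ l) z)) x v * g ((T ^^ l) x)) * a ((T ^^ l) x)"
          using dir_deriv_mult[OF Cl[OF aC] Cr_functions_mult[OF Cl[OF gC] Cl[OF gC]] c]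
            dir_deriv_mult[OF Cl[OF gC] Cl[OF gC] c] by simp
        also have "\<dots> = (if i = l then 1 else 0)"
        proof (cases "i = l")
          case True
          have "a ((T ^^ l) x) = 0" using True by (simp add: a_def)
          moreover have "dir_deriv n c (\<lambda>z. a ((T ^^ l) z)) x v = 1"
          proof -
            have 1: "(\<lambda>z. a ((T ^^ l) z)) = (\<lambda>z. inverse (dir_deriv n c e0 x v) * (e0 z + (- e ((T ^^ i) x))))"
              using True TT by (simp add: a_def e_def)
            have e0C: "e0 \<in> Cr_functions n r A" using e0(1) E0(2) by blast
            show ?thesis unfolding 1
              using dir_deriv_mult[OF Cr_functions_const Cr_functions_add[OF e0C Cr_functions_const] c]
                dir_deriv_add[OF e0C Cr_functions_const c] e0(2) by (simp del: add_uminus_conv_diff)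
          qed
          ultimately show ?thesis using True g(2) by simp
        next
          case False
          then have "g ((T ^^ l) x) = 0" using l by (intro g(3)) (auto simp: Q_def)
          then show ?thesis using False by simp
        qed
        finally show ?thesis .
      qed
      then show "\<exists>b. \<forall>l<k. (\<Sum>j<?m. b j * dir_deriv n c (\<lambda>z. hs j ((T ^^ l) z)) x v) = (if i = l then 1 else 0)"
        by blast
    qed simp
    then show "\<exists>c\<in>A. x \<in> fst c \<and> (\<forall>v. (\<exists>i<n. v i \<noteq> 0) \<longrightarrow>
      (\<exists>b. \<forall>i<k. \<forall>l<k. (\<Sum>j<?m. b i j * dir_deriv n c (\<lambda>z. hs j ((T ^^ l) z)) x v) = (if i = l then 1 else 0)))"
      using c by blast
  qed
qed

end

section \<open>The Riemannian distance\<close>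

locale compact_Riemannian_manifold = compact_Cr_manifold n r A
  for n :: nat and r :: enat and A :: "'a::t2_space chart set" +
  fixes g :: "'a metric_tensor" and \<rho> :: "'a \<Rightarrow> 'a \<Rightarrow> real"
  assumes metric: "Riemannian_metric n A g" and distance: "Riemannian_distance n A g \<rho>"
begin

section \<open>Tangent vectors and curves under a change of charts\<close>

definition metric_form :: "'a chart \<Rightarrow> 'a \<Rightarrow> (nat \<Rightarrow> real) \<Rightarrow> real" where
  "metric_form c x v = (\<Sum>i<n. \<Sum>j<n. g c x i j * v i * v j)"

text \<open>The Jacobian of the transition map from c to d at x, applied to v: the coordinates in d
  of the tangent vector with coordinates v in c.\<close>

definition chart_push :: "'a chart \<Rightarrow> 'a chart \<Rightarrow> 'a \<Rightarrow> (nat \<Rightarrow> real) \<Rightarrow> nat \<Rightarrow> real" where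
  "chart_push c d x v a = (\<Sum>i<n. partial_deriv i (\<lambda>u. snd d (chart_inv c u) a) (snd c x) * v i)"

lemma metric_transform:
  "\<lbrakk>c \<in> A; d \<in> A; x \<in> fst c; x \<in> fst d; i < n; j < n\<rbrakk> \<Longrightarrow> g c x i j = (\<Sum>a<n. \<Sum>b<n. g d x a b
     * partial_deriv i (\<lambda>u. snd d (chart_inv c u) a) (snd c x)
     * partial_deriv j (\<lambda>u. snd d (chart_inv c u) b) (snd c x))"
  using metric unfolding Riemannian_metric_def by blast

lemma metric_continuous: "c \<in> A \<Longrightarrow> i < n \<Longrightarrow> j < n \<Longrightarrow> continuous_on (fst c) (\<lambda>x. g c x i j)"
  using metric unfolding Riemannian_metric_def by blast

lemma metric_form_pos: "c \<in> A \<Longrightarrow> x \<in> fst c \<Longrightarrow> \<exists>i<n. v i \<noteq> 0 \<Longrightarrow> metric_form c x v > 0"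
  using metric unfolding Riemannian_metric_def metric_form_def by blast

lemma metric_form_push:
  assumes "c \<in> A" "d \<in> A" "x \<in> fst c" "x \<in> fst d"
  shows "metric_form d x (chart_push c d x v) = metric_form c x v"
proof -
  let ?J = "\<lambda>i a. partial_deriv i (\<lambda>u. snd d (chart_inv c u) a) (snd c x)"
  have "metric_form c x v = (\<Sum>i<n. \<Sum>j<n. (\<Sum>a<n. \<Sum>b<n. g d x a b * ?J i a * ?J j b) * v i * v j)"
    unfolding metric_form_def using metric_transform[OF assms] by (intro sum.cong refl) (simp only: lessThan_iff)
  also have "\<dots> = (\<Sum>i<n. \<Sum>j<n. \<Sum>a<n. \<Sum>b<n. g d x a b * (?J i a * v i) * (?J j b * v j))"
    by (simp add: sum_distrib_left sum_distrib_right mult_ac)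
  also have "\<dots> = (\<Sum>i<n. \<Sum>a<n. \<Sum>j<n. \<Sum>b<n. g d x a b * (?J i a * v i) * (?J j b * v j))"
    by (rule sum.cong[OF refl]) (rule sum.swap)
  also have "\<dots> = (\<Sum>a<n. \<Sum>i<n. \<Sum>j<n. \<Sum>b<n. g d x a b * (?J i a * v i) * (?J j b * v j))"
    by (rule sum.swap)
  also have "\<dots> = (\<Sum>a<n. \<Sum>i<n. \<Sum>b<n. \<Sum>j<n. g d x a b * (?J i a * v i) * (?J j b * v j))"
    by (rule sum.cong[OF refl], rule sum.cong[OF refl], rule sum.swap)
  also have "\<dots> = (\<Sum>a<n. \<Sum>b<n. \<Sum>i<n. \<Sum>j<n. g d x a b * (?J i a * v i) * (?J j b * v j))"
    by (rule sum.cong[OF refl]) (rule sum.swap)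
  also have "\<dots> = metric_form d x (chart_push c d x v)"
    unfolding metric_form_def chart_push_def by (simp add: sum_distrib_left sum_distrib_right mult_ac)
  finally show ?thesis by simp
qed

lemma dir_deriv_push:
  assumes "h \<in> Cr_functions n r A" "c \<in> A" "d \<in> A" "x \<in> fst c" "x \<in> fst d"
  shows "dir_deriv n d h x (chart_push c d x v) = dir_deriv n c h x v"
proof -
  let ?U = "snd c ` (fst c \<inter> fst d)"
  note W = chart_image_of_open[OF assms(2) chart_open[OF assms(3)]]
  let ?J = "\<lambda>i a. partial_deriv i (\<lambda>u. snd d (chart_inv c u) a) (snd c x)"
  have xU: "snd c x \<in> ?U" using assms by blast
  have "partial_deriv i (\<lambda>u. h (chart_inv c u)) (snd c x)
      = (\<Sum>a<n. partial_deriv a (\<lambda>u. h (chart_inv d u)) (snd d x) * ?J i a)" if i: "i < n" for i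
  proof -
    have "partial_deriv i (\<lambda>u. h (chart_inv c u)) (snd c x)
        = partial_deriv i (\<lambda>u. h (chart_inv d (snd d (chart_inv c u)))) (snd c x)"
      by (rule partial_deriv_cong[OF W(1) xU i]) (use W(2) assms in auto)
    also have "\<dots> = (\<Sum>a<n. partial_deriv a (\<lambda>u. h (chart_inv d u)) (snd d (chart_inv c (snd c x))) * ?J i a)"
    proof (rule partial_deriv_eqI, rule Ck_on_compose_has_partial[where F = "\<lambda>u. snd d (chart_inv c u)" and m = 0,
        OF W(1) chart_image_open[OF assms(3)] _ _ Cr_functions_C1[OF assms(1,3)] i xU])
      show "(\<lambda>u. snd d (chart_inv c u)) ` ?U \<subseteq> chart_image d" using W(2) assms by auto
      show "Ck_on n (Suc 0) ?U (\<lambda>u. snd d (chart_inv c u) j)" if "j < n" for j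
        by (rule Cr_on_C1[OF transition_Cr[OF assms(2,3) that] r1])
    qed
    finally show ?thesis using assms by simp
  qed
  then have "dir_deriv n c h x v = (\<Sum>i<n. \<Sum>a<n. partial_deriv a (\<lambda>u. h (chart_inv d u)) (snd d x) * ?J i a * v i)"
    by (simp add: dir_deriv_def sum_distrib_right)
  also have "\<dots> = (\<Sum>a<n. \<Sum>i<n. partial_deriv a (\<lambda>u. h (chart_inv d u)) (snd d x) * ?J i a * v i)"
    by (rule sum.swap)
  also have "\<dots> = dir_deriv n d h x (chart_push c d x v)"
    by (simp add: dir_deriv_def chart_push_def sum_distrib_left mult.assoc)
  finally show ?thesis by simp
qed

text \<open>Stated for an open part V of the chart domain because transition maps, one of its two
  applications, are smooth only on the overlap of two charts.\<close>

lemma curve_chain: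
  assumes "f = (\<lambda>y. F (snd c y))" "open V" "V \<subseteq> fst c" "c \<in> A" "Ck_on n (Suc 0) (snd c ` V) F"
    "\<gamma> t \<in> V" "continuous (at t within S) \<gamma>"
    "\<And>i. i < n \<Longrightarrow> ((\<lambda>s. snd c (\<gamma> s) i) has_real_derivative v i) (at t within S)"
  shows "((\<lambda>s. f (\<gamma> s)) has_real_derivative (\<Sum>i<n. partial_deriv i F (snd c (\<gamma> t)) * v i)) (at t within S)"
  unfolding assms(1)
proof (rule Ck_on_chain_curve[where \<gamma> = "\<lambda>s. snd c (\<gamma> s)"])
  have "fst c \<inter> V = V" using assms(3) by blast
  then show "openin (Euclidean_space n) (snd c ` V)" using chart_image_of_open(1)[OF assms(4,2)] by simp
  show "Ck_on n (Suc 0) (snd c ` V) F" "snd c (\<gamma> t) \<in> snd c ` V" using assms by auto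
  have "\<forall>\<^sub>F s in at t within S. \<gamma> s \<in> V"
    using assms(2,6,7) unfolding continuous_within by (rule topological_tendstoD[rotated])
  then show "\<forall>\<^sub>F s in at t within S. snd c (\<gamma> s) \<in> Rn n"
    by eventually_elim (use assms(3,4) chart_image_Rn snd_in_chart_image in blast)
qed (rule assms(8))

lemma curve_push:
  assumes "c \<in> A" "d \<in> A" "\<gamma> t \<in> fst c" "\<gamma> t \<in> fst d" "continuous (at t within S) \<gamma>" "a < n"
    "\<And>i. i < n \<Longrightarrow> ((\<lambda>s. snd c (\<gamma> s) i) has_real_derivative v i) (at t within S)"
  shows "((\<lambda>s. snd d (\<gamma> s) a) has_real_derivative chart_push c d (\<gamma> t) v a) (at t within S)"
proof -
  have V: "open (fst c \<inter> fst d)" using assms by auto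
  have "((\<lambda>s. snd d (chart_inv c (snd c (\<gamma> s))) a) has_real_derivative chart_push c d (\<gamma> t) v a) (at t within S)"
    unfolding chart_push_def
    using curve_chain[where F = "\<lambda>u. snd d (chart_inv c u) a", OF refl V _ assms(1)
        Cr_on_C1[OF transition_Cr[OF assms(1,2,6)] r1] _ assms(5,7)] assms(3,4) by simp
  moreover have "\<forall>\<^sub>F s in at t within S. snd d (chart_inv c (snd c (\<gamma> s))) a = snd d (\<gamma> s) a"
  proof -
    have "\<forall>\<^sub>F s in at t within S. \<gamma> s \<in> fst c"
      using chart_open[OF assms(1)] assms(3,5) unfolding continuous_within by (rule topological_tendstoD[rotated])
    then show ?thesis by eventually_elim (use assms(1) in simp)
  qed
  ultimately show ?thesis
    using assms(1,3) has_field_derivative_cong_eventually[of "\<lambda>s. snd d (chart_inv c (snd c (\<gamma> s))) a" "\<lambda>s. snd d (\<gamma> s) a" t S]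
    by simp
qed

lemma curve_function:
  assumes "c \<in> A" "h \<in> Cr_functions n r A" "\<gamma> t \<in> fst c" "continuous (at t within S) \<gamma>"
    "\<And>i. i < n \<Longrightarrow> ((\<lambda>s. snd c (\<gamma> s) i) has_real_derivative v i) (at t within S)"
  shows "((\<lambda>s. h (\<gamma> s)) has_real_derivative dir_deriv n c h (\<gamma> t) v) (at t within S)"
proof -
  have im: "chart_image c = snd c ` fst c" by (simp add: chart_image_def)
  have "((\<lambda>s. h (chart_inv c (snd c (\<gamma> s)))) has_real_derivative dir_deriv n c h (\<gamma> t) v) (at t within S)"
    unfolding dir_deriv_def
    using curve_chain[where F = "\<lambda>u. h (chart_inv c u)", OF refl chart_open[OF assms(1)] subset_refl assms(1)
        Cr_functions_C1[OF assms(2,1), unfolded im] assms(3,4,5)] by simp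
  moreover have "\<forall>\<^sub>F s in at t within S. h (chart_inv c (snd c (\<gamma> s))) = h (\<gamma> s)"
  proof -
    have "\<forall>\<^sub>F s in at t within S. \<gamma> s \<in> fst c"
      using chart_open[OF assms(1)] assms(3,4) unfolding continuous_within by (rule topological_tendstoD[rotated])
    then show ?thesis by eventually_elim (use assms(1) in simp)
  qed
  ultimately show ?thesis
    using assms(1,3) has_field_derivative_cong_eventually[of "\<lambda>s. h (chart_inv c (snd c (\<gamma> s)))" "\<lambda>s. h (\<gamma> s)" t S]
    by simp
qed

text \<open>The chart chosen in the definition of \<open>speed\<close> may be exchanged for any
  other, since coordinate velocities and metric coefficients transform compatibly.\<close>

lemma speed_eq:
  assumes "c \<in> A" "\<gamma> t \<in> fst c" "continuous (at t) \<gamma>"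
    "\<And>i. i < n \<Longrightarrow> ((\<lambda>s. snd c (\<gamma> s) i) has_real_derivative v i) (at t)"
  shows "speed n A g \<gamma> t = sqrt (metric_form c (\<gamma> t) v)"
proof -
  define d where "d = (SOME d. d \<in> A \<and> \<gamma> t \<in> fst d)"
  have "d \<in> A \<and> \<gamma> t \<in> fst d" unfolding d_def by (rule someI[of _ c]) (use assms in simp)
  then have d: "d \<in> A" "\<gamma> t \<in> fst d" by auto
  have "deriv (\<lambda>s. snd d (\<gamma> s) i) t = chart_push c d (\<gamma> t) v i" if "i < n" for i
    by (rule DERIV_imp_deriv, rule curve_push[OF assms(1) d(1) assms(2) d(2) assms(3) that assms(4)])
  then have "speed n A g \<gamma> t = sqrt (metric_form d (\<gamma> t) (chart_push c d (\<gamma> t) v))"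
    unfolding speed_def Let_def d_def[symmetric] metric_form_def by simp
  then show ?thesis using metric_form_push[OF assms(1) d(1) assms(2) d(2)] by simp
qed

section \<open>The distance is bounded above by chart coordinates\<close>

text \<open>The segment joining two points in chart coordinates is an admissible curve, and its
  speed is bounded because the metric coefficients are bounded on a compact box. In particular
  nearby points have finite path distance, so that there \<rho> is the infimum of lengths.\<close>

lemma rho_upper:
  assumes c: "c \<in> A" "p \<in> fst c"
  obtains N C where "open N" "p \<in> N" "N \<subseteq> fst c" "C \<ge> 0"
    "\<And>y y' \<eta>. y \<in> N \<Longrightarrow> y' \<in> N \<Longrightarrow> \<eta> \<ge> 0 \<Longrightarrow> (\<And>i. i < n \<Longrightarrow> \<bar>snd c y i - snd c y' i\<bar> \<le> \<eta>) \<Longrightarrow>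
       path_distance n A g y y' < \<infinity> \<and> \<rho> y y' \<le> C * \<eta>"
proof -
  obtain e where e: "e > 0" and K: "{y \<in> Rn n. \<forall>i<n. \<bar>y i - snd c p i\<bar> \<le> e} \<subseteq> chart_image c"
    using openin_contains_cbox[OF chart_image_open[OF c(1)], of "snd c p"] c by auto
  let ?K = "{y \<in> Rn n. \<forall>i<n. \<bar>y i - snd c p i\<bar> \<le> e}"
  define N where "N = {y \<in> fst c. snd c y \<in> {u \<in> Rn n. \<forall>i<n. \<bar>u i - snd c p i\<bar> < e}}"
  have "open N" unfolding N_def by (rule chart_inv_image_open[OF c(1) openin_box])
  have cK: "compact (chart_inv c ` ?K)"
    using K continuous_on_subset[OF chart_inv_cont[OF c(1)]] compact_cbox by (intro compact_continuous_image) auto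
  have "\<exists>B. \<forall>x\<in>chart_inv c ` ?K. \<bar>g c x i j\<bar> \<le> B" if "i < n" "j < n" for i j
  proof -
    have "continuous_on (chart_inv c ` ?K) (\<lambda>x. g c x i j)"
      by (rule continuous_on_subset[OF metric_continuous[OF c(1) that]]) (use K chart_inv_in[OF c(1)] in blast)
    then have "bounded ((\<lambda>x. g c x i j) ` chart_inv c ` ?K)"
      using cK compact_continuous_image compact_imp_bounded by blast
    then show ?thesis unfolding bounded_iff by auto
  qed
  note ex = this
  define B where "B i j = (SOME B. \<forall>x\<in>chart_inv c ` ?K. \<bar>g c x i j\<bar> \<le> B)" for i j
  have B: "\<bar>g c x i j\<bar> \<le> B i j" if "i < n" "j < n" "x \<in> chart_inv c ` ?K" for i j x
    using someI_ex[OF ex[OF that(1,2)]] that(3) unfolding B_def by blast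
  \<comment> \<open>The sum of bounds for all coefficients; its square root is the constant
    comparing the Riemannian norm with the sup norm over the compact box.\<close>
  define BB where "BB = (\<Sum>i<n. \<Sum>j<n. \<bar>B i j\<bar>)"
  have BB: "BB \<ge> 0" unfolding BB_def by (intro sum_nonneg) auto
  have gqB: "sqrt (metric_form c x v) \<le> sqrt BB * \<eta>" if "x \<in> chart_inv c ` ?K" "\<And>i. i < n \<Longrightarrow> \<bar>v i\<bar> \<le> \<eta>" "\<eta> \<ge> 0" for x v \<eta>
  proof -
    have "metric_form c x v \<le> (\<Sum>i<n. \<Sum>j<n. \<bar>B i j\<bar> * \<eta>^2)"
      unfolding metric_form_def
    proof (intro sum_mono)
      fix i j assume ij: "i \<in> {..<n}" "j \<in> {..<n}"
      have "\<bar>g c x i j * v i * v j\<bar> = \<bar>g c x i j\<bar> * (\<bar>v i\<bar> * \<bar>v j\<bar>)" by (simp add: abs_mult)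
      also have "\<dots> \<le> \<bar>B i j\<bar> * (\<eta> * \<eta>)"
        using ij that B[of i j x] by (intro mult_mono) auto
      finally show "g c x i j * v i * v j \<le> \<bar>B i j\<bar> * \<eta>^2" by (simp add: power2_eq_square)
    qed
    then have "metric_form c x v \<le> BB * \<eta>^2" by (simp add: BB_def sum_distrib_right)
    then have "sqrt (metric_form c x v) \<le> sqrt (BB * \<eta>^2)" by simp
    then show ?thesis using that(3) by (simp add: real_sqrt_mult)
  qed
  show ?thesis
  proof (rule that[of N "sqrt BB"])
    show "open N" by fact
    show "p \<in> N" using c e chart_image_Rn[OF c(1)] snd_in_chart_image[OF c] by (auto simp: N_def)
    show "N \<subseteq> fst c" by (auto simp: N_def)
    show "sqrt BB \<ge> 0" using BB by simp
  next
    fix y y' and \<eta> :: real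
    assume y: "y \<in> N" "y' \<in> N" and \<eta>: "\<eta> \<ge> 0" "\<And>i. i < n \<Longrightarrow> \<bar>snd c y i - snd c y' i\<bar> \<le> \<eta>"
    define w where "w i = snd c y' i - snd c y i" for i
    define l where "l s i = snd c y i + s * w i" for s :: real and i
    \<comment> \<open>The segment remains in the box, hence in the image of the chart, because boxes
      are convex.\<close>
    define \<gamma> where "\<gamma> s = chart_inv c (l s)" for s
    have lK: "l s \<in> ?K" if "s \<in> {0..1}" for s
    proof -
      have "\<bar>l s i - snd c p i\<bar> \<le> e" if "i < n" for i
      proof -
        have "l s i - snd c p i = (1 - s) * (snd c y i - snd c p i) + s * (snd c y' i - snd c p i)"
          by (simp add: l_def w_def algebra_simps)
        also have "\<bar>\<dots>\<bar> \<le> (1 - s) * \<bar>snd c y i - snd c p i\<bar> + s * \<bar>snd c y' i - snd c p i\<bar>"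
          using \<open>s \<in> {0..1}\<close> by (intro order_trans[OF abs_triangle_ineq]) (simp add: abs_mult)
        also have "\<dots> \<le> (1 - s) * e + s * e"
          using \<open>s \<in> {0..1}\<close> y that by (intro add_mono mult_left_mono) (auto simp: N_def less_imp_le)
        finally show ?thesis by (simp add: algebra_simps)
      qed
      moreover have "l s \<in> Rn n" using y by (auto simp: N_def in_Rn l_def w_def)
      ultimately show ?thesis by blast
    qed
    have \<gamma>K: "\<gamma> s \<in> chart_inv c ` ?K" "\<gamma> s \<in> fst c" "snd c (\<gamma> s) = l s" if "s \<in> {0..1}" for s
      using lK[OF that] K c(1) by (auto simp: \<gamma>_def subset_iff)
    have lc: "continuous_on S l" for S
      unfolding l_def by (intro continuous_on_coordinatewise_then_product continuous_intros)
    have \<gamma>c: "continuous_on {0..1} \<gamma>"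
      unfolding \<gamma>_def by (rule continuous_on_compose2[OF chart_inv_cont[OF c(1)] lc]) (use lK K in blast)
    have ld: "((\<lambda>s. l s i) has_real_derivative w i) (at t within S)" for i t S
      unfolding l_def by (auto intro!: derivative_eq_intros)
    have lder: "((\<lambda>s. snd c (\<gamma> s) i) has_real_derivative w i) (at t within {0..1})" if t: "t \<in> {0..1}" for t i
      using ld[of i t "{0..1}"]
      by (rule has_field_derivative_transform_within[OF _ zero_less_one t]) (use \<gamma>K in auto)
    have arc: "C1_arc n A 0 1 \<gamma>"
      unfolding C1_arc_def
    proof (intro conjI ballI allI impI \<gamma>c)
      fix d i assume d: "d \<in> A" and i: "i < n"
      let ?S = "{0..1} \<inter> \<gamma> -` fst d"
      note W = chart_image_of_open[OF c(1) chart_open[OF d]]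
      show "\<exists>v. (\<forall>t\<in>?S. ((\<lambda>s. snd d (\<gamma> s) i) has_real_derivative v t) (at t within {0..1})) \<and> continuous_on ?S v"
      proof (intro exI conjI ballI)
        fix t assume t: "t \<in> ?S"
        show "((\<lambda>s. snd d (\<gamma> s) i) has_real_derivative (\<lambda>t. chart_push c d (\<gamma> t) w i) t) (at t within {0..1})"
          using t \<gamma>c \<gamma>K lder by (intro curve_push[OF c(1) d _ _ _ i]) (auto simp: continuous_on_eq_continuous_within)
      next
        have lW: "l ` ?S \<subseteq> snd c ` (fst c \<inter> fst d)"
        proof
          fix u assume "u \<in> l ` ?S"
          then obtain s where "s \<in> ?S" "u = l s" by blast
          then show "u \<in> snd c ` (fst c \<inter> fst d)" using \<gamma>K(2,3)[of s] by (auto intro!: image_eqI[of _ _ "\<gamma> s"])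
        qed
        have "continuous_on ?S (\<lambda>t. \<Sum>j<n. partial_deriv j (\<lambda>u. snd d (chart_inv c u) i) (l t) * w j)"
        proof (intro continuous_on_sum continuous_on_mult continuous_on_const)
          fix j assume "j \<in> {..<n}"
          then have "continuous_on (snd c ` (fst c \<inter> fst d)) (partial_deriv j (\<lambda>u. snd d (chart_inv c u) i))"
            using Cr_on_C1[OF transition_Cr[OF c(1) d i] r1] by simp
          then show "continuous_on ?S (\<lambda>t. partial_deriv j (\<lambda>u. snd d (chart_inv c u) i) (l t))"
            by (rule continuous_on_compose2[OF _ lc lW])
        qed
        then show "continuous_on ?S (\<lambda>t. chart_push c d (\<gamma> t) w i)"
          by (rule continuous_on_eq) (auto simp: chart_push_def \<gamma>K(3))
      qed
    qed
    have pw: "piecewise_C1_curve n A \<gamma>"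
      unfolding piecewise_C1_curve_def
      by (rule exI[of _ "{0, 1}"]) (use arc in auto)
    have "\<gamma> 0 = y" "\<gamma> 1 = y'"
    proof -
      have "l 0 = snd c y" "l 1 = snd c y'" by (auto simp: l_def w_def)
      then show "\<gamma> 0 = y" "\<gamma> 1 = y'" using y c(1) by (auto simp: \<gamma>_def N_def)
    qed
    then have "path_distance n A g y y' \<le> curve_length n A g \<gamma>"
      unfolding path_distance_def using pw by (intro INF_lower) auto
    also have "\<dots> \<le> (\<integral>\<^sup>+ t. ennreal (sqrt BB * \<eta>) * indicator {0..1} t \<partial>(lborel :: real measure))"
      unfolding curve_length_def
    proof (rule nn_integral_mono_AE)
      \<comment> \<open>At 0 and 1 the curve has only a one-sided derivative while
        \<open>speed\<close> uses the two-sided one; the two points form a null set.\<close>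
      have "AE t in lborel. t \<noteq> (0::real) \<and> t \<noteq> 1"
        using AE_lborel_singleton[of 0] AE_lborel_singleton[of 1] by eventually_elim auto
      then show "AE t in lborel. ennreal (speed n A g \<gamma> t) * indicator {0..1} t \<le> ennreal (sqrt BB * \<eta>) * indicator {0..1} (t::real)"
      proof eventually_elim
        case (elim t)
        show ?case
        proof (cases "t \<in> {0..1}")
          case True
          then have t: "t \<in> {0<..<1}" using elim by auto
          then have at: "at t within {0..1} = at t" by (intro at_within_interior) auto
          have "continuous (at t) \<gamma>" using \<gamma>c True at by (metis continuous_on_eq_continuous_within)
          then have "speed n A g \<gamma> t = sqrt (metric_form c (\<gamma> t) w)"
            using lder[OF True] \<gamma>K[OF True] c(1) unfolding at by (intro speed_eq) auto
          also have "\<dots> \<le> sqrt BB * \<eta>"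
            using \<eta> \<gamma>K[OF True] by (intro gqB) (auto simp: w_def abs_minus_commute)
          finally show ?thesis using True by (simp add: ennreal_leI)
        qed simp
      qed
    qed
    also have "\<dots> = ennreal (sqrt BB * \<eta>)"
      by (simp add: nn_integral_cmult)
    finally have le: "path_distance n A g y y' \<le> ennreal (sqrt BB * \<eta>)" .
    then have fin: "path_distance n A g y y' < \<infinity>" by (simp add: order_le_less_trans ennreal_less_top)
    then have "ennreal (\<rho> y y') = path_distance n A g y y'"
      using distance by (simp add: Riemannian_distance_def)
    then have "ennreal (\<rho> y y') \<le> ennreal (sqrt BB * \<eta>)" using le by simp
    then have "\<rho> y y' \<le> sqrt BB * \<eta>" using BB \<eta>(1) by (simp add: ennreal_le_iff)
    then show "path_distance n A g y y' < \<infinity> \<and> \<rho> y y' \<le> sqrt BB * \<eta>" using fin by simp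
  qed
qed

end

section \<open>Observables are Lipschitz for the distance\<close>

lemma compact_sup_sphere: "compact {v \<in> Rn n. (\<forall>i<n. \<bar>v i\<bar> \<le> 1) \<and> (\<exists>i<n. \<bar>v i\<bar> = 1)}"
proof -
  have "{v \<in> Rn n. (\<forall>i<n. \<bar>v i\<bar> \<le> 1) \<and> (\<exists>i<n. \<bar>v i\<bar> = 1)}
      = {v \<in> Rn n. \<forall>i<n. \<bar>v i - 0\<bar> \<le> 1} \<inter> (\<Union>i<n. {v. \<bar>v i\<bar> = 1})" by auto
  moreover have "closed {v :: nat \<Rightarrow> real. \<bar>v i\<bar> = 1}" for i
    by (intro closed_Collect_eq continuous_intros) (simp_all add: continuous_on_product_coordinates)
  then have "closed (\<Union>i<n. {v :: nat \<Rightarrow> real. \<bar>v i\<bar> = 1})" by (intro closed_UN) auto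
  ultimately show ?thesis using compact_Int_closed[OF compact_cbox[of n "\<lambda>_. 0" 1]] by simp
qed

lemma sup_normalize:
  fixes v :: "nat \<Rightarrow> real"
  assumes "\<exists>i<n. v i \<noteq> 0"
  obtains m w where "m > 0" "w \<in> Rn n" "\<forall>i<n. \<bar>w i\<bar> \<le> 1" "\<exists>i<n. \<bar>w i\<bar> = 1" "\<And>i. i < n \<Longrightarrow> v i = m * w i"
    "\<And>i. i < n \<Longrightarrow> \<bar>v i\<bar> \<le> m"
proof -
  define m where "m = Max ((\<lambda>i. \<bar>v i\<bar>) ` {..<n})"
  have ne: "(\<lambda>i. \<bar>v i\<bar>) ` {..<n} \<noteq> {}" "finite ((\<lambda>i. \<bar>v i\<bar>) ` {..<n})" using assms by auto
  have le: "\<bar>v i\<bar> \<le> m" if "i < n" for i unfolding m_def using that ne by (intro Max_ge) auto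
  have m: "m > 0" using assms le by (metis order_less_le_trans zero_less_abs_iff)
  have "m \<in> (\<lambda>i. \<bar>v i\<bar>) ` {..<n}" unfolding m_def using ne by (intro Max_in) auto
  then obtain i0 where i0: "i0 < n" "\<bar>v i0\<bar> = m" by auto
  show ?thesis
    using m le i0 by (intro that[of m "\<lambda>i. if i < n then v i / m else 0"]) (auto simp: in_Rn intro!: exI[of _ i0])
qed

context compact_Riemannian_manifold
begin

text \<open>On a compact box times the sup-norm unit sphere the quotient of the two sides is
  continuous, hence bounded; homogeneity extends the bound to all vectors. Finitely many boxes
  suffice, and the estimate passes to other charts because both sides are invariant under
  \<open>chart_push\<close>.\<close>

lemma dir_deriv_le_metric_form:
  assumes h: "h \<in> Cr_functions n r A"
  obtains L where "L > 0" "\<And>c x v. c \<in> A \<Longrightarrow> x \<in> fst c \<Longrightarrow> \<bar>dir_deriv n c h x v\<bar> \<le> L * sqrt (metric_form c x v)"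
proof -
  have "\<exists>N L. open N \<and> p \<in> N \<and> (\<exists>d\<in>A. N \<subseteq> fst d \<and> (\<forall>x\<in>N. \<forall>v. \<bar>dir_deriv n d h x v\<bar> \<le> L * sqrt (metric_form d x v)))" for p
  proof -
    obtain d where d: "d \<in> A" "p \<in> fst d" by (rule chart_cover)
    obtain e where e: "e > 0" and K: "{y \<in> Rn n. \<forall>i<n. \<bar>y i - snd d p i\<bar> \<le> e} \<subseteq> chart_image d"
      using openin_contains_cbox[OF chart_image_open[OF d(1)], of "snd d p"] d by auto
    let ?K = "{y \<in> Rn n. \<forall>i<n. \<bar>y i - snd d p i\<bar> \<le> e}"
    let ?S = "{v \<in> Rn n. (\<forall>i<n. \<bar>v i\<bar> \<le> 1) \<and> (\<exists>i<n. \<bar>v i\<bar> = 1)}"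
    define q where "q = (\<lambda>(u, v). \<bar>dir_deriv n d h (chart_inv d u) v\<bar> / sqrt (metric_form d (chart_inv d u) v))"
    have c1: "continuous_on (?K \<times> ?S) (\<lambda>z. snd z i)" for i
      by (rule continuous_on_product_then_coordinatewise) (rule continuous_on_snd[OF continuous_on_id])
    have cf: "continuous_on (?K \<times> ?S) (\<lambda>z. f (fst z))" if "continuous_on (chart_image d) f" for f :: "(nat \<Rightarrow> real) \<Rightarrow> real"
      by (rule continuous_on_compose2[OF that continuous_on_fst[OF continuous_on_id]]) (use K in auto)
    have "continuous_on (?K \<times> ?S) (\<lambda>z. dir_deriv n d h (chart_inv d (fst z)) (snd z))"
    proof -
      have "continuous_on (?K \<times> ?S) (\<lambda>z. \<Sum>i<n. partial_deriv i (\<lambda>u. h (chart_inv d u)) (fst z) * snd z i)"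
        using Cr_functions_C1[OF h d(1)]
        by (intro continuous_on_sum continuous_on_mult c1 cf) auto
      then show ?thesis by (rule continuous_on_eq) (use K d in \<open>auto simp: dir_deriv_def\<close>)
    qed
    moreover have "continuous_on (?K \<times> ?S) (\<lambda>z. metric_form d (chart_inv d (fst z)) (snd z))"
      unfolding metric_form_def
    proof (intro continuous_on_sum continuous_on_mult c1)
      fix i j assume "i \<in> {..<n}" "j \<in> {..<n}"
      then have "continuous_on (chart_image d) (\<lambda>u. g d (chart_inv d u) i j)"
        by (intro continuous_on_compose2[OF metric_continuous[OF d(1)] chart_inv_cont[OF d(1)]]) (use d in auto)
      then show "continuous_on (?K \<times> ?S) (\<lambda>z. g d (chart_inv d (fst z)) i j)" by (rule cf)
    qed
    moreover have pos: "metric_form d (chart_inv d u) v > 0" if "u \<in> ?K" "v \<in> ?S" for u v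
      by (rule metric_form_pos[OF d(1) chart_inv_in[OF d(1)]]) (use that K in force)+
    moreover have "sqrt (metric_form d (chart_inv d (fst z)) (snd z)) \<noteq> 0" if "z \<in> ?K \<times> ?S" for z
    proof -
      have "metric_form d (chart_inv d (fst z)) (snd z) > 0" using that by (intro pos) auto
      then show ?thesis by simp
    qed
    ultimately have "continuous_on (?K \<times> ?S) q"
      unfolding q_def case_prod_beta
      by (intro continuous_on_divide continuous_on_rabs continuous_on_real_sqrt) blast+
    then have "bounded (q ` (?K \<times> ?S))"
      using compact_Times[OF compact_cbox compact_sup_sphere] by (intro compact_imp_bounded compact_continuous_image)
    then obtain L where L: "\<And>u v. u \<in> ?K \<Longrightarrow> v \<in> ?S \<Longrightarrow> \<bar>q (u, v)\<bar> \<le> L"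
      unfolding bounded_iff by fastforce
    define N where "N = {y \<in> fst d. snd d y \<in> {u \<in> Rn n. \<forall>i<n. \<bar>u i - snd d p i\<bar> < e}}"
    have "open N" unfolding N_def by (rule chart_inv_image_open[OF d(1) openin_box])
    moreover have "p \<in> N" using d e chart_image_Rn[OF d(1)] snd_in_chart_image[OF d] by (auto simp: N_def)
    moreover have "\<bar>dir_deriv n d h x v\<bar> \<le> L * sqrt (metric_form d x v)" if x: "x \<in> N" for x v
    proof (cases "\<exists>i<n. v i \<noteq> 0")
      case True
      from sup_normalize[OF this] obtain m w where m: "m > 0" "w \<in> Rn n" "\<forall>i<n. \<bar>w i\<bar> \<le> 1" "\<exists>i<n. \<bar>w i\<bar> = 1"
        "\<And>i. i < n \<Longrightarrow> v i = m * w i" by metis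
      have w: "w \<in> ?S" using m by auto
      have u: "snd d x \<in> ?K" "chart_inv d (snd d x) = x" using x d by (auto simp: N_def less_imp_le)
      have "\<bar>dir_deriv n d h x w\<bar> / sqrt (metric_form d x w) \<le> L"
        using order_trans[OF abs_ge_self L[OF u(1) w]] u(2) by (simp add: q_def)
      then have *: "\<bar>dir_deriv n d h x w\<bar> \<le> L * sqrt (metric_form d x w)"
        using pos[OF u(1) w] u(2) by (simp add: pos_divide_le_eq)
      have "dir_deriv n d h x v = m * dir_deriv n d h x w"
        unfolding dir_deriv_def sum_distrib_left using m(5) by (intro sum.cong) auto
      moreover have "metric_form d x v = m^2 * metric_form d x w"
        unfolding metric_form_def sum_distrib_left using m(5) by (intro sum.cong) (auto simp: power2_eq_square)
      ultimately show ?thesis using * m(1) by (simp add: abs_mult real_sqrt_mult)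
    qed (simp add: dir_deriv_def metric_form_def)
    ultimately show ?thesis using d by (intro exI[of _ N] exI[of _ L]) (auto simp: N_def)
  qed
  then have ex: "\<forall>p. \<exists>N L. open N \<and> p \<in> N \<and> (\<exists>d\<in>A. N \<subseteq> fst d \<and> (\<forall>x\<in>N. \<forall>v. \<bar>dir_deriv n d h x v\<bar> \<le> L * sqrt (metric_form d x v)))" by blast
  from choice[OF this] obtain N where "\<forall>p. \<exists>L. open (N p) \<and> p \<in> N p \<and> (\<exists>d\<in>A. N p \<subseteq> fst d \<and> (\<forall>x\<in>N p. \<forall>v. \<bar>dir_deriv n d h x v\<bar> \<le> L * sqrt (metric_form d x v)))" by blast
  from choice[OF this] obtain L where NL: "\<And>p. open (N p)" "\<And>p. p \<in> N p"
    "\<And>p. \<exists>d\<in>A. N p \<subseteq> fst d \<and> (\<forall>x\<in>N p. \<forall>v. \<bar>dir_deriv n d h x v\<bar> \<le> L p * sqrt (metric_form d x v))" by blast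
  obtain P where P: "finite P" "UNIV \<subseteq> (\<Union>p\<in>P. N p)"
    using compactE_image[OF cpt, of UNIV N] NL(1,2) by (metis UNIV_I UN_I subsetI)
  \<comment> \<open>The summand 1 keeps the constant positive, since lengths are later divided by
    it.\<close>
  define LL where "LL = (\<Sum>p\<in>P. \<bar>L p\<bar>) + 1"
  show ?thesis
  proof (rule that[of LL])
    show "LL > 0" unfolding LL_def by (intro add_nonneg_pos sum_nonneg) auto
    fix c x v assume c: "c \<in> A" "x \<in> fst c"
    obtain p where p: "p \<in> P" "x \<in> N p" using P by blast
    obtain d where d: "d \<in> A" "N p \<subseteq> fst d" "\<And>x v. x \<in> N p \<Longrightarrow> \<bar>dir_deriv n d h x v\<bar> \<le> L p * sqrt (metric_form d x v)"
      using NL(3)[of p] by blast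
    have xd: "x \<in> fst d" using d p by blast
    have "L p \<le> LL" using member_le_sum[OF p(1), of "\<lambda>p. \<bar>L p\<bar>"] P(1) by (auto simp: LL_def)
    have "\<bar>dir_deriv n c h x v\<bar> \<le> L p * sqrt (metric_form c x v)"
      using d(3)[OF p(2), of "chart_push c d x v"] dir_deriv_push[OF h c(1) d(1) c(2) xd, of v] metric_form_push[OF c(1) d(1) c(2) xd, of v] by simp
    also have "\<dots> \<le> LL * sqrt (metric_form c x v)"
    proof (rule mult_right_mono[OF \<open>L p \<le> LL\<close>])
      have "metric_form c x v \<ge> 0"
        using metric_form_pos[OF c, of v] by (cases "\<exists>i<n. v i \<noteq> 0") (auto simp: metric_form_def)
      then show "sqrt (metric_form c x v) \<ge> 0" by simp
    qed
    finally show "\<bar>dir_deriv n c h x v\<bar> \<le> LL * sqrt (metric_form c x v)" .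
  qed
qed

lemma consecutive_points:
  fixes P :: "real set"
  assumes "finite P" "{0, 1} \<subseteq> P" "t \<in> {0<..<1} - P"
  obtains a b where "a \<in> P" "b \<in> P" "a < t" "t < b" "{a<..<b} \<inter> P = {}"
proof -
  define a where "a = Max {p \<in> P. p < t}"
  define b where "b = Min {p \<in> P. t < p}"
  have "a \<in> {p \<in> P. p < t}" unfolding a_def using assms by (intro Max_in) auto
  moreover have "b \<in> {p \<in> P. t < p}" unfolding b_def using assms by (intro Min_in) auto
  moreover have "p \<le> a" if "p \<in> P" "p < t" for p unfolding a_def using assms that by (intro Max_ge) auto
  moreover have "b \<le> p" if "p \<in> P" "p > t" for p unfolding b_def using assms that by (intro Min_le) auto
  moreover have "t \<notin> P" using assms(3) by blast
  ultimately have "{a<..<b} \<inter> P = {}"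
    by (metis (no_types, lifting) disjoint_iff greaterThanLessThan_iff linorder_neqE_linordered_idom not_le)
  with \<open>a \<in> _\<close> \<open>b \<in> _\<close> show ?thesis by (intro that[of a b]) auto
qed

text \<open>Arcs are glued from the left, by induction on the number of partition points below
  b.\<close>

lemma piecewise_continuous:
  fixes \<gamma> :: "real \<Rightarrow> 'b::topological_space"
  assumes "finite P" "{0, 1} \<subseteq> P" "P \<subseteq> {0..1}"
    "\<And>a b. a \<in> P \<Longrightarrow> b \<in> P \<Longrightarrow> a < b \<Longrightarrow> {a<..<b} \<inter> P = {} \<Longrightarrow> continuous_on {a..b} \<gamma>"
  shows "continuous_on {0..1} \<gamma>"
proof -
  have "continuous_on {0..b} \<gamma>" if "b \<in> P" for b
    using that
  proof (induction "card {p \<in> P. p < b}" arbitrary: b rule: less_induct)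
    case less
    show ?case
    proof (cases "b = 0")
      case False
      define a where "a = Max {p \<in> P. p < b}"
      have ne: "{p \<in> P. p < b} \<noteq> {}" "finite {p \<in> P. p < b}" using assms less(2) False by force+
      have a: "a \<in> P" "a < b" using Max_in[OF ne(2,1)] by (auto simp: a_def)
      have "p \<le> a" if "p \<in> P" "p < b" for p unfolding a_def using ne that by (intro Max_ge) auto
      then have "{a<..<b} \<inter> P = {}" by force
      then have ab: "continuous_on {a..b} \<gamma>" using assms(4) a less(2) by blast
      have "{p \<in> P. p < a} \<subset> {p \<in> P. p < b}" using a by auto
      then have "continuous_on {0..a} \<gamma>" using less(1)[OF psubset_card_mono[OF ne(2)] a(1)] by blast
      then have "continuous_on ({0..a} \<union> {a..b}) \<gamma>" using ab by (intro continuous_on_closed_Un) auto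
      moreover have "{0..a} \<union> {a..b} = {0..b}" using a assms(3) by auto
      ultimately show ?thesis by simp
    qed simp
  qed
  then show ?thesis using assms(2) by blast
qed

text \<open>Along a curve the derivative of h is at most L times the speed, so the increment of h is
  at most L times the length; the infimum over curves gives the claim. It is restricted to points of
  finite path distance, as between components \<rho> is not tied to lengths.\<close>

lemma rho_lower:
  assumes h: "h \<in> Cr_functions n r A"
  obtains L where "L > 0" "\<And>x y. path_distance n A g x y < \<infinity> \<Longrightarrow> \<bar>h x - h y\<bar> \<le> L * \<rho> x y"
proof -
  obtain L where L: "L > 0" "\<And>c x v. c \<in> A \<Longrightarrow> x \<in> fst c \<Longrightarrow> \<bar>dir_deriv n c h x v\<bar> \<le> L * sqrt (metric_form c x v)"
    using dir_deriv_le_metric_form[OF h] by blast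
  have main: "ennreal (\<bar>h (\<gamma> 0) - h (\<gamma> 1)\<bar> / L) \<le> curve_length n A g \<gamma>" if pw: "piecewise_C1_curve n A \<gamma>" for \<gamma>
  proof -
    obtain P where P0: "finite P \<and> {0, 1} \<subseteq> P \<and> P \<subseteq> {0..1} \<and>
        (\<forall>a\<in>P. \<forall>b\<in>P. a < b \<and> {a<..<b} \<inter> P = {} \<longrightarrow> C1_arc n A a b \<gamma>)"
      using pw unfolding piecewise_C1_curve_def by (rule exE)
    then have P: "finite P" "{0, 1} \<subseteq> P" "P \<subseteq> {0..1}" by auto
    have arc: "C1_arc n A a b \<gamma>" if "a \<in> P" "b \<in> P" "a < b" "{a<..<b} \<inter> P = {}" for a b
      using P0 that by simp
    have \<gamma>c: "continuous_on {0..1} \<gamma>"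
      by (rule piecewise_continuous[OF P]) (use arc in \<open>auto simp: C1_arc_def\<close>)
    define f where "f = (\<lambda>t. h (\<gamma> t))"
    have fc: "continuous_on {0..1} f"
      unfolding f_def by (rule continuous_on_compose2[OF Cr_functions_continuous[OF h] \<gamma>c]) simp
    \<comment> \<open>Away from the partition points the curve lies locally in one arc and one
      chart. A local derivative D is produced together with its continuity, which is what later
      makes the derivative of f continuous and hence measurable.\<close>
    have loc: "\<exists>D. (f has_real_derivative D t) (at t) \<and> isCont D t \<and> \<bar>D t\<bar> \<le> L * speed n A g \<gamma> t \<and>
        (\<forall>\<^sub>F s in nhds t. (f has_real_derivative D s) (at s))" if t: "t \<in> {0<..<1} - P" for t
    proof -
      obtain a b where ab: "a \<in> P" "b \<in> P" "a < t" "t < b" "{a<..<b} \<inter> P = {}"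
        using consecutive_points[OF P(1,2) t] by blast
      note C1 = arc[OF ab(1,2) less_trans[OF ab(3,4)] ab(5)]
      obtain c where c: "c \<in> A" "\<gamma> t \<in> fst c" by (rule chart_cover)
      have "\<forall>i. \<exists>v. i < n \<longrightarrow> (\<forall>t\<in>{a..b} \<inter> \<gamma> -` fst c. ((\<lambda>s. snd c (\<gamma> s) i) has_real_derivative v t) (at t within {a..b})) \<and>
        continuous_on ({a..b} \<inter> \<gamma> -` fst c) v"
        using C1 c(1) unfolding C1_arc_def by blast
      from choice[OF this] obtain v where v: "\<And>i s. i < n \<Longrightarrow> s \<in> {a..b} \<inter> \<gamma> -` fst c \<Longrightarrow>
          ((\<lambda>s. snd c (\<gamma> s) i) has_real_derivative v i s) (at s within {a..b})"
        "\<And>i. i < n \<Longrightarrow> continuous_on ({a..b} \<inter> \<gamma> -` fst c) (v i)" by blast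
      define Q where "Q = {a<..<b} \<inter> \<gamma> -` fst c"
      have cab: "continuous_on {a<..<b} \<gamma>"
        by (rule continuous_on_subset[of "{a..b}"]) (use C1 in \<open>auto simp: C1_arc_def\<close>)
      have Oo: "open Q" unfolding Q_def
        using continuous_on_open_vimage[of "{a<..<b}" \<gamma>] cab chart_open[OF c(1)] by (auto simp: Int_commute)
      have tO: "t \<in> Q" using ab c by (auto simp: Q_def)
      define D where "D s = dir_deriv n c h (\<gamma> s) (\<lambda>i. v i s)" for s
      have at: "at s within {a..b} = at s" if "s \<in> Q" for s
        using that by (intro at_within_interior) (auto simp: Q_def)
      have \<gamma>s: "continuous (at s) \<gamma>" if "s \<in> Q" for s
        using cab that continuous_on_eq_continuous_at[of "{a<..<b}" \<gamma>] by (auto simp: Q_def)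
      have vs: "((\<lambda>s. snd c (\<gamma> s) i) has_real_derivative v i s) (at s)" if "s \<in> Q" "i < n" for s i
        using v(1)[OF that(2), of s] that(1) at[OF that(1)] by (auto simp: Q_def)
      have Ds: "(f has_real_derivative D s) (at s)" if "s \<in> Q" for s
        unfolding f_def D_def using that vs[OF that]
        by (intro curve_function[OF c(1) h _ \<gamma>s[OF that]]) (auto simp: Q_def)
      have "continuous_on Q (\<lambda>s. \<Sum>i<n. partial_deriv i (\<lambda>u. h (chart_inv c u)) (snd c (\<gamma> s)) * v i s)"
      proof (intro continuous_on_sum continuous_on_mult)
        fix i assume i: "i \<in> {..<n}"
        show "continuous_on Q (v i)" by (rule continuous_on_subset[OF v(2)]) (use i in \<open>auto simp: Q_def\<close>)
        have cc: "continuous_on Q (\<lambda>s. snd c (\<gamma> s))"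
          by (rule continuous_on_compose2[OF chart_cont[OF c(1)] continuous_on_subset[OF cab]]) (auto simp: Q_def)
        have "continuous_on (chart_image c) (partial_deriv i (\<lambda>u. h (chart_inv c u)))"
          using Cr_functions_C1[OF h c(1)] i by simp
        then show "continuous_on Q (\<lambda>s. partial_deriv i (\<lambda>u. h (chart_inv c u)) (snd c (\<gamma> s)))"
          by (rule continuous_on_compose2[OF _ cc]) (use c(1) in \<open>auto simp: Q_def\<close>)
      qed
      then have "continuous_on Q D" unfolding D_def dir_deriv_def .
      then have "isCont D t" using Oo tO continuous_on_eq_continuous_at by blast
      moreover have "\<bar>D t\<bar> \<le> L * speed n A g \<gamma> t"
      proof -
        have "speed n A g \<gamma> t = sqrt (metric_form c (\<gamma> t) (\<lambda>i. v i t))"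
          by (rule speed_eq[OF c \<gamma>s[OF tO] vs[OF tO]])
        then show ?thesis using L(2)[OF c, of "\<lambda>i. v i t"] by (simp add: D_def)
      qed
      moreover have "\<forall>\<^sub>F s in nhds t. (f has_real_derivative D s) (at s)"
        using eventually_nhds_in_open[OF Oo tO] by eventually_elim (rule Ds)
      ultimately show ?thesis using Ds[OF tO] by blast
    qed
    let ?I = "{0<..<1} - P"
    have Io: "open ?I" using finite_imp_closed[OF P(1)] by (intro open_Diff) auto
    have dd: "(f has_real_derivative deriv f t) (at t)" "\<bar>deriv f t\<bar> \<le> L * speed n A g \<gamma> t" "isCont (deriv f) t"
      if t: "t \<in> ?I" for t
    proof -
      obtain D where D: "(f has_real_derivative D t) (at t)" "isCont D t" "\<bar>D t\<bar> \<le> L * speed n A g \<gamma> t"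
        "\<forall>\<^sub>F s in nhds t. (f has_real_derivative D s) (at s)" using loc[OF t] by blast
      have ev: "\<forall>\<^sub>F s in nhds t. deriv f s = D s" using D(4) by eventually_elim (rule DERIV_imp_deriv)
      show "(f has_real_derivative deriv f t) (at t)" "\<bar>deriv f t\<bar> \<le> L * speed n A g \<gamma> t"
        using D DERIV_imp_deriv[OF D(1)] by auto
      show "isCont (deriv f) t" using isCont_cong[OF ev] D(2) by simp
    qed
    have ftc: "(deriv f has_integral (f 1 - f 0)) {0..1}"
      by (rule fundamental_theorem_of_calculus_interior_strong[OF P(1) _ _ fc])
         (use dd(1) in \<open>auto simp: has_real_derivative_iff_has_vector_derivative[symmetric]\<close>)
    \<comment> \<open>The comparison with the length goes through w: it is Borel, being continuous
      on an open set and 0 elsewhere, and it differs from the derivative of f on (0,1) only at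
      finitely many points.\<close>
    define w where "w t = indicator ?I t *\<^sub>R deriv f t" for t
    have wm: "w \<in> borel_measurable borel"
      unfolding w_def using Io dd(3)
      by (intro borel_measurable_continuous_on_indicator continuous_at_imp_continuous_on) auto
    have wle: "ennreal (\<bar>w t\<bar> / L) \<le> ennreal (speed n A g \<gamma> t) * indicator {0..1} t" for t
      using dd(2)[of t] L(1) by (auto simp: w_def indicator_def pos_divide_le_eq mult.commute intro!: ennreal_leI)
    have I: "(\<integral>\<^sup>+ t. ennreal (\<bar>w t\<bar> / L) \<partial>lborel) \<le> curve_length n A g \<gamma>"
      unfolding curve_length_def by (intro nn_integral_mono wle)
    \<comment> \<open>If the integral of w is infinite, so is the length. Otherwise w is Lebesgue
      integrable, and its integral coincides with the increment given by the fundamental theorem for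
      the gauge integral.\<close>
    show ?thesis
    proof (cases "(\<integral>\<^sup>+ t. ennreal (\<bar>w t\<bar> / L) \<partial>lborel) < \<infinity>")
      case True
      have int: "integrable lborel (\<lambda>t. w t / L)"
        by (rule integrableI_bounded) (use wm True L(1) in auto)
      then have intw: "integrable lborel w" using integrable_mult_right[OF int, of L] L(1) by simp
      have "(w has_integral (LINT t|lborel. w t)) UNIV" by (rule has_integral_integral_lborel[OF intw])
      moreover have "w = (\<lambda>t. if t \<in> {0..1} then w t else 0)"
        by (rule ext) (auto simp: w_def indicator_def)
      ultimately have "(w has_integral (LINT t|lborel. w t)) {0..1}"
        using has_integral_restrict_UNIV[of "{0..1}" w] by metis
      moreover have "(w has_integral (f 1 - f 0)) {0..1}"
        by (rule has_integral_spike_finite[OF P(1) _ ftc]) (use P(2) in \<open>auto simp: w_def indicator_def order_less_le\<close>)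
      ultimately have "f 1 - f 0 = (LINT t|lborel. w t)" by (rule has_integral_unique[rotated])
      then have "\<bar>f 1 - f 0\<bar> / L \<le> (LINT t|lborel. \<bar>w t\<bar>) / L"
        using integral_abs_bound[of lborel w] L(1) by (intro divide_right_mono) auto
      also have "\<dots> = (LINT t|lborel. \<bar>w t\<bar> / L)" by simp
      finally have "ennreal (\<bar>f 1 - f 0\<bar> / L) \<le> ennreal (LINT t|lborel. \<bar>w t\<bar> / L)" by (rule ennreal_leI)
      also have "\<dots> = (\<integral>\<^sup>+ t. ennreal (\<bar>w t\<bar> / L) \<partial>lborel)"
        by (rule nn_integral_eq_integral[symmetric]) (use intw L(1) in auto)
      finally show ?thesis using I by (simp add: f_def abs_minus_commute)
    next
      case False
      then show ?thesis using I by (simp add: top_unique not_less)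
    qed
  qed
  show ?thesis
  proof (rule that[OF L(1)])
    fix x y assume fin: "path_distance n A g x y < \<infinity>"
    have "ennreal (\<bar>h x - h y\<bar> / L) \<le> path_distance n A g x y"
      unfolding path_distance_def by (rule INF_greatest) (use main in auto)
    also have "\<dots> = ennreal (\<rho> x y)"
      using distance fin by (simp add: Riemannian_distance_def)
    finally have "ennreal (\<bar>h x - h y\<bar> / L) \<le> ennreal (\<rho> x y)" .
    moreover have "\<rho> x y \<ge> 0"
      using distance Metric_space.nonneg[of UNIV \<rho> x y] by (simp add: Riemannian_distance_def)
    ultimately have "\<bar>h x - h y\<bar> / L \<le> \<rho> x y" by (simp add: ennreal_le_iff)
    then show "\<bar>h x - h y\<bar> \<le> L * \<rho> x y" using L(1) by (simp add: pos_divide_le_eq mult.commute)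
  qed
qed

lemma rho_metric: "Metric_space UNIV \<rho>"
  using distance by (simp add: Riemannian_distance_def)

lemma rho_nonneg: "\<rho> x y \<ge> 0" and rho_refl [simp]: "\<rho> x x = 0" and rho_commute: "\<rho> x y = \<rho> y x"
  and rho_zero_iff: "\<rho> x y = 0 \<longleftrightarrow> x = y" and rho_triangle: "\<rho> x z \<le> \<rho> x y + \<rho> y z"
  using Metric_space.nonneg[OF rho_metric] Metric_space.commute[OF rho_metric]
    Metric_space.zero[OF rho_metric] Metric_space.triangle[OF rho_metric] by auto

text \<open>Lipschitz bounds hold only between points of finite path distance, so the almost sure
  arguments are carried out on such neighbourhoods.\<close>

lemma rho_local:
  obtains N where "open N" "p \<in> N" "\<And>y y'. y \<in> N \<Longrightarrow> y' \<in> N \<Longrightarrow> path_distance n A g y y' < \<infinity>"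
proof -
  obtain c where c: "c \<in> A" "p \<in> fst c" by (rule chart_cover)
  obtain N C where N: "open N" "p \<in> N" "N \<subseteq> fst c" "C \<ge> 0"
    "\<And>y y' \<eta>. y \<in> N \<Longrightarrow> y' \<in> N \<Longrightarrow> \<eta> \<ge> 0 \<Longrightarrow> (\<And>i. i < n \<Longrightarrow> \<bar>snd c y i - snd c y' i\<bar> \<le> \<eta>) \<Longrightarrow>
       path_distance n A g y y' < \<infinity> \<and> \<rho> y y' \<le> C * \<eta>" using rho_upper[OF c] by blast
  show ?thesis
  proof (rule that[OF N(1,2)])
    fix y y' assume y: "y \<in> N" "y' \<in> N"
    define \<eta> where "\<eta> = (\<Sum>i<n. \<bar>snd c y i - snd c y' i\<bar>)"
    have "\<bar>snd c y i - snd c y' i\<bar> \<le> \<eta>" if "i < n" for i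
      unfolding \<eta>_def using that member_le_sum[of i "{..<n}" "\<lambda>i. \<bar>snd c y i - snd c y' i\<bar>"] by simp
    moreover have "\<eta> \<ge> 0" unfolding \<eta>_def by (intro sum_nonneg) auto
    ultimately show "path_distance n A g y y' < \<infinity>" using N(5)[OF y] by blast
  qed
qed

text \<open>Connects the given topology with \<rho>: chart neighbourhoods are small for \<rho>,
  which makes \<rho> continuous on the product.\<close>

lemma rho_near:
  assumes "e > 0"
  obtains N where "open N" "p \<in> N" "\<And>y. y \<in> N \<Longrightarrow> \<rho> p y < e"
proof -
  obtain c where c: "c \<in> A" "p \<in> fst c" by (rule chart_cover)
  obtain N C where N: "open N" "p \<in> N" "N \<subseteq> fst c" "C \<ge> 0"
    "\<And>y y' \<eta>. y \<in> N \<Longrightarrow> y' \<in> N \<Longrightarrow> \<eta> \<ge> 0 \<Longrightarrow> (\<And>i. i < n \<Longrightarrow> \<bar>snd c y i - snd c y' i\<bar> \<le> \<eta>) \<Longrightarrow>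
       path_distance n A g y y' < \<infinity> \<and> \<rho> y y' \<le> C * \<eta>" using rho_upper[OF c] by blast
  define \<eta> where "\<eta> = e / (C + 1)"
  have \<eta>: "\<eta> > 0" "C * \<eta> < e" using N(4) assms by (auto simp: \<eta>_def field_simps)
  let ?B = "{u \<in> Rn n. \<forall>i<n. \<bar>u i - snd c p i\<bar> < \<eta>}"
  show ?thesis
  proof (rule that[of "N \<inter> {y \<in> fst c. snd c y \<in> ?B}"])
    show "open (N \<inter> {y \<in> fst c. snd c y \<in> ?B})"
      using N(1) chart_inv_image_open[OF c(1) openin_box] by blast
    show "p \<in> N \<inter> {y \<in> fst c. snd c y \<in> ?B}"
      using N(2) c \<eta> chart_image_Rn[OF c(1)] snd_in_chart_image[OF c] by auto
    fix y assume y: "y \<in> N \<inter> {y \<in> fst c. snd c y \<in> ?B}"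
    then have "\<rho> p y \<le> C * \<eta>"
      using N(5)[OF N(2), of y \<eta>] \<eta>(1) by (auto simp: abs_minus_commute less_imp_le)
    then show "\<rho> p y < e" using \<eta> by simp
  qed
qed

lemma rho_continuous: "continuous_on UNIV (\<lambda>z. \<rho> (fst z) (snd z))"
  unfolding continuous_on_eq_continuous_at[OF open_UNIV]
proof
  fix z :: "'a \<times> 'a"
  show "isCont (\<lambda>z. \<rho> (fst z) (snd z)) z"
    unfolding isCont_def
  proof (rule tendstoI)
    fix e :: real assume "e > 0"
    then have "e / 2 > 0" by simp
    obtain N where N: "open N" "fst z \<in> N" "\<And>y. y \<in> N \<Longrightarrow> \<rho> (fst z) y < e / 2" using rho_near[OF \<open>e / 2 > 0\<close>] by blast
    obtain N' where N': "open N'" "snd z \<in> N'" "\<And>y. y \<in> N' \<Longrightarrow> \<rho> (snd z) y < e / 2" using rho_near[OF \<open>e / 2 > 0\<close>] by blast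
    have "\<forall>\<^sub>F y in at z. y \<in> N \<times> N'"
      using N N' by (intro eventually_at_in_open' open_Times) (auto simp: mem_Times_iff)
    then show "\<forall>\<^sub>F y in at z. dist (\<rho> (fst y) (snd y)) (\<rho> (fst z) (snd z)) < e"
    proof eventually_elim
      case (elim y)
      then have "\<rho> (fst z) (fst y) < e / 2" "\<rho> (snd z) (snd y) < e / 2" using N(3) N'(3) by auto
      moreover have "\<rho> (fst y) (snd y) \<le> \<rho> (fst y) (fst z) + (\<rho> (fst z) (snd z) + \<rho> (snd z) (snd y))"
        using rho_triangle[of "fst y" "snd y" "fst z"] rho_triangle[of "fst z" "snd y" "snd z"] by linarith
      moreover have "\<rho> (fst z) (snd z) \<le> \<rho> (fst z) (fst y) + (\<rho> (fst y) (snd y) + \<rho> (snd y) (snd z))"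
        using rho_triangle[of "fst z" "snd z" "fst y"] rho_triangle[of "fst y" "snd z" "snd y"] by linarith
      ultimately show ?case
        by (simp add: dist_real_def rho_commute[of "fst y" "fst z"] rho_commute[of "snd y" "snd z"])
    qed
  qed
qed

end

section \<open>Null sets of parameters\<close>

text \<open>The points of this measure space are functions that are \<open>undefined\<close> from
  index m on, not members of \<open>Rn m\<close>; the two representations are reconciled when the
  probe is built.\<close>

abbreviation lebesgue_prod :: "nat \<Rightarrow> (nat \<Rightarrow> real) measure" where
  "lebesgue_prod m \<equiv> Pi\<^sub>M {..<m} (\<lambda>_. lborel)"

interpretation lborel_prod: product_sigma_finite "\<lambda>_::nat. lborel :: real measure"
  by standard

text \<open>The product measure is determined by its values on boxes, so invariance of the
  one-dimensional Lebesgue measure is enough.\<close>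

lemma lebesgue_prod_shift:
  "distr (lebesgue_prod m) (lebesgue_prod m) (\<lambda>\<alpha>. \<lambda>j\<in>{..<m}. \<alpha> j + t j) = lebesgue_prod m"
proof (rule lborel_prod.PiM_eqI)
  let ?f = "\<lambda>\<alpha>. \<lambda>j\<in>{..<m}. \<alpha> j + t j"
  fix A :: "nat \<Rightarrow> real set" assume A: "\<And>i. i \<in> {..<m} \<Longrightarrow> A i \<in> sets lborel"
  have f: "?f \<in> measurable (lebesgue_prod m) (lebesgue_prod m)"
    by (intro measurable_restrict) simp
  have "emeasure (distr (lebesgue_prod m) (lebesgue_prod m) ?f) (Pi\<^sub>E {..<m} A)
      = emeasure (lebesgue_prod m) (?f -` Pi\<^sub>E {..<m} A \<inter> space (lebesgue_prod m))"
    by (rule emeasure_distr[OF f]) (use A in \<open>auto intro: sets_PiM_I_finite\<close>)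
  also have "?f -` Pi\<^sub>E {..<m} A \<inter> space (lebesgue_prod m) = Pi\<^sub>E {..<m} (\<lambda>j. (+) (t j) -` A j)"
    by (auto simp: space_PiM PiE_iff add.commute)
  also have "emeasure (lebesgue_prod m) \<dots> = (\<Prod>j<m. emeasure lborel ((+) (t j) -` A j))"
  proof (rule lborel_prod.emeasure_PiM)
    fix j assume "j \<in> {..<m}"
    then show "(+) (t j) -` A j \<in> sets lborel"
      using measurable_sets[of "(+) (t j)" borel borel "A j"] A[of j] by simp
  qed simp
  also have "\<dots> = (\<Prod>j<m. emeasure lborel (A j))"
  proof (rule prod.cong[OF refl])
    fix j assume "j \<in> {..<m}"
    then have "A j \<in> sets borel" using A by simp
    then have "emeasure (distr lborel borel ((+) (t j))) (A j) = emeasure lborel ((+) (t j) -` A j)"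
      by (subst emeasure_distr) auto
    then show "emeasure lborel ((+) (t j) -` A j) = emeasure lborel (A j)" by (simp add: lborel_distr_plus)
  qed
  finally show "emeasure (distr (lebesgue_prod m) (lebesgue_prod m) ?f) (Pi\<^sub>E {..<m} A)
      = (\<Prod>j<m. emeasure lborel (A j))" .
qed simp_all

lemma emeasure_lebesgue_prod_box:
  assumes "\<And>j. j < m \<Longrightarrow> a j \<le> b j"
  shows "emeasure (lebesgue_prod m) (Pi\<^sub>E {..<m} (\<lambda>j. {a j..b j})) = ennreal (\<Prod>j<m. b j - a j)"
  using assms by (subst lborel_prod.emeasure_PiM) (auto intro!: prod_ennreal)

text \<open>For a nonzero integer vector w look at an index l where its modulus is maximal, say D,
  so D is at least 1. The diagonal contributes D and the k error terms together at most k * D / (4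
  k), which leaves 3 D / 4.\<close>

lemma near_identity_separates:
  fixes z z' :: "nat \<Rightarrow> nat" and A :: "nat \<Rightarrow> nat \<Rightarrow> real"
  assumes A: "\<And>i l. i < k \<Longrightarrow> l < k \<Longrightarrow> \<bar>A i l - (if i = l then 1 else 0)\<bar> \<le> 1 / (4 * real k)"
    and z: "\<exists>i<k. z i \<noteq> z' i"
  obtains l where "l < k" "3 / 4 \<le> \<bar>\<Sum>i<k. (real (z i) - real (z' i)) * A i l\<bar>"
proof -
  define w where "w i = real (z i) - real (z' i)" for i
  define D where "D = Max ((\<lambda>i. \<bar>w i\<bar>) ` {..<k})"
  have ne: "(\<lambda>i. \<bar>w i\<bar>) ` {..<k} \<noteq> {}" "finite ((\<lambda>i. \<bar>w i\<bar>) ` {..<k})" using z by auto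
  have le: "\<bar>w i\<bar> \<le> D" if "i < k" for i unfolding D_def using that ne by (intro Max_ge) auto
  have "D \<in> (\<lambda>i. \<bar>w i\<bar>) ` {..<k}" unfolding D_def using ne by (intro Max_in) auto
  then obtain l where l: "l < k" "\<bar>w l\<bar> = D" by auto
  obtain i where i: "i < k" "z i \<noteq> z' i" using z by blast
  have "1 \<le> \<bar>w i\<bar>" using i by (simp add: w_def)
  then have D1: "1 \<le> D" using le[OF i(1)] by linarith
  define r where "r i = A i l - (if i = l then 1 else 0)" for i
  have "(\<Sum>i<k. w i * A i l) = (\<Sum>i<k. (if i = l then w l else 0) + w i * r i)"
    by (rule sum.cong) (auto simp: r_def algebra_simps)
  also have "\<dots> = w l + (\<Sum>i<k. w i * r i)" using l by (simp add: sum.distrib)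
  finally have eq: "(\<Sum>i<k. w i * A i l) = w l + (\<Sum>i<k. w i * r i)" .
  have "\<bar>\<Sum>i<k. w i * r i\<bar> \<le> (\<Sum>i<k. D * (1 / (4 * real k)))"
  proof (rule order_trans[OF sum_abs], rule sum_mono)
    fix i assume "i \<in> {..<k}"
    then show "\<bar>w i * r i\<bar> \<le> D * (1 / (4 * real k))"
      unfolding abs_mult r_def using le A l D1 by (intro mult_mono) auto
  qed
  also have "\<dots> = D / 4" using l by simp
  finally have "D - D / 4 \<le> \<bar>\<Sum>i<k. w i * A i l\<bar>" using eq l(2) by linarith
  then have "3 / 4 \<le> \<bar>\<Sum>i<k. w i * A i l\<bar>" using D1 by linarith
  then show ?thesis using that[OF l(1)] by (simp add: w_def)
qed

text \<open>Of order \<open>\<epsilon>\<^sup>-\<^sup>k\<close> translates of \<open>S\<close> along the rows of \<open>b\<close> are disjoint and lie in a fixed cube; this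
  replaces a determinant and a change of variables.\<close>

lemma measure_small_values_aux:
  fixes a :: "nat \<Rightarrow> nat \<Rightarrow> real" and off :: "nat \<Rightarrow> real"
  assumes b: "\<And>i l. i < k \<Longrightarrow> l < k \<Longrightarrow> \<bar>(\<Sum>j<m. b i j * a l j) - (if i = l then 1 else 0)\<bar> \<le> 1 / (4 * real k)"
    and R: "\<And>i j. i < k \<Longrightarrow> j < m \<Longrightarrow> \<bar>b i j\<bar> \<le> R" "R \<ge> 0"
    and \<epsilon>: "0 < \<epsilon>" "\<epsilon> \<le> 1"
  defines "S \<equiv> {\<alpha> \<in> space (lebesgue_prod m). (\<forall>j<m. \<alpha> j \<in> {0..1}) \<and> (\<forall>l<k. \<bar>off l + (\<Sum>j<m. \<alpha> j * a l j)\<bar> \<le> \<epsilon>)}"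
  shows "emeasure (lebesgue_prod m) S \<le> ennreal ((1 + 16 * real k * R) ^ m * \<epsilon> ^ k)"
proof -
  let ?L = "lebesgue_prod m"
  have Sm: "S \<in> sets ?L" unfolding S_def by measurable
  \<comment> \<open>The number of translates in each of the k directions: M * \<epsilon> lies
    between 1 and 2, the lower bound giving enough translates and the upper bound keeping them in a
    fixed cube.\<close>
  define M where "M = nat \<lceil>1 / \<epsilon>\<rceil>"
  have "1 / \<epsilon> \<ge> 1" using \<epsilon> by simp
  then have M: "1 \<le> M * \<epsilon>" "M * \<epsilon> \<le> 2"
  proof -
    have *: "1 / \<epsilon> \<le> M" "M \<le> 1 / \<epsilon> + 1" using \<open>1 / \<epsilon> \<ge> 1\<close> unfolding M_def by linarith+
    show "1 \<le> M * \<epsilon>" using *(1) \<epsilon> by (simp add: pos_divide_le_eq)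
    have "M * \<epsilon> \<le> (1 / \<epsilon> + 1) * \<epsilon>" using *(2) \<epsilon> by (intro mult_right_mono) auto
    also have "\<dots> = 1 + \<epsilon>" using \<epsilon> by (simp add: distrib_right)
    finally show "M * \<epsilon> \<le> 2" using \<epsilon> by linarith
  qed
  \<comment> \<open>The spacing 4 \<epsilon> is chosen so that distinct translation vectors move
    some component by at least 3 \<epsilon>, more than the width 2 \<epsilon> of the allowed
    interval.\<close>
  define t where "t z j = - (4 * \<epsilon> * (\<Sum>i<k. real (z i) * b i j))" for z :: "nat \<Rightarrow> nat" and j
  define Z where "Z = Pi\<^sub>E {..<k} (\<lambda>_. {..<M})"
  define G where "G z = (\<lambda>\<alpha>. \<lambda>j\<in>{..<m}. \<alpha> j + t z j) -` S \<inter> space ?L" for z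
  have f: "(\<lambda>\<alpha>. \<lambda>j\<in>{..<m}. \<alpha> j + t z j) \<in> measurable ?L ?L" for z
    by (intro measurable_restrict) simp
  have Gm: "G z \<in> sets ?L" for z unfolding G_def using f Sm by (rule measurable_sets)
  have Ge: "emeasure ?L (G z) = emeasure ?L S" for z
    unfolding G_def using emeasure_distr[OF f Sm, of z] lebesgue_prod_shift[of m "t z"] by simp
  have fin: "finite Z" "card Z = M ^ k" by (auto simp: Z_def finite_PiE card_PiE)
  have tb: "\<bar>t z j\<bar> \<le> 8 * real k * R" if "z \<in> Z" "j < m" for z j
  proof -
    have "\<bar>\<Sum>i<k. real (z i) * b i j\<bar> \<le> (\<Sum>i<k. real M * R)"
    proof (rule order_trans[OF sum_abs], rule sum_mono)
      fix i assume "i \<in> {..<k}"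
      then show "\<bar>real (z i) * b i j\<bar> \<le> real M * R"
        unfolding abs_mult using that R by (intro mult_mono) (auto simp: Z_def PiE_iff less_imp_le)
    qed
    then have "\<bar>t z j\<bar> \<le> 4 * \<epsilon> * (k * (real M * R))"
      using \<epsilon> by (simp add: t_def abs_mult)
    also have "\<dots> = 4 * (M * \<epsilon>) * (k * R)" by (simp add: mult_ac)
    also have "\<dots> \<le> 4 * 2 * (k * R)" using M R(2) by (intro mult_right_mono mult_left_mono) auto
    finally show ?thesis by simp
  qed
  \<comment> \<open>A common point of two translates would give two points of S for which every
    component differs by at most 2 \<epsilon>, while the separation lemma finds a component
    differing by 3 \<epsilon>.\<close>
  have disj: "disjoint_family_on G Z"
    unfolding disjoint_family_on_def
  proof (intro ballI impI equals0I)
    fix z z' \<alpha> assume z: "z \<in> Z" "z' \<in> Z" "z \<noteq> z'" and "\<alpha> \<in> G z \<inter> G z'"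
    then have \<alpha>: "(\<lambda>j\<in>{..<m}. \<alpha> j + t z j) \<in> S" "(\<lambda>j\<in>{..<m}. \<alpha> j + t z' j) \<in> S" by (auto simp: G_def)
    have "\<exists>i<k. z i \<noteq> z' i"
      using z PiE_ext[of z "{..<k}" "\<lambda>_. {..<M}" z'] by (auto simp: Z_def)
    from near_identity_separates[where A = "\<lambda>i l. \<Sum>j<m. b i j * a l j", OF b this]
    obtain l where l: "l < k" "3 / 4 \<le> \<bar>\<Sum>i<k. (real (z i) - real (z' i)) * (\<Sum>j<m. b i j * a l j)\<bar>" by blast
    have S1: "\<bar>off l + (\<Sum>j<m. (\<alpha> j + t z j) * a l j)\<bar> \<le> \<epsilon>" "\<bar>off l + (\<Sum>j<m. (\<alpha> j + t z' j) * a l j)\<bar> \<le> \<epsilon>"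
      using \<alpha> l(1) by (auto simp: S_def)
    have "(off l + (\<Sum>j<m. (\<alpha> j + t z' j) * a l j)) - (off l + (\<Sum>j<m. (\<alpha> j + t z j) * a l j))
        = (\<Sum>j<m. (t z' j - t z j) * a l j)"
      by (simp add: sum_subtractf[symmetric] algebra_simps)
    also have "\<dots> = (\<Sum>j<m. 4 * \<epsilon> * (\<Sum>i<k. (real (z i) - real (z' i)) * (b i j * a l j)))"
      by (rule sum.cong[OF refl])
         (simp add: t_def sum_distrib_left sum_distrib_right sum_subtractf[symmetric] sum_negf[symmetric] algebra_simps)
    also have "\<dots> = 4 * \<epsilon> * (\<Sum>i<k. (real (z i) - real (z' i)) * (\<Sum>j<m. b i j * a l j))"
      unfolding sum_distrib_left[symmetric] by (subst sum.swap) (simp add: sum_distrib_left)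
    finally have "\<bar>4 * \<epsilon> * (\<Sum>i<k. (real (z i) - real (z' i)) * (\<Sum>j<m. b i j * a l j))\<bar> \<le> 2 * \<epsilon>"
      using S1 by linarith
    moreover have "4 * \<epsilon> * (3 / 4) \<le> \<bar>4 * \<epsilon> * (\<Sum>i<k. (real (z i) - real (z' i)) * (\<Sum>j<m. b i j * a l j))\<bar>"
      using \<epsilon> l(2) by (simp add: abs_mult)
    ultimately show False using \<epsilon> by linarith
  qed
  \<comment> \<open>Translations move each coordinate by at most 4 * (M * \<epsilon>) * k * R, hence
    by at most 8 k R, in either direction from the unit interval.\<close>
  let ?B = "Pi\<^sub>E {..<m} (\<lambda>j. {- (8 * real k * R)..1 + 8 * real k * R})"
  have GB: "G z \<subseteq> ?B" if "z \<in> Z" for z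
  proof
    fix \<alpha> assume "\<alpha> \<in> G z"
    then have \<alpha>: "\<alpha> \<in> space ?L" "\<And>j. j < m \<Longrightarrow> \<alpha> j + t z j \<in> {0..1}" by (auto simp: G_def S_def)
    have "\<alpha> j \<in> {- (8 * real k * R)..1 + 8 * real k * R}" if "j < m" for j
      using \<alpha>(2)[OF that] tb[OF \<open>z \<in> Z\<close> that] by auto
    then show "\<alpha> \<in> ?B" using \<alpha>(1) by (auto simp: space_PiM PiE_iff)
  qed
  have "ennreal (M ^ k) * emeasure ?L S = (\<Sum>z\<in>Z. emeasure ?L (G z))"
    by (simp add: Ge fin ennreal_of_nat_eq_real_of_nat)
  also have "\<dots> = emeasure ?L (\<Union>z\<in>Z. G z)"
    by (rule sum_emeasure) (use Gm disj fin in auto)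
  also have "\<dots> \<le> emeasure ?L ?B"
    using GB by (intro emeasure_mono) (auto intro!: sets_PiM_I_finite)
  also have "\<dots> = ennreal ((1 + 16 * real k * R) ^ m)"
    using R(2) by (subst emeasure_lebesgue_prod_box) (auto simp: algebra_simps)
  finally have *: "ennreal (M ^ k) * emeasure ?L S \<le> ennreal ((1 + 16 * real k * R) ^ m)" .
  have "1 \<le> (M * \<epsilon>) ^ k" using M(1) by simp
  then have "ennreal 1 * emeasure ?L S \<le> ennreal ((M * \<epsilon>) ^ k) * emeasure ?L S"
    by (intro mult_right_mono ennreal_leI) auto
  also have "\<dots> = ennreal (\<epsilon> ^ k) * (ennreal (M ^ k) * emeasure ?L S)"
    using \<epsilon> by (simp add: power_mult_distrib ennreal_mult mult_ac)
  also have "\<dots> \<le> ennreal (\<epsilon> ^ k) * ennreal ((1 + 16 * real k * R) ^ m)"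
    by (rule mult_left_mono[OF *]) simp
  also have "\<dots> = ennreal ((1 + 16 * real k * R) ^ m * \<epsilon> ^ k)"
    using \<epsilon> R(2) by (simp add: ennreal_mult[symmetric] mult.commute)
  finally show ?thesis by simp
qed

text \<open>Removes the restriction on \<epsilon>. For \<epsilon> = 0 the set lies in those for all
  small positive values, and for \<epsilon> > 1 the bound exceeds the measure 1 of the unit
  cube.\<close>

lemma measure_small_values:
  fixes a :: "nat \<Rightarrow> nat \<Rightarrow> real" and off :: "nat \<Rightarrow> real"
  assumes b: "\<And>i l. i < k \<Longrightarrow> l < k \<Longrightarrow> \<bar>(\<Sum>j<m. b i j * a l j) - (if i = l then 1 else 0)\<bar> \<le> 1 / (4 * real k)"
    and R: "\<And>i j. i < k \<Longrightarrow> j < m \<Longrightarrow> \<bar>b i j\<bar> \<le> R" "R \<ge> 0"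
    and \<epsilon>: "0 \<le> \<epsilon>" and k: "k \<ge> 1"
  defines "S \<equiv> \<lambda>\<epsilon>. {\<alpha> \<in> space (lebesgue_prod m). (\<forall>j<m. \<alpha> j \<in> {0..1}) \<and> (\<forall>l<k. \<bar>off l + (\<Sum>j<m. \<alpha> j * a l j)\<bar> \<le> \<epsilon>)}"
  shows "S \<epsilon> \<in> sets (lebesgue_prod m)"
    "emeasure (lebesgue_prod m) (S \<epsilon>) \<le> ennreal ((1 + 16 * real k * R) ^ m * \<epsilon> ^ k)"
proof -
  let ?L = "lebesgue_prod m" and ?C = "(1 + 16 * real k * R) ^ m"
  show Sm: "S \<epsilon> \<in> sets ?L" for \<epsilon> unfolding S_def by measurable
  have C: "?C \<ge> 1" using R(2) by (intro one_le_power) simp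
  have small: "emeasure ?L (S \<epsilon>) \<le> ennreal (?C * \<epsilon> ^ k)" if "0 < \<epsilon>" "\<epsilon> \<le> 1" for \<epsilon>
    unfolding S_def by (rule measure_small_values_aux[where a = a and b = b and off = off, OF b R that])
  consider "\<epsilon> = 0" | "0 < \<epsilon>" "\<epsilon> \<le> 1" | "\<epsilon> > 1" using \<epsilon> by linarith
  then show "emeasure ?L (S \<epsilon>) \<le> ennreal (?C * \<epsilon> ^ k)"
  proof cases
    case 1
    show ?thesis
    proof (rule ennreal_le_epsilon)
      fix e :: real assume e: "e > 0"
      define \<delta> where "\<delta> = min 1 (e / ?C)"
      have \<delta>: "0 < \<delta>" "\<delta> \<le> 1" "?C * \<delta> \<le> e" using e C by (auto simp: \<delta>_def min_def field_simps)
      have "emeasure ?L (S \<epsilon>) \<le> emeasure ?L (S \<delta>)"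
        by (rule emeasure_mono[OF _ Sm]) (use 1 \<delta> in \<open>fastforce simp: S_def\<close>)
      also have "\<dots> \<le> ennreal (?C * \<delta> ^ k)" by (rule small[OF \<delta>(1,2)])
      also have "\<dots> \<le> ennreal (?C * \<delta>)"
        using \<delta> k C power_decreasing[of 1 k \<delta>] by (intro ennreal_leI mult_left_mono) auto
      also have "\<dots> \<le> ennreal e" by (rule ennreal_leI[OF \<delta>(3)])
      finally show "emeasure ?L (S \<epsilon>) \<le> ennreal (?C * \<epsilon> ^ k) + ennreal e"
        by (rule order_trans) simp
    qed
  next
    case 2
    then show ?thesis by (rule small)
  next
    case 3
    have "emeasure ?L (S \<epsilon>) \<le> emeasure ?L (Pi\<^sub>E {..<m} (\<lambda>j. {0..1}))"
      by (rule emeasure_mono) (auto simp: S_def space_PiM PiE_iff extensional_def intro!: sets_PiM_I_finite)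
    also have "\<dots> = 1" by (subst emeasure_lebesgue_prod_box) auto
    also have "\<dots> \<le> ennreal (?C * \<epsilon> ^ k)"
      using mult_mono[OF C one_le_power[of \<epsilon> k]] 3 C by simp
    finally show ?thesis .
  qed
qed

section \<open>Sets of vanishing Hausdorff measure and almost sure absence of zeros\<close>

text \<open>Vanishing of the k-dimensional Hausdorff content. Numbers \<open>d i\<close> bounding
  the distances inside \<open>E i \<inter> S\<close> stand in for diameters, which keeps the notion
  monotone in S and free of infinite values, and \<rho> may be any function of two points, such as a
  distance between directions.\<close>

definition hausdorff_null :: "('b \<Rightarrow> 'b \<Rightarrow> real) \<Rightarrow> nat \<Rightarrow> 'b set \<Rightarrow> bool" where
  "hausdorff_null \<rho> k S \<longleftrightarrow> (\<forall>\<epsilon>>0. \<exists>E d. S \<subseteq> (\<Union>i::nat. E i) \<and> (\<forall>i. d i \<ge> 0) \<and>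
     (\<forall>i. \<forall>y\<in>E i \<inter> S. \<forall>y'\<in>E i \<inter> S. \<rho> y y' \<le> d i) \<and> (\<Sum>i. ennreal (d i ^ k)) \<le> ennreal \<epsilon>)"

lemma hausdorff_null_subset: "hausdorff_null \<rho> k S \<Longrightarrow> S' \<subseteq> S \<Longrightarrow> hausdorff_null \<rho> k S'"
  unfolding hausdorff_null_def
proof (intro allI impI)
  fix \<epsilon> :: real
  assume "\<forall>\<epsilon>>0. \<exists>E d. S \<subseteq> (\<Union>i::nat. E i) \<and> (\<forall>i. d i \<ge> 0) \<and>
     (\<forall>i. \<forall>y\<in>E i \<inter> S. \<forall>y'\<in>E i \<inter> S. \<rho> y y' \<le> d i) \<and> (\<Sum>i. ennreal (d i ^ k)) \<le> ennreal \<epsilon>"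
    and S': "S' \<subseteq> S" and "\<epsilon> > 0"
  then obtain E d where "S \<subseteq> (\<Union>i::nat. E i) \<and> (\<forall>i. d i \<ge> 0) \<and>
     (\<forall>i. \<forall>y\<in>E i \<inter> S. \<forall>y'\<in>E i \<inter> S. \<rho> y y' \<le> d i) \<and> (\<Sum>i. ennreal (d i ^ k)) \<le> ennreal \<epsilon>"
    by meson
  then show "\<exists>E d. S' \<subseteq> (\<Union>i::nat. E i) \<and> (\<forall>i. d i \<ge> 0) \<and>
     (\<forall>i. \<forall>y\<in>E i \<inter> S'. \<forall>y'\<in>E i \<inter> S'. \<rho> y y' \<le> d i) \<and> (\<Sum>i. ennreal (d i ^ k)) \<le> ennreal \<epsilon>"
    using S' by (intro exI[of _ E] exI[of _ d]) blast
qed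

text \<open>The core estimate. A zero at some point of a covering set forces the value at a sample
  point of this set to be of the order of its diameter \<open>d i\<close>, an event of measure
  O(\<open>d i ^ k\<close>). Summing over a cover makes the total arbitrarily small. One matrix b
  serves for all of S, which is why S is later taken to be a small neighbourhood.\<close>

lemma AE_no_zero_local:
  fixes fo :: "'b \<Rightarrow> nat \<Rightarrow> real" and f :: "nat \<Rightarrow> 'b \<Rightarrow> nat \<Rightarrow> real"
  assumes k: "k \<ge> 1" and S: "hausdorff_null \<rho> k S" and L: "L \<ge> 0"
    and lip: "\<And>y y' l. y \<in> S \<Longrightarrow> y' \<in> S \<Longrightarrow> l < k \<Longrightarrow> \<bar>fo y l - fo y' l\<bar> \<le> L * \<rho> y y'"
      "\<And>y y' l j. y \<in> S \<Longrightarrow> y' \<in> S \<Longrightarrow> l < k \<Longrightarrow> j < m \<Longrightarrow> \<bar>f j y l - f j y' l\<bar> \<le> L * \<rho> y y'"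
    and b: "\<And>y i l. y \<in> S \<Longrightarrow> i < k \<Longrightarrow> l < k \<Longrightarrow> \<bar>(\<Sum>j<m. b i j * f j y l) - (if i = l then 1 else 0)\<bar> \<le> 1 / (4 * real k)"
  shows "AE \<alpha> in lebesgue_prod m. (\<forall>j<m. \<alpha> j \<in> {0..1}) \<longrightarrow> (\<forall>y\<in>S. \<exists>l<k. fo y l + (\<Sum>j<m. \<alpha> j * f j y l) \<noteq> 0)"
proof -
  let ?L = "lebesgue_prod m"
  define R where "R = (\<Sum>i<k. \<Sum>j<m. \<bar>b i j\<bar>)"
  have R0: "R \<ge> 0" unfolding R_def by (intro sum_nonneg) auto
  have R: "\<bar>b i j\<bar> \<le> R" if "i < k" "j < m" for i j
  proof -
    have "\<bar>b i j\<bar> \<le> (\<Sum>j<m. \<bar>b i j\<bar>)" using that by (intro member_le_sum) auto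
    also have "\<dots> \<le> R" unfolding R_def using that by (intro member_le_sum sum_nonneg) auto
    finally show ?thesis .
  qed
  define C where "C = (1 + 16 * real k * R) ^ m * (L * (1 + m)) ^ k"
  have C: "C \<ge> 0" using R0 L by (simp add: C_def)
  define bad where "bad = {\<alpha> \<in> space ?L. (\<forall>j<m. \<alpha> j \<in> {0..1}) \<and> (\<exists>y\<in>S. \<forall>l<k. fo y l + (\<Sum>j<m. \<alpha> j * f j y l) = 0)}"
  have cover: "\<exists>N\<in>sets ?L. bad \<subseteq> N \<and> emeasure ?L N \<le> ennreal (C * \<epsilon>)" if "\<epsilon> > 0" for \<epsilon> :: real
  proof -
    from S[unfolded hausdorff_null_def, THEN spec, THEN mp, OF that]
    obtain E d where Ed0: "S \<subseteq> (\<Union>i::nat. E i) \<and> (\<forall>i. d i \<ge> 0) \<and>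
      (\<forall>i. \<forall>y\<in>E i \<inter> S. \<forall>y'\<in>E i \<inter> S. \<rho> y y' \<le> d i) \<and> (\<Sum>i. ennreal (d i ^ k)) \<le> ennreal \<epsilon>" by (elim exE)
    then have Ed: "S \<subseteq> (\<Union>i::nat. E i)" "\<And>i. d i \<ge> 0"
      "\<And>i y y'. y \<in> E i \<inter> S \<Longrightarrow> y' \<in> E i \<inter> S \<Longrightarrow> \<rho> y y' \<le> d i" "(\<Sum>i. ennreal (d i ^ k)) \<le> ennreal \<epsilon>"
      by simp_all
    define y where "y i = (SOME y. y \<in> E i \<inter> S)" for i
    \<comment> \<open>Moving from a zero to the sample point changes the offset by at most L *
      \<open>d i\<close>, and each of the m summands by as much because the coefficients lie in the
      unit interval; this accounts for the factor 1 + m.\<close>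
    define N where "N i = (if E i \<inter> S = {} then {} else
      {\<alpha> \<in> space ?L. (\<forall>j<m. \<alpha> j \<in> {0..1}) \<and> (\<forall>l<k. \<bar>fo (y i) l + (\<Sum>j<m. \<alpha> j * f j (y i) l)\<bar> \<le> L * (1 + m) * d i)})" for i
    have y: "y i \<in> E i \<inter> S" if "E i \<inter> S \<noteq> {}" for i
      unfolding y_def using that by (metis equals0I someI)
    have N: "N i \<in> sets ?L" "emeasure ?L (N i) \<le> ennreal C * ennreal (d i ^ k)" for i
    proof -
      have "N i \<in> sets ?L \<and> emeasure ?L (N i) \<le> ennreal ((1 + 16 * real k * R) ^ m * (L * (1 + m) * d i) ^ k)"
      proof (cases "E i \<inter> S = {}")
        case False
        have nn: "0 \<le> L * (1 + m) * d i" using L Ed(2)[of i] by simp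
        have bb: "\<bar>(\<Sum>j<m. b i' j * f j (y i) l) - (if i' = l then 1 else 0)\<bar> \<le> 1 / (4 * real k)" if "i' < k" "l < k" for i' l
          using b[of "y i" i' l] that y[OF False] by simp
        have "N i = {\<alpha> \<in> space ?L. (\<forall>j<m. \<alpha> j \<in> {0..1}) \<and> (\<forall>l<k. \<bar>fo (y i) l + (\<Sum>j<m. \<alpha> j * f j (y i) l)\<bar> \<le> L * (1 + m) * d i)}"
          using False by (simp add: N_def)
        then show ?thesis
          using measure_small_values[where b = b and a = "\<lambda>l j. f j (y i) l" and off = "fo (y i)" and m = m, OF bb R R0 nn k] by simp
      qed (simp add: N_def)
      moreover have "ennreal ((1 + 16 * real k * R) ^ m * (L * (1 + m) * d i) ^ k) = ennreal C * ennreal (d i ^ k)"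
        using C Ed(2)[of i] by (simp add: C_def power_mult_distrib ennreal_mult[symmetric] mult_ac)
      ultimately show "N i \<in> sets ?L" "emeasure ?L (N i) \<le> ennreal C * ennreal (d i ^ k)" by auto
    qed
    have "bad \<subseteq> (\<Union>i. N i)"
    proof
      fix \<alpha> assume "\<alpha> \<in> bad"
      then obtain x where \<alpha>: "\<alpha> \<in> space ?L" "\<And>j. j < m \<Longrightarrow> \<alpha> j \<in> {0..1}" and x: "x \<in> S"
        "\<And>l. l < k \<Longrightarrow> fo x l + (\<Sum>j<m. \<alpha> j * f j x l) = 0" unfolding bad_def by blast
      obtain i where i: "x \<in> E i" using Ed(1) x(1) by blast
      then have ne: "E i \<inter> S \<noteq> {}" using x by blast
      have yi: "y i \<in> S" "\<rho> (y i) x \<le> d i" using y[OF ne] Ed(3) i x(1) by auto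
      have "\<bar>fo (y i) l + (\<Sum>j<m. \<alpha> j * f j (y i) l)\<bar> \<le> L * (1 + m) * d i" if l: "l < k" for l
      proof -
        have "fo (y i) l + (\<Sum>j<m. \<alpha> j * f j (y i) l)
            = (fo (y i) l - fo x l) + (\<Sum>j<m. \<alpha> j * (f j (y i) l - f j x l))"
          using x(2)[OF l] by (simp add: sum_subtractf right_diff_distrib)
        also have "\<bar>\<dots>\<bar> \<le> L * \<rho> (y i) x + (\<Sum>j<m. 1 * (L * \<rho> (y i) x))"
        proof (rule order_trans[OF abs_triangle_ineq], rule add_mono)
          show "\<bar>fo (y i) l - fo x l\<bar> \<le> L * \<rho> (y i) x" by (rule lip(1)[OF yi(1) x(1) l])
          show "\<bar>\<Sum>j<m. \<alpha> j * (f j (y i) l - f j x l)\<bar> \<le> (\<Sum>j<m. 1 * (L * \<rho> (y i) x))"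
          proof (rule order_trans[OF sum_abs], rule sum_mono)
            fix j assume "j \<in> {..<m}"
            then show "\<bar>\<alpha> j * (f j (y i) l - f j x l)\<bar> \<le> 1 * (L * \<rho> (y i) x)"
              unfolding abs_mult using \<alpha>(2)[of j] lip(2)[OF yi(1) x(1) l] by (intro mult_mono) auto
          qed
        qed
        also have "\<dots> = L * (1 + m) * \<rho> (y i) x" by (simp add: algebra_simps)
        also have "\<dots> \<le> L * (1 + m) * d i" using L yi(2) by (intro mult_left_mono) auto
        finally show ?thesis .
      qed
      then have "\<alpha> \<in> N i" using ne \<alpha> by (auto simp: N_def)
      then show "\<alpha> \<in> (\<Union>i. N i)" by blast
    qed
    moreover have "emeasure ?L (\<Union>i. N i) \<le> ennreal (C * \<epsilon>)"
    proof -
      have "emeasure ?L (\<Union>i. N i) \<le> (\<Sum>i. emeasure ?L (N i))"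
        using N(1) by (intro emeasure_subadditive_countably) auto
      also have "\<dots> \<le> (\<Sum>i. ennreal C * ennreal (d i ^ k))"
        by (intro suminf_le N(2)) auto
      also have "\<dots> = ennreal C * (\<Sum>i. ennreal (d i ^ k))" by simp
      also have "\<dots> \<le> ennreal C * ennreal \<epsilon>" by (intro mult_left_mono Ed(4)) simp
      also have "\<dots> = ennreal (C * \<epsilon>)" using C \<open>\<epsilon> > 0\<close> by (simp add: ennreal_mult)
      finally show ?thesis .
    qed
    moreover have "(\<Union>i. N i) \<in> sets ?L" using N(1) by blast
    ultimately show ?thesis by blast
  qed
  then have "\<forall>q::nat. \<exists>N. N \<in> sets ?L \<and> bad \<subseteq> N \<and> emeasure ?L N \<le> ennreal (C * (1 / Suc q))"
    by (metis divide_pos_pos of_nat_0_less_iff zero_less_Suc zero_less_one)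
  from choice[OF this] obtain N where N: "\<And>q::nat. N q \<in> sets ?L" "\<And>q. bad \<subseteq> N q"
    "\<And>q. emeasure ?L (N q) \<le> ennreal (C * (1 / Suc q))" by blast
  have "emeasure ?L (\<Inter>q. N q) \<le> 0"
  proof (rule ennreal_le_epsilon)
    fix e :: real assume e: "e > 0"
    obtain q :: nat where q: "C / e < Suc q" using reals_Archimedean2[of "C / e"] by (metis less_SucI of_nat_less_iff order_less_trans lessI)
    have "emeasure ?L (\<Inter>q. N q) \<le> emeasure ?L (N q)" using N(1) by (intro emeasure_mono) auto
    also have "\<dots> \<le> ennreal (C * (1 / Suc q))" by (rule N(3))
    also have "\<dots> \<le> ennreal e" using q e by (intro ennreal_leI) (simp add: field_simps)
    finally show "emeasure ?L (\<Inter>q. N q) \<le> 0 + ennreal e" by simp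
  qed
  then have 0: "emeasure ?L (\<Inter>q. N q) = 0" by simp
  have "(\<Inter>q. N q) \<in> sets ?L" using N(1) by blast
  moreover have "bad \<subseteq> (\<Inter>q. N q)" using N(2) by blast
  ultimately show ?thesis
    by (intro AE_I[OF _ 0]) (auto simp: bad_def)
qed

text \<open>A set described by fewer than k bounded coordinates splits into at most (M + 1)^(k - 1)
  cells of diameter O(1 / M); the sum of k-th powers is then O(1 / M).\<close>

lemma hausdorff_null_grid:
  fixes u :: "'b \<Rightarrow> nat \<Rightarrow> real" and a :: "nat \<Rightarrow> real"
  assumes I: "finite I" "card I < k" and R: "R > 0" "\<And>z i. z \<in> Z \<Longrightarrow> i \<in> I \<Longrightarrow> \<bar>u z i - a i\<bar> \<le> R"
    and C: "C \<ge> 0" "\<And>z z' \<eta>. z \<in> Z \<Longrightarrow> z' \<in> Z \<Longrightarrow> \<eta> \<ge> 0 \<Longrightarrow> (\<And>i. i \<in> I \<Longrightarrow> \<bar>u z i - u z' i\<bar> \<le> \<eta>) \<Longrightarrow> \<rho> z z' \<le> C * \<eta>"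
  shows "hausdorff_null \<rho> k Z"
  unfolding hausdorff_null_def
proof (intro allI impI)
  fix \<epsilon> :: real assume \<epsilon>: "\<epsilon> > 0"
  \<comment> \<open>Comes from (2 M)^(k - 1) cells of diameter 2 R C / M: the sum of k-th powers is
    at most K / M.\<close>
  define K where "K = 2 ^ k * (2 * R * C) ^ k"
  have K: "K \<ge> 0" using R C by (simp add: K_def)
  obtain M0 :: nat where M0: "K / \<epsilon> < M0" using reals_Archimedean2 by blast
  define M where "M = Suc M0"
  have M: "M \<ge> 1" "K / M < \<epsilon>"
  proof -
    have "K / \<epsilon> < M" using M0 by (simp add: M_def)
    then show "K / M < \<epsilon>" using \<epsilon> by (simp add: M_def field_simps)
  qed (simp add: M_def)
  define cell where "cell z = (\<lambda>i\<in>I. nat \<lfloor>(u z i - a i + R) * M / (2 * R)\<rfloor>)" for z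
  \<comment> \<open>The index M is included because points on the far face of the box have rescaled
    coordinate exactly M.\<close>
  define Q where "Q = Pi\<^sub>E I (\<lambda>_. {..M})"
  have Q: "finite Q" "card Q = (M + 1) ^ card I" using I by (auto simp: Q_def finite_PiE card_PiE)
  have bnd: "0 \<le> (u z i - a i + R) * M / (2 * R)" "(u z i - a i + R) * M / (2 * R) \<le> M" if "z \<in> Z" "i \<in> I" for z i
  proof -
    have "0 \<le> u z i - a i + R" "u z i - a i + R \<le> 2 * R" using R(2)[OF that] by auto
    then have "0 \<le> (u z i - a i + R) * M" "(u z i - a i + R) * M \<le> 2 * R * M" by (auto intro: mult_right_mono)
    then show "0 \<le> (u z i - a i + R) * M / (2 * R)" "(u z i - a i + R) * M / (2 * R) \<le> M"
      using R(1) by (auto simp: field_simps)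
  qed
  have cellQ: "cell z \<in> Q" if "z \<in> Z" for z
    using bnd[OF that] by (auto simp: cell_def Q_def floor_le_iff le_nat_iff nat_le_iff) (smt (verit) of_int_of_nat_eq floor_le_iff)
  have same: "\<rho> z z' \<le> C * (2 * R / M)" if z: "z \<in> Z" "z' \<in> Z" "cell z = cell z'" for z z'
  proof (rule C(2)[OF z(1,2)])
    show "0 \<le> 2 * R / M" using R by simp
    fix i assume i: "i \<in> I"
    let ?x = "(u z i - a i + R) * M / (2 * R)" and ?y = "(u z' i - a i + R) * M / (2 * R)"
    have "nat \<lfloor>?x\<rfloor> = nat \<lfloor>?y\<rfloor>" using fun_cong[OF z(3), of i] i by (simp add: cell_def)
    then have "\<lfloor>?x\<rfloor> = \<lfloor>?y\<rfloor>" using bnd[OF z(1) i] bnd[OF z(2) i] by (metis eq_nat_nat_iff zero_le_floor)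
    then have "\<bar>?x - ?y\<bar> \<le> 1" by linarith
    moreover have "?x - ?y = (u z i - u z' i) * (M / (2 * R))"
      by (simp add: diff_divide_distrib[symmetric] algebra_simps)
    ultimately have "\<bar>u z i - u z' i\<bar> * (M / (2 * R)) \<le> 1" using R(1) by (simp add: abs_mult)
    then show "\<bar>u z i - u z' i\<bar> \<le> 2 * R / M" using R(1) M by (simp add: field_simps)
  qed
  obtain h where h: "bij_betw h {0..<card Q} Q" using ex_bij_betw_nat_finite[OF Q(1)] by blast
  define E where "E i = (if i < card Q then {z \<in> Z. cell z = h i} else {})" for i
  define d where "d i = (if i < card Q then C * (2 * R / M) else 0)" for i
  show "\<exists>E d. Z \<subseteq> (\<Union>i::nat. E i) \<and> (\<forall>i. d i \<ge> 0) \<and>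
     (\<forall>i. \<forall>y\<in>E i \<inter> Z. \<forall>y'\<in>E i \<inter> Z. \<rho> y y' \<le> d i) \<and> (\<Sum>i. ennreal (d i ^ k)) \<le> ennreal \<epsilon>"
  proof (intro exI conjI allI ballI)
    show "Z \<subseteq> (\<Union>i. E i)"
    proof
      fix z assume z: "z \<in> Z"
      then obtain i where "i < card Q" "h i = cell z"
        using cellQ h by (metis atLeastLessThan_iff bij_betw_imp_surj_on imageE)
      then show "z \<in> (\<Union>i. E i)" using z by (auto simp: E_def)
    qed
    show "d i \<ge> 0" for i using C R by (simp add: d_def)
    show "\<rho> y y' \<le> d i" if "y \<in> E i \<inter> Z" "y' \<in> E i \<inter> Z" for i y y'
      using same[of y y'] that by (auto simp: E_def d_def split: if_splits)
    have k0: "k > 0" using I by simp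
    have "(\<Sum>i. ennreal (d i ^ k)) = (\<Sum>i<card Q. ennreal (d i ^ k))"
      using k0 by (intro suminf_finite) (auto simp: d_def)
    also have "\<dots> = ennreal (card Q * (C * (2 * R / M)) ^ k)"
      using C R by (simp add: d_def ennreal_mult ennreal_of_nat_eq_real_of_nat)
    also have "\<dots> \<le> ennreal \<epsilon>"
    proof (rule ennreal_leI)
      have "card I \<le> k - 1" using I by simp
      then have "real (M + 1) ^ card I \<le> real (M + 1) ^ (k - 1)" by (intro power_increasing) auto
      also have "\<dots> \<le> (2 * real M) ^ (k - 1)" using M(1) by (intro power_mono) auto
      finally have "real (card Q) \<le> 2 ^ (k - 1) * real M ^ (k - 1)" unfolding Q by (simp add: power_mult_distrib)
      also have "\<dots> \<le> 2 ^ k * real M ^ (k - 1)" by (intro mult_right_mono power_increasing) auto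
      finally have "card Q * (C * (2 * R / M)) ^ k \<le> (2 ^ k * real M ^ (k - 1)) * (C * (2 * R / M)) ^ k"
        using C R by (intro mult_right_mono) auto
      also have "\<dots> = K / M"
      proof -
        have "real M ^ k = M * real M ^ (k - 1)" using k0 by (simp add: power_eq_if)
        then show ?thesis using M(1) by (simp add: K_def power_mult_distrib power_divide field_simps)
      qed
      finally show "card Q * (C * (2 * R / M)) ^ k \<le> \<epsilon>" using M(2) by linarith
    qed
    finally show "(\<Sum>i. ennreal (d i ^ k)) \<le> ennreal \<epsilon>" .
  qed
qed

text \<open>Some exponent s below k already has measure 0. Covers of mesh 1 suffice, because
  diameters at most 1 satisfy d^k \<le> d^s.\<close>

lemma hausdorff_null_of_dim:
  assumes dim: "of_nat k > hausdorff_dim \<rho> X" and k: "k \<ge> 1"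
  shows "hausdorff_null \<rho> k X"
  unfolding hausdorff_null_def
proof (intro allI impI)
  fix \<epsilon> :: real assume \<epsilon>: "\<epsilon> > 0"
  obtain s where s: "0 < s" "hausdorff_measure \<rho> s X = 0" "ennreal s < of_nat k"
    using dim unfolding hausdorff_dim_def INF_less_iff by auto
  have sk: "s < k" using s(1,3) by (simp add: ennreal_of_nat_eq_real_of_nat ennreal_less_iff)
  have "hausdorff_content \<rho> s 1 X \<le> hausdorff_measure \<rho> s X"
    unfolding hausdorff_measure_def by (rule SUP_upper) simp
  then have "hausdorff_content \<rho> s 1 X < ennreal \<epsilon>" using s(2) \<epsilon> by simp
  then obtain E where E: "X \<subseteq> (\<Union>i::nat. E i)" "\<And>i. ediam \<rho> (E i) \<le> ennreal 1"
    "(\<Sum>i. ennreal (enn2real (ediam \<rho> (E i)) powr s)) < ennreal \<epsilon>"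
    unfolding hausdorff_content_def INF_less_iff by auto
  define d where "d i = enn2real (ediam \<rho> (E i))" for i
  have fin: "ediam \<rho> (E i) < top" for i using le_less_trans[OF E(2)[of i] ennreal_less_top] .
  have d: "0 \<le> d i" "d i \<le> 1" "ennreal (d i) = ediam \<rho> (E i)" for i
    using E(2)[of i] fin[of i] by (auto simp: d_def enn2real_leI)
  show "\<exists>E d. X \<subseteq> (\<Union>i::nat. E i) \<and> (\<forall>i. d i \<ge> 0) \<and>
     (\<forall>i. \<forall>y\<in>E i \<inter> X. \<forall>y'\<in>E i \<inter> X. \<rho> y y' \<le> d i) \<and> (\<Sum>i. ennreal (d i ^ k)) \<le> ennreal \<epsilon>"
  proof (intro exI conjI allI ballI)
    show "X \<subseteq> (\<Union>i. E i)" "0 \<le> d i" for i using E(1) d(1) by auto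
    fix i y y' assume y: "y \<in> E i \<inter> X" "y' \<in> E i \<inter> X"
    have "ennreal (\<rho> y y') \<le> ediam \<rho> (E i)"
      unfolding ediam_def by (rule SUP_upper2[of y], use y in blast, rule SUP_upper2[of y'], use y in auto)
    then show "\<rho> y y' \<le> d i" using d(1,3)[of i] by (metis ennreal_le_iff)
  next
    \<comment> \<open>Sets of diameter 0 are treated apart, as \<open>powr\<close> agrees with the
      natural power only for a positive base; there both sides are 0 since k is positive.\<close>
    have "d i ^ k \<le> d i powr s" for i
    proof (cases "d i = 0")
      case False
      then have "d i ^ k = d i powr k" using d(1)[of i] by (simp add: powr_realpow)
      also have "\<dots> \<le> d i powr s" using d[of i] sk by (intro powr_mono') auto
      finally show ?thesis .
    qed (use k in \<open>simp add: power_0_left\<close>)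
    then have "(\<Sum>i. ennreal (d i ^ k)) \<le> (\<Sum>i. ennreal (d i powr s))"
      by (intro suminf_le ennreal_leI) auto
    also have "\<dots> \<le> ennreal \<epsilon>" using E(3) by (simp add: d_def)
    finally show "(\<Sum>i. ennreal (d i ^ k)) \<le> ennreal \<epsilon>" .
  qed
qed

lemma hausdorff_null_singleton: "\<rho> y y \<le> 0 \<Longrightarrow> k \<ge> 1 \<Longrightarrow> hausdorff_null \<rho> k {y}"
  unfolding hausdorff_null_def
  by (intro allI impI exI[of _ "\<lambda>_. {y}"] exI[of _ "\<lambda>_. 0"]) (auto simp: power_0_left)

section \<open>The space of observables\<close>

lemma Ck_on_foldr_partial_deriv:
  "Ck_on n (length is + p) U f \<Longrightarrow> set is \<subseteq> {..<n} \<Longrightarrow> Ck_on n p U (foldr partial_deriv is f)"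
proof (induction "is" arbitrary: p)
  case (Cons i "is")
  then have "Ck_on n (Suc p) U (foldr partial_deriv is f)" by (intro Cons.IH) auto
  then show ?case using Cons.prems by simp
qed simp

text \<open>Iterated derivatives are linear on functions smooth enough for them to exist; this is
  what makes the basic open sets behave well under linear combinations and translations.\<close>

lemma foldr_partial_deriv_combination:
  assumes "openin (Euclidean_space n) U" "\<And>j. j \<in> J \<Longrightarrow> Ck_on n (length is) U (f j)" "set is \<subseteq> {..<n}" "x \<in> U"
  shows "foldr partial_deriv is (\<lambda>u. \<Sum>j\<in>J. c j * f j u) x = (\<Sum>j\<in>J. c j * foldr partial_deriv is (f j) x)"
  using assms(2,3,4)
proof (induction "is" arbitrary: x)
  case (Cons i "is")
  have C1: "Ck_on n (Suc 0) U (foldr partial_deriv is (f j))" if "j \<in> J" for j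
    using Cons.prems that by (intro Ck_on_foldr_partial_deriv) auto
  have i: "i < n" using Cons.prems by simp
  have IH: "foldr partial_deriv is (\<lambda>u. \<Sum>j\<in>J. c j * f j u) y = (\<Sum>j\<in>J. c j * foldr partial_deriv is (f j) y)" if "y \<in> U" for y
    using Cons.prems that by (intro Cons.IH) (auto intro: Ck_on_SucD simp del: Ck_on.simps)
  have "partial_deriv i (foldr partial_deriv is (\<lambda>u. \<Sum>j\<in>J. c j * f j u)) x
      = partial_deriv i (\<lambda>y. \<Sum>j\<in>J. c j * foldr partial_deriv is (f j) y) x"
    by (rule partial_deriv_cong[OF assms(1) Cons.prems(3) i IH])
  also have "\<dots> = (\<Sum>j\<in>J. c j * partial_deriv i (foldr partial_deriv is (f j)) x)"
    by (rule partial_deriv_eqI, rule DERIV_sum, rule DERIV_cmult, rule Ck_on_has_partial[OF C1 i Cons.prems(3)])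
  finally show ?case by simp
qed simp

context compact_Cr_manifold
begin

section \<open>The topology of uniform convergence of derivatives\<close>

lemma openin_Cr_basic:
  "\<lbrakk>c \<in> A; compact K; K \<subseteq> fst c; set is \<subseteq> {..<n}; enat (length is) \<le> r; f \<in> Cr_functions n r A; \<epsilon> > 0\<rbrakk> \<Longrightarrow>
   openin (Cr_topology n r A) (Cr_basic_open n r A c K is f \<epsilon>)"
  unfolding Cr_topology_def by (rule topology_generated_by_Basis) blast

lemma topspace_Cr_topology [simp]: "topspace (Cr_topology n r A) = Cr_functions n r A"
proof
  show "topspace (Cr_topology n r A) \<subseteq> Cr_functions n r A"
    unfolding Cr_topology_def topology_generated_by_topspace by (auto simp: Cr_basic_open_def)
  obtain c where c: "c \<in> A" using chart_cover by blast
  \<comment> \<open>With an empty compact set the condition is void, so a single basic open set is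
    the whole space.\<close>
  have "openin (Cr_topology n r A) (Cr_basic_open n r A c {} [] (\<lambda>x. 0) 1)"
    using c by (intro openin_Cr_basic) (auto simp: zero_enat_def[symmetric])
  then have "Cr_basic_open n r A c {} [] (\<lambda>x. 0) 1 \<subseteq> topspace (Cr_topology n r A)" by (rule openin_subset)
  then show "Cr_functions n r A \<subseteq> topspace (Cr_topology n r A)" by (simp add: Cr_basic_open_def)
qed

lemma finite_compact_chart_cover:
  obtains P K C where "finite (P :: 'a set)" "UNIV = (\<Union>p\<in>P. K p)" "\<And>p. compact (K p :: 'a set)" "\<And>p. C p \<in> A" "\<And>p. K p \<subseteq> fst (C p)"
proof -
  have ex: "\<forall>p. \<exists>N K. open N \<and> p \<in> N \<and> N \<subseteq> K \<and> compact K \<and> (\<exists>c\<in>A. K \<subseteq> fst c)"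
  proof
    fix p
    obtain c where c: "c \<in> A" "p \<in> fst c" by (rule chart_cover)
    obtain e where e: "e > 0" and K: "{y \<in> Rn n. \<forall>i<n. \<bar>y i - snd c p i\<bar> \<le> e} \<subseteq> chart_image c"
      using openin_contains_cbox[OF chart_image_open[OF c(1)], of "snd c p"] c by auto
    let ?K = "{y \<in> Rn n. \<forall>i<n. \<bar>y i - snd c p i\<bar> \<le> e}"
    let ?N = "{y \<in> fst c. snd c y \<in> {u \<in> Rn n. \<forall>i<n. \<bar>u i - snd c p i\<bar> < e}}"
    have "open ?N" by (rule chart_inv_image_open[OF c(1) openin_box])
    moreover have "p \<in> ?N" using c e chart_image_Rn[OF c(1)] snd_in_chart_image[OF c] by auto
    moreover have "?N \<subseteq> chart_inv c ` ?K"
    proof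
      fix y assume y: "y \<in> ?N"
      then have "y = chart_inv c (snd c y)" "snd c y \<in> ?K" using c(1) by (auto simp: less_imp_le)
      then show "y \<in> chart_inv c ` ?K" by blast
    qed
    moreover have "compact (chart_inv c ` ?K)"
      using K continuous_on_subset[OF chart_inv_cont[OF c(1)]] compact_cbox by (intro compact_continuous_image) auto
    moreover have "chart_inv c ` ?K \<subseteq> fst c" using K chart_inv_in[OF c(1)] by blast
    ultimately show "\<exists>N K. open N \<and> p \<in> N \<and> N \<subseteq> K \<and> compact K \<and> (\<exists>c\<in>A. K \<subseteq> fst c)"
      using c(1) by (intro exI[of _ ?N] exI[of _ "chart_inv c ` ?K"] conjI bexI[of _ c])
  qed
  from choice[OF this] obtain N where "\<forall>p. \<exists>K. open (N p) \<and> p \<in> N p \<and> N p \<subseteq> K \<and> compact K \<and> (\<exists>c\<in>A. K \<subseteq> fst c)" by blast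
  from choice[OF this] obtain K where NK: "\<forall>p. open (N p) \<and> p \<in> N p \<and> N p \<subseteq> K p \<and> compact (K p) \<and> (\<exists>c\<in>A. K p \<subseteq> fst c)" by blast
  then have "\<forall>p. \<exists>c. c \<in> A \<and> K p \<subseteq> fst c" by blast
  from choice[OF this] obtain C where C: "\<And>p. C p \<in> A" "\<And>p. K p \<subseteq> fst (C p)" by blast
  have cov: "UNIV \<subseteq> (\<Union>p\<in>UNIV. N p)" and No: "open (N p)" for p using NK by blast+
  obtain P where P: "finite P" "UNIV \<subseteq> (\<Union>p\<in>P. N p)"
    by (rule compactE_image[OF cpt No cov])
  have U: "UNIV = (\<Union>p\<in>P. K p)" using P(2) NK by blast
  have Kc: "\<And>p. compact (K p)" using NK by blast
  show ?thesis by (rule that[OF P(1) U Kc C])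
qed

text \<open>Derivatives of order 0, on finitely many compact pieces of charts covering the manifold,
  control the sup norm. This is the part of the topology used for separation and for the Borel
  property.\<close>

lemma sup_neighbourhood:
  assumes "h \<in> Cr_functions n r A" "\<eta> > 0"
  obtains V where "openin (Cr_topology n r A) V" "h \<in> V" "\<And>h' x. h' \<in> V \<Longrightarrow> \<bar>h' x - h x\<bar> < \<eta>"
proof -
  obtain P K C where P: "finite (P :: 'a set)" "UNIV = (\<Union>p\<in>P. K p)" "\<And>p. compact (K p :: 'a set)"
    "\<And>p. C p \<in> A" "\<And>p. K p \<subseteq> fst (C p)" using finite_compact_chart_cover by blast
  have ne: "P \<noteq> {}" using P(2) by blast
  let ?V = "\<Inter>p\<in>P. Cr_basic_open n r A (C p) (K p) [] h \<eta>"
  show ?thesis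
  proof (rule that[of ?V])
    show "openin (Cr_topology n r A) ?V"
    proof (rule openin_Inter)
      fix V assume "V \<in> (\<lambda>p. Cr_basic_open n r A (C p) (K p) [] h \<eta>) ` P"
      then obtain p where "V = Cr_basic_open n r A (C p) (K p) [] h \<eta>" by blast
      then show "openin (Cr_topology n r A) V"
        using openin_Cr_basic[OF P(4,3,5), of "[]" h \<eta>] assms by (simp add: zero_enat_def[symmetric])
    qed (use P ne in auto)
    show "h \<in> ?V" using assms by (auto simp: Cr_basic_open_def)
    fix h' x assume h': "h' \<in> ?V"
    obtain p where p: "p \<in> P" "x \<in> K p" using P(2) by blast
    then have "\<bar>(h' \<circ> chart_inv (C p)) (snd (C p) x) - (h \<circ> chart_inv (C p)) (snd (C p) x)\<bar> < \<eta>"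
      using h' by (auto simp: Cr_basic_open_def)
    moreover have "chart_inv (C p) (snd (C p) x) = x" using p P(4,5) by (intro chart_inv_snd) auto
    ultimately show "\<bar>h' x - h x\<bar> < \<eta>" by simp
  qed
qed

text \<open>Needed so that the compact set carrying the probe measure is closed, hence
  Borel.\<close>

lemma Hausdorff_Cr_topology: "Hausdorff_space (Cr_topology n r A)"
  unfolding Hausdorff_space_def
proof (intro allI impI)
  fix f h assume "f \<in> topspace (Cr_topology n r A) \<and> h \<in> topspace (Cr_topology n r A) \<and> f \<noteq> h"
  then have fh: "f \<in> Cr_functions n r A" "h \<in> Cr_functions n r A" "f \<noteq> h" by auto
  then obtain x where x: "f x \<noteq> h x" by blast
  define e where "e = \<bar>f x - h x\<bar> / 2"
  have e: "e > 0" using x by (simp add: e_def)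
  obtain U where U: "openin (Cr_topology n r A) U" "f \<in> U" "\<And>h' x. h' \<in> U \<Longrightarrow> \<bar>h' x - f x\<bar> < e"
    using sup_neighbourhood[OF fh(1) e] by blast
  obtain V where V: "openin (Cr_topology n r A) V" "h \<in> V" "\<And>h' x. h' \<in> V \<Longrightarrow> \<bar>h' x - h x\<bar> < e"
    using sup_neighbourhood[OF fh(2) e] by blast
  have "disjnt U V"
    unfolding disjnt_iff
  proof (intro allI notI)
    fix h' assume "h' \<in> U \<and> h' \<in> V"
    then have "\<bar>h' x - f x\<bar> < e" "\<bar>h' x - h x\<bar> < e" using U(3) V(3) by auto
    then show False unfolding e_def by (auto simp: abs_if field_simps split: if_splits)
  qed
  then show "\<exists>U V. openin (Cr_topology n r A) U \<and> openin (Cr_topology n r A) V \<and> f \<in> U \<and> h \<in> V \<and> disjnt U V" using U V by blast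
qed

lemma Cr_functions_combination:
  fixes m :: nat
  shows "(\<And>j. j < m \<Longrightarrow> hs j \<in> Cr_functions n r A) \<Longrightarrow> (\<lambda>x. \<Sum>j<m. \<alpha> j * hs j x) \<in> Cr_functions n r A"
  by (intro Cr_functions_sum Cr_functions_mult) auto

text \<open>On a compact set the derivatives of the combination are linear in the coefficients with
  bounded factors, so a small change of m coefficients stays within any basic open set.\<close>

lemma continuous_map_combination:
  fixes hs :: "nat \<Rightarrow> 'a \<Rightarrow> real"
  assumes hs: "\<And>j. j < m \<Longrightarrow> hs j \<in> Cr_functions n r A"
  shows "continuous_map euclidean (Cr_topology n r A) (\<lambda>\<alpha> x. \<Sum>j<m. \<alpha> j * hs j x)"
proof -
  let ?\<Phi> = "\<lambda>\<alpha> x. \<Sum>j<m. \<alpha> j * hs j x"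
  have op: "open {\<alpha>. ?\<Phi> \<alpha> \<in> Cr_basic_open n r A c K is f \<epsilon>}"
    if c: "c \<in> A" "compact K" "K \<subseteq> fst c" and "is": "set is \<subseteq> {..<n}" "enat (length is) \<le> r"
      and f: "f \<in> Cr_functions n r A" "\<epsilon> > 0" for c K "is" f \<epsilon>
  proof -
    define D where "D h x = foldr partial_deriv is (\<lambda>u. h (chart_inv c u)) (snd c x)" for h x
    have Dc: "continuous_on K (D h)" if "h \<in> Cr_functions n r A" for h
    proof -
      have "Ck_on n (length is + 0) (chart_image c) (\<lambda>u. h (chart_inv c u))"
        using Cr_onD[OF Cr_functionsD[OF that c(1)] "is"(2)] by simp
      then have "continuous_on (chart_image c) (foldr partial_deriv is (\<lambda>u. h (chart_inv c u)))"
        using Ck_on_foldr_partial_deriv[OF _ "is"(1)] Ck_on_continuous by blast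
      then show ?thesis unfolding D_def
        by (rule continuous_on_compose2[OF _ continuous_on_subset[OF chart_cont[OF c(1)] c(3)]]) (use c in auto)
    qed
    have lin: "D (?\<Phi> \<alpha>) x = (\<Sum>j<m. \<alpha> j * D (hs j) x)" if "x \<in> K" for \<alpha> x
      unfolding D_def
      by (rule foldr_partial_deriv_combination[OF chart_image_open[OF c(1)] _ "is"(1)])
         (use hs c "is" that in \<open>auto intro: Cr_onD Cr_functionsD\<close>)
    have eq: "{\<alpha>. ?\<Phi> \<alpha> \<in> Cr_basic_open n r A c K is f \<epsilon>} = {\<alpha>. \<forall>x\<in>K. \<bar>D (?\<Phi> \<alpha>) x - D f x\<bar> < \<epsilon>}"
      using Cr_functions_combination[of m hs, OF hs] by (simp add: Cr_basic_open_def D_def o_def)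
    have "\<exists>T. open T \<and> \<beta> \<in> T \<and> T \<subseteq> {\<alpha>. \<forall>x\<in>K. \<bar>D (?\<Phi> \<alpha>) x - D f x\<bar> < \<epsilon>}"
      if \<beta>: "\<forall>x\<in>K. \<bar>D (?\<Phi> \<beta>) x - D f x\<bar> < \<epsilon>" for \<beta>
    proof (cases "K = {}")
      case False
      have "continuous_on K (\<lambda>x. \<bar>D (?\<Phi> \<beta>) x - D f x\<bar>)"
        by (intro continuous_intros Dc f Cr_functions_combination hs)
      then obtain x0 where x0: "x0 \<in> K" "\<And>x. x \<in> K \<Longrightarrow> \<bar>D (?\<Phi> \<beta>) x - D f x\<bar> \<le> \<bar>D (?\<Phi> \<beta>) x0 - D f x0\<bar>"
        using continuous_attains_sup[OF c(2) False] by blast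
      have "continuous_on K (\<lambda>x. \<Sum>j<m. \<bar>D (hs j) x\<bar>)" using hs by (intro continuous_intros Dc) auto
      then obtain x1 where x1: "x1 \<in> K" "\<And>x. x \<in> K \<Longrightarrow> (\<Sum>j<m. \<bar>D (hs j) x\<bar>) \<le> (\<Sum>j<m. \<bar>D (hs j) x1\<bar>)"
        using continuous_attains_sup[OF c(2) False] by blast
      define B where "B = (\<Sum>j<m. \<bar>D (hs j) x1\<bar>) + 1"
      have B: "B > 0" unfolding B_def by (intro add_nonneg_pos sum_nonneg) auto
      \<comment> \<open>The room left at the point where the deviation is largest, divided by a
        bound for the sum of all derivatives of the family.\<close>
      define \<delta> where "\<delta> = (\<epsilon> - \<bar>D (?\<Phi> \<beta>) x0 - D f x0\<bar>) / B"
      have \<delta>: "\<delta> > 0" using \<beta> x0(1) B by (simp add: \<delta>_def)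
      show ?thesis
      proof (intro exI conjI subsetI CollectI ballI)
        show "open {\<alpha>. \<forall>j<m. \<bar>\<alpha> j - \<beta> j\<bar> < \<delta>}" by (rule open_box)
        show "\<beta> \<in> {\<alpha>. \<forall>j<m. \<bar>\<alpha> j - \<beta> j\<bar> < \<delta>}" using \<delta> by simp
        fix \<alpha> x assume \<alpha>: "\<alpha> \<in> {\<alpha>. \<forall>j<m. \<bar>\<alpha> j - \<beta> j\<bar> < \<delta>}" and x: "x \<in> K"
        have "D (?\<Phi> \<alpha>) x - D (?\<Phi> \<beta>) x = (\<Sum>j<m. (\<alpha> j - \<beta> j) * D (hs j) x)"
          unfolding lin[OF x] by (simp add: sum_subtractf left_diff_distrib)
        also have "\<bar>\<dots>\<bar> \<le> (\<Sum>j<m. \<delta> * \<bar>D (hs j) x\<bar>)"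
        proof (rule order_trans[OF sum_abs], rule sum_mono)
          fix j assume "j \<in> {..<m}"
          then show "\<bar>(\<alpha> j - \<beta> j) * D (hs j) x\<bar> \<le> \<delta> * \<bar>D (hs j) x\<bar>"
            using \<alpha> unfolding abs_mult by (intro mult_right_mono) (auto simp: less_imp_le)
        qed
        also have "\<dots> \<le> \<delta> * (B - 1)"
          unfolding sum_distrib_left[symmetric] B_def using \<delta> x1(2)[OF x] by (intro mult_left_mono) auto
        also have "\<dots> < \<delta> * B" using \<delta> by simp
        also have "\<dots> = \<epsilon> - \<bar>D (?\<Phi> \<beta>) x0 - D f x0\<bar>" using B by (simp add: \<delta>_def)
        finally show "\<bar>D (?\<Phi> \<alpha>) x - D f x\<bar> < \<epsilon>" using x0(2)[OF x] by linarith
      qed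
    qed auto
    then have "open {\<alpha>. \<forall>x\<in>K. \<bar>D (?\<Phi> \<alpha>) x - D f x\<bar> < \<epsilon>}" by (subst open_subopen) blast
    then show ?thesis unfolding eq .
  qed
  show ?thesis
    unfolding Cr_topology_def continuous_on_generated_topo_iff
  proof (intro conjI allI impI)
    fix U assume "U \<in> {Cr_basic_open n r A c K is f \<epsilon> | c K is f \<epsilon>.
        c \<in> A \<and> compact K \<and> K \<subseteq> fst c \<and> set is \<subseteq> {..<n} \<and> enat (length is) \<le> r \<and>
        f \<in> Cr_functions n r A \<and> \<epsilon> > 0}"
    then obtain c K "is" f \<epsilon> where U: "U = Cr_basic_open n r A c K is f \<epsilon>" "c \<in> A" "compact K" "K \<subseteq> fst c"
      "set is \<subseteq> {..<n}" "enat (length is) \<le> r" "f \<in> Cr_functions n r A" "\<epsilon> > 0" by blast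
    show "openin euclidean (?\<Phi> -` U \<inter> topspace euclidean)"
      using op[OF U(2-8)] unfolding U(1) by (simp add: vimage_def)
  next
    have "?\<Phi> ` topspace euclidean \<subseteq> topspace (Cr_topology n r A)" using Cr_functions_combination[of m hs, OF hs] by auto
    then show "?\<Phi> ` topspace euclidean \<subseteq> \<Union> {Cr_basic_open n r A c K is f \<epsilon> | c K is f \<epsilon>.
        c \<in> A \<and> compact K \<and> K \<subseteq> fst c \<and> set is \<subseteq> {..<n} \<and> enat (length is) \<le> r \<and>
        f \<in> Cr_functions n r A \<and> \<epsilon> > 0}"
      unfolding Cr_topology_def topology_generated_by_topspace .
  qed
qed

lemma Cr_functions_diff:
  "f \<in> Cr_functions n r A \<Longrightarrow> g \<in> Cr_functions n r A \<Longrightarrow> (\<lambda>x. f x - g x) \<in> Cr_functions n r A"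
  using Cr_functions_add[OF _ Cr_functions_mult[OF Cr_functions_const[of "-1"]], of f g] by simp

text \<open>The preimage of a basic open set around f is the basic open set around f - v. Continuity
  makes translations Borel, which is needed to move almost sure statements to the image
  measure.\<close>

lemma continuous_map_translation:
  assumes v: "v \<in> Cr_functions n r A"
  shows "continuous_map (Cr_topology n r A) (Cr_topology n r A) (\<lambda>e x. v x + e x)"
proof -
  have pre: "{e \<in> Cr_functions n r A. (\<lambda>x. v x + e x) \<in> Cr_basic_open n r A c K is f \<epsilon>} = Cr_basic_open n r A c K is (\<lambda>x. f x - v x) \<epsilon>"
    if c: "c \<in> A" "K \<subseteq> fst c" and "is": "set is \<subseteq> {..<n}" "enat (length is) \<le> r" and f: "f \<in> Cr_functions n r A" for c K "is" f \<epsilon>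
  proof -
    have Cl: "Ck_on n (length is) (chart_image c) (\<lambda>u. h (chart_inv c u))" if "h \<in> Cr_functions n r A" for h
      using Cr_onD[OF Cr_functionsD[OF that c(1)] "is"(2)] .
    have lin: "foldr partial_deriv is (\<lambda>u. a * h1 (chart_inv c u) + b * h2 (chart_inv c u)) u
        = a * foldr partial_deriv is (\<lambda>u. h1 (chart_inv c u)) u + b * foldr partial_deriv is (\<lambda>u. h2 (chart_inv c u)) u"
      if "h1 \<in> Cr_functions n r A" "h2 \<in> Cr_functions n r A" "u \<in> chart_image c" for h1 h2 u and a b :: real
    proof -
      have "foldr partial_deriv is (\<lambda>u. \<Sum>j\<in>{True, False}. (if j then a else b) * (if j then h1 else h2) (chart_inv c u)) u
        = (\<Sum>j\<in>{True, False}. (if j then a else b) * foldr partial_deriv is (\<lambda>u. (if j then h1 else h2) (chart_inv c u)) u)"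
        by (rule foldr_partial_deriv_combination[OF chart_image_open[OF c(1)] _ "is"(1) that(3)]) (use Cl that in auto)
      then show ?thesis by simp
    qed
    have key: "foldr partial_deriv is (\<lambda>u. v (chart_inv c u) + e (chart_inv c u)) u - foldr partial_deriv is (\<lambda>u. f (chart_inv c u)) u
        = foldr partial_deriv is (\<lambda>u. e (chart_inv c u)) u - foldr partial_deriv is (\<lambda>u. f (chart_inv c u) - v (chart_inv c u)) u"
      if "e \<in> Cr_functions n r A" "u \<in> chart_image c" for e u
      using lin[OF v that, of 1 1] lin[OF f v that(2), of 1 "-1"] by simp
    show ?thesis
      using key c Cr_functions_add[OF v] by (auto simp: Cr_basic_open_def o_def subset_iff)
  qed
  show ?thesis
    unfolding Cr_topology_def[of n r A] continuous_on_generated_topo_iff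
  proof (intro conjI allI impI)
    fix U assume "U \<in> {Cr_basic_open n r A c K is f \<epsilon> | c K is f \<epsilon>.
        c \<in> A \<and> compact K \<and> K \<subseteq> fst c \<and> set is \<subseteq> {..<n} \<and> enat (length is) \<le> r \<and>
        f \<in> Cr_functions n r A \<and> \<epsilon> > 0}"
    then obtain c K "is" f \<epsilon> where U: "U = Cr_basic_open n r A c K is f \<epsilon>" "c \<in> A" "compact K" "K \<subseteq> fst c"
      "set is \<subseteq> {..<n}" "enat (length is) \<le> r" "f \<in> Cr_functions n r A" "\<epsilon> > 0" by blast
    have "(\<lambda>e x. v x + e x) -` U \<inter> topspace (Cr_topology n r A) = Cr_basic_open n r A c K is (\<lambda>x. f x - v x) \<epsilon>"
      unfolding U(1) pre[OF U(2,4,5,6,7), symmetric] by auto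
    moreover have "openin (Cr_topology n r A) (Cr_basic_open n r A c K is (\<lambda>x. f x - v x) \<epsilon>)"
      using U v by (intro openin_Cr_basic Cr_functions_diff) auto
    ultimately show "openin (topology_generated_by {Cr_basic_open n r A c K is f \<epsilon> | c K is f \<epsilon>.
        c \<in> A \<and> compact K \<and> K \<subseteq> fst c \<and> set is \<subseteq> {..<n} \<and> enat (length is) \<le> r \<and>
        f \<in> Cr_functions n r A \<and> \<epsilon> > 0}) ((\<lambda>e x. v x + e x) -` U \<inter> topspace (topology_generated_by {Cr_basic_open n r A c K is f \<epsilon> | c K is f \<epsilon>.
        c \<in> A \<and> compact K \<and> K \<subseteq> fst c \<and> set is \<subseteq> {..<n} \<and> enat (length is) \<le> r \<and>
        f \<in> Cr_functions n r A \<and> \<epsilon> > 0}))"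
      unfolding Cr_topology_def[symmetric] by simp
  next
    have "(\<lambda>e x. v x + e x) ` topspace (Cr_topology n r A) \<subseteq> topspace (Cr_topology n r A)" using Cr_functions_add[OF v] by auto
    then show "(\<lambda>e x. v x + e x) ` topspace (topology_generated_by {Cr_basic_open n r A c K is f \<epsilon> | c K is f \<epsilon>.
        c \<in> A \<and> compact K \<and> K \<subseteq> fst c \<and> set is \<subseteq> {..<n} \<and> enat (length is) \<le> r \<and>
        f \<in> Cr_functions n r A \<and> \<epsilon> > 0}) \<subseteq> \<Union> {Cr_basic_open n r A c K is f \<epsilon> | c K is f \<epsilon>.
        c \<in> A \<and> compact K \<and> K \<subseteq> fst c \<and> set is \<subseteq> {..<n} \<and> enat (length is) \<le> r \<and>
        f \<in> Cr_functions n r A \<and> \<epsilon> > 0}"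
      unfolding Cr_topology_def topology_generated_by_topspace .
  qed
qed

text \<open>The witness for prevalence is the image of Lebesgue measure on the unit cube under the
  coefficient map; the image of the cube is a compact set of measure 1.\<close>

lemma prevalent_borel_probe:
  fixes hs :: "nat \<Rightarrow> 'a \<Rightarrow> real"
  assumes hs: "\<And>j. j < m \<Longrightarrow> hs j \<in> Cr_functions n r A" and B: "B \<in> borel_sets_of (Cr_topology n r A)"
    and ae: "\<And>v. v \<in> Cr_functions n r A \<Longrightarrow>
      AE \<alpha> in lebesgue_prod m. (\<forall>j<m. \<alpha> j \<in> {0..1}) \<longrightarrow> (\<lambda>x. v x + (\<Sum>j<m. \<alpha> j * hs j x)) \<in> B"
  shows "prevalent_borel (Cr_topology n r A) B"
proof -
  let ?\<Phi> = "\<lambda>\<alpha> x. \<Sum>j<m. \<alpha> j * hs j x"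
  let ?O = "{U. openin (Cr_topology n r A) U}"
  define N where "N = measure_of (topspace (Cr_topology n r A)) ?O (\<lambda>_. 0)"
  have OP: "?O \<subseteq> Pow (topspace (Cr_topology n r A))" using openin_subset by blast
  have N: "space N = topspace (Cr_topology n r A)" "sets N = borel_sets_of (Cr_topology n r A)"
    unfolding N_def borel_sets_of_def using OP by (auto simp: space_measure_of_conv sets_measure_of)
  \<comment> \<open>Replaces the value \<open>undefined\<close> beyond index m by 0, turning points
    of the product measure space into ordinary sequences, on which the coefficient map is known to
    be continuous.\<close>
  define \<iota> where "\<iota> \<alpha> = (\<lambda>j. if j < m then \<alpha> j else 0)" for \<alpha> :: "nat \<Rightarrow> real"
  have \<iota>: "\<iota> \<in> measurable (lebesgue_prod m) borel"
  proof (rule measurable_coordinatewise_then_product)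
    fix j show "(\<lambda>\<alpha>. \<iota> \<alpha> j) \<in> borel_measurable (lebesgue_prod m)"
      by (cases "j < m") (auto simp: \<iota>_def)
  qed
  have \<Phi>\<iota>: "?\<Phi> (\<iota> \<alpha>) = ?\<Phi> \<alpha>" for \<alpha> by (simp add: \<iota>_def)
  have \<Phi>C: "?\<Phi> \<alpha> \<in> topspace (Cr_topology n r A)" for \<alpha> using Cr_functions_combination[of m hs, OF hs] by simp
  have \<Phi>m: "?\<Phi> \<in> measurable (lebesgue_prod m) N"
    unfolding N_def
  proof (rule measurable_measure_of[OF OP])
    fix U assume "U \<in> ?O"
    then have "openin euclidean {x \<in> topspace euclidean. ?\<Phi> x \<in> U}"
      by (intro openin_continuous_map_preimage[OF continuous_map_combination[OF hs]]) auto
    then have "?\<Phi> -` U \<in> sets borel" by (simp add: vimage_def)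
    from measurable_sets[OF \<iota> this]
    show "?\<Phi> -` U \<inter> space (lebesgue_prod m) \<in> sets (lebesgue_prod m)"
      by (simp add: vimage_comp[symmetric] vimage_def \<Phi>\<iota>)
  qed (use \<Phi>C in auto)
  let ?Q = "Pi\<^sub>E {..<m} (\<lambda>_. {0..1::real})"
  have Qm: "?Q \<in> sets (lebesgue_prod m)" by (intro sets_PiM_I_finite) auto
  define L where "L = restrict_space (lebesgue_prod m) ?Q"
  have Qs: "?Q \<inter> space (lebesgue_prod m) = ?Q" by (auto simp: space_PiM PiE_iff)
  have \<Phi>L: "?\<Phi> \<in> measurable L N" unfolding L_def by (rule measurable_restrict_space1[OF \<Phi>m])
  define \<nu> where "\<nu> = distr L N ?\<Phi>"
  have spL: "space L = ?Q" unfolding L_def space_restrict_space by (rule Qs)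
  define K where "K = ?\<Phi> ` {y \<in> Rn m. \<forall>i<m. 0 \<le> y i \<and> y i \<le> 1}"
  have Kc: "compactin (Cr_topology n r A) K"
    unfolding K_def by (rule image_compactin[OF _ continuous_map_combination[OF hs]]) (use compact_box[of m "\<lambda>_. 0" "\<lambda>_. 1"] in auto)
  \<comment> \<open>Closedness puts K among the Borel sets, so that the image measure can be
    evaluated on it.\<close>
  have "closedin (Cr_topology n r A) K" using Kc Hausdorff_Cr_topology by (rule compactin_imp_closedin[rotated])
  then have "openin (Cr_topology n r A) (topspace (Cr_topology n r A) - K)" "K \<subseteq> topspace (Cr_topology n r A)" by (auto simp: closedin_def)
  then have "topspace (Cr_topology n r A) - (topspace (Cr_topology n r A) - K) \<in> borel_sets_of (Cr_topology n r A)"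
    unfolding borel_sets_of_def by (intro sigma_sets.Compl sigma_sets.Basic) auto
  then have KB: "K \<in> sets N" using \<open>K \<subseteq> topspace (Cr_topology n r A)\<close> N by (simp add: double_diff)
  have "?\<Phi> \<alpha> \<in> K" if "\<alpha> \<in> ?Q" for \<alpha>
    unfolding K_def \<Phi>\<iota>[of \<alpha>, symmetric] using that by (intro imageI) (auto simp: \<iota>_def in_Rn PiE_iff)
  then have "?\<Phi> -` K \<inter> space L = ?Q" using spL by auto
  then have "emeasure \<nu> K = emeasure L ?Q"
    unfolding \<nu>_def using emeasure_distr[OF \<Phi>L KB] by simp
  also have "\<dots> = emeasure (lebesgue_prod m) ?Q"
    unfolding L_def by (subst emeasure_restrict_space) (use Qm Qs in auto)
  also have "\<dots> = 1" by (subst emeasure_lebesgue_prod_box) auto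
  finally have K1: "emeasure \<nu> K = 1" .
  have "AE e in \<nu>. v + e \<in> B" if v: "v \<in> topspace (Cr_topology n r A)" for v
  proof -
    have v': "v \<in> Cr_functions n r A" using v by simp
    have t: "(\<lambda>e x. v x + e x) \<in> measurable N N"
      unfolding N_def
    proof (rule measurable_measure_of[OF OP])
      fix U assume U: "U \<in> ?O"
      then have "openin (Cr_topology n r A) {x \<in> topspace (Cr_topology n r A). (\<lambda>z. v z + x z) \<in> U}"
        by (intro openin_continuous_map_preimage[OF continuous_map_translation[OF v']]) auto
      moreover have "{x \<in> topspace (Cr_topology n r A). (\<lambda>z. v z + x z) \<in> U} = (\<lambda>e x. v x + e x) -` U \<inter> space (measure_of (topspace (Cr_topology n r A)) ?O (\<lambda>_. 0))"
        by (auto simp: space_measure_of_conv)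
      ultimately show "(\<lambda>e x. v x + e x) -` U \<inter> space (measure_of (topspace (Cr_topology n r A)) ?O (\<lambda>_. 0)) \<in> sets (measure_of (topspace (Cr_topology n r A)) ?O (\<lambda>_. 0))"
        using OP by (auto simp: sets_measure_of)
    qed (use Cr_functions_add[OF v'] in \<open>auto simp: space_measure_of_conv\<close>)
    have plus: "v + e = (\<lambda>x. v x + e x)" for e by (simp add: fun_eq_iff)
    have "{e \<in> space N. v + e \<in> B} = (\<lambda>e x. v x + e x) -` B \<inter> space N" unfolding plus by auto
    then have "{e \<in> space N. v + e \<in> B} \<in> sets N" using measurable_sets[OF t, of B] B N(2) by simp
    moreover have "AE \<alpha> in L. v + ?\<Phi> \<alpha> \<in> B"
      unfolding L_def AE_restrict_space_iff[of ?Q "lebesgue_prod m", unfolded Qs, OF Qm] plus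
      using ae[OF v'] by eventually_elim (auto simp: PiE_iff)
    ultimately show ?thesis unfolding \<nu>_def by (subst AE_distr_iff[OF \<Phi>L])
  qed
  moreover have "space \<nu> = topspace (Cr_topology n r A)" "sets \<nu> = borel_sets_of (Cr_topology n r A)" using N by (auto simp: \<nu>_def)
  ultimately show ?thesis
    unfolding prevalent_borel_def using B Kc K1
    by (intro conjI exI[of _ \<nu>] exI[of _ K]) auto
qed

end

section \<open>Regular points of delay coordinate maps\<close>

text \<open>Local almost sure statements have exceptional sets depending on the neighbourhood;
  countably many neighbourhoods suffice by the Lindelof property. It is a hypothesis here so that
  the lemma serves both the manifold and the space of directions.\<close>

lemma AE_countable_cover:
  fixes S :: "'b::topological_space set"
  assumes Lindelof: "\<And>F :: 'b set set. (\<forall>U\<in>F. open U) \<Longrightarrow> \<exists>F'. F' \<subseteq> F \<and> countable F' \<and> \<Union>F' = \<Union>F"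
    and loc: "\<And>y. y \<in> S \<Longrightarrow> \<exists>N. open N \<and> y \<in> N \<and> (AE \<alpha> in M. \<forall>y\<in>N \<inter> S. P \<alpha> y)"
  shows "AE \<alpha> in M. \<forall>y\<in>S. P \<alpha> y"
proof -
  define F where "F = {N. open N \<and> (AE \<alpha> in M. \<forall>y\<in>N \<inter> S. P \<alpha> y)}"
  obtain F' where F': "F' \<subseteq> F" "countable F'" "\<Union>F' = \<Union>F" using Lindelof[of F] by (auto simp: F_def)
  have "AE \<alpha> in M. \<forall>N\<in>F'. \<forall>y\<in>N \<inter> S. P \<alpha> y"
  proof (rule AE_ball_countable'[OF _ F'(2)])
    fix N assume "N \<in> F'"
    then have "N \<in> F" using F'(1) by blast
    then show "AE \<alpha> in M. \<forall>y\<in>N \<inter> S. P \<alpha> y" unfolding F_def by blast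
  qed
  moreover have "S \<subseteq> \<Union>F'" unfolding F'(3) F_def using loc by blast
  ultimately show ?thesis by (elim AE_mp) (intro AE_I2, blast)
qed

lemma Lindelof_nat_real:
  fixes F :: "(nat \<Rightarrow> real) set set"
  assumes "\<forall>U\<in>F. open U"
  shows "\<exists>F'. F' \<subseteq> F \<and> countable F' \<and> \<Union>F' = \<Union>F"
proof -
  obtain F' where "F' \<subseteq> F" "countable F'" "\<Union>F' = \<Union>F" by (rule Lindelof[of F]) (use assms in blast)
  then show ?thesis by blast
qed

context compact_Riemannian_manifold
begin

text \<open>Each chart image is a subset of a second countable space, and finitely many charts cover
  the manifold.\<close>

lemma manifold_Lindelof:
  fixes F :: "'a set set"
  assumes F: "\<forall>U\<in>F. open U"
  shows "\<exists>F'. F' \<subseteq> F \<and> countable F' \<and> \<Union>F' = \<Union>F"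
proof -
  have chart: "\<exists>F'. F' \<subseteq> F \<and> countable F' \<and> fst c \<inter> \<Union>F \<subseteq> \<Union>F'" if c: "c \<in> A" for c
  proof -
    define G where "G = (\<lambda>U. snd c ` (fst c \<inter> U)) ` F"
    have "openin (top_of_set (Rn n)) S" if "S \<in> G" for S
      using that chart_image_of_open(1)[OF c] F unfolding G_def openin_Rn_top_of_set by blast
    then obtain G' where G': "G' \<subseteq> G" "countable G'" "\<Union>G' = \<Union>G" by (rule Lindelof_openin)
    obtain F' where F': "F' \<subseteq> F" "countable F'" "G' = (\<lambda>U. snd c ` (fst c \<inter> U)) ` F'"
      using G'(1,2) unfolding G_def by (metis countable_subset_image)
    have "fst c \<inter> \<Union>F \<subseteq> \<Union>F'"
    proof
      fix x assume x: "x \<in> fst c \<inter> \<Union>F"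
      then have "snd c x \<in> \<Union>G" by (auto simp: G_def)
      then obtain U y where U: "U \<in> F'" "y \<in> fst c \<inter> U" "snd c x = snd c y" using G'(3) F'(3) by blast
      then have "x = y" using x c chart_inv_snd[OF c] by (metis IntD1)
      then show "x \<in> \<Union>F'" using U by blast
    qed
    then show ?thesis using F' by blast
  qed
  obtain P K C where P: "finite (P :: 'a set)" "UNIV = (\<Union>p\<in>P. K p)" "\<And>p. compact (K p :: 'a set)"
    "\<And>p. C p \<in> A" "\<And>p. K p \<subseteq> fst (C p)" using finite_compact_chart_cover by blast
  have "\<forall>p. \<exists>F'. F' \<subseteq> F \<and> countable F' \<and> fst (C p) \<inter> \<Union>F \<subseteq> \<Union>F'" using chart P(4) by blast
  from choice[OF this] obtain F' where "\<forall>p. F' p \<subseteq> F \<and> countable (F' p) \<and> fst (C p) \<inter> \<Union>F \<subseteq> \<Union>(F' p)" by (rule exE)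
  then have F': "F' p \<subseteq> F" "countable (F' p)" "fst (C p) \<inter> \<Union>F \<subseteq> \<Union>(F' p)" for p by simp_all
  have sub: "(\<Union>p\<in>P. F' p) \<subseteq> F" using F'(1) by blast
  have "\<Union>F \<subseteq> \<Union>(\<Union>p\<in>P. F' p)"
  proof
    fix x assume x: "x \<in> \<Union>F"
    obtain p where p: "p \<in> P" "x \<in> K p" using P(2) by blast
    then have "x \<in> fst (C p) \<inter> \<Union>F" using P(5)[of p] x by blast
    then show "x \<in> \<Union>(\<Union>p\<in>P. F' p)" using F'(3)[of p] p(1) by blast
  qed
  moreover have "countable (\<Union>p\<in>P. F' p)" using P(1) F'(2) by (intro countable_UN) (auto intro: countable_finite)
  ultimately show ?thesis using sub by (intro exI[of _ "\<Union>p\<in>P. F' p"]) blast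
qed

text \<open>A dense subset of Y itself is required, so density is pulled back from the chart images
  of the parts of Y.\<close>

lemma manifold_separable:
  fixes Y :: "'a set"
  obtains D where "countable D" "D \<subseteq> Y" "Y \<subseteq> closure D"
proof -
  have chart: "\<exists>D. countable D \<and> D \<subseteq> Y \<and> fst c \<inter> Y \<subseteq> closure D" if c: "c \<in> A" for c
  proof -
    obtain T where T: "countable T" "T \<subseteq> snd c ` (fst c \<inter> Y)" "snd c ` (fst c \<inter> Y) \<subseteq> closure T"
      by (rule separable)
    have "chart_inv c ` T \<subseteq> Y" using T(2) c by auto
    moreover have "fst c \<inter> Y \<subseteq> closure (chart_inv c ` T)"
    proof
      fix y assume y: "y \<in> fst c \<inter> Y"
      show "y \<in> closure (chart_inv c ` T)"
        unfolding closure_iff_nhds_not_empty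
      proof (intro allI impI)
        fix B V assume V: "V \<subseteq> B" "y \<in> V" "open V"
        note W = chart_image_of_open[OF c V(3)]
        obtain V' where V': "open V'" "snd c ` (fst c \<inter> V) = Rn n \<inter> V'"
          using W(1) by (auto simp: openin_Rn_top_of_set openin_open)
        have "snd c y \<in> V' \<inter> closure T" using V' y V(2) T(3) by blast
        then have "V' \<inter> T \<noteq> {}" using V'(1) open_Int_closure_eq_empty[of V' T] by blast
        then obtain u where u: "u \<in> V'" "u \<in> T" by blast
        have uc: "u \<in> chart_image c" using T(2) u(2) c by auto
        then have "u \<in> snd c ` (fst c \<inter> V)" using V'(2) u(1) chart_image_Rn[OF c] by blast
        then have "chart_inv c u \<in> V" using W(2) by blast
        then show "chart_inv c ` T \<inter> B \<noteq> {}" using u(2) V(1) by blast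
      qed
    qed
    ultimately show ?thesis using T(1) by (intro exI[of _ "chart_inv c ` T"]) auto
  qed
  obtain P K C where P: "finite (P :: 'a set)" "UNIV = (\<Union>p\<in>P. K p)" "\<And>p. compact (K p :: 'a set)"
    "\<And>p. C p \<in> A" "\<And>p. K p \<subseteq> fst (C p)" using finite_compact_chart_cover by blast
  have "\<forall>p. \<exists>D. countable D \<and> D \<subseteq> Y \<and> fst (C p) \<inter> Y \<subseteq> closure D" using chart P(4) by blast
  from choice[OF this] obtain D where "\<forall>p. countable (D p) \<and> D p \<subseteq> Y \<and> fst (C p) \<inter> Y \<subseteq> closure (D p)" by (rule exE)
  then have D: "countable (D p)" "D p \<subseteq> Y" "fst (C p) \<inter> Y \<subseteq> closure (D p)" for p by simp_all
  show ?thesis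
  proof (rule that[of "\<Union>p\<in>P. D p"])
    show "countable (\<Union>p\<in>P. D p)" using P(1) D(1) by (intro countable_UN) (auto intro: countable_finite)
    show "(\<Union>p\<in>P. D p) \<subseteq> Y" using D(2) by blast
    show "Y \<subseteq> closure (\<Union>p\<in>P. D p)"
    proof
      fix y assume y: "y \<in> Y"
      obtain p where p: "p \<in> P" "y \<in> K p" using P(2) by blast
      then have "y \<in> closure (D p)" using P(5)[of p] D(3)[of p] y by blast
      moreover have "closure (D p) \<subseteq> closure (\<Union>p\<in>P. D p)" using p(1) by (intro closure_mono) blast
      ultimately show "y \<in> closure (\<Union>p\<in>P. D p)" by blast
    qed
  qed
qed

section \<open>The Lipschitz bound at a point\<close>

definition delay_dist :: "('a \<Rightarrow> 'a) \<Rightarrow> nat \<Rightarrow> ('a \<Rightarrow> real) \<Rightarrow> 'a \<Rightarrow> 'a \<Rightarrow> real" where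
  "delay_dist T k h x y = L2_set (\<lambda>l. h ((T ^^ l) x) - h ((T ^^ l) y)) {..<k}"

lemma euclidean_norm_delay: "euclidean_norm k (delay_map T h k x - delay_map T h k y) = delay_dist T k h x y"
  unfolding euclidean_norm_def delay_dist_def by (rule L2_set_cong) (auto simp: delay_map_def)

lemma delay_dist_nonneg: "delay_dist T k h x y \<ge> 0"
  by (simp add: delay_dist_def)

lemma delay_dist_component: "l < k \<Longrightarrow> \<bar>h ((T ^^ l) x) - h ((T ^^ l) y)\<bar> \<le> delay_dist T k h x y"
  unfolding delay_dist_def L2_set_def
  by (rule real_le_rsqrt) (simp add: member_le_sum[of l "{..<k}" "\<lambda>l. (h ((T ^^ l) x) - h ((T ^^ l) y))\<^sup>2"])

lemma delay_dist_perturb: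
  assumes "\<And>z. \<bar>h' z - h z\<bar> \<le> \<eta>"
  shows "delay_dist T k h' x y \<le> delay_dist T k h x y + 2 * real k * \<eta>"
proof -
  let ?d = "\<lambda>l. (h' ((T ^^ l) x) - h ((T ^^ l) x)) - (h' ((T ^^ l) y) - h ((T ^^ l) y))"
  have "delay_dist T k h' x y = L2_set (\<lambda>l. (h ((T ^^ l) x) - h ((T ^^ l) y)) + ?d l) {..<k}"
    unfolding delay_dist_def by (rule L2_set_cong) auto
  also have "\<dots> \<le> delay_dist T k h x y + L2_set ?d {..<k}"
    unfolding delay_dist_def by (rule L2_set_triangle_ineq)
  also have "L2_set ?d {..<k} \<le> (\<Sum>l<k. \<bar>?d l\<bar>)" by (rule L2_set_le_sum_abs)
  also have "\<dots> \<le> (\<Sum>l<k. 2 * \<eta>)"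
  proof (rule sum_mono)
    fix l
    show "\<bar>?d l\<bar> \<le> 2 * \<eta>" using assms[of "(T ^^ l) x"] assms[of "(T ^^ l) y"] by linarith
  qed
  finally show ?thesis by simp
qed

lemma funpow_continuous:
  fixes T :: "'a \<Rightarrow> 'a"
  shows "continuous_on UNIV T \<Longrightarrow> continuous_on UNIV (T ^^ l)"
  by (induction l) (auto intro: continuous_on_compose2[of UNIV T UNIV] simp: o_def)

lemma delay_dist_continuous:
  assumes "continuous_on UNIV T" "continuous_on UNIV h"
  shows "continuous_on UNIV (\<lambda>x. delay_dist T k h x y)" "continuous_on UNIV (\<lambda>y. delay_dist T k h x y)"
  unfolding delay_dist_def L2_set_def
  by (intro continuous_intros continuous_on_compose2[OF assms(2) funpow_continuous[OF assms(1)]]; simp)+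

lemma rho_continuous_fst: "continuous_on UNIV (\<lambda>x. \<rho> x y)" and rho_continuous_snd: "continuous_on UNIV (\<lambda>y. \<rho> x y)"
proof -
  have "continuous_on UNIV (\<lambda>x. (x, y))" "continuous_on UNIV (\<lambda>y. (x, y))"
    by (intro continuous_on_Pair continuous_on_id continuous_on_const)+
  from this[THEN continuous_on_compose2[OF rho_continuous]]
  show "continuous_on UNIV (\<lambda>x. \<rho> x y)" "continuous_on UNIV (\<lambda>y. \<rho> x y)" by simp_all
qed

text \<open>The property on which everything turns. Y is the given compact set X for statement (1)
  and the whole manifold when k exceeds the dimension.\<close>

definition delay_regular :: "('a \<Rightarrow> 'a) \<Rightarrow> nat \<Rightarrow> 'a set \<Rightarrow> ('a \<Rightarrow> real) \<Rightarrow> 'a \<Rightarrow> bool" where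
  "delay_regular T k Y h x \<longleftrightarrow> (\<exists>C\<ge>0. \<forall>y\<in>Y. \<rho> x y \<le> C * delay_dist T k h x y)"

text \<open>Integer constants turn the existential quantifier into a countable union.\<close>

lemma delay_regular_nat: "delay_regular T k Y h x \<longleftrightarrow> (\<exists>C::nat. \<forall>y\<in>Y. \<rho> x y \<le> C * delay_dist T k h x y)"
proof
  assume "delay_regular T k Y h x"
  then obtain C where C: "\<forall>y\<in>Y. \<rho> x y \<le> C * delay_dist T k h x y" unfolding delay_regular_def by blast
  obtain N :: nat where N: "C \<le> N" using real_arch_simple by blast
  have "\<rho> x y \<le> N * delay_dist T k h x y" if "y \<in> Y" for y
    using C that mult_right_mono[OF N delay_dist_nonneg] by (meson order_trans)
  then show "\<exists>C::nat. \<forall>y\<in>Y. \<rho> x y \<le> C * delay_dist T k h x y" by blast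
qed (auto simp: delay_regular_def intro: exI[of _ "real _"])

text \<open>For a fixed constant the measure of the set of good points is upper semicontinuous in h,
  so the observables for which it is at least a given number form a closed set. Almost sure
  regularity is a countable intersection of countable unions of such sets.\<close>

lemma delay_regular_borel:
  fixes \<mu> :: "'a measure"
  assumes T: "continuous_on UNIV T" and \<mu>: "prob_space \<mu>" "sets \<mu> = sets (restrict_space borel X)"
  shows "{h \<in> Cr_functions n r A. AE x in \<mu>. delay_regular T k Y h x} \<in> borel_sets_of (Cr_topology n r A)"
proof -
  interpret prob_space \<mu> by fact
  have sp: "space \<mu> = X" using sets_eq_imp_space_eq[OF \<mu>(2)] by (simp add: space_restrict_space)
  \<comment> \<open>The slack \<delta> absorbs a perturbation of h; without slack the set for a
    perturbed observable could not be compared with that of h.\<close>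
  define S where "S C \<delta> h = X \<inter> {x. \<forall>y\<in>Y. \<rho> x y \<le> C * delay_dist T k h x y + \<delta>}" for C \<delta> :: real and h
  have Sm: "S C \<delta> h \<in> sets \<mu>" if h: "h \<in> Cr_functions n r A" for C \<delta> h
  proof -
    have "{x. \<forall>y\<in>Y. \<rho> x y \<le> C * delay_dist T k h x y + \<delta>} = (\<Inter>y\<in>Y. {x. \<rho> x y \<le> C * delay_dist T k h x y + \<delta>})" by auto
    moreover have "closed {x. \<rho> x y \<le> C * delay_dist T k h x y + \<delta>}" for y
      by (intro closed_Collect_le continuous_intros rho_continuous_fst delay_dist_continuous[OF T Cr_functions_continuous[OF h]])
    ultimately have "closed {x. \<forall>y\<in>Y. \<rho> x y \<le> C * delay_dist T k h x y + \<delta>}" by (simp add: closed_INT)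
    then show ?thesis unfolding \<mu>(2) S_def sets_restrict_space by (intro imageI) simp
  qed
  \<comment> \<open>As the slack tends to 0 the sets decrease to the one without slack, so some
    positive slack still keeps the measure below c; a uniformly small change of h uses up no more
    than this slack.\<close>
  have op: "openin (Cr_topology n r A) {h \<in> Cr_functions n r A. measure \<mu> (S C 0 h) < c}" if C: "C \<ge> 0" for C c
  proof (subst openin_subopen, intro ballI)
    fix h assume "h \<in> {h \<in> Cr_functions n r A. measure \<mu> (S C 0 h) < c}"
    then have h: "h \<in> Cr_functions n r A" "measure \<mu> (S C 0 h) < c" by auto
    have "(\<lambda>p. measure \<mu> (S C (1 / Suc p) h)) \<longlonglongrightarrow> measure \<mu> (\<Inter>p. S C (1 / Suc p) h)"
    proof (rule finite_Lim_measure_decseq)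
      show "decseq (\<lambda>p. S C (1 / Suc p) h)"
        unfolding decseq_def S_def
      proof (intro allI impI subsetI)
        fix p q x assume pq: "p \<le> q" and x: "x \<in> X \<inter> {x. \<forall>y\<in>Y. \<rho> x y \<le> C * delay_dist T k h x y + 1 / real (Suc q)}"
        have "1 / real (Suc q) \<le> 1 / real (Suc p)" using pq by (intro divide_left_mono) auto
        then show "x \<in> X \<inter> {x. \<forall>y\<in>Y. \<rho> x y \<le> C * delay_dist T k h x y + 1 / real (Suc p)}" using x by force
      qed
    qed (use Sm[OF h(1)] in auto)
    moreover have "(\<Inter>p. S C (1 / Suc p) h) = S C 0 h"
    proof
      show "(\<Inter>p. S C (1 / Suc p) h) \<subseteq> S C 0 h"
      proof
        fix x assume x: "x \<in> (\<Inter>p. S C (1 / Suc p) h)"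
        have "\<rho> x y \<le> C * delay_dist T k h x y + 0" if "y \<in> Y" for y
        proof (rule field_le_epsilon)
          fix e :: real assume "e > 0"
          then obtain p where p: "1 / Suc p < e" using nat_approx_posE by blast
          have "\<rho> x y \<le> C * delay_dist T k h x y + 1 / Suc p" using x that by (auto simp: S_def)
          then show "\<rho> x y \<le> C * delay_dist T k h x y + 0 + e" using p by linarith
        qed
        then show "x \<in> S C 0 h" using x by (auto simp: S_def)
      qed
      show "S C 0 h \<subseteq> (\<Inter>p. S C (1 / Suc p) h)" by (auto simp: S_def intro: order_trans)
    qed
    ultimately have "(\<lambda>p. measure \<mu> (S C (1 / Suc p) h)) \<longlonglongrightarrow> measure \<mu> (S C 0 h)" by simp
    from order_tendstoD(2)[OF this h(2)] obtain p where p: "measure \<mu> (S C (1 / Suc p) h) < c"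
      by (auto simp: eventually_sequentially)
    \<comment> \<open>A uniform change by \<eta> alters C times the delay distance by at most 2 k C
      \<eta>, which must not exceed the slack 1 / (p + 1). The added 1 covers C = 0.\<close>
    define \<eta> where "\<eta> = (1 / Suc p) / (2 * k * C + 1)"
    have \<eta>: "\<eta> > 0" "C * (2 * k * \<eta>) \<le> 1 / Suc p"
    proof -
      have pos: "2 * k * C + 1 > 0" using C by (simp add: add_nonneg_pos)
      then show "\<eta> > 0" by (simp add: \<eta>_def)
      have "C * (2 * k * \<eta>) = (2 * k * C) * \<eta>" by simp
      also have "\<dots> \<le> (2 * k * C + 1) * \<eta>" using \<open>\<eta> > 0\<close> by (intro mult_right_mono) auto
      also have "\<dots> = 1 / Suc p" using pos by (simp add: \<eta>_def)
      finally show "C * (2 * k * \<eta>) \<le> 1 / Suc p" .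
    qed
    obtain V where V: "openin (Cr_topology n r A) V" "h \<in> V" "\<And>h' x. h' \<in> V \<Longrightarrow> \<bar>h' x - h x\<bar> < \<eta>"
      using sup_neighbourhood[OF h(1) \<eta>(1)] by blast
    have "V \<subseteq> {h \<in> Cr_functions n r A. measure \<mu> (S C 0 h) < c}"
    proof
      fix h' assume h': "h' \<in> V"
      then have h'C: "h' \<in> Cr_functions n r A" using openin_subset[OF V(1)] by auto
      have "S C 0 h' \<subseteq> S C (1 / Suc p) h"
      proof
        fix x assume x: "x \<in> S C 0 h'"
        have "\<rho> x y \<le> C * delay_dist T k h x y + 1 / Suc p" if "y \<in> Y" for y
        proof -
          have "\<rho> x y \<le> C * delay_dist T k h' x y" using x that by (auto simp: S_def)
          also have "\<dots> \<le> C * (delay_dist T k h x y + 2 * real k * \<eta>)"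
            using V(3)[OF h'] C by (intro mult_left_mono delay_dist_perturb) (auto simp: less_imp_le)
          also have "\<dots> \<le> C * delay_dist T k h x y + 1 / Suc p" using \<eta>(2) by (simp add: distrib_left)
          finally show ?thesis .
        qed
        then show "x \<in> S C (1 / Suc p) h" using x by (auto simp: S_def)
      qed
      then have "measure \<mu> (S C 0 h') \<le> measure \<mu> (S C (1 / Suc p) h)"
        using Sm[OF h(1)] by (rule finite_measure_mono)
      then show "h' \<in> {h \<in> Cr_functions n r A. measure \<mu> (S C 0 h) < c}" using p h'C by simp
    qed
    then show "\<exists>V. openin (Cr_topology n r A) V \<and> h \<in> V \<and> V \<subseteq> {h \<in> Cr_functions n r A. measure \<mu> (S C 0 h) < c}"
      using V by blast
  qed
  \<comment> \<open>The continuity of the measure along increasing constants gives, for each q, a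
    constant that works up to measure 1 / (q + 1).\<close>
  define B where "B q C = {h \<in> Cr_functions n r A. measure \<mu> (S (real C) 0 h) \<ge> 1 - 1 / Suc q}" for q C :: nat
  interpret sa: sigma_algebra "topspace (Cr_topology n r A)" "borel_sets_of (Cr_topology n r A)"
    unfolding borel_sets_of_def by (rule sigma_algebra_sigma_sets) (use openin_subset in blast)
  have Bm: "B q C \<in> borel_sets_of (Cr_topology n r A)" for q C
  proof -
    have "B q C = topspace (Cr_topology n r A) - {h \<in> Cr_functions n r A. measure \<mu> (S (real C) 0 h) < 1 - 1 / Suc q}"
      by (auto simp: B_def)
    moreover have "{h \<in> Cr_functions n r A. measure \<mu> (S (real C) 0 h) < 1 - 1 / Suc q} \<in> borel_sets_of (Cr_topology n r A)"
      unfolding borel_sets_of_def by (intro sigma_sets.Basic CollectI op) simp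
    ultimately show ?thesis by (simp add: sa.compl_sets del: topspace_Cr_topology)
  qed
  have "(\<Inter>q. \<Union>C. B q C) \<in> borel_sets_of (Cr_topology n r A)" using Bm by (intro sa.countable_INT sa.countable_UN) auto
  moreover have "(\<Inter>q. \<Union>C. B q C) = {h \<in> Cr_functions n r A. AE x in \<mu>. delay_regular T k Y h x}"
  proof (rule set_eqI)
    fix h
    show "h \<in> (\<Inter>q. \<Union>C. B q C) \<longleftrightarrow> h \<in> {h \<in> Cr_functions n r A. AE x in \<mu>. delay_regular T k Y h x}"
    proof (cases "h \<in> Cr_functions n r A")
      case True
      let ?E = "\<Union>C::nat. S (real C) 0 h"
      have Em: "?E \<in> events" using Sm[OF True] by blast
      have "(AE x in \<mu>. delay_regular T k Y h x) \<longleftrightarrow> (AE x in \<mu>. x \<in> ?E)"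
        by (rule AE_cong) (auto simp: delay_regular_nat S_def sp)
      also have "\<dots> \<longleftrightarrow> prob ?E = 1" by (rule AE_in_set_eq_1[OF Em])
      also have "\<dots> \<longleftrightarrow> (\<forall>q. \<exists>C::nat. prob (S (real C) 0 h) \<ge> 1 - 1 / Suc q)"
      proof
        assume 1: "prob ?E = 1"
        have "(\<lambda>C. prob (S (real C) 0 h)) \<longlonglongrightarrow> prob ?E"
        proof (rule finite_Lim_measure_incseq)
          show "incseq (\<lambda>C. S (real C) 0 h)"
            unfolding incseq_def S_def
          proof (intro allI impI subsetI)
            fix p q :: nat and x assume pq: "p \<le> q" and x: "x \<in> X \<inter> {x. \<forall>y\<in>Y. \<rho> x y \<le> real p * delay_dist T k h x y + 0}"
            have "real p * delay_dist T k h x y \<le> real q * delay_dist T k h x y" for y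
              using pq delay_dist_nonneg by (intro mult_right_mono) auto
            then show "x \<in> X \<inter> {x. \<forall>y\<in>Y. \<rho> x y \<le> real q * delay_dist T k h x y + 0}" using x by (force intro: order_trans)
          qed
        qed (use Sm[OF True] in auto)
        then have lim: "(\<lambda>C. prob (S (real C) 0 h)) \<longlonglongrightarrow> 1" using 1 by simp
        show "\<forall>q. \<exists>C::nat. prob (S (real C) 0 h) \<ge> 1 - 1 / Suc q"
        proof
          fix q
          have "1 - 1 / real (Suc q) < 1" by simp
          from order_tendstoD(1)[OF lim this] show "\<exists>C::nat. prob (S (real C) 0 h) \<ge> 1 - 1 / Suc q"
            by (auto simp: eventually_sequentially intro: less_imp_le)
        qed
      next
        assume H: "\<forall>q. \<exists>C::nat. prob (S (real C) 0 h) \<ge> 1 - 1 / Suc q"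
        have "1 \<le> prob ?E"
        proof (rule field_le_epsilon)
          fix e :: real assume "e > 0"
          then obtain q where q: "1 / Suc q < e" using nat_approx_posE by blast
          obtain C :: nat where "prob (S (real C) 0 h) \<ge> 1 - 1 / Suc q" using H by blast
          moreover have "prob (S (real C) 0 h) \<le> prob ?E" using Em by (intro finite_measure_mono) auto
          ultimately show "1 \<le> prob ?E + e" using q by linarith
        qed
        then show "prob ?E = 1" using prob_le_1[of ?E] by linarith
      qed
      also have "\<dots> \<longleftrightarrow> h \<in> (\<Inter>q. \<Union>C. B q C)" using True by (auto simp: B_def)
      finally show ?thesis using True by simp
    qed (auto simp: B_def)
  qed
  ultimately show ?thesis by simp
qed

text \<open>Near x the first order expansion dominates, and the differential is bounded below on the
  sup-norm sphere by compactness. Away from x the delay distance has a positive minimum on the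
  compact rest of Y.\<close>

lemma delay_regularI:
  assumes h: "h \<in> Cr_functions n r A" and T: "Cr_between n n r UNIV A UNIV A T" and Y: "closed Y"
    and c: "c \<in> A" "x \<in> fst c" and k: "k \<ge> 1"
    and inj: "\<And>y. y \<in> Y \<Longrightarrow> y \<noteq> x \<Longrightarrow> \<exists>l<k. h ((T ^^ l) x) \<noteq> h ((T ^^ l) y)"
    and imm: "\<And>v. \<exists>i<n. v i \<noteq> 0 \<Longrightarrow> \<exists>l<k. dir_deriv n c (\<lambda>z. h ((T ^^ l) z)) x v \<noteq> 0"
  shows "delay_regular T k Y h x"
proof -
  have Tc: "continuous_on UNIV T" using T by (simp add: Cr_between_def)
  define H where "H l = (\<lambda>z. h ((T ^^ l) z))" for l
  have HC: "H l \<in> Cr_functions n r A" for l unfolding H_def by (rule Cr_functions_funpow[OF T h])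
  let ?d = "delay_dist T k h x"
  let ?u = "snd c x"
  obtain N C0 where N: "open N" "x \<in> N" "N \<subseteq> fst c" "C0 \<ge> 0"
    "\<And>y y' \<eta>. y \<in> N \<Longrightarrow> y' \<in> N \<Longrightarrow> \<eta> \<ge> 0 \<Longrightarrow> (\<And>i. i < n \<Longrightarrow> \<bar>snd c y i - snd c y' i\<bar> \<le> \<eta>) \<Longrightarrow>
       path_distance n A g y y' < \<infinity> \<and> \<rho> y y' \<le> C0 * \<eta>" using rho_upper[OF c] by blast
  let ?S = "{v \<in> Rn n. (\<forall>i<n. \<bar>v i\<bar> \<le> 1) \<and> (\<exists>i<n. \<bar>v i\<bar> = 1)}"
  define G where "G v = (\<Sum>l<k. \<bar>dir_deriv n c (H l) x v\<bar>)" for v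
  \<comment> \<open>The sphere is empty in dimension 0, where any positive constant will do.\<close>
  obtain m0 where m0: "m0 > 0" "\<And>v. v \<in> ?S \<Longrightarrow> G v \<ge> m0"
  proof (cases "?S = {}")
    case True
    show ?thesis by (rule that[of 1]) (use True in auto)
  next
    case False
    have "continuous_on ?S G"
      unfolding G_def dir_deriv_def
      by (intro continuous_intros continuous_on_subset[OF continuous_on_product_coordinates]) auto
    from continuous_attains_inf[OF compact_sup_sphere False this]
    obtain v0 where v0a: "v0 \<in> ?S" "\<forall>v\<in>?S. G v0 \<le> G v" by (rule bexE)
    note v0 = v0a(1) v0a(2)[THEN bspec]
    have "\<exists>i<n. v0 i \<noteq> 0" using v0(1) by force
    then obtain l where l: "l < k" "dir_deriv n c (H l) x v0 \<noteq> 0" using imm unfolding H_def by blast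
    have "0 < \<bar>dir_deriv n c (H l) x v0\<bar>" using l by simp
    also have "\<dots> \<le> G v0" unfolding G_def using l by (intro member_le_sum) auto
    finally have "0 < G v0" .
    then show ?thesis using v0(2) by (rule that)
  qed
  \<comment> \<open>The k components each have a linearization error of at most n * \<eta> times the
    size of the increment; with this \<eta> they use up at most half of the lower bound m0.\<close>
  define \<eta> where "\<eta> = m0 / (2 * (k * n + 1))"
  have kn: "real k * real n + 1 > 0" by (simp add: add_nonneg_pos)
  have \<eta>: "\<eta> > 0" "k * (n * \<eta>) \<le> m0 / 2"
  proof -
    show "\<eta> > 0" using m0(1) kn unfolding \<eta>_def by (intro divide_pos_pos) auto
    have "k * (n * \<eta>) \<le> (k * n + 1) * \<eta>" using \<open>\<eta> > 0\<close> by (simp add: distrib_right)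
    also have "\<dots> = m0 / 2" using kn by (simp add: \<eta>_def field_simps)
    finally show "k * (n * \<eta>) \<le> m0 / 2" .
  qed
  let ?F = "at ?u within Rn n"
  have uI: "?u \<in> chart_image c" using c by simp
  have ev: "\<forall>\<^sub>F u in ?F. \<forall>m. (\<forall>i<n. \<bar>u i - ?u i\<bar> \<le> m) \<longrightarrow>
     \<bar>H l (chart_inv c u) - H l (chart_inv c ?u) - dir_deriv n c (H l) x (\<lambda>i. u i - ?u i)\<bar> \<le> n * \<eta> * m" for l
  proof -
    have g1: "\<forall>\<^sub>F u in ?F. u \<in> Rn n" by (simp add: eventually_at_filter)
    have g2: "((\<lambda>u. u i) \<longlongrightarrow> ?u i) ?F" for i
    proof -
      have "continuous_on (Rn n) (\<lambda>u :: nat \<Rightarrow> real. u i)"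
        by (rule continuous_on_subset[OF continuous_on_product_coordinates subset_UNIV])
      then show ?thesis using uI chart_image_Rn[OF c(1)] unfolding continuous_on_def by blast
    qed
    obtain q where q: "\<And>j. j < n \<Longrightarrow> (q j \<longlongrightarrow> partial_deriv j (\<lambda>u. H l (chart_inv c u)) ?u) ?F"
      "\<forall>\<^sub>F u in ?F. H l (chart_inv c u) - H l (chart_inv c ?u) = (\<Sum>j<n. q j u * (u j - ?u j))"
      using Ck_on_expansion[where \<gamma> = "\<lambda>u. u" and F = ?F, OF chart_image_open[OF c(1)] Cr_functions_C1[OF HC c(1)] uI g1 g2] by blast
    have "\<forall>\<^sub>F u in ?F. \<forall>j\<in>{..<n}. \<bar>q j u - partial_deriv j (\<lambda>u. H l (chart_inv c u)) ?u\<bar> < \<eta>"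
      using tendstoD[OF q(1) \<eta>(1)] by (intro eventually_ball_finite) (auto simp: dist_real_def)
    then show ?thesis using q(2)
    proof eventually_elim
      case (elim u)
      show ?case
      proof (intro allI impI)
        fix m assume m: "\<forall>i<n. \<bar>u i - ?u i\<bar> \<le> m"
        have "H l (chart_inv c u) - H l (chart_inv c ?u) - dir_deriv n c (H l) x (\<lambda>i. u i - ?u i)
            = (\<Sum>j<n. (q j u - partial_deriv j (\<lambda>u. H l (chart_inv c u)) ?u) * (u j - ?u j))"
          unfolding elim(2) dir_deriv_def by (simp add: sum_subtractf[symmetric] left_diff_distrib)
        also have "\<bar>\<dots>\<bar> \<le> (\<Sum>j<n. \<eta> * m)"
        proof (rule order_trans[OF sum_abs], rule sum_mono)
          fix j assume "j \<in> {..<n}"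
          then show "\<bar>(q j u - partial_deriv j (\<lambda>u. H l (chart_inv c u)) ?u) * (u j - ?u j)\<bar> \<le> \<eta> * m"
            unfolding abs_mult using elim(1) m by (intro mult_mono) (auto simp: less_imp_le \<eta>(1))
        qed
        finally show "\<bar>H l (chart_inv c u) - H l (chart_inv c ?u) - dir_deriv n c (H l) x (\<lambda>i. u i - ?u i)\<bar> \<le> n * \<eta> * m" by simp
      qed
    qed
  qed
  have "\<forall>\<^sub>F u in ?F. \<forall>l\<in>{..<k}. \<forall>m. (\<forall>i<n. \<bar>u i - ?u i\<bar> \<le> m) \<longrightarrow>
     \<bar>H l (chart_inv c u) - H l (chart_inv c ?u) - dir_deriv n c (H l) x (\<lambda>i. u i - ?u i)\<bar> \<le> n * \<eta> * m"
    using ev by (intro eventually_ball_finite) auto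
  then obtain O1 where O1a: "open O1" "?u \<in> O1" and O1b: "\<forall>u\<in>O1. u \<noteq> ?u \<longrightarrow> u \<in> Rn n \<longrightarrow>
     (\<forall>l\<in>{..<k}. \<forall>m. (\<forall>i<n. \<bar>u i - ?u i\<bar> \<le> m) \<longrightarrow>
     \<bar>H l (chart_inv c u) - H l (chart_inv c ?u) - dir_deriv n c (H l) x (\<lambda>i. u i - ?u i)\<bar> \<le> n * \<eta> * m)"
    unfolding eventually_at_topological by blast
  note O1 = O1a
  define N1 where "N1 = N \<inter> (snd c -` O1 \<inter> fst c)"
  have N1: "open N1" "x \<in> N1"
    using N(1,2) continuous_on_open_vimage[OF chart_open[OF c(1)], of "snd c"] chart_cont[OF c(1)] O1(1,2) c(2)
    by (auto simp: N1_def)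
  \<comment> \<open>Combines the bound of \<rho> by the sup norm of the coordinate increment, with
    factor C0, and the bound of this sup norm by (2 / m0) * k times the delay distance.\<close>
  define C1 where "C1 = C0 * (2 / m0) * k"
  have C1: "C1 \<ge> 0" using N(4) m0(1) by (simp add: C1_def)
  have near: "\<rho> x y \<le> C1 * ?d y" if y: "y \<in> N1" for y
  proof (cases "y = x")
    case False
    have yc: "y \<in> fst c" "snd c y \<in> O1" "y \<in> N" using y by (auto simp: N1_def)
    define v where "v i = snd c y i - ?u i" for i
    have nz: "\<exists>i<n. v i \<noteq> 0" using chart_eqI[OF c(1) yc(1) c(2)] False by (auto simp: v_def)
    obtain m w where m: "m > 0" "w \<in> Rn n" "\<forall>i<n. \<bar>w i\<bar> \<le> 1" "\<exists>i<n. \<bar>w i\<bar> = 1" "\<And>i. i < n \<Longrightarrow> v i = m * w i"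
      "\<And>i. i < n \<Longrightarrow> \<bar>v i\<bar> \<le> m" using sup_normalize[OF nz] by blast
    have ne: "snd c y \<noteq> ?u"
    proof
      assume "snd c y = ?u"
      then have "chart_inv c (snd c y) = chart_inv c ?u" by simp
      then show False using False c yc(1) by simp
    qed
    have yR: "snd c y \<in> Rn n" using chart_image_Rn[OF c(1)] snd_in_chart_image[OF c(1) yc(1)] by blast
    have dv: "dir_deriv n c (H l) x v = m * dir_deriv n c (H l) x w" for l
      unfolding dir_deriv_def sum_distrib_left using m(5) by (intro sum.cong) auto
    have "m0 * m \<le> G w * m" using m0(2)[of w] m by (intro mult_right_mono) auto
    also have "\<dots> = (\<Sum>l<k. \<bar>dir_deriv n c (H l) x v\<bar>)" using m(1) by (simp add: G_def dv abs_mult sum_distrib_left mult.commute)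
    also have "\<dots> \<le> (\<Sum>l<k. \<bar>H l x - H l y\<bar> + n * \<eta> * m)"
    proof (rule sum_mono)
      fix l assume l: "l \<in> {..<k}"
      have "\<bar>H l (chart_inv c (snd c y)) - H l (chart_inv c ?u) - dir_deriv n c (H l) x (\<lambda>i. snd c y i - ?u i)\<bar> \<le> n * \<eta> * m"
        using O1b[rule_format, OF yc(2) ne yR l, of m] m(6) by (simp add: v_def)
      then show "\<bar>dir_deriv n c (H l) x v\<bar> \<le> \<bar>H l x - H l y\<bar> + n * \<eta> * m"
        using c yc(1) unfolding v_def by (simp del: abs_le_iff)
    qed
    also have "\<dots> = (\<Sum>l<k. \<bar>H l x - H l y\<bar>) + k * (n * \<eta>) * m" by (simp add: sum.distrib mult.assoc)
    also have "\<dots> \<le> (\<Sum>l<k. ?d y) + m0 / 2 * m"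
      using \<eta>(2) m(1) by (intro add_mono sum_mono mult_right_mono) (auto simp: H_def intro: delay_dist_component)
    finally have "m0 * m / 2 \<le> k * ?d y" by simp
    then have "m \<le> (2 / m0) * k * ?d y" using m0(1) by (simp add: field_simps)
    then have "C0 * m \<le> C0 * ((2 / m0) * k * ?d y)" using N(4) by (rule mult_left_mono)
    moreover have "\<rho> x y \<le> C0 * m"
      using N(5)[OF N(2) yc(3), of m] m(1,6) by (auto simp: v_def abs_minus_commute)
    ultimately show ?thesis by (simp add: C1_def mult.assoc)
  qed (simp add: C1 delay_dist_nonneg)
  have cY: "compact (Y \<inter> - N1)" using Y N1(1) cpt by (metis compact_Int_closed closed_Compl closed_Int inf_top_left)
  have "\<exists>C2\<ge>0. \<forall>y\<in>Y \<inter> - N1. \<rho> x y \<le> C2 * ?d y"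
  proof (cases "Y \<inter> - N1 = {}")
    case False
    have "continuous_on (Y \<inter> - N1) ?d"
      using delay_dist_continuous(2)[OF Tc Cr_functions_continuous[OF h]] continuous_on_subset by blast
    then obtain y0 where y0: "y0 \<in> Y \<inter> - N1" "\<And>y. y \<in> Y \<inter> - N1 \<Longrightarrow> ?d y0 \<le> ?d y"
      using continuous_attains_inf[OF cY False] by blast
    have "continuous_on (Y \<inter> - N1) (\<lambda>y. \<rho> x y)" using rho_continuous_snd continuous_on_subset by blast
    then obtain y1 where y1: "y1 \<in> Y \<inter> - N1" "\<And>y. y \<in> Y \<inter> - N1 \<Longrightarrow> \<rho> x y \<le> \<rho> x y1"
      using continuous_attains_sup[OF cY False] by blast
    have "y0 \<noteq> x" using y0(1) N1(2) by blast
    then obtain l where l: "l < k" "h ((T ^^ l) x) \<noteq> h ((T ^^ l) y0)" using inj y0(1) by blast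
    have pos: "?d y0 > 0" using delay_dist_component[OF l(1), of h T x y0] l(2) by linarith
    have "\<rho> x y \<le> (\<rho> x y1 / ?d y0) * ?d y" if "y \<in> Y \<inter> - N1" for y
    proof -
      have "\<rho> x y \<le> (\<rho> x y1 / ?d y0) * ?d y0" using y1(2)[OF that] pos by simp
      also have "\<dots> \<le> (\<rho> x y1 / ?d y0) * ?d y" using y0(2)[OF that] pos rho_nonneg by (intro mult_left_mono) auto
      finally show ?thesis .
    qed
    then show ?thesis using pos rho_nonneg by (intro exI[of _ "\<rho> x y1 / ?d y0"]) auto
  qed auto
  then obtain C2 where C2: "C2 \<ge> 0" "\<And>y. y \<in> Y \<inter> - N1 \<Longrightarrow> \<rho> x y \<le> C2 * ?d y" by blast
  have "\<rho> x y \<le> (C1 + C2) * ?d y" if "y \<in> Y" for y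
  proof (cases "y \<in> N1")
    case True
    then show ?thesis using near[OF True] mult_nonneg_nonneg[OF C2(1) delay_dist_nonneg[of T k h x y]] by (simp add: distrib_right)
  next
    case False
    then show ?thesis using C2(2)[of y] that mult_nonneg_nonneg[OF C1 delay_dist_nonneg[of T k h x y]] by (simp add: distrib_right)
  qed
  then show ?thesis unfolding delay_regular_def using C1 C2(1) by (intro exI[of _ "C1 + C2"]) auto
qed

end

context compact_Riemannian_manifold
begin

section \<open>Almost sure injectivity and immersivity at a fixed point\<close>

lemma rho_lower_family:
  assumes "finite J" "\<And>j. j \<in> J \<Longrightarrow> h j \<in> Cr_functions n r A"
  obtains L where "L \<ge> 0" "\<And>j x y. j \<in> J \<Longrightarrow> path_distance n A g x y < \<infinity> \<Longrightarrow> \<bar>h j x - h j y\<bar> \<le> L * \<rho> x y"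
proof -
  have "\<forall>j. \<exists>L. j \<in> J \<longrightarrow> L > 0 \<and> (\<forall>x y. path_distance n A g x y < \<infinity> \<longrightarrow> \<bar>h j x - h j y\<bar> \<le> L * \<rho> x y)"
  proof
    fix j
    show "\<exists>L. j \<in> J \<longrightarrow> L > 0 \<and> (\<forall>x y. path_distance n A g x y < \<infinity> \<longrightarrow> \<bar>h j x - h j y\<bar> \<le> L * \<rho> x y)"
    proof (cases "j \<in> J")
      case True
      obtain L where "L > 0" "\<And>x y. path_distance n A g x y < \<infinity> \<Longrightarrow> \<bar>h j x - h j y\<bar> \<le> L * \<rho> x y"
        using rho_lower[OF assms(2)[OF True]] by blast
      then show ?thesis by blast
    qed simp
  qed
  from choice[OF this] obtain L where L: "\<And>j. j \<in> J \<Longrightarrow> L j > 0"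
    "\<And>j x y. j \<in> J \<Longrightarrow> path_distance n A g x y < \<infinity> \<Longrightarrow> \<bar>h j x - h j y\<bar> \<le> L j * \<rho> x y" by blast
  show ?thesis
  proof (rule that[of "\<Sum>j\<in>J. L j"])
    show "(\<Sum>j\<in>J. L j) \<ge> 0" using L(1) by (intro sum_nonneg) (auto simp: less_imp_le)
    fix j x y assume j: "j \<in> J" "path_distance n A g x y < \<infinity>"
    have "L j \<le> (\<Sum>j\<in>J. L j)" using j(1) assms(1) L(1) by (intro member_le_sum) (auto simp: less_imp_le)
    then have "L j * \<rho> x y \<le> (\<Sum>j\<in>J. L j) * \<rho> x y" using rho_nonneg by (rule mult_right_mono)
    then show "\<bar>h j x - h j y\<bar> \<le> (\<Sum>j\<in>J. L j) * \<rho> x y" using L(2)[OF j] by linarith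
  qed
qed

text \<open>Where the orbit segments of x and y are disjoint, the rank is k and the local estimate
  applies on a set of vanishing k-dimensional measure. The remaining y are finitely many and each is
  separated by a single nonzero coefficient.\<close>

lemma AE_separates:
  fixes hs :: "nat \<Rightarrow> 'a \<Rightarrow> real"
  assumes T: "Cr_between n n r UNIV A UNIV A T" "inj T" and k: "k \<ge> 1"
    and hs: "\<And>j. j < m \<Longrightarrow> hs j \<in> Cr_functions n r A" and v: "v \<in> Cr_functions n r A"
    and sep: "\<forall>x y. x \<noteq> y \<longrightarrow> (\<exists>j<m. hs j x \<noteq> hs j y)"
    and full: "\<And>y. (\<forall>l<k. \<forall>l'<k. (T ^^ l') y \<noteq> (T ^^ l) x) \<longrightarrow>
      (\<exists>b. \<forall>i<k. \<forall>l<k. (\<Sum>j<m. b i j * (hs j ((T ^^ l) x) - hs j ((T ^^ l) y))) = (if i = l then 1 else 0))"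
    and Y: "\<And>y. y \<in> Y \<Longrightarrow> \<exists>N. open N \<and> y \<in> N \<and> hausdorff_null \<rho> k (N \<inter> Y)"
  shows "AE \<alpha> in lebesgue_prod m. \<forall>y\<in>Y - {x}. (\<forall>j<m. \<alpha> j \<in> {0..1}) \<longrightarrow>
      (\<exists>l<k. (v ((T ^^ l) x) + (\<Sum>j<m. \<alpha> j * hs j ((T ^^ l) x))) \<noteq> (v ((T ^^ l) y) + (\<Sum>j<m. \<alpha> j * hs j ((T ^^ l) y))))"
proof -
  define F0 where "F0 y l = v ((T ^^ l) x) - v ((T ^^ l) y)" for y l
  define F where "F j y l = hs j ((T ^^ l) x) - hs j ((T ^^ l) y)" for j y l
  \<comment> \<open>The points whose orbit segment meets that of x; there the interpolation
    conditions may conflict, so full rank cannot be expected. Injectivity of T makes the set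
    finite.\<close>
  define Bx where "Bx = {y. \<exists>l<k. \<exists>l'<k. (T ^^ l') y = (T ^^ l) x}"
  define P where "P \<alpha> y \<longleftrightarrow> (\<forall>j<m. \<alpha> j \<in> {0..1}) \<longrightarrow> (\<exists>l<k. F0 y l + (\<Sum>j<m. \<alpha> j * F j y l) \<noteq> 0)" for \<alpha> :: "nat \<Rightarrow> real" and y
  have Tc: "continuous_on UNIV T" using T by (simp add: Cr_between_def)
  have finB: "finite Bx"
  proof -
    have "Bx = (\<Union>l<k. \<Union>l'<k. (T ^^ l') -` {(T ^^ l) x})" by (auto simp: Bx_def)
    moreover have "finite ((T ^^ l') -` {(T ^^ l) x})" for l l'
      using T(2) inj_fn by (intro finite_vimageI) auto
    ultimately show ?thesis by simp
  qed
  \<comment> \<open>For a single point the component with l = 0 is enough: the core estimate is used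
    with k = 1 and Lipschitz constant 0 on a singleton.\<close>
  have exc: "AE \<alpha> in lebesgue_prod m. P \<alpha> y" if y: "y \<noteq> x" for y
  proof -
    have "\<exists>j<m. hs j x \<noteq> hs j y" using sep[THEN spec, THEN spec, of x y] y by simp
    then obtain j0 where j0: "j0 < m" "hs j0 x \<noteq> hs j0 y" by (elim exE conjE)
    define b where "b i j = (if j = j0 then inverse (hs j0 x - hs j0 y) else 0)" for i j :: nat
    have "AE \<alpha> in lebesgue_prod m. (\<forall>j<m. \<alpha> j \<in> {0..1}) \<longrightarrow> (\<forall>y\<in>{y}. \<exists>l<1. F0 y l + (\<Sum>j<m. \<alpha> j * F j y l) \<noteq> 0)"
    proof (rule AE_no_zero_local[where \<rho> = \<rho> and L = 0 and b = b])
      show "hausdorff_null \<rho> 1 {y}" by (rule hausdorff_null_singleton) auto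
      fix z and i l :: nat assume z: "z \<in> {y}" "i < 1" "l < 1"
      have "(\<Sum>j<m. b i j * F j z l) = (\<Sum>j<m. if j = j0 then 1 else 0)"
        by (rule sum.cong) (use z j0 in \<open>auto simp: b_def F_def\<close>)
      then show "\<bar>(\<Sum>j<m. b i j * F j z l) - (if i = l then 1 else 0)\<bar> \<le> 1 / (4 * real 1)"
        using j0(1) z by simp
    qed auto
    then show ?thesis by eventually_elim (use k in \<open>auto simp: P_def Suc_le_eq\<close>)
  qed
  have "AE \<alpha> in lebesgue_prod m. \<forall>y\<in>Bx - {x}. P \<alpha> y"
    by (rule AE_ball_countable') (use exc finB in \<open>auto intro: countable_finite\<close>)
  moreover have "AE \<alpha> in lebesgue_prod m. \<forall>y\<in>Y - Bx. P \<alpha> y"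
  proof (rule AE_countable_cover[OF manifold_Lindelof])
    fix y assume y: "y \<in> Y - Bx"
    obtain N1 where N1: "open N1" "y \<in> N1" "hausdorff_null \<rho> k (N1 \<inter> Y)" using Y y by blast
    obtain N2 where N2: "open N2" "y \<in> N2" "\<And>z z'. z \<in> N2 \<Longrightarrow> z' \<in> N2 \<Longrightarrow> path_distance n A g z z' < \<infinity>"
      using rho_local by blast
    have "\<forall>l<k. \<forall>l'<k. (T ^^ l') y \<noteq> (T ^^ l) x" using y unfolding Bx_def by blast
    from full[THEN mp, OF this]
    obtain b where b: "\<forall>i<k. \<forall>l<k. (\<Sum>j<m. b i j * F j y l) = (if i = l then 1 else 0)"
      unfolding F_def by (rule exE)
    \<comment> \<open>The exact identity at y persists approximately with the same b, which is why
      only closeness to the identity is demanded in the core estimate.\<close>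
    define N3 where "N3 = (\<Inter>i\<in>{..<k}. \<Inter>l\<in>{..<k}. {z. \<bar>(\<Sum>j<m. b i j * F j z l) - (if i = l then 1 else 0)\<bar> < 1 / (4 * real k)})"
    have hsc: "continuous_on UNIV (\<lambda>z. hs j ((T ^^ l) z))" if "j < m" for j l
      by (rule Cr_functions_continuous[OF Cr_functions_funpow[OF T(1) hs[OF that]]])
    have "open {z. \<bar>(\<Sum>j<m. b i j * F j z l) - (if i = l then 1 else 0)\<bar> < 1 / (4 * real k)}" for i l
      unfolding F_def by (intro open_Collect_less continuous_intros hsc) auto
    then have "open N3" unfolding N3_def by (intro open_INT) auto
    moreover have "y \<in> N3" using b k by (auto simp: N3_def)
    ultimately have N: "open (N1 \<inter> N2 \<inter> N3)" "y \<in> N1 \<inter> N2 \<inter> N3" using N1 N2 by auto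
    let ?S = "(N1 \<inter> N2 \<inter> N3) \<inter> (Y - Bx)"
    \<comment> \<open>Bundles the family and the fixed observable v, the latter under the index m,
      so that one Lipschitz constant serves for all.\<close>
    define H where "H = (\<lambda>(j, l) z. if j < m then hs j ((T ^^ l) z) else v ((T ^^ l) z))"
    obtain L where L: "L \<ge> 0" "\<And>p z z'. p \<in> {..m} \<times> {..<k} \<Longrightarrow> path_distance n A g z z' < \<infinity> \<Longrightarrow> \<bar>H p z - H p z'\<bar> \<le> L * \<rho> z z'"
    proof (rule rho_lower_family[of "{..m} \<times> {..<k}" H])
      fix p assume "p \<in> {..m} \<times> {..<k}"
      then show "H p \<in> Cr_functions n r A"
        unfolding H_def using Cr_functions_funpow[OF T(1) hs] Cr_functions_funpow[OF T(1) v]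
        by (cases p; cases "fst p < m"; simp)
    qed auto
    have "AE \<alpha> in lebesgue_prod m. (\<forall>j<m. \<alpha> j \<in> {0..1}) \<longrightarrow> (\<forall>y\<in>?S. \<exists>l<k. F0 y l + (\<Sum>j<m. \<alpha> j * F j y l) \<noteq> 0)"
    proof (rule AE_no_zero_local[where \<rho> = \<rho> and L = L and b = b, OF k _ L(1)])
      show "hausdorff_null \<rho> k ?S" by (rule hausdorff_null_subset[OF N1(3)]) blast
      fix z z' l assume z: "z \<in> ?S" "z' \<in> ?S" "l < k"
      then have fin: "path_distance n A g z z' < \<infinity>" using N2(3) by blast
      show "\<bar>F0 z l - F0 z' l\<bar> \<le> L * \<rho> z z'"
        using L(2)[of "(m, l)", OF _ fin] z(3) by (simp add: H_def F0_def abs_minus_commute)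
      show "\<bar>F j z l - F j z' l\<bar> \<le> L * \<rho> z z'" if "j < m" for j
        using L(2)[of "(j, l)", OF _ fin] z(3) that by (simp add: H_def F_def abs_minus_commute)
    next
      fix z i l assume "z \<in> ?S" "i < k" "l < k"
      then show "\<bar>(\<Sum>j<m. b i j * F j z l) - (if i = l then 1 else 0)\<bar> \<le> 1 / (4 * real k)"
        by (auto simp: N3_def less_imp_le)
    qed
    then have "AE \<alpha> in lebesgue_prod m. \<forall>y\<in>?S. P \<alpha> y"
      by eventually_elim (auto simp: P_def)
    then show "\<exists>N. open N \<and> y \<in> N \<and> (AE \<alpha> in lebesgue_prod m. \<forall>y\<in>N \<inter> (Y - Bx). P \<alpha> y)"
      using N by (intro exI[of _ "N1 \<inter> N2 \<inter> N3"]) auto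
  qed
  ultimately have "AE \<alpha> in lebesgue_prod m. \<forall>y\<in>Y - {x}. P \<alpha> y"
    by eventually_elim blast
  then show ?thesis
  proof (eventually_elim, intro ballI impI)
    fix \<alpha> y assume "\<forall>y\<in>Y - {x}. P \<alpha> y" "y \<in> Y - {x}" "\<forall>j<m. \<alpha> j \<in> {0..1}"
    then obtain l where l: "l < k" "F0 y l + (\<Sum>j<m. \<alpha> j * F j y l) \<noteq> 0" unfolding P_def by blast
    have "F0 y l + (\<Sum>j<m. \<alpha> j * F j y l)
      = (v ((T ^^ l) x) + (\<Sum>j<m. \<alpha> j * hs j ((T ^^ l) x))) - (v ((T ^^ l) y) + (\<Sum>j<m. \<alpha> j * hs j ((T ^^ l) y)))"
      by (simp add: F0_def F_def right_diff_distrib sum_subtractf)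
    then show "\<exists>l<k. (v ((T ^^ l) x) + (\<Sum>j<m. \<alpha> j * hs j ((T ^^ l) x))) \<noteq> (v ((T ^^ l) y) + (\<Sum>j<m. \<alpha> j * hs j ((T ^^ l) y)))"
      using l by (intro exI[of _ l]) auto
  qed
qed

lemma dir_deriv_linear: "dir_deriv n c h x (\<lambda>i. a * w i) = a * dir_deriv n c h x w"
  unfolding dir_deriv_def sum_distrib_left by (intro sum.cong) auto

lemma dir_deriv_cong_dir: "(\<And>i. i < n \<Longrightarrow> v i = w i) \<Longrightarrow> dir_deriv n c h x v = dir_deriv n c h x w"
  unfolding dir_deriv_def by (intro sum.cong) auto

text \<open>By homogeneity only directions on the unit sphere of the sup norm matter. It is the
  union of the faces of a cube, each with n - 1 free coordinates, hence null in dimension k \<ge> n,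
  and the derivative is Lipschitz in the direction.\<close>

lemma AE_immersive:
  fixes hs :: "nat \<Rightarrow> 'a \<Rightarrow> real"
  assumes T: "Cr_between n n r UNIV A UNIV A T" and k: "k \<ge> 1" "k \<ge> n" and c: "c \<in> A" "x \<in> fst c"
    and hs: "\<And>j. j < m \<Longrightarrow> hs j \<in> Cr_functions n r A" and v: "v \<in> Cr_functions n r A"
    and full: "\<And>w. \<exists>i<n. w i \<noteq> 0 \<Longrightarrow>
      \<exists>b. \<forall>i<k. \<forall>l<k. (\<Sum>j<m. b i j * dir_deriv n c (\<lambda>z. hs j ((T ^^ l) z)) x w) = (if i = l then 1 else 0)"
  shows "AE \<alpha> in lebesgue_prod m. (\<forall>j<m. \<alpha> j \<in> {0..1}) \<longrightarrow> (\<forall>w. (\<exists>i<n. w i \<noteq> 0) \<longrightarrow>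
      (\<exists>l<k. dir_deriv n c (\<lambda>z. v ((T ^^ l) z) + (\<Sum>j<m. \<alpha> j * hs j ((T ^^ l) z))) x w \<noteq> 0))"
proof -
  define F0 where "F0 w l = dir_deriv n c (\<lambda>z. v ((T ^^ l) z)) x w" for w l
  define F where "F j w l = dir_deriv n c (\<lambda>z. hs j ((T ^^ l) z)) x w" for j w l
  define P where "P \<alpha> w \<longleftrightarrow> (\<forall>j<m. \<alpha> j \<in> {0..1}) \<longrightarrow> (\<exists>l<k. F0 w l + (\<Sum>j<m. \<alpha> j * F j w l) \<noteq> 0)" for \<alpha> w :: "nat \<Rightarrow> real"
  \<comment> \<open>The face on which coordinate i0 equals 1; the opposite face follows by changing
    the sign of the direction.\<close>
  define S where "S i0 = {w \<in> Rn n. w i0 = 1 \<and> (\<forall>i<n. \<bar>w i\<bar> \<le> 1)}" for i0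
  define d where "d w w' = (\<Sum>i<n. \<bar>w i - w' i\<bar>)" for w w' :: "nat \<Rightarrow> real"
  have lip: "\<bar>dir_deriv n c h x w - dir_deriv n c h x w'\<bar> \<le> (\<Sum>i<n. \<bar>partial_deriv i (\<lambda>u. h (chart_inv c u)) (snd c x)\<bar>) * d w w'" for h w w'
  proof -
    let ?p = "\<lambda>i. partial_deriv i (\<lambda>u. h (chart_inv c u)) (snd c x)"
    have "dir_deriv n c h x w - dir_deriv n c h x w' = (\<Sum>i<n. ?p i * (w i - w' i))"
      by (simp add: dir_deriv_def sum_subtractf right_diff_distrib)
    also have "\<bar>\<dots>\<bar> \<le> (\<Sum>i<n. \<bar>?p i\<bar> * d w w')"
    proof (rule order_trans[OF sum_abs], rule sum_mono)
      fix i assume "i \<in> {..<n}"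
      then show "\<bar>?p i * (w i - w' i)\<bar> \<le> \<bar>?p i\<bar> * d w w'"
        unfolding abs_mult d_def by (intro mult_left_mono member_le_sum) auto
    qed
    finally show ?thesis by (simp add: sum_distrib_right)
  qed
  have face: "AE \<alpha> in lebesgue_prod m. \<forall>w\<in>S i0. P \<alpha> w" if i0: "i0 < n" for i0
  proof (rule AE_countable_cover[OF Lindelof_nat_real])
    fix w assume w: "w \<in> S i0"
    have "\<exists>i<n. w i \<noteq> 0" using w i0 by (auto simp: S_def intro!: exI[of _ i0])
    from full[OF this]
    obtain b where b: "\<forall>i<k. \<forall>l<k. (\<Sum>j<m. b i j * F j w l) = (if i = l then 1 else 0)"
      unfolding F_def by (rule exE)
    define N where "N = (\<Inter>i\<in>{..<k}. \<Inter>l\<in>{..<k}. {w. \<bar>(\<Sum>j<m. b i j * F j w l) - (if i = l then 1 else 0)\<bar> < 1 / (4 * real k)})"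
    have "open {w. \<bar>(\<Sum>j<m. b i j * F j w l) - (if i = l then 1 else 0)\<bar> < 1 / (4 * real k)}" for i l
      unfolding F_def dir_deriv_def by (intro open_Collect_less continuous_intros continuous_on_product_coordinates) 
    then have N: "open N" unfolding N_def by (intro open_INT) auto
    have wN: "w \<in> N" using b k by (auto simp: N_def)
    define H where "H = (\<lambda>(j, l) z. if j < m then hs j ((T ^^ l) z) else v ((T ^^ l) z))"
    define LL where "LL p = (\<Sum>i<n. \<bar>partial_deriv i (\<lambda>u. H p (chart_inv c u)) (snd c x)\<bar>)" for p
    define L where "L = (\<Sum>p\<in>{..m} \<times> {..<k}. LL p)"
    have LL: "LL p \<ge> 0" for p unfolding LL_def by (intro sum_nonneg) auto
    have L0: "L \<ge> 0" unfolding L_def using LL by (intro sum_nonneg) auto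
    have dd: "d w w' \<ge> 0" for w w' unfolding d_def by (intro sum_nonneg) auto
    have HL: "\<bar>dir_deriv n c (H p) x w - dir_deriv n c (H p) x w'\<bar> \<le> L * d w w'" if "p \<in> {..m} \<times> {..<k}" for p w w'
    proof -
      have "LL p \<le> L" unfolding L_def using that LL by (intro member_le_sum) auto
      then show ?thesis using lip[of "H p" w w'] mult_right_mono[OF _ dd] unfolding LL_def by (meson order_trans)
    qed
    have "AE \<alpha> in lebesgue_prod m. (\<forall>j<m. \<alpha> j \<in> {0..1}) \<longrightarrow> (\<forall>w\<in>N \<inter> S i0. \<exists>l<k. F0 w l + (\<Sum>j<m. \<alpha> j * F j w l) \<noteq> 0)"
    proof (rule AE_no_zero_local[where \<rho> = d and L = L and b = b, OF k(1) _ L0])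
      \<comment> \<open>Coordinate i0 is constant on the face and is left out of the grid, which
        brings the number of coordinates to n - 1 < k.\<close>
      show "hausdorff_null d k (N \<inter> S i0)"
      proof (rule hausdorff_null_grid[where I = "{..<n} - {i0}" and u = "\<lambda>w. w" and a = "\<lambda>_. 0" and R = 1 and C = "real n"])
        show "card ({..<n} - {i0}) < k" using i0 k by simp
        fix z z' and \<eta> :: real
        assume z: "z \<in> N \<inter> S i0" "z' \<in> N \<inter> S i0" "\<eta> \<ge> 0" "\<And>i. i \<in> {..<n} - {i0} \<Longrightarrow> \<bar>z i - z' i\<bar> \<le> \<eta>"
        have "d z z' \<le> (\<Sum>i<n. \<eta>)" unfolding d_def
        proof (rule sum_mono)
          fix i assume "i \<in> {..<n}"
          then show "\<bar>z i - z' i\<bar> \<le> \<eta>" using z by (cases "i = i0") (auto simp: S_def)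
        qed
        then show "d z z' \<le> real n * \<eta>" by simp
      qed (auto simp: S_def)
      fix z z' l assume z: "l < k"
      show "\<bar>F0 z l - F0 z' l\<bar> \<le> L * d z z'"
        using HL[of "(m, l)"] z by (simp add: H_def F0_def)
      show "\<bar>F j z l - F j z' l\<bar> \<le> L * d z z'" if "j < m" for j
        using HL[of "(j, l)"] z that by (simp add: H_def F_def)
    next
      fix z i l assume "z \<in> N \<inter> S i0" "i < k" "l < k"
      then show "\<bar>(\<Sum>j<m. b i j * F j z l) - (if i = l then 1 else 0)\<bar> \<le> 1 / (4 * real k)"
        by (auto simp: N_def less_imp_le)
    qed
    then have "AE \<alpha> in lebesgue_prod m. \<forall>w\<in>N \<inter> S i0. P \<alpha> w"
      by eventually_elim (auto simp: P_def)
    then show "\<exists>N. open N \<and> w \<in> N \<and> (AE \<alpha> in lebesgue_prod m. \<forall>w\<in>N \<inter> S i0. P \<alpha> w)"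
      using N wN by blast
  qed
  have "AE \<alpha> in lebesgue_prod m. \<forall>i0\<in>{..<n}. \<forall>w\<in>S i0. P \<alpha> w"
    by (rule AE_ball_countable') (use face in auto)
  then show ?thesis
  proof (eventually_elim, intro impI allI)
    fix \<alpha> w :: "nat \<Rightarrow> real" assume PS: "\<forall>i0\<in>{..<n}. \<forall>w\<in>S i0. P \<alpha> w" and \<alpha>: "\<forall>j<m. \<alpha> j \<in> {0..1}" and w: "\<exists>i<n. w i \<noteq> 0"
    obtain a u where u: "a > 0" "u \<in> Rn n" "\<forall>i<n. \<bar>u i\<bar> \<le> 1" "\<exists>i<n. \<bar>u i\<bar> = 1" "\<And>i. i < n \<Longrightarrow> w i = a * u i"
      "\<And>i. i < n \<Longrightarrow> \<bar>w i\<bar> \<le> a"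
      using sup_normalize[OF w] by blast
    obtain i0 where i0: "i0 < n" "\<bar>u i0\<bar> = 1" using u(4) by blast
    \<comment> \<open>The sign 1 or -1 that moves the normalized direction onto the face with
      coordinate i0 equal to 1.\<close>
    define s where "s = u i0"
    have s: "s * s = 1" "s \<noteq> 0" using i0(2) by (auto simp: s_def abs_if split: if_splits)
    define u' where "u' i = s * u i" for i
    have "u' \<in> S i0" using u(2,3) i0 s by (auto simp: S_def u'_def in_Rn s_def abs_mult)
    then obtain l where l: "l < k" "F0 u' l + (\<Sum>j<m. \<alpha> j * F j u' l) \<noteq> 0"
      using PS i0(1) \<alpha> unfolding P_def by blast
    have "dir_deriv n c (\<lambda>z. v ((T ^^ l) z) + (\<Sum>j<m. \<alpha> j * hs j ((T ^^ l) z))) x u' = F0 u' l + (\<Sum>j<m. \<alpha> j * F j u' l)"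
      unfolding F0_def F_def
      using dir_deriv_add[OF Cr_functions_funpow[OF T v] Cr_functions_sum c, of "{..<m}" "\<lambda>j z. \<alpha> j * hs j ((T ^^ l) z)" l u']
        dir_deriv_sum[of "{..<m}" "\<lambda>j z. hs j ((T ^^ l) z)" c x \<alpha> u', OF _ c]
        Cr_functions_funpow[OF T hs] Cr_functions_mult[OF Cr_functions_const Cr_functions_funpow[OF T hs]] by auto
    moreover have "dir_deriv n c h x u' = (s / a) * dir_deriv n c h x w" for h
    proof -
      have "dir_deriv n c h x u' = dir_deriv n c h x (\<lambda>i. (s / a) * w i)"
        by (rule dir_deriv_cong_dir) (use u(1,5) in \<open>simp add: u'_def\<close>)
      then show ?thesis by (simp only: dir_deriv_linear)
    qed
    ultimately have "dir_deriv n c (\<lambda>z. v ((T ^^ l) z) + (\<Sum>j<m. \<alpha> j * hs j ((T ^^ l) z))) x w \<noteq> 0"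
      using l(2) by auto
    then show "\<exists>l<k. dir_deriv n c (\<lambda>z. v ((T ^^ l) z) + (\<Sum>j<m. \<alpha> j * hs j ((T ^^ l) z))) x w \<noteq> 0"
      using l(1) by blast
  qed
qed

text \<open>For each nonperiodic x almost every coefficient vector gives a regular point. Exchanging
  the quantifiers needs a jointly measurable formulation, and the resulting set of observables is
  already known to be Borel.\<close>

theorem prevalent_delay_regular:
  fixes \<mu> :: "'a measure"
  assumes T: "Cr_diffeo n r UNIV A UNIV A T"
    and \<mu>: "prob_space \<mu>" "sets \<mu> = sets (restrict_space borel X)"
    and k: "k \<ge> 1" "k \<ge> n" and per: "emeasure \<mu> (X \<inter> (\<Union>p\<in>{1..k-1}. Per p T)) = 0"
    and Y: "closed Y" "\<And>y. y \<in> Y \<Longrightarrow> \<exists>N. open N \<and> y \<in> N \<and> hausdorff_null \<rho> k (N \<inter> Y)"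
  shows "prevalent_borel (Cr_topology n r A) {h \<in> Cr_functions n r A. AE x in \<mu>. delay_regular T k Y h x}"
proof -
  interpret mu: prob_space \<mu> by fact
  have T1: "Cr_between n n r UNIV A UNIV A T" "Cr_between n n r UNIV A UNIV A (inv T)" "bij T"
    using T by (auto simp: Cr_diffeo_def)
  have Tc: "continuous_on UNIV T" using T1 by (simp add: Cr_between_def)
  have injT: "inj T" using T1(3) by (rule bij_is_inj)
  have sp: "space \<mu> = X" using sets_eq_imp_space_eq[OF \<mu>(2)] by (simp add: space_restrict_space)
  obtain m :: nat and hs :: "nat \<Rightarrow> 'a \<Rightarrow> real" where hs0: "\<forall>j<m. hs j \<in> Cr_functions n r A"
    and sep: "\<forall>x y. x \<noteq> y \<longrightarrow> (\<exists>j<m. hs j x \<noteq> hs j y)"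
    and full: "\<forall>x y. inj_on (\<lambda>l. (T ^^ l) x) {..<k} \<longrightarrow> (\<forall>l<k. \<forall>l'<k. (T ^^ l') y \<noteq> (T ^^ l) x) \<longrightarrow>
      (\<exists>b. \<forall>i<k. \<forall>l<k. (\<Sum>j<m. b i j * (hs j ((T ^^ l) x) - hs j ((T ^^ l) y))) = (if i = l then 1 else 0))"
    and imm: "\<forall>x. inj_on (\<lambda>l. (T ^^ l) x) {..<k} \<longrightarrow> (\<exists>c\<in>A. x \<in> fst c \<and> (\<forall>v. (\<exists>i<n. v i \<noteq> 0) \<longrightarrow>
      (\<exists>b. \<forall>i<k. \<forall>l<k. (\<Sum>j<m. b i j * dir_deriv n c (\<lambda>z. hs j ((T ^^ l) z)) x v) = (if i = l then 1 else 0))))"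
    by (rule probe_family[OF T1 k(1)])
  have hs: "hs j \<in> Cr_functions n r A" if "j < m" for j using hs0 that by blast
  have nonper: "AE x in \<mu>. inj_on (\<lambda>l. (T ^^ l) x) {..<k}"
  proof -
    \<comment> \<open>Written as the intersection of the equalizers of e composed with
      \<open>T ^^ p\<close> and e, over a separating family of continuous functions.\<close>
    have "closed (Per p T)" for p
    proof -
      obtain E where E: "E \<subseteq> Cr_functions n r A" "\<And>x y. x \<noteq> y \<Longrightarrow> \<exists>e\<in>E. e x \<noteq> e y"
        using separating_immersive_family by metis
      have "Per p T = (\<Inter>e\<in>E. {x. e ((T ^^ p) x) = e x})" using E(2) by (auto simp: Per_def)
      moreover have "closed {x. e ((T ^^ p) x) = e x}" if "e \<in> E" for e
        using E(1) that Cr_functions_funpow[OF T1(1)] by (intro closed_Collect_eq Cr_functions_continuous) auto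
      ultimately show ?thesis by (simp add: closed_INT)
    qed
    then have "X \<inter> (\<Union>p\<in>{1..k-1}. Per p T) \<in> sets \<mu>"
      unfolding \<mu>(2) sets_restrict_space by (intro imageI borel_closed closed_UN) auto
    then have "AE x in \<mu>. x \<notin> X \<inter> (\<Union>p\<in>{1..k-1}. Per p T)"
      using per by (intro AE_not_in) (simp add: null_sets_def)
    then show ?thesis
    proof (rule AE_mp, intro AE_I2 impI)
      fix x assume x: "x \<in> space \<mu>" "x \<notin> X \<inter> (\<Union>p\<in>{1..k-1}. Per p T)"
      \<comment> \<open>A repetition in the orbit segment cancels to a period b - a between 1 and k
        - 1, exactly the periods excluded almost surely.\<close>
      have False if "a < b" "b < k" "(T ^^ a) x = (T ^^ b) x" for a b
      proof -
        have "(T ^^ a) ((T ^^ (b - a)) x) = (T ^^ a) x"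
          using that by (metis add_diff_inverse_nat comp_apply funpow_add less_imp_le not_less)
        then have "(T ^^ (b - a)) x = x" using inj_fn[OF injT, of a] by (simp add: inj_eq)
        then have "x \<in> Per (b - a) T" by (simp add: Per_def)
        moreover have "b - a \<in> {1..k-1}" using that by auto
        ultimately show False using x sp by blast
      qed
      then show "inj_on (\<lambda>l. (T ^^ l) x) {..<k}"
        unfolding inj_on_def by (metis lessThan_iff linorder_neqE_nat)
    qed
  qed
  show ?thesis
  proof (rule prevalent_borel_probe[where m = m and hs = hs])
    show "{h \<in> Cr_functions n r A. AE x in \<mu>. delay_regular T k Y h x} \<in> borel_sets_of (Cr_topology n r A)"
      by (rule delay_regular_borel[OF Tc \<mu>])
    fix v assume v: "v \<in> Cr_functions n r A"
    let ?h = "\<lambda>\<alpha> x. v x + (\<Sum>j<m. \<alpha> j * hs j x)"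
    have hC: "?h \<alpha> \<in> Cr_functions n r A" for \<alpha>
      by (intro Cr_functions_add v Cr_functions_combination hs)
    define Q where "Q x \<alpha> \<longleftrightarrow> (\<forall>j<m. \<alpha> j \<in> {0..1}) \<longrightarrow> delay_regular T k Y (?h \<alpha>) x" for x and \<alpha> :: "nat \<Rightarrow> real"
    have pt: "AE \<alpha> in lebesgue_prod m. Q x \<alpha>" if x: "inj_on (\<lambda>l. (T ^^ l) x) {..<k}" for x
    proof -
      obtain c where c: "c \<in> A" and c': "x \<in> fst c \<and> (\<forall>w. (\<exists>i<n. w i \<noteq> 0) \<longrightarrow>
        (\<exists>b. \<forall>i<k. \<forall>l<k. (\<Sum>j<m. b i j * dir_deriv n c (\<lambda>z. hs j ((T ^^ l) z)) x w) = (if i = l then 1 else 0)))"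
        using imm[THEN spec, THEN mp, OF x] by (rule bexE)
      note c = c conjunct1[OF c'] and imm' = conjunct2[OF c', THEN spec, THEN mp]
      have "AE \<alpha> in lebesgue_prod m. \<forall>y\<in>Y - {x}. (\<forall>j<m. \<alpha> j \<in> {0..1}) \<longrightarrow>
          (\<exists>l<k. (v ((T ^^ l) x) + (\<Sum>j<m. \<alpha> j * hs j ((T ^^ l) x))) \<noteq> (v ((T ^^ l) y) + (\<Sum>j<m. \<alpha> j * hs j ((T ^^ l) y))))"
        by (rule AE_separates[OF T1(1) injT k(1) hs v sep full[THEN spec, THEN spec, THEN mp, OF x] Y(2)])
      moreover have "AE \<alpha> in lebesgue_prod m. (\<forall>j<m. \<alpha> j \<in> {0..1}) \<longrightarrow> (\<forall>w. (\<exists>i<n. w i \<noteq> 0) \<longrightarrow>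
          (\<exists>l<k. dir_deriv n c (\<lambda>z. v ((T ^^ l) z) + (\<Sum>j<m. \<alpha> j * hs j ((T ^^ l) z))) x w \<noteq> 0))"
        by (rule AE_immersive[OF T1(1) k c hs v imm'])
      ultimately show ?thesis
      proof eventually_elim
        case (elim \<alpha>)
        show ?case
          unfolding Q_def
        proof
          assume \<alpha>: "\<forall>j<m. \<alpha> j \<in> {0..1}"
          show "delay_regular T k Y (?h \<alpha>) x"
          proof (rule delay_regularI[OF hC T1(1) Y(1) c k(1)])
            show "\<exists>l<k. ?h \<alpha> ((T ^^ l) x) \<noteq> ?h \<alpha> ((T ^^ l) y)" if "y \<in> Y" "y \<noteq> x" for y
              using elim(1) \<alpha> that by blast
            show "\<exists>l<k. dir_deriv n c (\<lambda>z. ?h \<alpha> ((T ^^ l) z)) x w \<noteq> 0" if "\<exists>i<n. w i \<noteq> 0" for w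
              using elim(2) \<alpha> that by blast
          qed
        qed
      qed
    qed
    have meas: "{z \<in> space (\<mu> \<Otimes>\<^sub>M lebesgue_prod m). Q (fst z) (snd z)} \<in> sets (\<mu> \<Otimes>\<^sub>M lebesgue_prod m)"
    proof -
      \<comment> \<open>For fixed x, constant and coefficients the inequality is closed in y, so a
        countable dense subset of Y decides it; together with integer constants this makes Q a
        countable combination of measurable conditions.\<close>
      obtain D where D: "countable D" "D \<subseteq> Y" "Y \<subseteq> closure D" by (rule manifold_separable)
      have dense: "(\<forall>y\<in>Y. \<rho> x y \<le> C * delay_dist T k (?h \<alpha>) x y) \<longleftrightarrow> (\<forall>y\<in>D. \<rho> x y \<le> C * delay_dist T k (?h \<alpha>) x y)" for x \<alpha> C
      proof
        assume H: "\<forall>y\<in>D. \<rho> x y \<le> C * delay_dist T k (?h \<alpha>) x y"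
        have "closed {y. \<rho> x y \<le> C * delay_dist T k (?h \<alpha>) x y}"
          by (intro closed_Collect_le continuous_intros rho_continuous_snd delay_dist_continuous(2)[OF Tc Cr_functions_continuous[OF hC]])
        then have "closure D \<subseteq> {y. \<rho> x y \<le> C * delay_dist T k (?h \<alpha>) x y}"
          by (rule closure_minimal[rotated]) (use H in blast)
        then show "\<forall>y\<in>Y. \<rho> x y \<le> C * delay_dist T k (?h \<alpha>) x y" using D(3) by blast
      qed (use D(2) in blast)
      have Qeq: "Q x \<alpha> \<longleftrightarrow> (\<forall>j\<in>{..<m}. \<alpha> j \<in> {0..1}) \<longrightarrow> (\<exists>C::nat. \<forall>y\<in>D. \<rho> x y \<le> C * delay_dist T k (?h \<alpha>) x y)" for x \<alpha>
        unfolding Q_def delay_regular_nat dense by auto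
      let ?M = "\<mu> \<Otimes>\<^sub>M lebesgue_prod m"
      have cm: "f \<in> borel_measurable \<mu>" if "continuous_on UNIV f" for f :: "'a \<Rightarrow> real"
        using measurable_restrict_space1[OF borel_measurable_continuous_onI[OF that], of X] \<mu>(2)
        by (simp cong: measurable_cong_sets)
      have fstm: "(\<lambda>z. f (fst z)) \<in> borel_measurable ?M" if "continuous_on UNIV f" for f :: "'a \<Rightarrow> real"
        using cm[OF that] by measurable
      have \<alpha>m: "(\<lambda>z. snd z j) \<in> borel_measurable ?M" if "j < m" for j
        using measurable_compose[OF measurable_snd measurable_component_singleton[of j "{..<m}"], of \<mu> "\<lambda>_. lborel"] that by simp
      have fpc: "continuous_on UNIV (\<lambda>z. f ((T ^^ l) z))" if "f \<in> Cr_functions n r A" for f l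
        by (rule Cr_functions_continuous[OF Cr_functions_funpow[OF T1(1) that]])
      have dm: "(\<lambda>z. delay_dist T k (?h (snd z)) (fst z) y) \<in> borel_measurable ?M" for y
      proof -
        have 1: "(\<lambda>z. ?h (snd z) ((T ^^ l) (fst z)) - ?h (snd z) ((T ^^ l) y)) \<in> borel_measurable ?M" for l
          using fstm[OF fpc[OF v]] fstm[OF fpc[OF hs]] \<alpha>m
          by (intro borel_measurable_diff borel_measurable_add borel_measurable_sum borel_measurable_times borel_measurable_const) auto
        show ?thesis
          unfolding delay_dist_def L2_set_def
          by (rule measurable_compose[OF _ borel_measurable_continuous_onI[OF continuous_on_real_sqrt[OF continuous_on_id]]])
             (intro borel_measurable_sum borel_measurable_power 1)
      qed
      show ?thesis
        unfolding Qeq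
        by (intro sets.sets_Collect_imp sets.sets_Collect_countable_Ex sets.sets_Collect_countable_All'[OF _ D(1)]
          sets.sets_Collect_finite_All borel_measurable_le borel_measurable_times borel_measurable_const dm
          fstm[OF rho_continuous_fst] measurable_sets_Collect[OF \<alpha>m]) auto
    qed
    have sfL: "sigma_finite_measure (lebesgue_prod m)" by (rule lborel_prod.sigma_finite) simp
    interpret pair: pair_sigma_finite \<mu> "lebesgue_prod m"
      unfolding pair_sigma_finite_def using sfL mu.sigma_finite_measure_axioms by blast
    have "AE x in \<mu>. AE \<alpha> in lebesgue_prod m. Q x \<alpha>"
      using nonper by eventually_elim (rule pt)
    then have "AE \<alpha> in lebesgue_prod m. AE x in \<mu>. Q x \<alpha>"
      using pair.AE_commute[OF meas] by blast
    then show "AE \<alpha> in lebesgue_prod m. (\<forall>j<m. \<alpha> j \<in> {0..1}) \<longrightarrow>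
        (\<lambda>x. v x + (\<Sum>j<m. \<alpha> j * hs j x)) \<in> {h \<in> Cr_functions n r A. AE x in \<mu>. delay_regular T k Y h x}"
      by eventually_elim (use hC in \<open>auto simp: Q_def\<close>)
  qed (rule hs)
qed

end

section \<open>Delay coordinates as local embeddings\<close>

lemma openin_preimage_Rn:
  assumes "openin (Euclidean_space n) W" "continuous_on W F" "F ` W \<subseteq> Rn p" "openin (Euclidean_space p) V"
  shows "openin (Euclidean_space n) {u \<in> W. F u \<in> V}"
proof -
  obtain V' where V': "open V'" "V = Rn p \<inter> V'" using assms(4) by (auto simp: openin_Rn_top_of_set openin_open)
  have "openin (top_of_set W) (W \<inter> F -` V')" by (rule continuous_openin_preimage_gen[OF assms(2) V'(1)])
  then have "openin (top_of_set (Rn n)) (W \<inter> F -` V')"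
    using assms(1) unfolding openin_Rn_top_of_set by (rule openin_trans)
  moreover have "W \<inter> F -` V' = {u \<in> W. F u \<in> V}" using V'(2) assms(3) by auto
  ultimately show ?thesis by (simp add: openin_Rn_top_of_set)
qed

text \<open>Gives the open coordinate domain of a submanifold, where a slice chart meets the
  subspace of the first n coordinates.\<close>

lemma openin_slice:
  assumes "openin (Euclidean_space k) W" "n \<le> k"
  shows "openin (Euclidean_space n) (W \<inter> Rn n)"
proof -
  obtain V' where V': "open V'" "W = Rn k \<inter> V'" using assms(1) by (auto simp: openin_Rn_top_of_set openin_open)
  have "W \<inter> Rn n = Rn n \<inter> V'" using V' assms(2) by (auto simp: in_Rn)
  then show ?thesis using V'(1) by (simp add: openin_Rn_top_of_set openin_open_Int)
qed

lemma Cr_on_slice: "Cr_on k r W f \<Longrightarrow> n \<le> k \<Longrightarrow> W' \<subseteq> W \<Longrightarrow> Cr_on n r W' f"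
  unfolding Cr_on_def using Ck_on_slice Ck_on_subset by blast

lemma Cr_on_subset: "Cr_on n r W f \<Longrightarrow> W' \<subseteq> W \<Longrightarrow> Cr_on n r W' f"
  unfolding Cr_on_def using Ck_on_subset by blast

lemma Cr_on_continuous: "Cr_on n r U f \<Longrightarrow> continuous_on U f"
  using Cr_onD[of n r U f 0] by (simp add: zero_enat_def[symmetric])

lemma Cr_on_coord: "openin (Euclidean_space n) U \<Longrightarrow> Cr_on n r U (\<lambda>x. x j)"
  by (simp add: Cr_on_def Ck_on_coord)

lemma Cr_on_const [simp]: "Cr_on n r U (\<lambda>x. c)"
  by (simp add: Cr_on_def)

text \<open>The coordinates are replaced one at a time, in Dini's way, so that only a scalar
  inverse function theorem is needed.\<close>

lemma coordinate_selection_step: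
  fixes \<psi> :: "nat \<Rightarrow> (nat \<Rightarrow> real) \<Rightarrow> real"
  assumes r: "r \<ge> 1" and \<psi>: "\<And>l. l < k \<Longrightarrow> Cr_on n r U (\<psi> l)" and U: "openin (Euclidean_space n) U"
    and imm: "\<forall>v. (\<exists>i<n. v i \<noteq> 0) \<longrightarrow> (\<exists>l<k. (\<Sum>i<n. partial_deriv i (\<psi> l) u0 * v i) \<noteq> 0)"
    and j: "j < n" and \<sigma>: "inj_on \<sigma> {..<j}" "\<sigma> ` {..<j} \<subseteq> {..<k}"
    and W: "openin (Euclidean_space n) W" "u0 \<in> W" "W \<subseteq> U"
    and \<theta>_def: "\<theta> = (\<lambda>u i. if i < j then \<psi> (\<sigma> i) u else u i)"
    and V: "openin (Euclidean_space n) (\<theta> ` W)" and inv: "\<And>u. u \<in> W \<Longrightarrow> \<theta>' (\<theta> u) = u"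
    and Cr: "\<And>i. i < n \<Longrightarrow> Cr_on n r (\<theta> ` W) (\<lambda>w. \<theta>' w i)"
  shows "\<exists>s W1 \<theta>1. s < k \<and> s \<notin> \<sigma> ` {..<j} \<and> openin (Euclidean_space n) W1 \<and> u0 \<in> W1 \<and> W1 \<subseteq> W \<and>
    openin (Euclidean_space n) ((\<lambda>u. (\<theta> u)(j := \<psi> s u)) ` W1) \<and> (\<forall>u\<in>W1. \<theta>1 ((\<theta> u)(j := \<psi> s u)) = u) \<and>
    (\<forall>i<n. Cr_on n r ((\<lambda>u. (\<theta> u)(j := \<psi> s u)) ` W1) (\<lambda>w. \<theta>1 w i))"
proof -
  let ?V = "\<theta> ` W" and ?w = "\<theta> u0"
  define \<xi> where "\<xi> l w = \<psi> l (\<theta>' w)" for l w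
  have \<theta>'W: "\<theta>' w \<in> W" "\<theta> (\<theta>' w) = w" if "w \<in> ?V" for w using that inv by auto
  have \<theta>'U: "\<theta>' ` ?V \<subseteq> U" using \<theta>'W W(3) by blast
  have w0: "?w \<in> ?V" using W(2) by blast
  have \<xi>C: "Cr_on n r ?V (\<xi> l)" if "l < k" for l
    unfolding \<xi>_def by (rule Cr_on_compose[OF V U \<theta>'U Cr \<psi>[OF that]])
  have coord: "\<theta>' w i = w i" if "w \<in> ?V" "i \<ge> j" for w i
    using fun_cong[OF \<theta>'W(2)[OF that(1)], of i] that(2) by (simp add: \<theta>_def)
  have \<xi>\<sigma>: "\<xi> (\<sigma> i) w = w i" if "w \<in> ?V" "i < j" for w i
    using fun_cong[OF \<theta>'W(2)[OF that(1)], of i] that(2) by (simp add: \<theta>_def \<xi>_def)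
  \<comment> \<open>The direction that changes only the j-th of the current coordinates \<theta>,
    expressed in the original coordinates. Its own j-th entry is 1, so immersivity yields a
    component s whose derivative along it is nonzero.\<close>
  define v where "v i = partial_deriv j (\<lambda>w. \<theta>' w i) ?w" for i
  have "v j = 1"
    unfolding v_def using partial_deriv_cong[OF V w0 j, of "\<lambda>w. \<theta>' w j" "\<lambda>w. w j"] coord
    by (simp add: partial_deriv_coord)
  then have "\<exists>i<n. v i \<noteq> 0" using j by (intro exI[of _ j]) simp
  then obtain s where s: "s < k" "(\<Sum>i<n. partial_deriv i (\<psi> s) u0 * v i) \<noteq> 0" using imm[THEN spec, of v] by blast
  have "partial_deriv j (\<xi> s) ?w = (\<Sum>i<n. partial_deriv i (\<psi> s) (\<theta>' ?w) * v i)"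
    unfolding \<xi>_def v_def
    by (rule partial_deriv_eqI, rule Ck_on_compose_has_partial[where m = 0, OF V U \<theta>'U Cr_on_C1[OF Cr r] Cr_on_C1[OF \<psi>[OF s(1)] r] j w0])
  then have nz: "partial_deriv j (\<xi> s) ?w \<noteq> 0" using s(2) inv[OF W(2)] by simp
  \<comment> \<open>A component already used is the i-th coordinate with i < j in the current
    system, and its derivative in coordinate j vanishes.\<close>
  have s\<sigma>: "s \<notin> \<sigma> ` {..<j}"
  proof
    assume "s \<in> \<sigma> ` {..<j}"
    then obtain i where i: "i < j" "s = \<sigma> i" by blast
    have "partial_deriv j (\<xi> s) ?w = partial_deriv j (\<lambda>w. w i) ?w"
      by (rule partial_deriv_cong[OF V w0 j]) (use \<xi>\<sigma> i in auto)
    then show False using nz i by (simp add: partial_deriv_coord)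
  qed
  obtain V1 \<eta> where V1: "openin (Euclidean_space n) V1" "?w \<in> V1" "V1 \<subseteq> ?V"
    "openin (Euclidean_space n) ((\<lambda>u. u(j := \<xi> s u)) ` V1)"
    "\<And>u. u \<in> V1 \<Longrightarrow> \<eta> (u(j := \<xi> s u)) = u j" "Cr_on n r ((\<lambda>u. u(j := \<xi> s u)) ` V1) \<eta>"
    using primitive_map_inverse[OF V \<xi>C[OF s(1)] r w0 j nz] by blast
  let ?G = "\<lambda>u. u(j := \<xi> s u)"
  let ?W1 = "{u \<in> W. \<theta> u \<in> V1}"
  have GW: "(\<theta> u)(j := \<psi> s u) = ?G (\<theta> u)" if "u \<in> W" for u
    using inv[OF that] by (simp add: \<xi>_def)
  have im: "(\<lambda>u. (\<theta> u)(j := \<psi> s u)) ` ?W1 = ?G ` V1"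
  proof
    show "(\<lambda>u. (\<theta> u)(j := \<psi> s u)) ` ?W1 \<subseteq> ?G ` V1" using GW by blast
    show "?G ` V1 \<subseteq> (\<lambda>u. (\<theta> u)(j := \<psi> s u)) ` ?W1"
    proof
      fix z assume "z \<in> ?G ` V1"
      then obtain w where w: "w \<in> V1" "z = ?G w" by blast
      obtain u where u: "u \<in> W" "w = \<theta> u" using w(1) V1(3) by blast
      then show "z \<in> (\<lambda>u. (\<theta> u)(j := \<psi> s u)) ` ?W1" using w GW[OF u(1)] by (intro image_eqI[of _ _ u]) auto
    qed
  qed
  have VR: "?V \<subseteq> Rn n" using V openin_subset by blast
  have \<theta>c: "continuous_on W \<theta>"
  proof (rule continuous_on_coordinatewise_then_product)
    fix i
    have "continuous_on W (\<psi> (\<sigma> i))" if "i < j"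
      using \<sigma>(2) that by (intro continuous_on_subset[OF Cr_on_continuous[OF \<psi>] W(3)]) auto
    then show "continuous_on W (\<lambda>u. \<theta> u i)"
      unfolding \<theta>_def by (cases "i < j") (auto intro: continuous_on_subset[OF continuous_on_product_coordinates])
  qed
  \<comment> \<open>The new inverse first restores coordinate j by the scalar inverse \<eta> and
    then applies the previous inverse.\<close>
  define \<theta>1 where "\<theta>1 z = \<theta>' (z(j := \<eta> z))" for z :: "nat \<Rightarrow> real"
  have G_back: "(?G w)(j := \<eta> (?G w)) = w" if "w \<in> V1" for w using V1(5)[OF that] by simp
  show ?thesis
  proof (intro exI[of _ s] exI[of _ ?W1] exI[of _ \<theta>1] conjI ballI allI impI)
    show "openin (Euclidean_space n) ?W1" by (rule openin_preimage_Rn[OF W(1) \<theta>c VR V1(1)])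
    show "openin (Euclidean_space n) ((\<lambda>u. (\<theta> u)(j := \<psi> s u)) ` ?W1)" unfolding im by (rule V1(4))
    show "\<theta>1 ((\<theta> u)(j := \<psi> s u)) = u" if "u \<in> ?W1" for u
      using that GW[of u] G_back[of "\<theta> u"] inv[of u] by (simp add: \<theta>1_def)
    fix i assume i: "i < n"
    show "Cr_on n r ((\<lambda>u. (\<theta> u)(j := \<psi> s u)) ` ?W1) (\<lambda>w. \<theta>1 w i)"
      unfolding im \<theta>1_def
    proof (rule Cr_on_compose[OF V1(4) V _ _ Cr[OF i]])
      show "(\<lambda>z. z(j := \<eta> z)) ` ?G ` V1 \<subseteq> ?V"
      proof
        fix z assume "z \<in> (\<lambda>z. z(j := \<eta> z)) ` ?G ` V1"
        then obtain w where "w \<in> V1" "z = (?G w)(j := \<eta> (?G w))" by blast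
        then show "z \<in> ?V" using G_back V1(3) by auto
      qed
      show "Cr_on n r (?G ` V1) (\<lambda>z. (z(j := \<eta> z)) i')" for i'
        by (cases "i' = j") (use V1(6) Cr_on_coord[OF V1(4)] in auto)
    qed
  qed (use s s\<sigma> W V1 in auto)
qed

text \<open>Iterating the step from j = 0, where \<theta> is the identity, replaces all coordinates
  by n of the k components. The result is a local inverse function theorem that also selects the
  components.\<close>

lemma coordinate_selection:
  fixes \<psi> :: "nat \<Rightarrow> (nat \<Rightarrow> real) \<Rightarrow> real"
  assumes r: "r \<ge> 1" and \<psi>: "\<And>l. l < k \<Longrightarrow> Cr_on n r U (\<psi> l)" and U: "openin (Euclidean_space n) U" "u0 \<in> U"
    and imm: "\<forall>v. (\<exists>i<n. v i \<noteq> 0) \<longrightarrow> (\<exists>l<k. (\<Sum>i<n. partial_deriv i (\<psi> l) u0 * v i) \<noteq> 0)"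
  shows "\<exists>\<sigma> W \<theta>'. inj_on \<sigma> {..<n} \<and> \<sigma> ` {..<n} \<subseteq> {..<k} \<and> openin (Euclidean_space n) W \<and> u0 \<in> W \<and> W \<subseteq> U \<and>
    openin (Euclidean_space n) ((\<lambda>u i. if i < n then \<psi> (\<sigma> i) u else 0) ` W) \<and>
    (\<forall>u\<in>W. \<theta>' (\<lambda>i. if i < n then \<psi> (\<sigma> i) u else 0) = u) \<and>
    (\<forall>i<n. Cr_on n r ((\<lambda>u i. if i < n then \<psi> (\<sigma> i) u else 0) ` W) (\<lambda>w. \<theta>' w i))"
proof -
  have "\<exists>\<sigma> W \<theta>'. inj_on \<sigma> {..<j} \<and> \<sigma> ` {..<j} \<subseteq> {..<k} \<and> openin (Euclidean_space n) W \<and> u0 \<in> W \<and> W \<subseteq> U \<and>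
    openin (Euclidean_space n) ((\<lambda>u i. if i < j then \<psi> (\<sigma> i) u else u i) ` W) \<and>
    (\<forall>u\<in>W. \<theta>' (\<lambda>i. if i < j then \<psi> (\<sigma> i) u else u i) = u) \<and>
    (\<forall>i<n. Cr_on n r ((\<lambda>u i. if i < j then \<psi> (\<sigma> i) u else u i) ` W) (\<lambda>w. \<theta>' w i))" if "j \<le> n" for j
    using that
  proof (induction j)
    case 0
    show ?case
      by (rule exI[of _ "\<lambda>i. i"], rule exI[of _ U], rule exI[of _ "\<lambda>u. u"]) (use U Cr_on_coord[OF U(1)] in auto)
  next
    case (Suc j)
    then have j: "j < n" by simp
    obtain \<sigma> W \<theta>' where IH: "inj_on \<sigma> {..<j}" "\<sigma> ` {..<j} \<subseteq> {..<k}" "openin (Euclidean_space n) W" "u0 \<in> W" "W \<subseteq> U"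
      "openin (Euclidean_space n) ((\<lambda>u i. if i < j then \<psi> (\<sigma> i) u else u i) ` W)"
      "\<forall>u\<in>W. \<theta>' (\<lambda>i. if i < j then \<psi> (\<sigma> i) u else u i) = u"
      "\<forall>i<n. Cr_on n r ((\<lambda>u i. if i < j then \<psi> (\<sigma> i) u else u i) ` W) (\<lambda>w. \<theta>' w i)"
      using Suc.IH j by (auto simp del: image_subset_iff)
    define \<theta> where "\<theta> = (\<lambda>u i. if i < j then \<psi> (\<sigma> i) u else u i)"
    have "\<exists>s W1 \<theta>1. s < k \<and> s \<notin> \<sigma> ` {..<j} \<and> openin (Euclidean_space n) W1 \<and> u0 \<in> W1 \<and> W1 \<subseteq> W \<and>
      openin (Euclidean_space n) ((\<lambda>u. (\<theta> u)(j := \<psi> s u)) ` W1) \<and> (\<forall>u\<in>W1. \<theta>1 ((\<theta> u)(j := \<psi> s u)) = u) \<and>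
      (\<forall>i<n. Cr_on n r ((\<lambda>u. (\<theta> u)(j := \<psi> s u)) ` W1) (\<lambda>w. \<theta>1 w i))"
    proof (rule coordinate_selection_step[OF r \<psi> U(1) imm j IH(1-5) \<theta>_def])
      show "openin (Euclidean_space n) (\<theta> ` W)" using IH(6) by (simp add: \<theta>_def)
      show "\<theta>' (\<theta> u) = u" if "u \<in> W" for u using IH(7) that by (simp add: \<theta>_def)
      show "Cr_on n r (\<theta> ` W) (\<lambda>w. \<theta>' w i)" if "i < n" for i using IH(8) that by (simp add: \<theta>_def)
    qed
    then obtain s W1 \<theta>1 where st: "s < k" "s \<notin> \<sigma> ` {..<j}" "openin (Euclidean_space n) W1" "u0 \<in> W1" "W1 \<subseteq> W"
      "openin (Euclidean_space n) ((\<lambda>u. (\<theta> u)(j := \<psi> s u)) ` W1)" "\<forall>u\<in>W1. \<theta>1 ((\<theta> u)(j := \<psi> s u)) = u"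
      "\<forall>i<n. Cr_on n r ((\<lambda>u. (\<theta> u)(j := \<psi> s u)) ` W1) (\<lambda>w. \<theta>1 w i)" by (elim exE conjE)
    define \<sigma>1 where "\<sigma>1 = \<sigma>(j := s)"
    have eq: "(\<lambda>u i. if i < Suc j then \<psi> (\<sigma>1 i) u else u i) = (\<lambda>u. (\<theta> u)(j := \<psi> s u))"
      by (auto simp: \<theta>_def \<sigma>1_def fun_eq_iff less_Suc_eq)
    have eq': "(\<lambda>i. if i < Suc j then \<psi> (\<sigma>1 i) u else u i) = (\<theta> u)(j := \<psi> s u)" for u
      using fun_cong[OF eq, of u] .
    have "inj_on \<sigma>1 {..<Suc j}" using IH(1) st(2) unfolding \<sigma>1_def lessThan_Suc by (auto simp: inj_on_def)
    moreover have "\<sigma>1 ` {..<Suc j} \<subseteq> {..<k}"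
    proof -
      have "\<sigma> i < k" if "i < j" for i using IH(2) that by blast
      then show ?thesis using st(1) by (auto simp: \<sigma>1_def less_Suc_eq)
    qed
    moreover have "W1 \<subseteq> U" using st(5) IH(5) by blast
    ultimately show ?case
      using st(3,4,6,7,8) by (intro exI[of _ \<sigma>1] exI[of _ W1] exI[of _ \<theta>1]) (simp add: eq eq')
  qed
  from this[OF order_refl] obtain \<sigma> W \<theta>' where *: "inj_on \<sigma> {..<n}" "\<sigma> ` {..<n} \<subseteq> {..<k}" "openin (Euclidean_space n) W" "u0 \<in> W" "W \<subseteq> U"
      "openin (Euclidean_space n) ((\<lambda>u i. if i < n then \<psi> (\<sigma> i) u else u i) ` W)"
      "\<forall>u\<in>W. \<theta>' (\<lambda>i. if i < n then \<psi> (\<sigma> i) u else u i) = u"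
      "\<forall>i<n. Cr_on n r ((\<lambda>u i. if i < n then \<psi> (\<sigma> i) u else u i) ` W) (\<lambda>w. \<theta>' w i)" by (elim exE conjE)
  \<comment> \<open>Points of W vanish from index n on, so after n steps no original coordinate is
    left.\<close>
  have eq: "(\<lambda>i. if i < n then \<psi> (\<sigma> i) u else u i) = (\<lambda>i. if i < n then \<psi> (\<sigma> i) u else 0)" if "u \<in> W" for u
    using that openin_subset[OF *(3)] by (auto simp: in_Rn fun_eq_iff)
  then have im: "(\<lambda>u i. if i < n then \<psi> (\<sigma> i) u else u i) ` W = (\<lambda>u i. if i < n then \<psi> (\<sigma> i) u else 0) ` W"
    by (rule image_cong[OF refl])
  show ?thesis
    using *(1-5) *(6,8)[unfolded im] *(7) eq by (intro exI[of _ \<sigma>] exI[of _ W] exI[of _ \<theta>']) simp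
qed

text \<open>The selected components are completed to a permutation of all k, so that the
  straightening map can put them first.\<close>

lemma extend_injection:
  fixes \<sigma> :: "nat \<Rightarrow> nat"
  assumes "inj_on \<sigma> {..<n}" "\<sigma> ` {..<n} \<subseteq> {..<k}"
  obtains \<tau> \<tau>' where "\<And>i. i < n \<Longrightarrow> \<tau> i = \<sigma> i" "\<And>i. i < k \<Longrightarrow> \<tau> i < k" "\<And>i. i < k \<Longrightarrow> \<tau>' i < k"
    "\<And>i. i < k \<Longrightarrow> \<tau>' (\<tau> i) = i" "\<And>i. i < k \<Longrightarrow> \<tau> (\<tau>' i) = i"
proof -
  have cn: "card (\<sigma> ` {..<n}) = n" using card_image[OF assms(1)] by simp
  have nk: "n \<le> k" using card_mono[OF _ assms(2)] cn by simp
  have "card ({..<k} - \<sigma> ` {..<n}) = card {n..<k}"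
    using cn assms(2) by (simp add: card_Diff_subset)
  then obtain \<beta> where \<beta>: "bij_betw \<beta> {n..<k} ({..<k} - \<sigma> ` {..<n})"
    using finite_same_card_bij[of "{n..<k}" "{..<k} - \<sigma> ` {..<n}"] by auto
  define \<tau> where "\<tau> i = (if i < n then \<sigma> i else \<beta> i)" for i
  have "bij_betw \<tau> ({..<n} \<union> {n..<k}) (\<sigma> ` {..<n} \<union> ({..<k} - \<sigma> ` {..<n}))"
  proof (rule bij_betw_combine)
    show "bij_betw \<tau> {..<n} (\<sigma> ` {..<n})"
      using assms(1) by (subst bij_betw_cong[of _ _ \<sigma>]) (auto simp: \<tau>_def inj_on_imp_bij_betw)
    show "bij_betw \<tau> {n..<k} ({..<k} - \<sigma> ` {..<n})"
      using \<beta> by (subst bij_betw_cong[of _ _ \<beta>]) (auto simp: \<tau>_def)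
  qed auto
  moreover have "{..<n} \<union> {n..<k} = {..<k}" "\<sigma> ` {..<n} \<union> ({..<k} - \<sigma> ` {..<n}) = {..<k}"
    using nk assms(2) by auto
  ultimately have b: "bij_betw \<tau> {..<k} {..<k}" by simp
  show ?thesis
  proof (rule that[of \<tau> "inv_into {..<k} \<tau>"])
    show "\<tau> i < k" if "i < k" for i using b that by (auto simp: bij_betw_def)
    show "inv_into {..<k} \<tau> i < k" if "i < k" for i
      using inv_into_into[of i \<tau> "{..<k}"] b that by (auto simp: bij_betw_def)
    show "inv_into {..<k} \<tau> (\<tau> i) = i" if "i < k" for i using bij_betw_inv_into_left[OF b] that by simp
    show "\<tau> (inv_into {..<k} \<tau> i) = i" if "i < k" for i using bij_betw_inv_into_right[OF b] that by simp
  qed (simp add: \<tau>_def)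
qed

context compact_Riemannian_manifold
begin

section \<open>From the Lipschitz bound to a slice chart\<close>

text \<open>A test observable e takes the place of \<rho>, which need not be differentiable. By the
  Lipschitz bounds the increments of e along a curve are dominated by those of the delay components,
  so vanishing of their derivatives in direction v would force the derivative of e to
  vanish.\<close>

lemma delay_regular_imp_immersive:
  assumes reg: "delay_regular T k UNIV h x" and h: "h \<in> Cr_functions n r A" and T: "Cr_between n n r UNIV A UNIV A T"
    and c: "c \<in> A" "x \<in> fst c" and e: "e \<in> Cr_functions n r A" "dir_deriv n c e x v \<noteq> 0"
  shows "\<exists>l<k. dir_deriv n c (\<lambda>z. h ((T ^^ l) z)) x v \<noteq> 0"
proof (rule ccontr)
  assume "\<not> ?thesis"
  then have zero: "dir_deriv n c (\<lambda>z. h ((T ^^ l) z)) x v = 0" if "l < k" for l using that by blast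
  obtain C where C: "C \<ge> 0" "\<And>y. \<rho> x y \<le> C * delay_dist T k h x y" using reg by (auto simp: delay_regular_def)
  obtain L where L: "L > 0" "\<And>x y. path_distance n A g x y < \<infinity> \<Longrightarrow> \<bar>e x - e y\<bar> \<le> L * \<rho> x y"
    using rho_lower[OF e(1)] by blast
  obtain N where N: "open N" "x \<in> N" "\<And>y y'. y \<in> N \<Longrightarrow> y' \<in> N \<Longrightarrow> path_distance n A g y y' < \<infinity>"
    using rho_local by blast
  have u0: "snd c x \<in> chart_image c" "snd c x \<in> Rn n" using c chart_image_Rn snd_in_chart_image by blast+
  \<comment> \<open>The line through x in direction v in chart coordinates, cut off at n so that it
    stays in \<open>Rn n\<close> even if v has further entries.\<close>
  define l where "l s i = (if i < n then snd c x i + s * v i else 0)" for s :: real and i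
  have l0: "l 0 = snd c x" using u0(2) by (auto simp: l_def in_Rn fun_eq_iff)
  have lR: "l s \<in> Rn n" for s by (simp add: l_def in_Rn)
  have lc: "continuous_on S l" for S
  proof (rule continuous_on_coordinatewise_then_product)
    fix i show "continuous_on S (\<lambda>s. l s i)"
      unfolding l_def by (cases "i < n") (auto intro!: continuous_intros)
  qed
  define Z where "Z = {s. l s \<in> chart_image c}"
  have Zo: "open Z"
  proof -
    obtain V' where V': "open V'" "chart_image c = Rn n \<inter> V'"
      using chart_image_open[OF c(1)] by (auto simp: openin_Rn_top_of_set openin_open)
    have "Z = l -` V'" using V'(2) lR by (auto simp: Z_def)
    then show ?thesis using open_vimage[OF V'(1) lc] by simp
  qed
  have Z0: "0 \<in> Z" using l0 u0 by (simp add: Z_def)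
  define \<gamma> where "\<gamma> s = chart_inv c (l s)" for s
  have "continuous_on Z \<gamma>"
    unfolding \<gamma>_def by (rule continuous_on_compose2[OF chart_inv_cont[OF c(1)] lc]) (auto simp: Z_def)
  then have \<gamma>c: "isCont \<gamma> 0" using Zo Z0 continuous_on_eq_continuous_at by blast
  have \<gamma>0: "\<gamma> 0 = x" using c l0 by (simp add: \<gamma>_def)
  have evZ: "\<forall>\<^sub>F s in nhds 0. s \<in> Z" by (rule eventually_nhds_in_open[OF Zo Z0])
  have \<gamma>d: "((\<lambda>s. snd c (\<gamma> s) i) has_real_derivative v i) (at 0)" if i: "i < n" for i
  proof -
    have "((\<lambda>s. l s i) has_real_derivative v i) (at 0)"
      using i unfolding l_def by (auto intro!: derivative_eq_intros)
    moreover have "\<forall>\<^sub>F s in nhds 0. l s i = snd c (\<gamma> s) i"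
      using evZ by eventually_elim (use c in \<open>auto simp: \<gamma>_def Z_def\<close>)
    ultimately show ?thesis using DERIV_cong_ev[OF refl _ refl, of "\<lambda>s. l s i" "\<lambda>s. snd c (\<gamma> s) i" 0 "v i"] by blast
  qed
  have dh: "((\<lambda>s. f (\<gamma> s)) has_real_derivative dir_deriv n c f x v) (at 0)" if "f \<in> Cr_functions n r A" for f
    using curve_function[of c f \<gamma> 0 UNIV v, OF c(1) that _ \<gamma>c \<gamma>d] \<gamma>0 c(2) by simp
  have "((\<lambda>s. (e (\<gamma> s) - e (\<gamma> 0)) / (s - 0)) \<longlongrightarrow> 0) (at 0)"
  proof (rule Lim_null_comparison)
    have "((\<lambda>s. L * C * (\<Sum>l<k. \<bar>(h ((T ^^ l) (\<gamma> s)) - h ((T ^^ l) (\<gamma> 0))) / (s - 0)\<bar>)) \<longlongrightarrow> L * C * (\<Sum>l<k. \<bar>0\<bar>)) (at 0)"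
    proof (intro tendsto_mult tendsto_const tendsto_sum tendsto_rabs)
      fix l assume "l \<in> {..<k}"
      then show "((\<lambda>s. (h ((T ^^ l) (\<gamma> s)) - h ((T ^^ l) (\<gamma> 0))) / (s - 0)) \<longlongrightarrow> 0) (at 0)"
        using dh[OF Cr_functions_funpow[OF T h], of l] zero[of l] by (simp add: has_field_derivative_iff)
    qed
    then show "((\<lambda>s. L * C * (\<Sum>l<k. \<bar>(h ((T ^^ l) (\<gamma> s)) - h ((T ^^ l) (\<gamma> 0))) / (s - 0)\<bar>)) \<longlongrightarrow> 0) (at 0)" by simp
    have "\<forall>\<^sub>F s in at 0. \<gamma> s \<in> N"
      using \<gamma>c N(1,2) \<gamma>0 unfolding isCont_def by (auto dest: topological_tendstoD)
    then show "\<forall>\<^sub>F s in at 0. norm ((e (\<gamma> s) - e (\<gamma> 0)) / (s - 0)) \<le>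
        L * C * (\<Sum>l<k. \<bar>(h ((T ^^ l) (\<gamma> s)) - h ((T ^^ l) (\<gamma> 0))) / (s - 0)\<bar>)"
    proof eventually_elim
      case (elim s)
      have "\<bar>e x - e (\<gamma> s)\<bar> \<le> L * \<rho> x (\<gamma> s)" by (rule L(2)[OF N(3)[OF N(2) elim]])
      also have "\<dots> \<le> L * (C * delay_dist T k h x (\<gamma> s))" using L(1) C(2) by (intro mult_left_mono) auto
      also have "\<dots> \<le> L * (C * (\<Sum>l<k. \<bar>h ((T ^^ l) x) - h ((T ^^ l) (\<gamma> s))\<bar>))"
        unfolding delay_dist_def using L(1) C(1) by (intro mult_left_mono L2_set_le_sum_abs) auto
      finally have "\<bar>e (\<gamma> s) - e (\<gamma> 0)\<bar> / \<bar>s\<bar> \<le> L * (C * (\<Sum>l<k. \<bar>h ((T ^^ l) x) - h ((T ^^ l) (\<gamma> s))\<bar>)) / \<bar>s\<bar>"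
        unfolding \<gamma>0 by (intro divide_right_mono) (auto simp: abs_minus_commute)
      then show ?case unfolding \<gamma>0 by (simp add: sum_divide_distrib[symmetric] abs_minus_commute mult.assoc)
    qed
  qed
  then have "((\<lambda>s. e (\<gamma> s)) has_real_derivative 0) (at 0)" by (simp add: has_field_derivative_iff)
  then have "dir_deriv n c e x v = 0" using DERIV_unique dh[OF e(1)] by blast
  then show False using e(2) by simp
qed

lemma delay_map_continuous:
  fixes T :: "'a \<Rightarrow> 'a" and h :: "'a \<Rightarrow> real"
  assumes "continuous_on UNIV T" "continuous_on UNIV h"
  shows "continuous_on UNIV (delay_map T h k)"
proof (rule continuous_on_coordinatewise_then_product)
  fix i
  have "continuous_on UNIV (\<lambda>x. h ((T ^^ i) x))"
    by (rule continuous_on_compose2[OF assms(2) funpow_continuous[OF assms(1)]]) simp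
  then show "continuous_on UNIV (\<lambda>x. delay_map T h k x i)"
    by (cases "i < k") (simp_all add: delay_map_def)
qed

lemma delay_map_Rn: "delay_map T h k x \<in> Rn k"
  by (simp add: delay_map_def in_Rn)

text \<open>Immersivity provides an inverse on a chart neighbourhood U0. Points outside U0 might
  still be mapped close to \<open>delay_map T h k x\<close>; their image is compact and misses this
  value, as regularity makes x the only preimage, so it can be cut away from the target.\<close>

theorem delay_map_local_diffeo:
  assumes reg: "delay_regular T k UNIV h x" and h: "h \<in> Cr_functions n r A" and T: "Cr_between n n r UNIV A UNIV A T" and nk: "n \<le> k"
  shows "\<exists>U V. open U \<and> x \<in> U \<and> openin (Euclidean_space k) V \<and> delay_map T h k x \<in> V \<and>
            embedded_submanifold k n r (V \<inter> range (delay_map T h k)) \<and>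
            Cr_diffeo n r U (restrict_atlas A U) (V \<inter> range (delay_map T h k))
              (slice_atlas k n r (V \<inter> range (delay_map T h k))) (delay_map T h k)"
proof -
  let ?\<phi> = "delay_map T h k"
  have Tc: "continuous_on UNIV T" using T by (simp add: Cr_between_def)
  have \<phi>c: "continuous_on S ?\<phi>" for S
    using delay_map_continuous[OF Tc Cr_functions_continuous[OF h]] continuous_on_subset by blast
  obtain E where E: "E \<subseteq> Cr_functions n r A"
    "\<And>x. \<exists>c\<in>A. x \<in> fst c \<and> (\<forall>v. (\<exists>i<n. v i \<noteq> 0) \<longrightarrow> (\<exists>e\<in>E. dir_deriv n c e x v \<noteq> 0))"
    using separating_immersive_family by metis
  obtain c where c: "c \<in> A" "x \<in> fst c" and Ec: "\<And>v. \<exists>i<n. v i \<noteq> 0 \<Longrightarrow> \<exists>e\<in>E. dir_deriv n c e x v \<noteq> 0"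
    using E(2)[of x] by blast
  define \<psi> where "\<psi> l u = h ((T ^^ l) (chart_inv c u))" for l u
  have \<psi>C: "Cr_on n r (chart_image c) (\<psi> l)" for l
    using Cr_functionsD[OF Cr_functions_funpow[OF T h] c(1)] by (simp add: \<psi>_def[abs_def])
  have imm: "\<exists>l<k. (\<Sum>i<n. partial_deriv i (\<psi> l) (snd c x) * v i) \<noteq> 0" if nz: "\<exists>i<n. v i \<noteq> 0" for v
  proof -
    obtain e where e: "e \<in> E" "dir_deriv n c e x v \<noteq> 0" using Ec[OF nz] by blast
    then have "e \<in> Cr_functions n r A" using E(1) by blast
    from delay_regular_imp_immersive[OF reg h T c this e(2)] show ?thesis by (simp add: dir_deriv_def \<psi>_def[abs_def])
  qed
  then have imm': "\<forall>v. (\<exists>i<n. v i \<noteq> 0) \<longrightarrow> (\<exists>l<k. (\<Sum>i<n. partial_deriv i (\<psi> l) (snd c x) * v i) \<noteq> 0)" by blast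
  have sx: "snd c x \<in> chart_image c" using c by simp
  obtain \<sigma> W \<theta>' where \<sigma>: "inj_on \<sigma> {..<n}" "\<sigma> ` {..<n} \<subseteq> {..<k}"
    and W: "openin (Euclidean_space n) W" "snd c x \<in> W" "W \<subseteq> chart_image c"
    and th: "openin (Euclidean_space n) ((\<lambda>u i. if i < n then \<psi> (\<sigma> i) u else 0) ` W)"
      "\<forall>u\<in>W. \<theta>' (\<lambda>i. if i < n then \<psi> (\<sigma> i) u else 0) = u"
      "\<forall>i<n. Cr_on n r ((\<lambda>u i. if i < n then \<psi> (\<sigma> i) u else 0) ` W) (\<lambda>w. \<theta>' w i)"
    using coordinate_selection[OF r1 \<psi>C chart_image_open[OF c(1)] sx imm'] by (elim exE conjE)
  define \<theta> where "\<theta> u i = (if i < n then \<psi> (\<sigma> i) u else 0)" for u i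
  have \<theta>o: "openin (Euclidean_space n) (\<theta> ` W)" and \<theta>'\<theta>: "\<And>u. u \<in> W \<Longrightarrow> \<theta>' (\<theta> u) = u"
    and \<theta>'C: "\<And>i. i < n \<Longrightarrow> Cr_on n r (\<theta> ` W) (\<lambda>w. \<theta>' w i)"
    using th unfolding \<theta>_def[abs_def] by auto
  have \<theta>'W: "\<theta>' w \<in> W" "\<theta> (\<theta>' w) = w" if "w \<in> \<theta> ` W" for w using that \<theta>'\<theta> by auto
  have WR: "W \<subseteq> Rn n" and \<theta>R: "\<theta> ` W \<subseteq> Rn n" using W(1) \<theta>o openin_subset by blast+
  obtain \<tau> \<tau>' where \<tau>: "\<And>i. i < n \<Longrightarrow> \<tau> i = \<sigma> i" "\<And>i. i < k \<Longrightarrow> \<tau> i < k" "\<And>i. i < k \<Longrightarrow> \<tau>' i < k"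
    "\<And>i. i < k \<Longrightarrow> \<tau>' (\<tau> i) = i" "\<And>i. i < k \<Longrightarrow> \<tau> (\<tau>' i) = i"
    using extend_injection[OF \<sigma>] by blast
  \<comment> \<open>Extracts the n selected components of a delay vector; on the image near x they
    determine the point through \<theta>'. The companion \<open>pn\<close> reads the same data off
    the straightened coordinates.\<close>
  define R where "R z i = (if i < n then z (\<sigma> i) else 0)" for z :: "nat \<Rightarrow> real" and i
  define pn where "pn y i = (if i < n then y i else 0)" for y :: "nat \<Rightarrow> real" and i
  define \<Omega> where "\<Omega> = {z \<in> Rn k. R z \<in> \<theta> ` W}"
  define \<Omega>' where "\<Omega>' = {y \<in> Rn k. pn y \<in> \<theta> ` W}"
  have R_Rn: "R z \<in> Rn n" "pn z \<in> Rn n" for z by (auto simp: R_def pn_def in_Rn)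
  have Rc: "continuous_on S R" "continuous_on S pn" for S :: "(nat \<Rightarrow> real) set"
  proof -
    have c: "continuous_on S (\<lambda>z. z j)" for j
      by (rule continuous_on_subset[OF continuous_on_product_coordinates]) simp
    have "continuous_on S (\<lambda>z. R z i)" "continuous_on S (\<lambda>z. pn z i)" for i
      unfolding R_def pn_def by (cases "i < n"; simp add: c)+
    then show "continuous_on S R" "continuous_on S pn"
      by (intro continuous_on_coordinatewise_then_product; blast)+
  qed
  have \<Omega>o: "openin (Euclidean_space k) \<Omega>" "openin (Euclidean_space k) \<Omega>'"
    unfolding \<Omega>_def \<Omega>'_def
    by (rule openin_preimage_Rn[OF openin_Rn Rc(1) _ \<theta>o], use R_Rn in blast, rule openin_preimage_Rn[OF openin_Rn Rc(2) _ \<theta>o], use R_Rn in blast)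
  have RC: "Cr_on k r S (\<lambda>z. R z i)" "Cr_on k r S (\<lambda>z. pn z i)" if "openin (Euclidean_space k) S" for S i
    using Cr_on_coord[OF that] unfolding R_def pn_def by (cases "i < n"; simp)+
  have \<psi>R: "Cr_on k r \<Omega> (\<lambda>z. \<psi> l (\<theta>' (R z)))" "Cr_on k r \<Omega>' (\<lambda>z. \<psi> l (\<theta>' (pn z)))" for l
  proof -
    have "Cr_on n r (\<theta> ` W) (\<lambda>w. \<psi> l (\<theta>' w))"
      by (rule Cr_on_compose[OF \<theta>o chart_image_open[OF c(1)] _ \<theta>'C \<psi>C]) (use \<theta>'W W(3) in blast)
    note C = this
    show "Cr_on k r \<Omega> (\<lambda>z. \<psi> l (\<theta>' (R z)))"
      by (rule Cr_on_compose[OF \<Omega>o(1) \<theta>o _ RC(1)[OF \<Omega>o(1)] C]) (auto simp: \<Omega>_def)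
    show "Cr_on k r \<Omega>' (\<lambda>z. \<psi> l (\<theta>' (pn z)))"
      by (rule Cr_on_compose[OF \<Omega>o(2) \<theta>o _ RC(2)[OF \<Omega>o(2)] C]) (auto simp: \<Omega>'_def)
  qed
  \<comment> \<open>The straightening of a graph: the selected components come first, and from each
    of the others the function of them that it equals on the image is subtracted. D' adds it back;
    the two are inverse because R and \<open>pn\<close> give them the same base point.\<close>
  define D where "D z i = (if i < n then z (\<tau> i) else if i < k then z (\<tau> i) - \<psi> (\<tau> i) (\<theta>' (R z)) else 0)" for z i
  define D' where "D' y l = (if l < k then (if \<tau>' l < n then y (\<tau>' l) else y (\<tau>' l) + \<psi> l (\<theta>' (pn y))) else 0)" for y l
  have DC: "Cr_on k r \<Omega> (\<lambda>z. D z i)" for i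
  proof -
    have "Cr_on k r \<Omega> (\<lambda>z. z (\<tau> i) - \<psi> (\<tau> i) (\<theta>' (R z)))"
      using Ck_on_diff[OF \<Omega>o(1)] Cr_on_coord[OF \<Omega>o(1)] \<psi>R(1) by (simp add: Cr_on_def)
    then show ?thesis using Cr_on_coord[OF \<Omega>o(1)] unfolding D_def by (cases "i < n"; cases "i < k"; simp)
  qed
  have D'C: "Cr_on k r \<Omega>' (\<lambda>y. D' y l)" for l
  proof -
    have "Cr_on k r \<Omega>' (\<lambda>y. y (\<tau>' l) + \<psi> l (\<theta>' (pn y)))"
      using Ck_on_add[OF \<Omega>o(2)] Cr_on_coord[OF \<Omega>o(2)] \<psi>R(2) by (simp add: Cr_on_def)
    then show ?thesis using Cr_on_coord[OF \<Omega>o(2)] unfolding D'_def by (cases "l < k"; cases "\<tau>' l < n"; simp)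
  qed
  have pD: "pn (D z) = R z" for z by (auto simp: pn_def D_def R_def \<tau>(1) fun_eq_iff)
  have DR: "D z \<in> Rn k" "D' z \<in> Rn k" for z using nk by (auto simp: D_def D'_def in_Rn)
  have D\<Omega>: "D z \<in> \<Omega>'" "D' (D z) = z" if "z \<in> \<Omega>" for z
  proof -
    show "D z \<in> \<Omega>'" using that DR pD by (simp add: \<Omega>_def \<Omega>'_def)
    show "D' (D z) = z"
    proof
      fix l
      show "D' (D z) l = z l"
      proof (cases "l < k")
        case True
        then show ?thesis unfolding D'_def pD using \<tau>(3,5)[OF True] by (auto simp: D_def)
      next
        case False
        then show ?thesis using that by (simp add: D'_def \<Omega>_def in_Rn)
      qed
    qed
  qed
  have RD': "R (D' y) = pn y" for y
  proof
    fix i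
    have "\<sigma> i < k" "\<tau>' (\<sigma> i) = i" if "i < n" using \<sigma>(2) that \<tau>(1)[OF that] \<tau>(4)[of i] nk by auto
    then show "R (D' y) i = pn y i" by (simp add: R_def pn_def D'_def)
  qed
  have D'\<Omega>: "D' y \<in> \<Omega>" "D (D' y) = y" if "y \<in> \<Omega>'" for y
  proof -
    show "D' y \<in> \<Omega>" using that DR RD' by (simp add: \<Omega>_def \<Omega>'_def)
    show "D (D' y) = y"
    proof
      fix i
      show "D (D' y) i = y i"
      proof (cases "i < k")
        case True
        then show ?thesis unfolding D_def RD' using \<tau>(2,4)[OF True] nk by (auto simp: D'_def)
      next
        case False
        then show ?thesis using that nk by (auto simp: D_def \<Omega>'_def in_Rn)
      qed
    qed
  qed
  define U0 where "U0 = {y \<in> fst c. snd c y \<in> W}"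
  have U0o: "open U0" unfolding U0_def by (rule chart_inv_image_open[OF c(1) W(1)])
  have \<phi>\<psi>: "?\<phi> y = (\<lambda>l. if l < k then \<psi> l (snd c y) else 0)" if "y \<in> fst c" for y
    using that c by (auto simp: delay_map_def \<psi>_def)
  have R\<phi>: "R (?\<phi> y) = \<theta> (snd c y)" if "y \<in> fst c" for y
    using \<sigma>(2) unfolding \<phi>\<psi>[OF that] by (auto simp: R_def \<theta>_def fun_eq_iff)
  \<comment> \<open>Removing the image of the complement of U0 ensures that every point of the image
    in V comes from U0.\<close>
  define V where "V = \<Omega> - ?\<phi> ` (- U0)"
  have Vo: "openin (Euclidean_space k) V"
  proof -
    have "compact (- U0)" using cpt U0o by (metis Compl_eq_Diff_UNIV compact_diff)
    then have "closed (?\<phi> ` (- U0))" by (intro compact_imp_closed compact_continuous_image \<phi>c)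
    then have "openin (top_of_set (Rn k)) (\<Omega> \<inter> (- ?\<phi> ` (- U0)))"
      using \<Omega>o(1) by (auto simp: openin_Rn_top_of_set openin_open Int_assoc open_Compl)
    then show ?thesis by (simp add: V_def openin_Rn_top_of_set Diff_eq)
  qed
  define S where "S = V \<inter> range ?\<phi>"
  \<comment> \<open>Injectivity is known only against x itself: if the delay vectors agree, the
    Lipschitz bound gives \<rho> = 0.\<close>
  have inj_x: "y = x" if "?\<phi> y = ?\<phi> x" for y
  proof -
    obtain C where "\<rho> x y \<le> C * delay_dist T k h x y" using reg by (auto simp: delay_regular_def)
    moreover have "delay_dist T k h x y = 0"
      unfolding euclidean_norm_delay[symmetric] using that by (simp add: euclidean_norm_def L2_set_def)
    ultimately have "\<rho> x y = 0" using rho_nonneg[of x y] by simp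
    then show ?thesis by (simp add: rho_zero_iff)
  qed
  \<comment> \<open>The full preimage of V, so that the delay map takes U onto the whole of
    \<open>V \<inter> range (delay_map T h k)\<close>.\<close>
  define U where "U = {y. ?\<phi> y \<in> V}"
  have Uo: "open U"
  proof -
    obtain V' where V': "open V'" "V = Rn k \<inter> V'" using Vo by (auto simp: openin_Rn_top_of_set openin_open)
    have "U = ?\<phi> -` V'" using V' delay_map_Rn by (auto simp: U_def)
    then show ?thesis using open_vimage[OF V'(1) \<phi>c] by simp
  qed
  have xV: "?\<phi> x \<in> V"
  proof -
    have "R (?\<phi> x) \<in> \<theta> ` W" using R\<phi>[OF c(2)] W(2) by simp
    moreover have "?\<phi> x \<notin> ?\<phi> ` (- U0)"
    proof
      assume "?\<phi> x \<in> ?\<phi> ` (- U0)"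
      then obtain y where "y \<notin> U0" "?\<phi> y = ?\<phi> x" by auto
      then show False using inj_x c W(2) by (auto simp: U0_def)
    qed
    ultimately show ?thesis using delay_map_Rn by (simp add: V_def \<Omega>_def)
  qed
  have UU0: "y \<in> fst c" "snd c y \<in> W" if "y \<in> U" for y
    using that by (auto simp: U_def V_def U0_def)
  define \<iota> where "\<iota> z = chart_inv c (\<theta>' (R z))" for z
  have \<iota>\<phi>: "\<iota> (?\<phi> y) = y" if "y \<in> U" for y
    using R\<phi>[OF UU0(1)[OF that]] \<theta>'\<theta>[OF UU0(2)[OF that]] UU0(1)[OF that] c by (simp add: \<iota>_def)
  have bij: "bij_betw ?\<phi> U S"
  proof (rule bij_betw_imageI)
    show "inj_on ?\<phi> U" by (rule inj_on_inverseI[of _ \<iota>]) (rule \<iota>\<phi>)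
    show "?\<phi> ` U = S" by (auto simp: U_def S_def)
  qed
  have inv\<phi>: "inv_into U ?\<phi> z = \<iota> z" "\<iota> z \<in> U" "?\<phi> (\<iota> z) = z" if zS: "z \<in> S" for z
  proof -
    obtain y where y: "y \<in> U" "z = ?\<phi> y" using zS by (auto simp: S_def U_def)
    then show "\<iota> z \<in> U" "?\<phi> (\<iota> z) = z" using \<iota>\<phi> by auto
    show "inv_into U ?\<phi> z = \<iota> z" using y \<iota>\<phi> bij_betw_inv_into_left[OF bij y(1)] by simp
  qed
  \<comment> \<open>The last k - n straightened coordinates vanish exactly on the graph. Conversely,
    such a point is the delay vector of the point recovered by \<theta>', hence lies in the
    image.\<close>
  have SD: "D ` (V \<inter> S) = D ` V \<inter> Rn n"
  proof
    show "D ` (V \<inter> S) \<subseteq> D ` V \<inter> Rn n"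
    proof
      fix w assume "w \<in> D ` (V \<inter> S)"
      then obtain z where z: "z \<in> V" "z \<in> S" "w = D z" by blast
      have y: "\<iota> z \<in> U" "?\<phi> (\<iota> z) = z" using inv\<phi>[OF z(2)] by auto
      have "R z = \<theta> (snd c (\<iota> z))" using R\<phi>[OF UU0(1)[OF y(1)]] y(2) by simp
      then have t: "\<theta>' (R z) = snd c (\<iota> z)" using \<theta>'\<theta>[OF UU0(2)[OF y(1)]] by simp
      have "z i = \<psi> i (snd c (\<iota> z))" if "i < k" for i using fun_cong[OF \<phi>\<psi>[OF UU0(1)[OF y(1)]], of i] that y(2) by simp
      then have "D z i = 0" if "i \<ge> n" for i using that \<tau>(2)[of i] t by (simp add: D_def)
      then show "w \<in> D ` V \<inter> Rn n" using z by (auto simp: in_Rn)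
    qed
    show "D ` V \<inter> Rn n \<subseteq> D ` (V \<inter> S)"
    proof
      fix w assume "w \<in> D ` V \<inter> Rn n"
      then obtain z where z: "z \<in> V" "w = D z" "D z \<in> Rn n" by blast
      have z\<Omega>: "z \<in> \<Omega>" using z(1) by (simp add: V_def)
      then have RW: "R z \<in> \<theta> ` W" and zR: "z \<in> Rn k" by (auto simp: \<Omega>_def)
      define u where "u = \<theta>' (R z)"
      have u: "u \<in> W" "\<theta> u = R z" using \<theta>'W[OF RW] by (auto simp: u_def)
      have uc: "chart_inv c u \<in> fst c" "snd c (chart_inv c u) = u" using u(1) W(3) c(1) by auto
      have "z l = \<psi> l u" if l: "l < k" for l
      proof (cases "\<tau>' l < n")
        case True
        have "\<theta> u (\<tau>' l) = R z (\<tau>' l)" using u(2) by simp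
        then show ?thesis using True \<tau>(1)[OF True] \<tau>(5)[OF l] by (simp add: \<theta>_def R_def)
      next
        case False
        have "D z (\<tau>' l) = 0" using z(3) False by (simp add: in_Rn)
        then show ?thesis using False \<tau>(3,5)[OF l] by (simp add: D_def u_def)
      qed
      then have "?\<phi> (chart_inv c u) = z"
        unfolding \<phi>\<psi>[OF uc(1)] uc(2) using zR by (auto simp: in_Rn fun_eq_iff)
      then have "z \<in> range ?\<phi>" by (metis rangeI)
      then show "w \<in> D ` (V \<inter> S)" using z by (auto simp: S_def)
    qed
  qed
  have V\<Omega>: "V \<subseteq> \<Omega>" by (auto simp: V_def)
  have DV: "D ` V = {y \<in> \<Omega>'. D' y \<in> V}"
  proof
    show "D ` V \<subseteq> {y \<in> \<Omega>'. D' y \<in> V}" using D\<Omega> V\<Omega> by auto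
    show "{y \<in> \<Omega>'. D' y \<in> V} \<subseteq> D ` V" using D'\<Omega> by (metis (no_types, lifting) image_eqI mem_Collect_eq subsetI)
  qed
  have D'c: "continuous_on \<Omega>' D'"
    by (rule continuous_on_coordinatewise_then_product) (rule Cr_on_continuous[OF D'C])
  have DVo: "openin (Euclidean_space k) (D ` V)"
    unfolding DV by (rule openin_preimage_Rn[OF \<Omega>o(2) D'c _ Vo]) (use DR in blast)
  have injD: "inj_on D V" by (rule inj_on_inverseI[of _ D']) (use D\<Omega>(2) V\<Omega> in blast)
  have ci: "chart_inv (V, D) y = D' y" if "y \<in> D ` V" for y
    using that D\<Omega>(2) V\<Omega> inv_into_f_f[OF injD] by (auto simp: chart_inv_def)
  have slice: "slice_chart k n r S (V, D)"
    unfolding slice_chart_def chart_image_def fst_conv snd_conv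
  proof (intro conjI Vo DVo injD SD)
    show "Cr_map_on k k r V D"
      using Cr_on_subset[OF DC V\<Omega>] DR by (auto simp: Cr_map_on_def)
    have "Cr_on k r (D ` V) (\<lambda>y. chart_inv (V, D) y l)" for l
      by (rule Cr_on_cong[OF DVo _ Cr_on_subset[OF D'C]]) (use ci DV in auto)
    moreover have "chart_inv (V, D) ` D ` V \<subseteq> Rn k" using ci DR by auto
    ultimately show "Cr_map_on k k r (D ` V) (chart_inv (V, D))" by (simp add: Cr_map_on_def)
  qed
  have emb: "embedded_submanifold k n r S"
    unfolding embedded_submanifold_def using nk slice openin_subset[OF Vo] by (auto simp: S_def)
  have fwd: "Cr_between n n r U (restrict_atlas A U) S (slice_atlas k n r S) ?\<phi>"
    unfolding Cr_between_def
  proof (intro conjI ballI \<phi>c)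
    show "?\<phi> ` U \<subseteq> S" using bij by (simp add: bij_betw_def)
    fix c1 d assume "c1 \<in> restrict_atlas A U" "d \<in> slice_atlas k n r S"
    then obtain a e where a: "a \<in> A" "c1 = (fst a \<inter> U, snd a)" and e: "slice_chart k n r S e" "d = (fst e \<inter> S, snd e)"
      by (auto simp: restrict_atlas_def slice_atlas_def)
    have e': "openin (Euclidean_space k) (fst e)" "Cr_map_on k k r (fst e) (snd e)"
      "snd e ` (fst e \<inter> S) = chart_image e \<inter> Rn n" using e(1) by (auto simp: slice_chart_def)
    define Q where "Q = {y. ?\<phi> y \<in> fst e}"
    have Qo: "open Q"
    proof -
      obtain V' where V': "open V'" "fst e = Rn k \<inter> V'" using e'(1) by (auto simp: openin_Rn_top_of_set openin_open)
      have "Q = ?\<phi> -` V'" using V' delay_map_Rn by (auto simp: Q_def)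
      then show ?thesis using open_vimage[OF V'(1) \<phi>c] by simp
    qed
    have dom: "fst c1 \<inter> ?\<phi> -` fst d = fst a \<inter> (U \<inter> Q)"
      using bij by (auto simp: a e Q_def bij_betw_def)
    have UQ: "open (U \<inter> Q)" using Uo Qo by blast
    note im = chart_image_of_open[OF a(1) UQ]
    \<comment> \<open>Shrinking the domain of a chart changes the set over which its inverse is
      chosen, but by injectivity not the values.\<close>
    have cinv: "chart_inv c1 u = chart_inv a u" if uQ: "u \<in> snd a ` (fst a \<inter> (U \<inter> Q))" for u
    proof -
      obtain y where y: "y \<in> fst a" "y \<in> U" "u = snd a y" using uQ by blast
      have "inj_on (snd a) (fst a \<inter> U)" by (rule inj_on_inverseI[of _ "chart_inv a"]) (use a(1) in auto)
      then have "chart_inv c1 u = y" using y inv_into_f_f[of "snd a" "fst a \<inter> U" y] by (simp add: chart_inv_def a)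
      then show ?thesis using y a(1) by simp
    qed
    show "Cr_map_on n n r (snd c1 ` (fst c1 \<inter> ?\<phi> -` fst d)) (snd d \<circ> ?\<phi> \<circ> chart_inv c1)"
      unfolding dom Cr_map_on_def
    proof (intro conjI allI impI)
      have s1: "snd c1 = snd a" "snd d = snd e" using a e by auto
      show "(snd d \<circ> ?\<phi> \<circ> chart_inv c1) ` snd c1 ` (fst a \<inter> (U \<inter> Q)) \<subseteq> Rn n"
      proof
        fix w assume "w \<in> (snd d \<circ> ?\<phi> \<circ> chart_inv c1) ` snd c1 ` (fst a \<inter> (U \<inter> Q))"
        then obtain y where y: "y \<in> fst a \<inter> (U \<inter> Q)" "w = snd e (?\<phi> (chart_inv c1 (snd a y)))" unfolding s1 by auto
        have "chart_inv c1 (snd a y) = y" using cinv[of "snd a y"] y(1) a(1) by simp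
        then have "w \<in> snd e ` (fst e \<inter> S)" using y bij by (auto simp: Q_def bij_betw_def)
        then show "w \<in> Rn n" using e'(3) by blast
      qed
      fix j assume j: "j < n"
      have "Cr_on n r (snd a ` (fst a \<inter> (U \<inter> Q))) (\<lambda>u. snd e (?\<phi> (chart_inv a u)) j)"
      proof (rule Cr_on_compose[where F = "\<lambda>u. ?\<phi> (chart_inv a u)" and f = "\<lambda>x. snd e x j", OF im(1) e'(1)])
        show "(\<lambda>u. ?\<phi> (chart_inv a u)) ` snd a ` (fst a \<inter> (U \<inter> Q)) \<subseteq> fst e" using im(2) by (auto simp: Q_def)
        show "Cr_on k r (fst e) (\<lambda>x. snd e x j)" using e'(2) j nk by (simp add: Cr_map_on_def)
        fix l assume "l < k"
        then show "Cr_on n r (snd a ` (fst a \<inter> (U \<inter> Q))) (\<lambda>u. ?\<phi> (chart_inv a u) l)"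
          using Cr_on_subset[OF Cr_functionsD[OF Cr_functions_funpow[OF T h, of l] a(1)]] im(2)
          by (simp add: delay_map_def)
      qed
      then show "Cr_on n r (snd c1 ` (fst a \<inter> (U \<inter> Q))) (\<lambda>x. (snd d \<circ> ?\<phi> \<circ> chart_inv c1) x j)"
        unfolding s1 by (rule Cr_on_cong[OF im(1), rotated]) (simp add: cinv)
    qed
  qed
  have bwd: "Cr_between n n r S (slice_atlas k n r S) U (restrict_atlas A U) (inv_into U ?\<phi>)"
    unfolding Cr_between_def
  proof (intro conjI ballI)
    show "inv_into U ?\<phi> ` S \<subseteq> U" using inv\<phi> by auto
    have \<theta>'c: "continuous_on (\<theta> ` W) \<theta>'"
      by (rule continuous_on_into_Rn[of _ _ n]) (use \<theta>'W(1) WR Cr_on_continuous[OF \<theta>'C] in auto)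
    have SR: "R z \<in> \<theta> ` W" if "z \<in> S" for z using that V\<Omega> by (auto simp: S_def \<Omega>_def)
    have "continuous_on S \<iota>"
      unfolding \<iota>_def
      by (rule continuous_on_compose2[OF chart_inv_cont[OF c(1)] continuous_on_compose2[OF \<theta>'c Rc(1)]])
         (use SR \<theta>'W(1) W(3) in auto)
    then show "continuous_on S (inv_into U ?\<phi>)" by (rule continuous_on_eq) (simp add: inv\<phi>(1))
    fix d c1 assume "d \<in> slice_atlas k n r S" "c1 \<in> restrict_atlas A U"
    then obtain a e where a: "a \<in> A" "c1 = (fst a \<inter> U, snd a)" and e: "slice_chart k n r S e" "d = (fst e \<inter> S, snd e)"
      by (auto simp: restrict_atlas_def slice_atlas_def)
    have e': "openin (Euclidean_space k) (chart_image e)" "Cr_map_on k k r (chart_image e) (chart_inv e)"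
      "snd e ` (fst e \<inter> S) = chart_image e \<inter> Rn n" "inj_on (snd e) (fst e)" using e(1) by (auto simp: slice_chart_def)
    \<comment> \<open>The coordinate domain of the submanifold in an arbitrary slice chart e; all
      such charts belong to the atlas, not just the one constructed above.\<close>
    define H where "H = chart_image e \<inter> Rn n"
    have Ho: "openin (Euclidean_space n) H" unfolding H_def by (rule openin_slice[OF e'(1) nk])
    have zS: "chart_inv e y \<in> fst e \<inter> S" "chart_inv d y = chart_inv e y" if yH: "y \<in> H" for y
    proof -
      obtain z where z: "z \<in> fst e" "z \<in> S" "y = snd e z" using yH e'(3) unfolding H_def by blast
      have "chart_inv e y = z" using z e'(4) by (simp add: chart_inv_def)
      moreover have "chart_inv d y = z"
        using z inv_into_f_f[OF inj_on_subset[OF e'(4)], of "fst e \<inter> S" z] by (simp add: chart_inv_def e(2))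
      ultimately show "chart_inv e y \<in> fst e \<inter> S" "chart_inv d y = chart_inv e y" using z by auto
    qed
    have ceC: "Cr_on n r H (\<lambda>y. chart_inv e y l)" if "l < k" for l
    proof (rule Cr_on_slice[OF _ nk])
      show "Cr_on k r (chart_image e) (\<lambda>y. chart_inv e y l)" using e'(2) that by (simp add: Cr_map_on_def)
    qed (simp add: H_def)
    define F where "F y = R (chart_inv e y)" for y
    have FW: "F y \<in> \<theta> ` W" if "y \<in> H" for y unfolding F_def using zS(1)[OF that] SR by blast
    have FC: "Cr_on n r H (\<lambda>y. F y i)" for i
      using ceC[of "\<sigma> i"] \<sigma>(2) by (cases "i < n") (auto simp: F_def R_def)
    have GC: "Cr_on n r H (\<lambda>y. \<theta>' (F y) i)" if "i < n" for i
      by (rule Cr_on_compose[OF Ho \<theta>o _ FC \<theta>'C[OF that]]) (use FW in blast)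
    define Q where "Q = {y \<in> H. \<theta>' (F y) \<in> snd c ` (fst c \<inter> fst a)}"
    note tr = chart_image_of_open[OF c(1) chart_open[OF a(1)]]
    have Qo: "openin (Euclidean_space n) Q"
      unfolding Q_def
    proof (rule openin_preimage_Rn[OF Ho _ _ tr(1)])
      show "(\<lambda>y. \<theta>' (F y)) ` H \<subseteq> Rn n" using FW \<theta>'W(1) WR by blast
      then show "continuous_on H (\<lambda>y. \<theta>' (F y))"
        by (rule continuous_on_into_Rn) (rule Cr_on_continuous[OF GC])
    qed
    \<comment> \<open>In coordinates the inverse is a composition of smooth maps: the slice chart
      inverse restricted to n variables, selection of components, \<theta>' and the chart c.\<close>
    have \<iota>e: "inv_into U ?\<phi> (chart_inv d y) = chart_inv c (\<theta>' (F y))" if "y \<in> H" for y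
      using zS[OF that] inv\<phi>(1) by (simp add: \<iota>_def F_def)
    have dom: "snd d ` (fst d \<inter> inv_into U ?\<phi> -` fst c1) = Q"
    proof
      show "snd d ` (fst d \<inter> inv_into U ?\<phi> -` fst c1) \<subseteq> Q"
      proof
        fix y assume "y \<in> snd d ` (fst d \<inter> inv_into U ?\<phi> -` fst c1)"
        then obtain z where z: "z \<in> fst e" "z \<in> S" "y = snd e z" "inv_into U ?\<phi> z \<in> fst a" by (auto simp: e(2) a(2))
        have yH: "y \<in> H" using z e'(3) unfolding H_def by blast
        have "chart_inv e y = z" using z e'(4) by (simp add: chart_inv_def)
        then have Fy: "F y = R z" by (simp add: F_def)
        have "\<theta>' (R z) \<in> W" using \<theta>'W(1) SR[OF z(2)] by blast
        then have "\<theta>' (R z) \<in> chart_image c" using W(3) by blast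
        moreover have "chart_inv c (\<theta>' (R z)) \<in> fst a" using z(4) inv\<phi>(1)[OF z(2)] by (simp add: \<iota>_def)
        ultimately show "y \<in> Q" using yH Fy tr(2) by (simp add: Q_def)
      qed
      show "Q \<subseteq> snd d ` (fst d \<inter> inv_into U ?\<phi> -` fst c1)"
      proof
        fix y assume y: "y \<in> Q"
        then have yH: "y \<in> H" by (simp add: Q_def)
        have z: "chart_inv e y \<in> fst e \<inter> S" by (rule zS(1)[OF yH])
        have "snd e (chart_inv e y) = y"
          using yH unfolding H_def chart_image_def chart_inv_def by (simp add: f_inv_into_f)
        moreover have "inv_into U ?\<phi> (chart_inv e y) \<in> fst a"
          using \<iota>e[OF yH] zS(2)[OF yH] y tr(2) by (simp add: Q_def)
        moreover have "inv_into U ?\<phi> (chart_inv e y) \<in> U" using inv\<phi>(1,2)[of "chart_inv e y"] z by simp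
        ultimately show "y \<in> snd d ` (fst d \<inter> inv_into U ?\<phi> -` fst c1)"
          using z by (intro image_eqI[of _ _ "chart_inv e y"]) (auto simp: a(2) e(2))
      qed
    qed
    have QH: "Q \<subseteq> H" by (auto simp: Q_def)
    show "Cr_map_on n n r (snd d ` (fst d \<inter> inv_into U ?\<phi> -` fst c1)) (snd c1 \<circ> inv_into U ?\<phi> \<circ> chart_inv d)"
      unfolding dom Cr_map_on_def
    proof (intro conjI allI impI)
      show "(snd c1 \<circ> inv_into U ?\<phi> \<circ> chart_inv d) ` Q \<subseteq> Rn n"
      proof
        fix w assume "w \<in> (snd c1 \<circ> inv_into U ?\<phi> \<circ> chart_inv d) ` Q"
        then obtain y where y: "y \<in> Q" "w = snd a (chart_inv c (\<theta>' (F y)))" using \<iota>e QH by (auto simp: a(2))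
        then have "chart_inv c (\<theta>' (F y)) \<in> fst a" using tr(2) by (simp add: Q_def)
        then show "w \<in> Rn n" using y(2) chart_image_Rn[OF a(1)] snd_in_chart_image[OF a(1)] by blast
      qed
      fix j assume j: "j < n"
      have "Cr_on n r Q (\<lambda>y. snd a (chart_inv c (\<theta>' (F y))) j)"
        by (rule Cr_on_compose[OF Qo tr(1) _ Cr_on_subset[OF GC QH] transition_Cr[OF c(1) a(1) j]]) (auto simp: Q_def)
      then show "Cr_on n r Q (\<lambda>x. (snd c1 \<circ> inv_into U ?\<phi> \<circ> chart_inv d) x j)"
        by (rule Cr_on_cong[OF Qo, rotated]) (use \<iota>e QH in \<open>auto simp: a(2)\<close>)
    qed
  qed
  have "Cr_diffeo n r U (restrict_atlas A U) S (slice_atlas k n r S) ?\<phi>"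
    using bij fwd bwd by (simp add: Cr_diffeo_def)
  moreover have "x \<in> U" using xV by (simp add: U_def)
  ultimately show ?thesis
    using Uo Vo xV emb unfolding S_def by (intro exI[of _ U] exI[of _ V] conjI)
qed

text \<open>A chart box has n < k coordinates, and the distance is bounded by them, so the grid
  argument applies to the manifold itself.\<close>

lemma hausdorff_null_local:
  assumes "n < k"
  shows "\<exists>N. open N \<and> y \<in> N \<and> hausdorff_null \<rho> k (N \<inter> UNIV)"
proof -
  obtain c where c: "c \<in> A" "y \<in> fst c" by (rule chart_cover)
  obtain N C where N: "open N" "y \<in> N" "N \<subseteq> fst c" "C \<ge> 0"
    "\<And>y y' \<eta>. y \<in> N \<Longrightarrow> y' \<in> N \<Longrightarrow> \<eta> \<ge> 0 \<Longrightarrow> (\<And>i. i < n \<Longrightarrow> \<bar>snd c y i - snd c y' i\<bar> \<le> \<eta>) \<Longrightarrow>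
       path_distance n A g y y' < \<infinity> \<and> \<rho> y y' \<le> C * \<eta>" using rho_upper[OF c] by blast
  let ?B = "{z \<in> fst c. snd c z \<in> {u \<in> Rn n. \<forall>i<n. \<bar>u i - snd c y i\<bar> < 1}}"
  have "open (N \<inter> ?B)" using N(1) chart_inv_image_open[OF c(1) openin_box] by blast
  moreover have "y \<in> N \<inter> ?B" using N(2) c chart_image_Rn[OF c(1)] snd_in_chart_image[OF c] by auto
  moreover have "hausdorff_null \<rho> k (N \<inter> ?B)"
  proof (rule hausdorff_null_grid[where I = "{..<n}" and u = "snd c" and a = "snd c y" and R = 1 and C = C])
    show "\<rho> z z' \<le> C * \<eta>" if "z \<in> N \<inter> ?B" "z' \<in> N \<inter> ?B" "\<eta> \<ge> 0" "\<And>i. i \<in> {..<n} \<Longrightarrow> \<bar>snd c z i - snd c z' i\<bar> \<le> \<eta>" for z z' \<eta>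
      using N(5)[of z z' \<eta>] that by auto
  qed (use assms N(4) in \<open>auto simp: less_imp_le\<close>)
  ultimately show ?thesis by (intro exI[of _ "N \<inter> ?B"]) simp
qed

end

theorem theorem1p1:
  fixes r :: enat
    and n k :: nat
    and A :: "'a::t2_space chart set"
    and g :: "'a metric_tensor"
    and \<rho> :: "'a \<Rightarrow> 'a \<Rightarrow> real"
    and T :: "'a \<Rightarrow> 'a"
    and X :: "'a set"
    and \<mu> :: "'a measure"
  assumes "r \<ge> 1"
    and "compact (UNIV :: 'a set)"
    and "Cr_atlas n r UNIV A"
    and "Riemannian_metric n A g"
    and "Riemannian_distance n A g \<rho>"
    and "Cr_diffeo n r UNIV A UNIV A T"
    and "compact X"
    and "sets \<mu> = sets (restrict_space borel X)"
    and "prob_space \<mu>"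
    and "k \<ge> 1"
    and "emeasure \<mu> (X \<inter> (\<Union>p\<in>{1..k-1}. Per p T)) = 0"
  shows "prevalent (Cr_topology n r A)
    {h \<in> Cr_functions n r A.
       (of_nat k > hausdorff_dim \<rho> X \<and> k \<ge> n \<longrightarrow>
         (AE x in \<mu>. \<exists>C\<ge>0. \<forall>y\<in>X.
            \<rho> x y \<le> C * euclidean_norm k (delay_map T h k x - delay_map T h k y))) \<and>
       (k > n \<longrightarrow>
         (AE x in \<mu>. \<exists>U V.
            open U \<and> x \<in> U \<and>
            openin (Euclidean_space k) V \<and> delay_map T h k x \<in> V \<and>
            embedded_submanifold k n r (V \<inter> range (delay_map T h k)) \<and>
            Cr_diffeo n r
              U (restrict_atlas A U)
              (V \<inter> range (delay_map T h k))
              (slice_atlas k n r (V \<inter> range (delay_map T h k)))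
              (delay_map T h k)))}" (is "prevalent _ ?S")
proof -
  interpret compact_Riemannian_manifold n r A g \<rho>
    using assms(1-5) by unfold_locales
  have T: "Cr_between n n r UNIV A UNIV A T" using assms(6) by (simp add: Cr_diffeo_def)
  have reg: "(\<exists>C\<ge>0. \<forall>y\<in>X. \<rho> x y \<le> C * euclidean_norm k (delay_map T h k x - delay_map T h k y)) \<longleftrightarrow> delay_regular T k X h x" for h x
    by (simp add: delay_regular_def euclidean_norm_delay)
  have "\<exists>B\<subseteq>?S. prevalent_borel (Cr_topology n r A) B"
  proof -
    \<comment> \<open>For k > n regularity over the whole manifold implies both statements. For k =
      n statement (2) is vacuous and the dimension of X enters; in the remaining case both
      statements are vacuous.\<close>
    consider "k > n" | "k \<le> n" "of_nat k > hausdorff_dim \<rho> X" "k \<ge> n" | "k \<le> n" "\<not> (of_nat k > hausdorff_dim \<rho> X \<and> k \<ge> n)" by linarith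
    then show ?thesis
    proof cases
      case 1
      let ?B = "{h \<in> Cr_functions n r A. AE x in \<mu>. delay_regular T k UNIV h x}"
      have "prevalent_borel (Cr_topology n r A) ?B"
        using 1 assms(10,11) hausdorff_null_local[OF 1]
        by (intro prevalent_delay_regular[OF assms(6,9,8)]) auto
      moreover have "?B \<subseteq> ?S"
      proof
        fix h assume "h \<in> ?B"
        then have h: "h \<in> Cr_functions n r A" and ae: "AE x in \<mu>. delay_regular T k UNIV h x" by auto
        have "AE x in \<mu>. delay_regular T k X h x"
          using ae by eventually_elim (auto simp: delay_regular_def)
        moreover have "AE x in \<mu>. \<exists>U V. open U \<and> x \<in> U \<and> openin (Euclidean_space k) V \<and> delay_map T h k x \<in> V \<and>
            embedded_submanifold k n r (V \<inter> range (delay_map T h k)) \<and>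
            Cr_diffeo n r U (restrict_atlas A U) (V \<inter> range (delay_map T h k))
              (slice_atlas k n r (V \<inter> range (delay_map T h k))) (delay_map T h k)"
          using ae by eventually_elim (rule delay_map_local_diffeo[OF _ h T less_imp_le[OF 1]])
        ultimately show "h \<in> ?S" using h by (simp add: reg)
      qed
      ultimately show ?thesis by blast
    next
      case 2
      let ?B = "{h \<in> Cr_functions n r A. AE x in \<mu>. delay_regular T k X h x}"
      \<comment> \<open>The dimension hypothesis is global on X, so the neighbourhood required at
        each point may be the whole space.\<close>
      have "hausdorff_null \<rho> k (UNIV \<inter> X)" using hausdorff_null_of_dim[OF 2(2) assms(10)] by simp
      then have "\<exists>N. open N \<and> y \<in> N \<and> hausdorff_null \<rho> k (N \<inter> X)" for y by blast
      then have "prevalent_borel (Cr_topology n r A) ?B"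
        using 2 assms(10,11) compact_imp_closed[OF assms(7)]
        by (intro prevalent_delay_regular[OF assms(6,9,8)]) auto
      moreover have "?B \<subseteq> ?S"
      proof
        fix h assume "h \<in> ?B"
        then have "h \<in> Cr_functions n r A" "AE x in \<mu>. delay_regular T k X h x" by auto
        then show "h \<in> ?S" using 2(1) by (simp add: reg)
      qed
      ultimately show ?thesis by blast
    next
      case 3
      have "Cr_functions n r A \<in> borel_sets_of (Cr_topology n r A)"
        unfolding borel_sets_of_def using sigma_sets_top[of "topspace (Cr_topology n r A)"] by simp
      \<comment> \<open>With m = 0 the probe has no parameters: its measure is a unit mass at the
        zero function.\<close>
      then have "prevalent_borel (Cr_topology n r A) (Cr_functions n r A)"
        by (rule prevalent_borel_probe[where m = 0, rotated]) auto
      moreover have "Cr_functions n r A \<subseteq> ?S" using 3 by auto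
      ultimately show ?thesis by blast
    qed
  qed
  then show ?thesis unfolding prevalent_def by auto
qed

end
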